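(* Let $Z(\tilde H)$ be the center of the affine Hecke algebra $\tilde H$ over $\mathbb K$. Then $Z(\tilde H)=\mathbb K[P]^W$, $Z(\tilde H)\mathbf 1_0=\mathbf 1_0\tilde H\mathbf 1_0$, and the maps $$\mathbb K[P]^W=Z(\tilde H)\ \xrightarrow{\ \Phi_1\ }\ Z(\tilde H)\mathbf 1_0=\mathbf 1_0\tilde H\mathbf 1_0\ \xrightarrow{\ \Phi_2\ }\ \varepsilon_0\tilde H\mathbf 1_0,\qquad f\ \longmapsto\ f\mathbf 1_0\ \longmapsto\ A_\rho f\mathbf 1_0,$$ are isomorphisms of $\mathbb K$-modules. Under them, for each $\lambda\in P^+$, $$s_\lambda\longmapsto s_\lambda\mathbf 1_0\longmapsto A_{\lambda+\rho}.$$
   Context: Root data. $R$ is a reduced irreducible root system spanning a finite-dimensional real vector space with nondegenerate symmetric bilinear form $\langle\,,\rangle$; $\alpha^\vee=2\alpha/\langle\alpha,\alpha\rangle$; $W$ is the Weyl group, $R^+$ a choice of positive roots, $\alpha_1,\dots,\alpha_n$ the simple roots, $s_i=s_{\alpha_i}$, $\ell$ the length function. $P=\{\lambda:\langle\lambda,\alpha^\vee\rangle\in\mathbb Z\ \forall\alpha\in R\}$, $P^+=\{\lambda\in P:\langle\lambda,\alpha^\vee\rangle\ge0\ \forall\alpha\in R^+\}$, $\rho=\frac12\sum_{\alpha\in R^+}\alpha$, $W_0(t)=\sum_{w\in W}t^{\ell(w)}$. Affine Hecke algebra. $\mathbb K=\mathbb Z[q,q^{-1}]$ with $W_0(q^2)^{-1}$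 adjoined. $\tilde H$ is the $\mathbb K$-algebra with generators $T_1,\dots,T_n$ and $x^\lambda$ ($\lambda\in P$) and relations: the braid relations $T_iT_jT_i\cdots=T_jT_iT_j\cdots$ ($m_{ij}$ factors on each side, $m_{ij}$ the order of $s_is_j$, $i\ne j$); $T_i^2=(q-q^{-1})T_i+1$; $x^\lambda x^\mu=x^\mu x^\lambda=x^{\lambda+\mu}$; and $x^\lambda T_i=T_ix^{s_i\lambda}+(q-q^{-1})\frac{x^\lambda-x^{s_i\lambda}}{1-x^{-\alpha_i}}$. For $w\in W$ with reduced word $w=s_{i_1}\cdots s_{i_p}$, $T_w=T_{i_1}\cdots T_{i_p}$; $\{x^\lambda T_w\}$ ($\lambda\in P$, $w\in W$) is a basis of $\tilde H$. $\mathbb K[P]=\mathbb K\text{-span}\{x^\lambda\}$ with $W$-action $wx^\lambda=x^{w\lambda}$, and $\mathbb K[P]^W$ is the subring of $W$-invariants. Put $\mathbf 1_0=\frac1{W_0(q^2)}\sum_{w\in W}q^{\ell(w)}T_w$ and $\varepsilon_0=\frac1{W_0(q^{-2})}\sum_{w\in W}(-q)^{-\ell(w)}T_w$ (idempotents with $T_i\mathbf 1_0=q\mathbf 1_0$, $T_i\varepsilon_0=-q^{-1}\varepsilon_0$). For $\mu\in P$, $A_\mu=\varepsilon_0x^\mu\mathbf 1_0$. With $a_\mu=\sum_{w\in W}(-1)^{\ell(w)}x^{w\mu}$, the Weyl character is $s_\lambda=a_{\lambda+\rho}/a_\rho\in\mathbb K[P]^W$. *)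

theory Defs
  imports
    "HOL-Library.Poly_Mapping"
    "HOL-Computational_Algebra.Polynomial"
    "HOL-Computational_Algebra.Fraction_Field"
    "HOL-Analysis.Linear_Algebra"
    "HOL-Algebra.Generated_Rings"
    "HOL-Algebra.QuotRing"
    "HOL-Algebra.Module"
    "HOL-Algebra.Algebraic_Closure_Type"
begin

section \<open>Algebraic preliminaries\<close>

text \<open>
  Words in letters from \<open>'g\<close>, as a monoid written additively, so that \<open>'g word \<Rightarrow>\<^sub>0 'c\<close>
  is the free associative algebra over \<open>'c\<close> on \<open>'g\<close> (multiplication is convolution).
\<close>

datatype 'g word = Word (letters: "'g list")

instantiation word :: (type) monoid_add
begin
definition "0 = Word []"
definition "u + v = Word (letters u @ letters v)"
instance by standard (simp_all add: zero_word_def plus_word_def)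
end

definition ring_center :: "('b, 'm) ring_scheme \<Rightarrow> 'b set" where
  "ring_center H = {z \<in> carrier H. \<forall>h\<in>carrier H. z \<otimes>\<^bsub>H\<^esub> h = h \<otimes>\<^bsub>H\<^esub> z}"

definition module_iso ::
  "('k, 'm) ring_scheme \<Rightarrow> ('k, 'b, 'n) module_scheme \<Rightarrow> ('k, 'd, 'o) module_scheme \<Rightarrow> ('b \<Rightarrow> 'd) \<Rightarrow> bool"
  where "module_iso K M N \<phi> \<longleftrightarrow>
    Module.module K M \<and> Module.module K N \<and> bij_betw \<phi> (carrier M) (carrier N) \<and>
    (\<forall>x\<in>carrier M. \<forall>y\<in>carrier M. \<phi> (x \<oplus>\<^bsub>M\<^esub> y) = \<phi> x \<oplus>\<^bsub>N\<^esub> \<phi> y) \<and>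
    (\<forall>k\<in>carrier K. \<forall>x\<in>carrier M. \<phi> (k \<odot>\<^bsub>M\<^esub> x) = k \<odot>\<^bsub>N\<^esub> \<phi> x)"

text \<open>
  The exact quotient \<open>f / g\<close> in a group algebra; it is determined whenever \<open>g\<close> divides \<open>f\<close>
  and is not a zero divisor.
\<close>

definition exact_quot :: "('v::comm_monoid_add \<Rightarrow>\<^sub>0 'c::comm_ring_1) \<Rightarrow> ('v \<Rightarrow>\<^sub>0 'c) \<Rightarrow> ('v \<Rightarrow>\<^sub>0 'c)" where
  "exact_quot f g = (THE h. h * g = f)"

text \<open>All scalars live in the fraction field of \<open>\<int>[q]\<close>.\<close>

type_synonym scalar = "int poly fract"

definition q :: scalar where "q = Fract [:0, 1:] 1"

text \<open>Generators of the affine Hecke algebra; the \<open>T\<^sub>i\<close> are indexed by the simple roots themselves.\<close>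

datatype 'v gen = X_gen 'v | T_gen 'v


section \<open>Root systems\<close>

text \<open>
  The form \<open>B\<close> is nondegenerate but not required to be positive definite.  Finite dimensionality
  of the ambient space is the conjunction of \<open>finite_R\<close> and \<open>span_R\<close>.  A choice of positive
  roots is the set of roots on the positive side of a linear functional vanishing on no root.
\<close>

locale based_root_system =
  fixes B :: "'v::real_vector \<Rightarrow> 'v \<Rightarrow> real" and R Rp :: "'v set"
  assumes bilinear_B: "bilinear B"
    and sym_B: "B x y = B y x"
    and nondegenerate_B: "(\<forall>y. B x y = 0) \<Longrightarrow> x = 0"
    and finite_R: "finite R"
    and span_R: "span R = UNIV"
    and zero_notin_R: "0 \<notin> R"
    and nonisotropic: "\<alpha> \<in> R \<Longrightarrow> B \<alpha> \<alpha> \<noteq> 0"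
    and reflection_closed:
      "\<alpha> \<in> R \<Longrightarrow> \<beta> \<in> R \<Longrightarrow> \<beta> - B \<beta> ((2 / B \<alpha> \<alpha>) *\<^sub>R \<alpha>) *\<^sub>R \<alpha> \<in> R"
    and crystallographic: "\<alpha> \<in> R \<Longrightarrow> \<beta> \<in> R \<Longrightarrow> B \<beta> ((2 / B \<alpha> \<alpha>) *\<^sub>R \<alpha>) \<in> \<int>"
    and reduced: "\<alpha> \<in> R \<Longrightarrow> c *\<^sub>R \<alpha> \<in> R \<Longrightarrow> c = 1 \<or> c = -1"
    and nonempty_R: "R \<noteq> {}"
    and irreducible_R: "R = R1 \<union> R2 \<Longrightarrow> R1 \<inter> R2 = {} \<Longrightarrow>
      (\<forall>\<alpha>\<in>R1. \<forall>\<beta>\<in>R2. B \<alpha> \<beta> = 0) \<Longrightarrow> R1 = {} \<or> R2 = {}"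
    and positive_roots:
      "\<exists>f :: 'v \<Rightarrow> real. linear f \<and> (\<forall>\<alpha>\<in>R. f \<alpha> \<noteq> 0) \<and> Rp = {\<alpha>\<in>R. f \<alpha> > 0}"
begin

definition coroot :: "'v \<Rightarrow> 'v" where "coroot \<alpha> = (2 / B \<alpha> \<alpha>) *\<^sub>R \<alpha>"

definition refl :: "'v \<Rightarrow> 'v \<Rightarrow> 'v" where "refl \<alpha> x = x - B x (coroot \<alpha>) *\<^sub>R \<alpha>"

definition refl_word :: "'v list \<Rightarrow> 'v \<Rightarrow> 'v" where
  "refl_word \<alpha>s = foldr (\<lambda>\<alpha> w. refl \<alpha> \<circ> w) \<alpha>s id"

text \<open>Reflections are involutions, so their products already form a group.\<close>

definition weyl :: "('v \<Rightarrow> 'v) set" where "weyl = refl_word ` lists R"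

definition simple_roots :: "'v set" where
  "simple_roots = {\<alpha> \<in> Rp. \<not> (\<exists>\<beta>\<in>Rp. \<exists>\<gamma>\<in>Rp. \<alpha> = \<beta> + \<gamma>)}"

definition len :: "('v \<Rightarrow> 'v) \<Rightarrow> nat" where
  "len w = (LEAST n. \<exists>\<alpha>s \<in> lists simple_roots. length \<alpha>s = n \<and> refl_word \<alpha>s = w)"

definition reduced_word :: "'v list \<Rightarrow> ('v \<Rightarrow> 'v) \<Rightarrow> bool" where
  "reduced_word \<alpha>s w \<longleftrightarrow> \<alpha>s \<in> lists simple_roots \<and> refl_word \<alpha>s = w \<and> length \<alpha>s = len w"

text \<open>The order of \<open>s\<^sub>i s\<^sub>j\<close>.\<close>

definition cox :: "'v \<Rightarrow> 'v \<Rightarrow> nat" where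
  "cox \<alpha> \<beta> = (LEAST m. m > 0 \<and> (refl \<alpha> \<circ> refl \<beta>) ^^ m = id)"

definition weights :: "'v set" where
  "weights = {\<mu>. \<forall>\<alpha>\<in>R. B \<mu> (coroot \<alpha>) \<in> \<int>}"

definition dominant_weights :: "'v set" where
  "dominant_weights = {\<mu> \<in> weights. \<forall>\<alpha>\<in>Rp. B \<mu> (coroot \<alpha>) \<ge> 0}"

definition \<rho> :: 'v where "\<rho> = (1/2) *\<^sub>R (\<Sum>\<alpha>\<in>Rp. \<alpha>)"

definition W0 :: "scalar \<Rightarrow> scalar" where "W0 t = (\<Sum>w\<in>weyl. t ^ len w)"


section \<open>The coefficient ring and the group algebra of the weight lattice\<close>

definition coeff_ring :: "scalar ring" where
  "coeff_ring = ring_of_type_algebra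
     \<lparr>carrier := generate_ring ring_of_type_algebra {q, inverse q, inverse (W0 (q\<^sup>2))}\<rparr>"

text \<open>The exponential \<open>x\<^sup>\<mu>\<close> is \<open>xpow \<mu>\<close>.\<close>

definition xpow :: "'v \<Rightarrow> ('v \<Rightarrow>\<^sub>0 scalar)" where "xpow \<mu> = Poly_Mapping.single \<mu> 1"

definition KP :: "('v \<Rightarrow>\<^sub>0 scalar) set" where
  "KP = {f. Poly_Mapping.keys f \<subseteq> weights \<and> (\<forall>\<mu>. Poly_Mapping.lookup f \<mu> \<in> carrier coeff_ring)}"

definition act :: "('v \<Rightarrow> 'v) \<Rightarrow> ('v \<Rightarrow>\<^sub>0 scalar) \<Rightarrow> ('v \<Rightarrow>\<^sub>0 scalar)" where
  "act w f = (\<Sum>\<mu>\<in>Poly_Mapping.keys f. Poly_Mapping.single (w \<mu>) (Poly_Mapping.lookup f \<mu>))"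

definition KPW :: "(scalar, 'v \<Rightarrow>\<^sub>0 scalar) module" where
  "KPW = \<lparr>carrier = {f \<in> KP. \<forall>w\<in>weyl. act w f = f},
     monoid.mult = (*), one = 1, ring.zero = 0, add = (+),
     module.smult = (\<lambda>k f. Poly_Mapping.single 0 k * f)\<rparr>"

definition alt_sum :: "'v \<Rightarrow> ('v \<Rightarrow>\<^sub>0 scalar)" where
  "alt_sum \<mu> = (\<Sum>w\<in>weyl. (-1) ^ len w * xpow (w \<mu>))"

definition weyl_character :: "'v \<Rightarrow> ('v \<Rightarrow>\<^sub>0 scalar)" where
  "weyl_character \<mu> = exact_quot (alt_sum (\<mu> + \<rho>)) (alt_sum \<rho>)"


section \<open>The affine Hecke algebra\<close>

text \<open>The free algebra over the coefficient ring on \<open>T\<^sub>i\<close> and \<open>x\<^sup>\<lambda>\<close>.\<close>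

definition free_alg :: "('v gen word \<Rightarrow>\<^sub>0 scalar) ring" where
  "free_alg = ring_of_type_algebra
     \<lparr>carrier := {f. (\<forall>u\<in>Poly_Mapping.keys f. letters u \<in> lists (X_gen ` weights \<union> T_gen ` simple_roots)) \<and>
        (\<forall>u. Poly_Mapping.lookup f u \<in> carrier coeff_ring)}\<rparr>"

definition const :: "scalar \<Rightarrow> ('v gen word \<Rightarrow>\<^sub>0 scalar)" where
  "const k = Poly_Mapping.single 0 k"

definition gX :: "'v \<Rightarrow> ('v gen word \<Rightarrow>\<^sub>0 scalar)" where
  "gX \<mu> = Poly_Mapping.single (Word [X_gen \<mu>]) 1"

definition gT :: "'v \<Rightarrow> ('v gen word \<Rightarrow>\<^sub>0 scalar)" where
  "gT \<alpha> = Poly_Mapping.single (Word [T_gen \<alpha>]) 1"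

definition T_word :: "'v list \<Rightarrow> ('v gen word \<Rightarrow>\<^sub>0 scalar)" where
  "T_word \<alpha>s = prod_list (map gT \<alpha>s)"

definition alternating :: "nat \<Rightarrow> 'v \<Rightarrow> 'v \<Rightarrow> 'v list" where
  "alternating m \<alpha> \<beta> = map (\<lambda>k. if even k then \<alpha> else \<beta>) [0..<m]"

definition lift_KP :: "('v \<Rightarrow>\<^sub>0 scalar) \<Rightarrow> ('v gen word \<Rightarrow>\<^sub>0 scalar)" where
  "lift_KP f = (\<Sum>\<mu>\<in>Poly_Mapping.keys f. const (Poly_Mapping.lookup f \<mu>) * gX \<mu>)"

text \<open>
  Each relation \<open>l = r\<close> is recorded as \<open>l - r\<close>.  The relation \<open>x\<^sup>0 = 1\<close> is part of the usual
  meaning of the exponential notation, but does not follow from the other relations.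
\<close>

definition relations :: "('v gen word \<Rightarrow>\<^sub>0 scalar) set" where
  "relations =
     {T_word (alternating (cox \<alpha> \<beta>) \<alpha> \<beta>) - T_word (alternating (cox \<alpha> \<beta>) \<beta> \<alpha>) | \<alpha> \<beta>.
        \<alpha> \<in> simple_roots \<and> \<beta> \<in> simple_roots \<and> \<alpha> \<noteq> \<beta>} \<union>
     {gT \<alpha> * gT \<alpha> - (const (q - inverse q) * gT \<alpha> + 1) | \<alpha>. \<alpha> \<in> simple_roots} \<union>
     {gX 0 - 1} \<union>
     {gX \<mu> * gX \<nu> - gX (\<mu> + \<nu>) | \<mu> \<nu>. \<mu> \<in> weights \<and> \<nu> \<in> weights} \<union>
     {gX \<mu> * gT \<alpha> - (gT \<alpha> * gX (refl \<alpha> \<mu>) + const (q - inverse q) *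
          lift_KP (exact_quot (xpow \<mu> - xpow (refl \<alpha> \<mu>)) (1 - xpow (- \<alpha>)))) | \<mu> \<alpha>.
        \<mu> \<in> weights \<and> \<alpha> \<in> simple_roots}"

definition rel_ideal :: "('v gen word \<Rightarrow>\<^sub>0 scalar) set" where
  "rel_ideal = Idl\<^bsub>free_alg\<^esub> relations"

text \<open>The class in the affine Hecke algebra of an element of the free algebra.\<close>

definition cls :: "('v gen word \<Rightarrow>\<^sub>0 scalar) \<Rightarrow> ('v gen word \<Rightarrow>\<^sub>0 scalar) set" where
  "cls f = rel_ideal +>\<^bsub>free_alg\<^esub> f"

definition hecke :: "(scalar, ('v gen word \<Rightarrow>\<^sub>0 scalar) set) module" where
  "hecke = (let Q = free_alg Quot rel_ideal in
     \<lparr>carrier = carrier Q, monoid.mult = monoid.mult Q, one = \<one>\<^bsub>Q\<^esub>, ring.zero = \<zero>\<^bsub>Q\<^esub>, add = add Q,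
      module.smult = (\<lambda>k h. cls (const k) \<otimes>\<^bsub>Q\<^esub> h)\<rparr>)"

text \<open>The canonical map from the group algebra of the weight lattice to the affine Hecke algebra.\<close>

definition KP_to_hecke :: "('v \<Rightarrow>\<^sub>0 scalar) \<Rightarrow> ('v gen word \<Rightarrow>\<^sub>0 scalar) set" where
  "KP_to_hecke f = cls (lift_KP f)"

text \<open>
  The lift to the free algebra depends on the reduced word; its class does not, by the braid
  relations.
\<close>

definition Tw :: "('v \<Rightarrow> 'v) \<Rightarrow> ('v gen word \<Rightarrow>\<^sub>0 scalar)" where
  "Tw w = T_word (SOME \<alpha>s. reduced_word \<alpha>s w)"

definition one0 :: "('v gen word \<Rightarrow>\<^sub>0 scalar) set" where
  "one0 = cls (const (inverse (W0 (q\<^sup>2))) * (\<Sum>w\<in>weyl. const (q ^ len w) * Tw w))"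

definition eps0 :: "('v gen word \<Rightarrow>\<^sub>0 scalar) set" where
  "eps0 = cls (const (inverse (W0 (inverse q ^ 2))) *
            (\<Sum>w\<in>weyl. const (inverse (- q) ^ len w) * Tw w))"

definition A :: "'v \<Rightarrow> ('v gen word \<Rightarrow>\<^sub>0 scalar) set" where
  "A \<mu> = eps0 \<otimes>\<^bsub>hecke\<^esub> cls (gX \<mu>) \<otimes>\<^bsub>hecke\<^esub> one0"

end

end

theory Submission
  imports Defs
begin

text \<open>
  The algebra acts on functions of the characters \<open>\<tau>\<close> of \<open>P\<close>: \<open>x\<^sup>\<mu>\<close> multiplies by \<open>\<tau> \<mu>\<close>, and
  \<open>T\<^sub>\<alpha> + q\<^sup>-\<^sup>1\<close> is the weighted average \<open>c\<^sub>\<alpha> + (q + q\<^sup>-\<^sup>1 - c\<^sub>\<alpha>) s\<^sub>\<alpha>\<close>, where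
  \<open>c\<^sub>\<alpha> = q\<^sup>-\<^sup>1 + (q - q\<^sup>-\<^sup>1) / (1 - x\<^sup>-\<^sup>\<alpha>)\<close>.  At a generic character the operators of the elements
  \<open>x\<^sup>\<lambda> T\<^sub>w\<close> are triangular with respect to length, so these elements are linearly independent.  Comparing
  coefficients at generic characters shows that a central element lies in \<open>K[P]\<close>; it is invariant because
  \<open>T\<^sub>\<alpha> f 1\<^sub>0 = q f 1\<^sub>0\<close> forces \<open>s\<^sub>\<alpha> f = f\<close>.  The same eigenvector argument gives
  \<open>1\<^sub>0 H 1\<^sub>0 = K[P]\<^sup>W 1\<^sub>0\<close>.

  Since \<open>T\<^sub>\<alpha>\<close> acts by \<open>- q\<^sup>-\<^sup>1\<close> on \<open>\<epsilon>\<^sub>0\<close> from the right and by \<open>q\<close> on \<open>1\<^sub>0\<close> from the left,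
  \<open>\<epsilon>\<^sub>0 f 1\<^sub>0 = 0\<close> for every \<open>f\<close> fixed by \<open>s\<^sub>\<alpha>\<close>; hence \<open>A\<^sub>\<mu>\<close> is alternating in \<open>\<mu>\<close>, and
  \<open>\<epsilon>\<^sub>0 a\<^sub>\<mu> 1\<^sub>0 = |W| A\<^sub>\<mu>\<close>.  With \<open>a\<^sub>\<lambda>\<^sub>+\<^sub>\<rho> = s\<^sub>\<lambda> a\<^sub>\<rho>\<close> and \<open>s\<^sub>\<lambda>\<close> central this gives
  \<open>A\<^sub>\<lambda>\<^sub>+\<^sub>\<rho> = A\<^sub>\<rho> s\<^sub>\<lambda> 1\<^sub>0\<close>, and so \<open>\<Phi>\<^sub>2\<close> is onto.  Finally \<open>K[P]\<close> has no zero divisors, so \<open>f A\<^sub>\<rho> = 0\<close>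
  with \<open>f \<noteq> 0\<close> forces \<open>A\<^sub>\<rho> = 0\<close>; then every \<open>A\<^sub>\<mu>\<close> vanishes and \<open>\<epsilon>\<^sub>0\<close> would act as zero on all
  functions \<open>\<tau> \<mapsto> \<tau> \<mu>\<close>.
\<close>

section \<open>Root systems\<close>

context based_root_system
begin

text \<open>The algebra is given by generators and relations only, so neither the independence of
  the elements x^\<lambda> T_w nor the nonvanishing of any product is available in advance. Both
  have to come from a representation, and the laborious point is that the operators satisfy the
  braid relations. They do so where no denominator vanishes, which is why functions of regular
  characters are used: the coefficients become scalars in a field and K[P] need not be localised. A
  rank-two braid relation is equivalent to the symmetry of the longest Kazhdan--Lusztig element, and
  this reduces to polynomial identities for A2, B2 and G2, fed by one relation between the
  coefficients of three roots \<gamma>, \<delta>, \<gamma> + \<delta>.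

  Since B may be indefinite, signs and lengths are measured by a second form built from the coroots.
  Since 2, |W| and q + q^-1 need not be units of K, division by them is replaced by the absence of
  torsion, which follows from the basis. That 1/W_0(q^-2) lies in K comes from the longest element,
  which reverses length.\<close>

definition pair :: "'v \<Rightarrow> 'v \<Rightarrow> real" where "pair x \<alpha> = B x (coroot \<alpha>)"

text \<open>Positive definite for every B, because the coroots separate points, and invariant under
  W, because reflections permute R. It replaces B in the arguments about signs and lengths.\<close>

definition ip :: "'v \<Rightarrow> 'v \<Rightarrow> real" where "ip x y = (\<Sum>\<gamma>\<in>R. pair x \<gamma> * pair y \<gamma>)"

lemma refl_pair: "refl \<alpha> x = x - pair x \<alpha> *\<^sub>R \<alpha>"
  by (simp add: refl_def pair_def)

lemma linear_pair: "linear (\<lambda>x. pair x \<alpha>)"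
  using bilinear_B unfolding pair_def bilinear_def by simp

lemma pair_add: "pair (x + y) \<alpha> = pair x \<alpha> + pair y \<alpha>"
  and pair_diff: "pair (x - y) \<alpha> = pair x \<alpha> - pair y \<alpha>"
  and pair_scaleR: "pair (c *\<^sub>R x) \<alpha> = c * pair x \<alpha>"
  and pair_minus: "pair (- x) \<alpha> = - pair x \<alpha>"
  and pair_zero [simp]: "pair 0 \<alpha> = 0"
  and pair_sum: "pair (sum g S) \<alpha> = (\<Sum>i\<in>S. pair (g i) \<alpha>)"
  using linear_add[OF linear_pair[of \<alpha>]] linear_diff[OF linear_pair[of \<alpha>]] linear_scale[OF linear_pair[of \<alpha>]]
    linear_neg[OF linear_pair[of \<alpha>]] linear_0[OF linear_pair[of \<alpha>]] linear_sum[OF linear_pair[of \<alpha>]]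
  by simp_all

lemmas pair_simps = pair_add pair_diff pair_scaleR pair_minus

lemma pair_eq: "pair x \<alpha> = 2 * B x \<alpha> / B \<alpha> \<alpha>"
  unfolding pair_def coroot_def using bilinear_rmul[OF bilinear_B] by simp

lemma pair_self: "\<alpha> \<in> R \<Longrightarrow> pair \<alpha> \<alpha> = 2"
  using nonisotropic by (simp add: pair_eq)

lemma pair_Ints: "\<alpha> \<in> R \<Longrightarrow> \<beta> \<in> R \<Longrightarrow> pair \<beta> \<alpha> \<in> \<int>"
  using crystallographic by (simp add: pair_def coroot_def)

lemma linear_refl: "linear (refl \<alpha>)"
  by (rule linearI) (simp_all add: refl_pair pair_simps scaleR_left.add algebra_simps)

lemma refl_add: "refl \<alpha> (x + y) = refl \<alpha> x + refl \<alpha> y"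
  and refl_scaleR: "refl \<alpha> (c *\<^sub>R x) = c *\<^sub>R refl \<alpha> x"
  and refl_minus: "refl \<alpha> (- x) = - refl \<alpha> x"
  and refl_zero [simp]: "refl \<alpha> 0 = 0"
  using linear_refl[of \<alpha>]
  by (simp_all add: linear_add linear_diff linear_scale linear_neg linear_0)

lemma refl_closed: "\<alpha> \<in> R \<Longrightarrow> \<beta> \<in> R \<Longrightarrow> refl \<alpha> \<beta> \<in> R"
  using reflection_closed by (simp add: refl_def coroot_def)

lemma refl_self: "\<alpha> \<in> R \<Longrightarrow> refl \<alpha> \<alpha> = - \<alpha>"
  by (simp add: refl_pair pair_self scaleR_2)

lemma refl_invol [simp]: "\<alpha> \<in> R \<Longrightarrow> refl \<alpha> (refl \<alpha> x) = x"
  by (simp add: refl_pair pair_simps pair_self)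

lemma refl_comp_self [simp]: "\<alpha> \<in> R \<Longrightarrow> refl \<alpha> \<circ> refl \<alpha> = id"
  by (simp add: fun_eq_iff)

lemma neg_closed: "\<alpha> \<in> R \<Longrightarrow> - \<alpha> \<in> R"
  using refl_closed[of \<alpha> \<alpha>] refl_self by simp

lemma B_simps:
  "B (x + y) z = B x z + B y z" "B (x - y) z = B x z - B y z" "B (c *\<^sub>R x) z = c * B x z"
  "B z (x + y) = B z x + B z y" "B z (x - y) = B z x - B z y" "B z (c *\<^sub>R x) = c * B z x"
  "B (- x) z = - B x z" "B z (- x) = - B z x"
  using bilinear_B by (simp_all add: bilinear_ladd bilinear_lsub bilinear_lmul bilinear_radd
    bilinear_rsub bilinear_rmul bilinear_lneg bilinear_rneg)

lemma B_refl: "\<alpha> \<in> R \<Longrightarrow> B (refl \<alpha> x) (refl \<alpha> y) = B x y"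
  using nonisotropic[of \<alpha>] sym_B[of \<alpha> y]
  by (simp add: refl_pair pair_eq B_simps field_simps)

lemma pair_refl: "\<alpha> \<in> R \<Longrightarrow> pair (refl \<alpha> x) (refl \<alpha> \<beta>) = pair x \<beta>"
  by (simp add: pair_eq B_refl)

lemma pair_neg_root: "pair x (- \<alpha>) = - pair x \<alpha>"
  by (simp add: pair_eq B_simps)

lemma refl_neg_root: "refl (- \<alpha>) = refl \<alpha>"
  by (simp add: fun_eq_iff refl_pair pair_neg_root)

lemma bij_refl: "\<alpha> \<in> R \<Longrightarrow> bij (refl \<alpha>)"
  by (rule o_bij[of "refl \<alpha>"]) simp_all

lemma bij_betw_refl_R: "\<alpha> \<in> R \<Longrightarrow> bij_betw (refl \<alpha>) R R"
  by (rule bij_betw_byWitness[where f' = "refl \<alpha>"]) (auto simp: refl_closed)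

section \<open>An invariant positive definite form\<close>

lemma ip_sym: "ip x y = ip y x"
  by (simp add: ip_def mult.commute)

lemma ip_simps:
  "ip (x + y) z = ip x z + ip y z" "ip (x - y) z = ip x z - ip y z"
  "ip (c *\<^sub>R x) z = c * ip x z" "ip (- x) z = - ip x z"
  "ip z (x + y) = ip z x + ip z y" "ip z (x - y) = ip z x - ip z y"
  "ip z (c *\<^sub>R x) = c * ip z x" "ip z (- x) = - ip z x"
  by (simp_all add: ip_def pair_simps algebra_simps sum.distrib sum_subtractf sum_distrib_left sum_negf)

lemma ip_refl: assumes "\<alpha> \<in> R" shows "ip (refl \<alpha> x) (refl \<alpha> y) = ip x y"
proof -
  have "ip (refl \<alpha> x) (refl \<alpha> y)
      = (\<Sum>\<gamma>\<in>R. pair (refl \<alpha> x) (refl \<alpha> \<gamma>) * pair (refl \<alpha> y) (refl \<alpha> \<gamma>))"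
    unfolding ip_def by (rule sum.reindex_bij_betw[OF bij_betw_refl_R[OF assms], symmetric])
  then show ?thesis by (simp add: pair_refl assms ip_def)
qed

text \<open>Orthogonality to R extends to the whole space because R spans it; nondegeneracy then
  applies.\<close>

lemma pair_all_zero: assumes "\<And>\<gamma>. \<gamma> \<in> R \<Longrightarrow> pair x \<gamma> = 0" shows "x = 0"
proof (rule nondegenerate_B, rule allI)
  fix y
  have lin: "linear (B x)" using bilinear_B by (simp add: bilinear_def)
  have "B x \<gamma> = 0" if "\<gamma> \<in> R" for \<gamma>
    using assms[OF that] nonisotropic[OF that] by (simp add: pair_eq)
  moreover have "y \<in> span R" using span_R by simp
  ultimately show "B x y = 0"
    using linear_eq_on[OF lin, of "\<lambda>_. 0" y R] by (simp add: linear_zero)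
qed

lemma ip_nonneg: "ip x x \<ge> 0"
  unfolding ip_def by (intro sum_nonneg) simp

lemma ip_eq_0: "ip x x = 0 \<Longrightarrow> x = 0"
  unfolding ip_def using finite_R
  by (subst (asm) sum_nonneg_eq_0_iff) (auto intro: pair_all_zero)

lemma ip_pos: "x \<noteq> 0 \<Longrightarrow> ip x x > 0"
  using ip_nonneg ip_eq_0 by (metis less_eq_real_def)

lemma root_nz: "\<alpha> \<in> R \<Longrightarrow> \<alpha> \<noteq> 0"
  using zero_notin_R by auto

text \<open>Invariance gives \<open>ip (refl \<alpha> x) \<alpha> = - ip x \<alpha>\<close>;
  expanding the reflection shows that pairings with coroots can be computed from \<open>ip\<close>.
  Hence the sign of the pairing of two roots is symmetric.\<close>

lemma ip_pair: assumes "\<alpha> \<in> R" shows "2 * ip x \<alpha> = pair x \<alpha> * ip \<alpha> \<alpha>"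
proof -
  have "ip (refl \<alpha> x) \<alpha> = ip (refl \<alpha> (refl \<alpha> x)) (refl \<alpha> \<alpha>)"
    by (rule ip_refl[symmetric]) fact
  then have "ip (refl \<alpha> x) \<alpha> = - ip x \<alpha>" using assms by (simp add: refl_self ip_simps)
  then show ?thesis by (simp add: ip_simps refl_pair)
qed

lemma pair_pos_iff: "\<alpha> \<in> R \<Longrightarrow> pair x \<alpha> > 0 \<longleftrightarrow> ip x \<alpha> > 0"
  using ip_pair[of \<alpha> x] ip_pos[OF root_nz, of \<alpha>]
  by (smt (verit, best) mult_nonpos_nonneg mult_pos_pos)

lemma pair_nonneg_iff: "\<alpha> \<in> R \<Longrightarrow> pair x \<alpha> \<ge> 0 \<longleftrightarrow> ip x \<alpha> \<ge> 0"
  using pair_pos_iff[of \<alpha> "-x"] by (auto simp add: pair_minus ip_simps not_less[symmetric])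

lemma pair_sym_pos: "\<alpha> \<in> R \<Longrightarrow> \<beta> \<in> R \<Longrightarrow> pair \<beta> \<alpha> > 0 \<longleftrightarrow> pair \<alpha> \<beta> > 0"
  by (simp add: pair_pos_iff ip_sym)

text \<open>Cauchy--Schwarz for \<open>ip\<close>: the product is 4 cos^2 of the angle. It stays
  below 4 because reducedness excludes proportional roots other than \<alpha> and its
  negative.\<close>

lemma pair_prod:
  assumes "\<alpha> \<in> R" "\<beta> \<in> R"
  shows "pair \<alpha> \<beta> * pair \<beta> \<alpha> \<ge> 0" "\<beta> \<noteq> \<alpha> \<Longrightarrow> \<beta> \<noteq> - \<alpha> \<Longrightarrow> pair \<alpha> \<beta> * pair \<beta> \<alpha> < 4"
proof -
  let ?a = "pair \<alpha> \<beta>" and ?b = "pair \<beta> \<alpha>" and ?A = "ip \<alpha> \<alpha>" and ?B = "ip \<beta> \<beta>"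
  have A: "?A > 0" "?B > 0" using assms ip_pos root_nz by auto
  have e: "?a * ?B = ?b * ?A" "2 * ip \<alpha> \<beta> = ?b * ?A" "2 * ip \<beta> \<alpha> = ?b * ?A"
    using ip_pair[OF assms(2), of \<alpha>] ip_pair[OF assms(1), of \<beta>] by (simp_all add: ip_sym)
  have "?a * ?b * ?B = ?b\<^sup>2 * ?A" using e(1) by (simp add: power2_eq_square algebra_simps)
  moreover have "?b\<^sup>2 * ?A \<ge> 0" using A by simp
  ultimately show "?a * ?b \<ge> 0" using A by (metis zero_le_mult_iff not_le)
  assume ne: "\<beta> \<noteq> \<alpha>" "\<beta> \<noteq> - \<alpha>"
  \<comment> \<open>The component of \<beta> orthogonal to \<alpha>; its squared length is the
    deficit in Cauchy--Schwarz.\<close>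
  define v where "v = \<beta> - (?b / 2) *\<^sub>R \<alpha>"
  have "v \<noteq> 0"
  proof
    assume "v = 0"
    then have "\<beta> = (?b / 2) *\<^sub>R \<alpha>" by (simp add: v_def)
    then show False using reduced[OF assms(1), of "?b/2"] assms ne by auto
  qed
  then have "ip v v > 0" by (rule ip_pos)
  also have "ip v v = ?B - ?b * ip \<alpha> \<beta> + ?b\<^sup>2 / 4 * ?A"
    unfolding v_def by (simp add: ip_simps ip_sym[of \<beta> \<alpha>] power2_eq_square algebra_simps)
  also have "\<dots> = ?B * (1 - ?a * ?b / 4)"
  proof -
    have "ip \<alpha> \<beta> = ?b * ?A / 2" using e by simp
    then have "?B - ?b * ip \<alpha> \<beta> + ?b\<^sup>2 / 4 * ?A = ?B - ?b * (?b * ?A) / 4"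
      by (simp only: power2_eq_square) (simp add: field_simps)
    also have "\<dots> = ?B - ?b * (?a * ?B) / 4" using e(1) by simp
    finally show ?thesis by (simp add: algebra_simps)
  qed
  finally show "?a * ?b < 4" using A by (simp add: zero_less_mult_iff)
qed

section \<open>Positive and simple roots\<close>

definition pf :: "'v \<Rightarrow> real" where
  "pf = (SOME f. linear f \<and> (\<forall>\<alpha>\<in>R. f \<alpha> \<noteq> 0) \<and> Rp = {\<alpha>\<in>R. f \<alpha> > 0})"

lemma pf: "linear pf" "\<And>\<alpha>. \<alpha> \<in> R \<Longrightarrow> pf \<alpha> \<noteq> 0" "Rp = {\<alpha>\<in>R. pf \<alpha> > 0}"
  using someI_ex[OF positive_roots] unfolding pf_def by blast+

lemma pf_simps: "pf (x + y) = pf x + pf y" "pf (x - y) = pf x - pf y" "pf (- x) = - pf x"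
  "pf (c *\<^sub>R x) = c * pf x"
  using pf(1) by (simp_all add: linear_add linear_diff linear_neg linear_scale)

lemma Rp_sub: "\<alpha> \<in> Rp \<Longrightarrow> \<alpha> \<in> R" and Rp_pf: "\<alpha> \<in> Rp \<Longrightarrow> pf \<alpha> > 0"
  using pf(3) by auto

lemma Rp_subset: "Rp \<subseteq> R" using Rp_sub by auto

lemma finite_Rp: "finite Rp" using finite_R Rp_subset by (rule rev_finite_subset)

lemma Rp_cases: "\<alpha> \<in> R \<Longrightarrow> \<alpha> \<in> Rp \<or> - \<alpha> \<in> Rp"
  using pf(2)[of \<alpha>] neg_closed[of \<alpha>] by (subst (1 2) pf(3)) (auto simp: pf_simps)

lemma Rp_neg: "\<alpha> \<in> Rp \<Longrightarrow> - \<alpha> \<notin> Rp"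
  using Rp_pf[of \<alpha>] Rp_pf[of "- \<alpha>"] by (auto simp: pf_simps)

lemma simple_Rp: "\<alpha> \<in> simple_roots \<Longrightarrow> \<alpha> \<in> Rp"
  by (simp add: simple_roots_def)

lemma simple_R: "\<alpha> \<in> simple_roots \<Longrightarrow> \<alpha> \<in> R"
  using simple_Rp Rp_sub by auto

lemma finite_simple: "finite simple_roots"
  using finite_Rp by (rule rev_finite_subset) (auto simp: simple_Rp)

text \<open>The measure is the number of positive roots with smaller value of \<open>pf\<close>.
  Both summands of a decomposition have smaller measure since \<open>pf\<close> is additive and
  positive on them.\<close>

lemma Rp_induct [consumes 1, case_names simple add]:
  assumes "\<alpha> \<in> Rp" "\<And>\<alpha>. \<alpha> \<in> simple_roots \<Longrightarrow> P \<alpha>"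
    "\<And>\<beta> \<gamma>. \<beta> \<in> Rp \<Longrightarrow> \<gamma> \<in> Rp \<Longrightarrow> \<beta> + \<gamma> \<in> Rp \<Longrightarrow> P \<beta> \<Longrightarrow> P \<gamma> \<Longrightarrow> P (\<beta> + \<gamma>)"
  shows "P \<alpha>"
  using assms(1)
proof (induction "card {\<beta>\<in>Rp. pf \<beta> < pf \<alpha>}" arbitrary: \<alpha> rule: less_induct)
  case less
  show ?case
  proof (cases "\<alpha> \<in> simple_roots")
    case True then show ?thesis by (rule assms)
  next
    case False
    then obtain \<beta> \<gamma> where bg: "\<beta> \<in> Rp" "\<gamma> \<in> Rp" "\<alpha> = \<beta> + \<gamma>"
      using less.prems by (auto simp: simple_roots_def)
    have lt: "card {\<delta>\<in>Rp. pf \<delta> < pf \<epsilon>} < card {\<delta>\<in>Rp. pf \<delta> < pf \<alpha>}"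
      if "\<epsilon> \<in> Rp" "pf \<epsilon> < pf \<alpha>" for \<epsilon>
      by (rule psubset_card_mono) (use that finite_Rp in auto)
    have "P \<beta>" "P \<gamma>"
      using less.hyps[OF lt] bg Rp_pf[of \<beta>] Rp_pf[of \<gamma>] by (auto simp: pf_simps)
    then show ?thesis using assms(3) bg less.prems by auto
  qed
qed

lemma Rp_simple_sum:
  assumes "\<alpha> \<in> Rp" shows "\<exists>n::'v \<Rightarrow> nat. \<alpha> = (\<Sum>\<beta>\<in>simple_roots. real (n \<beta>) *\<^sub>R \<beta>)"
  using assms
proof (induction rule: Rp_induct)
  case (simple \<alpha>)
  have "(\<Sum>\<beta>\<in>simple_roots. real (if \<beta> = \<alpha> then 1 else 0) *\<^sub>R \<beta>)
      = (\<Sum>\<beta>\<in>simple_roots. if \<beta> = \<alpha> then \<beta> else 0)"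
    by (rule sum.cong) auto
  also have "\<dots> = \<alpha>" using simple finite_simple by simp
  finally show ?case by (intro exI[of _ "\<lambda>\<beta>. if \<beta> = \<alpha> then 1 else 0"]) simp
next
  case (add \<beta> \<gamma>)
  then obtain m n :: "'v \<Rightarrow> nat" where
    "\<beta> = (\<Sum>\<beta>\<in>simple_roots. real (m \<beta>) *\<^sub>R \<beta>)" "\<gamma> = (\<Sum>\<beta>\<in>simple_roots. real (n \<beta>) *\<^sub>R \<beta>)"
    by blast
  then show ?case
    by (intro exI[of _ "\<lambda>\<delta>. m \<delta> + n \<delta>"]) (simp add: scaleR_left.add sum.distrib)
qed

lemma Ints_prod_lt_4:
  assumes "a \<in> \<int>" "b \<in> \<int>" "a > 0" "b > 0" "a * b < (4::real)" shows "a = 1 \<or> b = 1"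
proof (rule ccontr)
  obtain i j where ij: "a = of_int i" "b = of_int j" using assms by (auto elim!: Ints_cases)
  assume "\<not> ?thesis"
  then have "i \<ge> 2" "j \<ge> 2" using assms ij by auto
  then have "i * j \<ge> 2 * 2" by (intro mult_mono) auto
  moreover have "i * j < 4" using assms(5) ij by (metis of_int_less_numeral_iff of_int_mult)
  ultimately show False by simp
qed

text \<open>A positive pairing would make one of the two integers equal to 1, their product being
  below 4. A reflection then produces the root \<alpha> - \<beta>, and either \<alpha> or \<beta>
  becomes a sum of two positive roots.\<close>

lemma simple_obtuse:
  assumes "\<alpha> \<in> simple_roots" "\<beta> \<in> simple_roots" "\<alpha> \<noteq> \<beta>"
  shows "pair \<alpha> \<beta> \<le> 0"
proof (rule ccontr)
  assume "\<not> ?thesis"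
  then have p: "pair \<alpha> \<beta> > 0" "pair \<beta> \<alpha> > 0" using pair_sym_pos assms simple_R by auto
  have R: "\<alpha> \<in> R" "\<beta> \<in> R" "\<alpha> \<in> Rp" "\<beta> \<in> Rp" using assms simple_R simple_Rp by auto
  have "\<beta> \<noteq> - \<alpha>" using R Rp_neg by auto
  then have "pair \<alpha> \<beta> = 1 \<or> pair \<beta> \<alpha> = 1"
    using pair_prod(2)[OF R(1,2)] assms p R by (intro Ints_prod_lt_4) (auto simp: pair_Ints)
  then have "\<alpha> - \<beta> \<in> R"
    using refl_closed[of \<alpha> \<beta>] refl_closed[of \<beta> \<alpha>] R neg_closed[of "\<beta> - \<alpha>"] by (auto simp: refl_pair)
  then have "\<alpha> - \<beta> \<in> Rp \<or> \<beta> - \<alpha> \<in> Rp" using Rp_cases[of "\<alpha> - \<beta>"] by auto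
  moreover have "\<alpha> = (\<alpha> - \<beta>) + \<beta>" "\<beta> = (\<beta> - \<alpha>) + \<alpha>" by auto
  ultimately show False using assms R unfolding simple_roots_def by blast
qed

text \<open>If the reflected root were negative, its negative and the root itself would add up to a
  multiple of the simple root; obtuseness then forces both to be multiples.\<close>

lemma simple_refl_pos:
  assumes "\<alpha> \<in> simple_roots" "\<beta> \<in> Rp" "\<beta> \<noteq> \<alpha>"
  shows "refl \<alpha> \<beta> \<in> Rp"
proof (rule ccontr)
  assume neg: "refl \<alpha> \<beta> \<notin> Rp"
  define \<gamma> where "\<gamma> = - refl \<alpha> \<beta>"
  have a: "\<alpha> \<in> R" "\<alpha> \<in> Rp" using assms simple_R simple_Rp by auto
  have g: "\<gamma> \<in> Rp" using neg Rp_cases refl_closed a Rp_sub[OF assms(2)] unfolding \<gamma>_def by blast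
  have bg: "\<beta> + \<gamma> = pair \<beta> \<alpha> *\<^sub>R \<alpha>" by (simp add: \<gamma>_def refl_pair)
  obtain m n :: "'v \<Rightarrow> nat" where
    mn: "\<beta> = (\<Sum>\<delta>\<in>simple_roots. real (m \<delta>) *\<^sub>R \<delta>)" "\<gamma> = (\<Sum>\<delta>\<in>simple_roots. real (n \<delta>) *\<^sub>R \<delta>)"
    using Rp_simple_sum assms g by blast
  define S where "S = simple_roots - {\<alpha>}"
  have fS: "finite S" using finite_simple by (simp add: S_def)
  have mS: "\<beta> = real (m \<alpha>) *\<^sub>R \<alpha> + (\<Sum>\<delta>\<in>S. real (m \<delta>) *\<^sub>R \<delta>)"
    and nS: "\<gamma> = real (n \<alpha>) *\<^sub>R \<alpha> + (\<Sum>\<delta>\<in>S. real (n \<delta>) *\<^sub>R \<delta>)"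
    unfolding S_def using mn sum.remove[OF finite_simple assms(1)] by auto
  define v where "v = (\<Sum>\<delta>\<in>S. real (m \<delta> + n \<delta>) *\<^sub>R \<delta>)"
  define k where "k = pair \<beta> \<alpha> - real (m \<alpha>) - real (n \<alpha>)"
  have "v = (\<Sum>\<delta>\<in>S. real (m \<delta>) *\<^sub>R \<delta>) + (\<Sum>\<delta>\<in>S. real (n \<delta>) *\<^sub>R \<delta>)"
    by (simp add: v_def sum.distrib scaleR_left.add)
  also have "\<dots> = (\<beta> - real (m \<alpha>) *\<^sub>R \<alpha>) + (\<gamma> - real (n \<alpha>) *\<^sub>R \<alpha>)"
    using mS nS by (simp only: eq_diff_eq' add_diff_eq[symmetric]) (simp add: algebra_simps)
  also have "\<dots> = (\<beta> + \<gamma>) - real (m \<alpha>) *\<^sub>R \<alpha> - real (n \<alpha>) *\<^sub>R \<alpha>" by simp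
  also have "\<dots> = k *\<^sub>R \<alpha>" by (simp add: bg k_def scaleR_left.diff)
  finally have v: "v = k *\<^sub>R \<alpha>" .
  have "pair v \<alpha> = (\<Sum>\<delta>\<in>S. real (m \<delta> + n \<delta>) * pair \<delta> \<alpha>)"
    by (simp add: v_def pair_sum pair_scaleR)
  also have "\<dots> \<le> 0"
    by (intro sum_nonpos mult_nonneg_nonpos) (use assms simple_obtuse in \<open>auto simp: S_def\<close>)
  finally have "k \<le> 0" using v a by (simp add: pair_scaleR pair_self)
  moreover have pfv: "pf v = (\<Sum>\<delta>\<in>S. real (m \<delta> + n \<delta>) * pf \<delta>)"
    unfolding v_def using pf(1) by (simp add: linear_sum pf_simps)
  moreover have nn: "real (m \<delta> + n \<delta>) * pf \<delta> \<ge> 0" if "\<delta> \<in> S" for \<delta>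
    using that Rp_pf[OF simple_Rp, of \<delta>] by (auto simp: S_def)
  ultimately have "pf v = 0"
    using v Rp_pf[OF a(2)] sum_nonneg[of S "\<lambda>\<delta>. real (m \<delta> + n \<delta>) * pf \<delta>"]
    by (smt (verit) pf_simps(4) mult_nonpos_nonneg)
  then have "\<forall>\<delta>\<in>S. real (m \<delta> + n \<delta>) * pf \<delta> = 0"
    using pfv nn fS by (metis (no_types, lifting) sum_nonneg_eq_0_iff)
  then have "\<forall>\<delta>\<in>S. m \<delta> = 0"
    using Rp_pf[OF simple_Rp] by (fastforce simp: S_def)
  then have "\<beta> = real (m \<alpha>) *\<^sub>R \<alpha>" using mS by simp
  moreover from this have "real (m \<alpha>) = 1 \<or> real (m \<alpha>) = -1"
    using reduced[OF a(1), of "real (m \<alpha>)"] Rp_sub[OF assms(2)] by auto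
  ultimately show False using assms(3) by auto
qed

lemma bij_betw_simple_refl:
  assumes "\<alpha> \<in> simple_roots"
  shows "bij_betw (refl \<alpha>) (Rp - {\<alpha>}) (Rp - {\<alpha>})"
proof (rule bij_betw_byWitness[where f' = "refl \<alpha>"])
  have a: "\<alpha> \<in> R" using assms simple_R by auto
  have "refl \<alpha> \<beta> \<noteq> \<alpha>" if "\<beta> \<in> Rp" for \<beta>
  proof
    assume "refl \<alpha> \<beta> = \<alpha>"
    then have "\<beta> = - \<alpha>" using refl_invol[OF a, of \<beta>] refl_self[OF a] by simp
    then show False using that Rp_neg[of \<alpha>] simple_Rp[OF assms] by auto
  qed
  then show "refl \<alpha> ` (Rp - {\<alpha>}) \<subseteq> Rp - {\<alpha>}" "refl \<alpha> ` (Rp - {\<alpha>}) \<subseteq> Rp - {\<alpha>}"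
    using simple_refl_pos[OF assms] by auto
qed (use assms simple_R in auto)

section \<open>The Weyl group\<close>

abbreviation winv :: "('v \<Rightarrow> 'v) \<Rightarrow> 'v \<Rightarrow> 'v" where "winv w \<equiv> inv_into UNIV w"

text \<open>The pairing with the sum of the positive coroots, that is, twice the usual height. It is
  integral on weights and serves as the degree in the leading term arguments.\<close>

definition ht :: "'v \<Rightarrow> real" where "ht x = (\<Sum>\<alpha>\<in>Rp. pair x \<alpha>)"

lemma ht_simps: "ht (x + y) = ht x + ht y" "ht (x - y) = ht x - ht y" "ht (c *\<^sub>R x) = c * ht x"
  "ht (- x) = - ht x" "ht 0 = 0"
  by (simp_all add: ht_def pair_simps sum.distrib sum_subtractf sum_distrib_left sum_negf)

text \<open>\<open>refl \<alpha>\<close> permutes the other positive roots, so their total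
  contribution equals its own negative, and only the pairing of \<alpha> with itself
  remains.\<close>

lemma ht_simple: assumes "\<alpha> \<in> simple_roots" shows "ht \<alpha> = 2"
proof -
  have a: "\<alpha> \<in> R" "\<alpha> \<in> Rp" using assms simple_R simple_Rp by auto
  let ?s = "\<Sum>\<beta>\<in>Rp - {\<alpha>}. pair \<alpha> \<beta>"
  have "?s = (\<Sum>\<beta>\<in>Rp - {\<alpha>}. pair \<alpha> (refl \<alpha> \<beta>))"
    by (rule sum.reindex_bij_betw[OF bij_betw_simple_refl[OF assms], symmetric])
  also have "\<dots> = (\<Sum>\<beta>\<in>Rp - {\<alpha>}. pair (- \<alpha>) \<beta>)"
    using pair_refl[OF a(1), of "- \<alpha>"] by (simp add: refl_minus refl_self a)
  also have "\<dots> = - ?s" by (simp add: pair_minus sum_negf)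
  finally have "?s = 0" by simp
  then show ?thesis
    unfolding ht_def using sum.remove[OF finite_Rp a(2), of "pair \<alpha>"] by (simp add: pair_self a)
qed

lemma ht_pos: "\<alpha> \<in> Rp \<Longrightarrow> ht \<alpha> > 0"
  by (induction rule: Rp_induct) (auto simp: ht_simple ht_simps)

lemma ht_refl: "\<alpha> \<in> simple_roots \<Longrightarrow> ht (refl \<alpha> x) = ht x - 2 * pair x \<alpha>"
  by (simp add: refl_pair ht_simps ht_simple)

lemma refl_rho: assumes "\<alpha> \<in> simple_roots" shows "refl \<alpha> \<rho> = \<rho> - \<alpha>"
proof -
  have a: "\<alpha> \<in> R" "\<alpha> \<in> Rp" using assms simple_R simple_Rp by auto
  let ?s = "\<Sum>\<beta>\<in>Rp - {\<alpha>}. \<beta>"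
  have "refl \<alpha> ?s = (\<Sum>\<beta>\<in>Rp - {\<alpha>}. refl \<alpha> \<beta>)"
    by (rule linear_sum[OF linear_refl])
  also have "\<dots> = ?s"
    by (rule sum.reindex_bij_betw[OF bij_betw_simple_refl[OF assms]])
  finally have s: "refl \<alpha> ?s = ?s" .
  have r: "\<rho> = (1/2) *\<^sub>R \<alpha> + (1/2) *\<^sub>R ?s"
    unfolding \<rho>_def using sum.remove[OF finite_Rp a(2), of "\<lambda>x. x"] by (simp add: scaleR_right_distrib)
  have "refl \<alpha> \<rho> = - (1/2) *\<^sub>R \<alpha> + (1/2) *\<^sub>R ?s"
    by (simp add: r refl_add refl_scaleR s refl_self[OF a(1)])
  also have "\<dots> = \<rho> - \<alpha>"
  proof -
    have "\<alpha> = (1/2) *\<^sub>R \<alpha> + (1/2) *\<^sub>R \<alpha>" by (simp flip: scaleR_left.add)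
    then show ?thesis unfolding r by (simp add: algebra_simps)
  qed
  finally show ?thesis .
qed

lemma pair_rho: assumes "\<alpha> \<in> simple_roots" shows "pair \<rho> \<alpha> = 1"
proof -
  have "pair \<rho> \<alpha> *\<^sub>R \<alpha> = 1 *\<^sub>R \<alpha>" using refl_rho[OF assms] by (simp add: refl_pair)
  then show ?thesis using root_nz[OF simple_R[OF assms]] by (simp only: scaleR_cancel_right) auto
qed

lemma refl_word_Nil [simp]: "refl_word [] = id"
  and refl_word_Cons [simp]: "refl_word (\<alpha> # \<alpha>s) = refl \<alpha> \<circ> refl_word \<alpha>s"
  by (simp_all add: refl_word_def)

lemma refl_word_append [simp]: "refl_word (\<alpha>s @ \<beta>s) = refl_word \<alpha>s \<circ> refl_word \<beta>s"
  by (induction \<alpha>s) (simp_all add: comp_assoc)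

lemma refl_word_rev: "\<alpha>s \<in> lists R \<Longrightarrow> refl_word (rev \<alpha>s) \<circ> refl_word \<alpha>s = id"
proof (induction \<alpha>s)
  case (Cons \<alpha> \<alpha>s)
  have "refl_word (rev (\<alpha> # \<alpha>s)) \<circ> refl_word (\<alpha> # \<alpha>s)
      = refl_word (rev \<alpha>s) \<circ> (refl \<alpha> \<circ> refl \<alpha>) \<circ> refl_word \<alpha>s" by (simp add: comp_assoc)
  then show ?case using Cons by simp
qed simp

lemma refl_word_rev': "\<alpha>s \<in> lists R \<Longrightarrow> refl_word \<alpha>s \<circ> refl_word (rev \<alpha>s) = id"
  using refl_word_rev[of "rev \<alpha>s"] by (simp add: lists_eq_set)

lemma inv_refl_word: "\<alpha>s \<in> lists R \<Longrightarrow> winv (refl_word \<alpha>s) = refl_word (rev \<alpha>s)"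
  using refl_word_rev refl_word_rev' by (intro inv_unique_comp)

lemma weylE: assumes "w \<in> weyl" obtains \<alpha>s where "\<alpha>s \<in> lists R" "w = refl_word \<alpha>s"
  using assms by (auto simp: weyl_def)

lemma weyl_id [simp]: "id \<in> weyl" unfolding weyl_def by (rule image_eqI[of _ _ "[]"]) simp_all

lemma weyl_nonempty: "weyl \<noteq> {}" using weyl_id by blast

lemma weyl_refl: "\<alpha> \<in> R \<Longrightarrow> refl \<alpha> \<in> weyl"
  unfolding weyl_def by (rule image_eqI[of _ _ "[\<alpha>]"]) auto

lemma weyl_comp: "v \<in> weyl \<Longrightarrow> w \<in> weyl \<Longrightarrow> v \<circ> w \<in> weyl"
proof -
  assume "v \<in> weyl" "w \<in> weyl"
  then obtain a b where "a \<in> lists R" "v = refl_word a" "b \<in> lists R" "w = refl_word b"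
    unfolding weyl_def by blast
  then have "v \<circ> w = refl_word (a @ b)" "a @ b \<in> lists R" by simp_all
  then show ?thesis unfolding weyl_def by blast
qed

lemma weyl_inv: "w \<in> weyl \<Longrightarrow> winv w \<in> weyl"
  by (erule weylE) (auto simp: inv_refl_word weyl_def lists_eq_set intro!: imageI)

lemma weyl_bij: "w \<in> weyl \<Longrightarrow> bij w"
  by (erule weylE) (metis refl_word_rev refl_word_rev' o_bij)

lemma weyl_inv_comp: "w \<in> weyl \<Longrightarrow> winv w \<circ> w = id" "w \<in> weyl \<Longrightarrow> w \<circ> winv w = id"
  using weyl_bij by (simp_all add: bij_is_inj bij_is_surj surj_iff[symmetric])

lemma weyl_inv_apply: "w \<in> weyl \<Longrightarrow> winv w (w x) = x" "w \<in> weyl \<Longrightarrow> w (winv w x) = x"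
  using weyl_inv_comp by (simp_all add: pointfree_idE)

lemma weyl_inv_inv: "w \<in> weyl \<Longrightarrow> winv (winv w) = w"
  using weyl_bij inv_inv_eq by auto

lemma weyl_induct [consumes 1, case_names id refl]:
  assumes "w \<in> weyl" "P id" "\<And>\<alpha> w. \<alpha> \<in> R \<Longrightarrow> w \<in> weyl \<Longrightarrow> P w \<Longrightarrow> P (refl \<alpha> \<circ> w)"
  shows "P w"
proof -
  obtain \<alpha>s where "\<alpha>s \<in> lists R" "w = refl_word \<alpha>s" using assms by (auto elim: weylE)
  then show ?thesis
  proof (induction \<alpha>s arbitrary: w)
    case Nil then show ?case using assms(2) by (simp only: refl_word_Nil)
  next
    case (Cons \<alpha> \<alpha>s)
    then have "P (refl \<alpha> \<circ> refl_word \<alpha>s)" by (intro assms(3)) (auto simp: weyl_def)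
    then show ?case using Cons.prems by (simp only: refl_word_Cons)
  qed
qed

lemma weyl_linear: "w \<in> weyl \<Longrightarrow> linear w"
proof (induction rule: weyl_induct)
  case id then show ?case by (rule module_hom_id[unfolded id_def[symmetric]] | simp add: linear_id id_def)+
next
  case (refl \<alpha> w) then show ?case using linear_compose[OF _ linear_refl] by blast
qed

lemma weyl_add: "w \<in> weyl \<Longrightarrow> w (x + y) = w x + w y"
  and weyl_diff: "w \<in> weyl \<Longrightarrow> w (x - y) = w x - w y"
  and weyl_scaleR: "w \<in> weyl \<Longrightarrow> w (c *\<^sub>R x) = c *\<^sub>R w x"
  and weyl_minus: "w \<in> weyl \<Longrightarrow> w (- x) = - w x"
  and weyl_zero: "w \<in> weyl \<Longrightarrow> w 0 = 0"
  using weyl_linear[of w] linear_add linear_diff linear_scale linear_neg linear_0 by metis+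

lemma weyl_root: "w \<in> weyl \<Longrightarrow> \<alpha> \<in> R \<Longrightarrow> w \<alpha> \<in> R"
  by (induction rule: weyl_induct) (auto simp: refl_closed)

lemma weyl_pair: "w \<in> weyl \<Longrightarrow> pair (w x) (w \<alpha>) = pair x \<alpha>"
  by (induction rule: weyl_induct) (auto simp: pair_refl)

lemma weyl_pair_inv: "w \<in> weyl \<Longrightarrow> pair (w x) \<alpha> = pair x (winv w \<alpha>)"
  using weyl_pair[of w x "winv w \<alpha>"] by (simp add: weyl_inv_apply)

lemma weyl_conj: "w \<in> weyl \<Longrightarrow> w \<circ> refl \<alpha> = refl (w \<alpha>) \<circ> w"
  by (simp add: fun_eq_iff refl_pair weyl_pair weyl_diff weyl_scaleR)

lemma weyl_eq_on_R:
  assumes "v \<in> weyl" "w \<in> weyl" "\<And>\<alpha>. \<alpha> \<in> R \<Longrightarrow> v \<alpha> = w \<alpha>" shows "v = w"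
proof
  fix x
  have "x \<in> span R" using span_R by simp
  then show "v x = w x"
    using linear_eq_on[OF weyl_linear[OF assms(1)] weyl_linear[OF assms(2)]] assms(3) by blast
qed

text \<open>R spans, so an element of W is determined by its restriction to the finite set R, which
  it maps into itself.\<close>

lemma finite_weyl: "finite weyl"
proof (rule finite_imageD)
  show "inj_on (\<lambda>w. restrict w R) weyl"
    by (rule inj_onI) (metis weyl_eq_on_R restrict_apply')
  have "(\<lambda>w. restrict w R) ` weyl \<subseteq> (R \<rightarrow>\<^sub>E R)" using weyl_root by auto
  then show "finite ((\<lambda>w. restrict w R) ` weyl)"
    using finite_PiE[OF finite_R, of "\<lambda>_. R"] finite_R finite_subset by blast
qed

lemma lists_simple_R: "\<alpha>s \<in> lists simple_roots \<Longrightarrow> \<alpha>s \<in> lists R"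
  using simple_R by (auto simp: lists_eq_set)

text \<open>Expand one argument of \<open>ip \<alpha> \<alpha> > 0\<close> in simple roots with
  nonnegative coefficients; some summand must be positive.\<close>

lemma nonsimple_descent:
  assumes "\<alpha> \<in> Rp" obtains \<beta> where "\<beta> \<in> simple_roots" "pair \<alpha> \<beta> > 0"
proof -
  obtain n :: "'v \<Rightarrow> nat" where n: "\<alpha> = (\<Sum>\<beta>\<in>simple_roots. real (n \<beta>) *\<^sub>R \<beta>)"
    using Rp_simple_sum[OF assms] by blast
  have ipsum: "ip \<alpha> (sum g S) = (\<Sum>i\<in>S. ip \<alpha> (g i))" for g :: "'v \<Rightarrow> 'v" and S
    by (simp add: ip_def pair_sum sum_distrib_left sum.swap[of _ S])
  have "0 < ip \<alpha> \<alpha>" using assms ip_pos Rp_sub root_nz by blast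
  also have "ip \<alpha> \<alpha> = (\<Sum>\<beta>\<in>simple_roots. real (n \<beta>) * ip \<alpha> \<beta>)"
    by (subst (2) n) (simp add: ipsum ip_simps)
  finally obtain \<beta> where "\<beta> \<in> simple_roots" "real (n \<beta>) * ip \<alpha> \<beta> > 0"
    by (metis (no_types, lifting) not_le sum_nonpos)
  then show ?thesis using that pair_pos_iff simple_R by (simp add: zero_less_mult_iff)
qed

text \<open>Reflecting a nonsimple positive root in a simple root of positive pairing keeps it
  positive and lowers \<open>pf\<close>, so the process ends at a simple root.\<close>

lemma Rp_conj_simple:
  assumes "\<alpha> \<in> Rp"
  shows "\<exists>\<alpha>s\<in>lists simple_roots. \<exists>\<beta>\<in>simple_roots. \<alpha> = refl_word \<alpha>s \<beta>"
  using assms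
proof (induction "card {\<beta>\<in>Rp. pf \<beta> < pf \<alpha>}" arbitrary: \<alpha> rule: less_induct)
  case less
  show ?case
  proof (cases "\<alpha> \<in> simple_roots")
    case True then show ?thesis by (intro bexI[of _ "[]"] bexI[of _ \<alpha>]) auto
  next
    case False
    obtain \<beta> where b: "\<beta> \<in> simple_roots" "pair \<alpha> \<beta> > 0" using nonsimple_descent less.prems by blast
    let ?a = "refl \<beta> \<alpha>"
    have a: "?a \<in> Rp" using simple_refl_pos b False less.prems by auto
    have lt: "pf ?a < pf \<alpha>" using b Rp_pf[OF simple_Rp] by (auto simp: refl_pair pf_simps)
    have "card {\<gamma>\<in>Rp. pf \<gamma> < pf ?a} < card {\<gamma>\<in>Rp. pf \<gamma> < pf \<alpha>}"
      by (rule psubset_card_mono) (use a lt finite_Rp in auto)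
    then obtain \<alpha>s \<gamma> where "\<alpha>s\<in>lists simple_roots" "\<gamma>\<in>simple_roots" "?a = refl_word \<alpha>s \<gamma>"
      using less.hyps a by blast
    moreover from this have "\<alpha> = refl_word (\<beta> # \<alpha>s) \<gamma>"
      using refl_invol[OF simple_R[OF b(1)], of \<alpha>] by simp
    ultimately show ?thesis using b by (intro bexI[of _ "\<beta> # \<alpha>s"] bexI[of _ \<gamma>]) auto
  qed
qed

text \<open>Conjugate a simple reflection by the word of \<open>Rp_conj_simple\<close>. This is why
  the simple reflections generate W.\<close>

lemma refl_simple_word: assumes "\<alpha> \<in> R" shows "\<exists>\<alpha>s\<in>lists simple_roots. refl \<alpha> = refl_word \<alpha>s"
proof -
  have pos: "\<exists>\<alpha>s\<in>lists simple_roots. refl \<alpha> = refl_word \<alpha>s" if a: "\<alpha> \<in> Rp" for \<alpha>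
  proof -
    obtain \<alpha>s \<beta> where *: "\<alpha>s\<in>lists simple_roots" "\<beta>\<in>simple_roots" "\<alpha> = refl_word \<alpha>s \<beta>"
      using Rp_conj_simple[OF a] by blast
    have w: "refl_word \<alpha>s \<in> weyl" using * lists_simple_R by (auto simp: weyl_def)
    have "refl_word (\<alpha>s @ \<beta> # rev \<alpha>s) = (refl_word \<alpha>s \<circ> refl \<beta>) \<circ> refl_word (rev \<alpha>s)"
      by (simp add: comp_assoc)
    also have "\<dots> = refl \<alpha> \<circ> (refl_word \<alpha>s \<circ> refl_word (rev \<alpha>s))"
      using weyl_conj[OF w, of \<beta>] * by (simp add: comp_assoc)
    also have "\<dots> = refl \<alpha>" using refl_word_rev' lists_simple_R[OF *(1)] by simp
    finally show ?thesis using * by (intro bexI[of _ "\<alpha>s @ \<beta> # rev \<alpha>s"]) (auto simp: lists_eq_set)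
  qed
  show ?thesis using Rp_cases[OF assms] pos[of \<alpha>] pos[of "- \<alpha>"] refl_neg_root by auto
qed

lemma weyl_simple: "weyl = refl_word ` lists simple_roots"
proof
  show "refl_word ` lists simple_roots \<subseteq> weyl" using lists_simple_R by (auto simp: weyl_def)
  show "weyl \<subseteq> refl_word ` lists simple_roots"
  proof
    fix w assume "w \<in> weyl"
    then show "w \<in> refl_word ` lists simple_roots"
    proof (induction rule: weyl_induct)
      case id then show ?case by (rule image_eqI[of _ _ "[]"]) auto
    next
      case (refl \<alpha> w)
      then obtain \<alpha>s \<beta>s where "\<alpha>s\<in>lists simple_roots" "refl \<alpha> = refl_word \<alpha>s"
        "\<beta>s\<in>lists simple_roots" "w = refl_word \<beta>s"
        using refl_simple_word by blast
      then show ?case by (intro image_eqI[of _ _ "\<alpha>s @ \<beta>s"]) auto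
    qed
  qed
qed

lemma simple_word_weyl: "\<alpha>s \<in> lists simple_roots \<Longrightarrow> refl_word \<alpha>s \<in> weyl"
  using weyl_simple by auto

lemma len_le: "\<alpha>s \<in> lists simple_roots \<Longrightarrow> len (refl_word \<alpha>s) \<le> length \<alpha>s"
  unfolding len_def by (rule Least_le) auto

lemma reduced_word_exists: assumes "w \<in> weyl" shows "\<exists>\<alpha>s. reduced_word \<alpha>s w"
proof -
  obtain \<alpha>s where "\<alpha>s \<in> lists simple_roots" "refl_word \<alpha>s = w" using assms weyl_simple by auto
  then have "\<exists>n. \<exists>\<alpha>s\<in>lists simple_roots. length \<alpha>s = n \<and> refl_word \<alpha>s = w" by blast
  from LeastI_ex[OF this] show ?thesis unfolding reduced_word_def len_def by blast
qed

section \<open>Length, inversions and exchange\<close>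

definition inversions :: "('v \<Rightarrow> 'v) \<Rightarrow> 'v set" where "inversions w = {\<alpha>\<in>Rp. w \<alpha> \<notin> Rp}"

lemma finite_inversions: "finite (inversions w)" using finite_Rp by (simp add: inversions_def)

text \<open>The simple reflection permutes the positive roots other than \<beta>, so it carries the
  inversions of w to inversions of the product; \<beta> itself is the one new inversion.\<close>

lemma inversions_refl:
  assumes w: "w \<in> weyl" and b: "\<beta> \<in> simple_roots" "w \<beta> \<in> Rp"
  shows "card (inversions (w \<circ> refl \<beta>)) = Suc (card (inversions w))"
proof -
  have bR: "\<beta> \<in> R" "\<beta> \<in> Rp" using b simple_R simple_Rp by auto
  have nb: "- w \<beta> \<notin> Rp" using b Rp_neg by auto
  have "inversions (w \<circ> refl \<beta>) = insert \<beta> (refl \<beta> ` inversions w)" (is "?L = ?M")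
  proof
    show "?L \<subseteq> ?M"
    proof
      fix \<alpha> assume "\<alpha> \<in> ?L"
      then have a: "\<alpha> \<in> Rp" "w (refl \<beta> \<alpha>) \<notin> Rp" by (auto simp: inversions_def)
      show "\<alpha> \<in> ?M"
      proof (cases "\<alpha> = \<beta>")
        case False
        then have "refl \<beta> \<alpha> \<in> inversions w" using a simple_refl_pos[OF b(1)] by (auto simp: inversions_def)
        then show ?thesis using refl_invol[OF bR(1), of \<alpha>] by (metis image_eqI insertCI)
      qed simp
    qed
    show "?M \<subseteq> ?L"
    proof
      fix \<alpha> assume "\<alpha> \<in> ?M"
      then consider "\<alpha> = \<beta>" | \<gamma> where "\<alpha> = refl \<beta> \<gamma>" "\<gamma> \<in> Rp" "w \<gamma> \<notin> Rp" by (auto simp: inversions_def)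
      then show "\<alpha> \<in> ?L"
      proof cases
        case 1 then show ?thesis using bR nb w by (simp add: inversions_def refl_self weyl_minus)
      next
        case 2
        then have "\<gamma> \<noteq> \<beta>" using b by auto
        then show ?thesis using 2 simple_refl_pos[OF b(1)] bR by (simp add: inversions_def)
      qed
    qed
  qed
  moreover have "\<beta> \<notin> refl \<beta> ` inversions w"
  proof
    assume "\<beta> \<in> refl \<beta> ` inversions w"
    then obtain \<gamma> where "\<gamma> \<in> Rp" "\<beta> = refl \<beta> \<gamma>" by (auto simp: inversions_def)
    then show False using refl_invol[OF bR(1), of \<gamma>] refl_self[OF bR(1)] Rp_neg[of \<beta>] bR by auto
  qed
  moreover have "card (refl \<beta> ` inversions w) = card (inversions w)"
    using bij_refl[OF bR(1)] by (intro card_image) (auto simp: bij_def inj_on_def)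
  ultimately show ?thesis using finite_inversions by simp
qed

text \<open>Apply the letters to \<beta> from the right and stop at the letter that turns the
  positive root negative. A simple reflection does this only to its own root, so the image of
  \<beta> is that letter; conjugation moves \<open>refl \<beta>\<close> next to it, and the two
  cancel.\<close>

lemma exchange:
  assumes "\<alpha>s \<in> lists simple_roots" "\<beta> \<in> simple_roots" "refl_word \<alpha>s \<beta> \<notin> Rp"
  shows "\<exists>as \<alpha> bs. \<alpha>s = as @ \<alpha> # bs \<and> refl_word \<alpha>s \<circ> refl \<beta> = refl_word (as @ bs)"
  using assms
proof (induction \<alpha>s)
  case Nil then show ?case using simple_Rp by auto
next
  case (Cons \<alpha> t)
  have t: "t \<in> lists simple_roots" "\<alpha> \<in> simple_roots" using Cons.hyps by simp_all
  have w: "refl_word t \<in> weyl" using t simple_word_weyl by auto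
  show ?case
  proof (cases "refl_word t \<beta> \<in> Rp")
    case True
    then have "refl_word t \<beta> = \<alpha>" using Cons.prems simple_refl_pos[OF t(2)] by auto
    then have "refl_word t \<circ> refl \<beta> = refl \<alpha> \<circ> refl_word t" using weyl_conj[OF w, of \<beta>] by simp
    then have "refl_word (\<alpha> # t) \<circ> refl \<beta> = (refl \<alpha> \<circ> refl \<alpha>) \<circ> refl_word t"
      by (simp add: comp_assoc)
    then have "\<alpha> # t = [] @ \<alpha> # t \<and> refl_word (\<alpha> # t) \<circ> refl \<beta> = refl_word ([] @ t)"
      using simple_R[OF t(2)] by simp
    then show ?thesis by blast
  next
    case False
    then obtain as \<gamma> bs where "t = as @ \<gamma> # bs" "refl_word t \<circ> refl \<beta> = refl_word (as @ bs)"
      using Cons.IH[OF assms(2) False] by blast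
    then have "\<alpha> # t = (\<alpha> # as) @ \<gamma> # bs" "refl_word (\<alpha> # t) \<circ> refl \<beta> = refl_word ((\<alpha> # as) @ bs)"
      by (simp_all add: comp_assoc)
    then show ?thesis by blast
  qed
qed

text \<open>A shorter word for one factor would give a shorter word for w.\<close>

lemma reduced_prefix:
  assumes "reduced_word (as @ bs) w" shows "reduced_word as (refl_word as)" "reduced_word bs (refl_word bs)"
proof -
  have l: "as \<in> lists simple_roots" "bs \<in> lists simple_roots" using assms by (auto simp: reduced_word_def)
  obtain as' bs' where *: "reduced_word as' (refl_word as)" "reduced_word bs' (refl_word bs)"
    using reduced_word_exists simple_word_weyl l by metis
  have "refl_word (as' @ bs) = w" "refl_word (as @ bs') = w" using * assms by (auto simp: reduced_word_def)
  then have "len w \<le> length (as' @ bs)" "len w \<le> length (as @ bs')"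
    using len_le[of "as' @ bs"] len_le[of "as @ bs'"] l * by (auto simp: reduced_word_def)
  then show "reduced_word as (refl_word as)" "reduced_word bs (refl_word bs)"
    using * assms l len_le[OF l(1)] len_le[OF l(2)] by (auto simp: reduced_word_def)
qed

text \<open>Each further letter adds an inversion, since otherwise \<open>exchange\<close> would
  delete a letter and shorten a reduced word.\<close>

lemma reduced_inversions:
  "reduced_word \<alpha>s (refl_word \<alpha>s) \<Longrightarrow> card (inversions (refl_word \<alpha>s)) = length \<alpha>s"
proof (induction \<alpha>s rule: rev_induct)
  case Nil then show ?case by (simp add: inversions_def)
next
  case (snoc \<beta> t)
  have t: "reduced_word t (refl_word t)" using reduced_prefix snoc.prems by blast
  have l: "t \<in> lists simple_roots" "\<beta> \<in> simple_roots" using snoc.prems by (auto simp: reduced_word_def)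
  have w: "refl_word t \<in> weyl" using l simple_word_weyl by auto
  have "refl_word t \<beta> \<in> Rp"
  proof (rule ccontr)
    assume "refl_word t \<beta> \<notin> Rp"
    then obtain as \<alpha> bs where *: "t = as @ \<alpha> # bs" "refl_word t \<circ> refl \<beta> = refl_word (as @ bs)"
      using exchange l by blast
    then have "len (refl_word t \<circ> refl \<beta>) \<le> length (as @ bs)" using len_le[of "as @ bs"] l by auto
    then have "len (refl_word (t @ [\<beta>])) \<le> length (as @ bs)" by simp
    then show False using * snoc.prems by (auto simp: reduced_word_def)
  qed
  then have "card (inversions (refl_word t \<circ> refl \<beta>)) = Suc (length t)"
    using inversions_refl[of "refl_word t" \<beta>] w l(2) snoc.IH t by simp
  then show ?case by (simp add: comp_def)
qed

lemma len_inversions: assumes "w \<in> weyl" shows "len w = card (inversions w)"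
proof -
  obtain \<alpha>s where "reduced_word \<alpha>s w" using reduced_word_exists assms by blast
  then show ?thesis using reduced_inversions[of \<alpha>s] by (auto simp: reduced_word_def)
qed

lemma len_refl_pos: "w \<in> weyl \<Longrightarrow> \<beta> \<in> simple_roots \<Longrightarrow> w \<beta> \<in> Rp \<Longrightarrow> len (w \<circ> refl \<beta>) = Suc (len w)"
  using inversions_refl len_inversions weyl_comp weyl_refl simple_R by simp

lemma len_refl_neg:
  assumes "w \<in> weyl" "\<beta> \<in> simple_roots" "w \<beta> \<notin> Rp" shows "len w = Suc (len (w \<circ> refl \<beta>))"
proof -
  have b: "\<beta> \<in> R" using assms simple_R by auto
  have "(w \<circ> refl \<beta>) \<beta> \<in> Rp"
    using assms b Rp_cases[OF weyl_root[OF assms(1) b]] by (simp add: refl_self weyl_minus)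
  with len_refl_pos[of "w \<circ> refl \<beta>" \<beta>] have "len ((w \<circ> refl \<beta>) \<circ> refl \<beta>) = Suc (len (w \<circ> refl \<beta>))"
    using assms b weyl_comp weyl_refl by metis
  moreover have "(w \<circ> refl \<beta>) \<circ> refl \<beta> = w" using b by (simp add: comp_assoc)
  ultimately show ?thesis by simp
qed

lemma len_inv: assumes "w \<in> weyl" shows "len (winv w) = len w"
proof -
  have le: "len (winv w) \<le> len w" if w: "w \<in> weyl" for w
  proof -
    obtain \<alpha>s where *: "reduced_word \<alpha>s w" using reduced_word_exists \<open>w \<in> weyl\<close> by blast
    then have "winv w = refl_word (rev \<alpha>s)" using inv_refl_word lists_simple_R by (auto simp: reduced_word_def)
    then show ?thesis using len_le[of "rev \<alpha>s"] * by (auto simp: reduced_word_def lists_eq_set)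
  qed
  from le[OF assms] le[OF weyl_inv[OF assms]] weyl_inv_inv[OF assms] show ?thesis by simp
qed

lemma inv_refl_comp: "w \<in> weyl \<Longrightarrow> \<beta> \<in> R \<Longrightarrow> winv (refl \<beta> \<circ> w) = winv w \<circ> refl \<beta>"
  using o_inv_distrib[OF bij_refl weyl_bij] inv_unique_comp[of "refl \<beta>" "refl \<beta>"] by simp

lemma len_refl_left_pos:
  assumes "w \<in> weyl" "\<beta> \<in> simple_roots" "winv w \<beta> \<in> Rp" shows "len (refl \<beta> \<circ> w) = Suc (len w)"
proof -
  have "len (refl \<beta> \<circ> w) = len (winv w \<circ> refl \<beta>)"
    using len_inv[of "refl \<beta> \<circ> w"] inv_refl_comp assms simple_R weyl_comp weyl_refl by simp
  then show ?thesis using len_refl_pos[of "winv w" \<beta>] assms weyl_inv len_inv by simp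
qed

lemma len_refl_left_neg:
  assumes "w \<in> weyl" "\<beta> \<in> simple_roots" "winv w \<beta> \<notin> Rp" shows "len w = Suc (len (refl \<beta> \<circ> w))"
proof -
  have "len (refl \<beta> \<circ> w) = len (winv w \<circ> refl \<beta>)"
    using len_inv[of "refl \<beta> \<circ> w"] inv_refl_comp assms simple_R weyl_comp weyl_refl by simp
  then show ?thesis using len_refl_neg[of "winv w" \<beta>] assms weyl_inv len_inv by simp
qed

lemma len_id [simp]: "len id = 0" using len_le[of "[]"] by simp

lemma len_0: "w \<in> weyl \<Longrightarrow> len w = 0 \<Longrightarrow> w = id"
  using reduced_word_exists[of w] by (auto simp: reduced_word_def)

lemma sgn_refl: "w \<in> weyl \<Longrightarrow> \<beta> \<in> simple_roots \<Longrightarrow> (-1::'b::ring_1) ^ len (refl \<beta> \<circ> w) = - ((-1) ^ len w)"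
proof (cases "winv w \<beta> \<in> Rp")
  case False
  assume "w \<in> weyl" "\<beta> \<in> simple_roots"
  with False have "len w = Suc (len (refl \<beta> \<circ> w))" by (intro len_refl_left_neg)
  then show ?thesis by (simp add: \<open>len w = _\<close>)
next
  case True
  assume "w \<in> weyl" "\<beta> \<in> simple_roots"
  with True have "len (refl \<beta> \<circ> w) = Suc (len w)" by (intro len_refl_left_pos)
  then show ?thesis by simp
qed

lemma sgn_word: "\<alpha>s \<in> lists simple_roots \<Longrightarrow> w \<in> weyl \<Longrightarrow>
    (-1::'b::ring_1) ^ len (refl_word \<alpha>s \<circ> w) = (-1) ^ length \<alpha>s * (-1) ^ len w"
proof (induction \<alpha>s)
  case (Cons \<alpha> \<alpha>s)
  then have "(-1::'b) ^ len (refl \<alpha> \<circ> (refl_word \<alpha>s \<circ> w)) = - ((-1) ^ len (refl_word \<alpha>s \<circ> w))"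
    by (intro sgn_refl weyl_comp simple_word_weyl) auto
  moreover have "(-1::'b) ^ len (refl_word \<alpha>s \<circ> w) = (-1) ^ length \<alpha>s * (-1) ^ len w"
    using Cons by (simp add: comp_def)
  ultimately show ?case by (simp only: refl_word_Cons comp_assoc) simp
qed simp

lemma sgn_comp: assumes "v \<in> weyl" "w \<in> weyl"
  shows "(-1::'b::ring_1) ^ len (v \<circ> w) = (-1) ^ len v * (-1) ^ len w"
proof -
  obtain \<alpha>s where *: "\<alpha>s \<in> lists simple_roots" "v = refl_word \<alpha>s" using assms weyl_simple by auto
  have "(-1::'b) ^ len v = (-1) ^ length \<alpha>s" using sgn_word[of \<alpha>s id, where 'b='b] * by simp
  then show ?thesis using sgn_word[of \<alpha>s w, where 'b='b] * assms by simp
qed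

text \<open>Builds w by reading a reduced word from the left. The height estimates rely on the
  information \<open>w \<beta> \<in> Rp\<close> that each step supplies.\<close>

lemma weyl_reduced_induct [consumes 1, case_names id refl]:
  assumes "w \<in> weyl" "P id"
    "\<And>\<beta> w. \<beta> \<in> simple_roots \<Longrightarrow> w \<in> weyl \<Longrightarrow> w \<beta> \<in> Rp \<Longrightarrow> len (w \<circ> refl \<beta>) = Suc (len w) \<Longrightarrow> P w \<Longrightarrow> P (w \<circ> refl \<beta>)"
  shows "P w"
proof -
  have "P (refl_word \<alpha>s)" if "reduced_word \<alpha>s (refl_word \<alpha>s)" for \<alpha>s
    using that
  proof (induction \<alpha>s rule: rev_induct)
    case Nil then show ?case using assms(2) by (simp only: refl_word_Nil)
  next
    case (snoc \<beta> t)
    have t: "reduced_word t (refl_word t)" using reduced_prefix snoc.prems by blast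
    have l: "t \<in> lists simple_roots" "\<beta> \<in> simple_roots" using snoc.prems by (auto simp: reduced_word_def)
    have w: "refl_word t \<in> weyl" using l simple_word_weyl by auto
    have ln: "len (refl_word t \<circ> refl \<beta>) = Suc (len (refl_word t))"
      using t snoc.prems by (auto simp: reduced_word_def)
    then have "refl_word t \<beta> \<in> Rp" using len_refl_neg[OF w l(2)] by fastforce
    then show ?case using assms(3)[OF l(2) w _ ln] snoc.IH[OF t] by (simp add: comp_def)
  qed
  then show ?thesis using reduced_word_exists[OF assms(1)] by (auto simp: reduced_word_def)
qed

text \<open>An element of maximal length makes every simple root negative, hence every positive
  root, so left multiplication by it complements the inversion set. It is used for W_0(q^-2) and to
  bound lengths.\<close>

lemma longest_element:
  obtains w0 where "w0 \<in> weyl" "\<And>w. w \<in> weyl \<Longrightarrow> len (w0 \<circ> w) + len w = card Rp"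
proof -
  have "\<exists>w\<in>weyl. \<forall>v\<in>weyl. len v \<le> len w"
  proof -
    have "Max (len ` weyl) \<in> len ` weyl" using finite_weyl weyl_nonempty by (intro Max_in) simp_all
    then obtain w where "w \<in> weyl" "Max (len ` weyl) = len w" by auto
    then show ?thesis using finite_weyl by (metis Max_ge finite_imageI imageI)
  qed
  then obtain w0 where w0: "w0 \<in> weyl" "\<And>v. v \<in> weyl \<Longrightarrow> len v \<le> len w0" by auto
  have neg: "- w0 \<alpha> \<in> Rp" if "\<alpha> \<in> Rp" for \<alpha>
    using that
  proof (induction rule: Rp_induct)
    case (simple \<alpha>)
    have "w0 \<alpha> \<notin> Rp"
      using len_refl_pos[OF w0(1) simple] w0(2)[of "w0 \<circ> refl \<alpha>"] w0(1) weyl_comp weyl_refl simple_R[OF simple]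
      by fastforce
    then show ?case using Rp_cases weyl_root w0 simple simple_R by blast
  next
    case (add \<beta> \<gamma>)
    then have "- w0 (\<beta> + \<gamma>) \<in> R" using neg_closed weyl_root w0 Rp_sub by blast
    then show ?case using add w0 by (subst pf(3)) (auto simp: weyl_add pf_simps dest!: Rp_pf)
  qed
  have "len (w0 \<circ> w) + len w = card Rp" if w: "w \<in> weyl" for w
  proof -
    have "w0 (w \<alpha>) \<notin> Rp \<longleftrightarrow> w \<alpha> \<in> Rp" if "\<alpha> \<in> Rp" for \<alpha>
    proof -
      have r: "w \<alpha> \<in> R" using weyl_root w that Rp_sub by auto
      show ?thesis
      proof (cases "w \<alpha> \<in> Rp")
        case True then show ?thesis using neg[of "w \<alpha>"] Rp_neg[of "- w0 (w \<alpha>)"] by auto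
      next
        case False
        then have "- w \<alpha> \<in> Rp" using Rp_cases r by auto
        then have "w0 (w \<alpha>) \<in> Rp" using neg[of "- w \<alpha>"] w0 by (simp add: weyl_minus)
        then show ?thesis using False by simp
      qed
    qed
    then have "inversions (w0 \<circ> w) = Rp - inversions w" by (auto simp: inversions_def)
    moreover have "inversions w \<subseteq> Rp" by (auto simp: inversions_def)
    ultimately show ?thesis
      using len_inversions[OF w] len_inversions[OF weyl_comp[OF w0(1) w]] finite_Rp
      by (simp add: card_Diff_subset finite_inversions card_mono)
  qed
  then show ?thesis using that w0 by blast
qed

section \<open>Weights and reduced words\<close>

text \<open>Each step of a reduced chain subtracts from the image of x a nonnegative multiple of the
  positive root \<open>w \<beta>\<close>; equal heights force all these multiples to vanish.\<close>

lemma ht_weyl_le: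
  assumes "w \<in> weyl" "\<And>\<alpha>. \<alpha> \<in> simple_roots \<Longrightarrow> pair x \<alpha> \<ge> 0"
  shows "ht (w x) \<le> ht x \<and> (ht (w x) = ht x \<longrightarrow> w x = x)"
  using assms(1)
proof (induction rule: weyl_reduced_induct)
  case id then show ?case by simp
next
  case (refl \<beta> w)
  have e: "(w \<circ> refl \<beta>) x = w x - pair x \<beta> *\<^sub>R w \<beta>"
    using refl by (simp add: refl_pair weyl_diff weyl_scaleR)
  have h: "ht ((w \<circ> refl \<beta>) x) = ht (w x) - pair x \<beta> * ht (w \<beta>)"
    by (simp only: e ht_simps)
  have p: "ht (w \<beta>) > 0" "pair x \<beta> \<ge> 0" using refl ht_pos assms(2) by auto
  then have nn: "pair x \<beta> * ht (w \<beta>) \<ge> 0" by simp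
  have "(w \<circ> refl \<beta>) x = x" if "ht ((w \<circ> refl \<beta>) x) = ht x"
  proof -
    have "pair x \<beta> * ht (w \<beta>) = 0" "ht (w x) = ht x" using that h nn refl.IH by linarith+
    then show ?thesis using p refl.IH e by simp
  qed
  then show ?case using h nn refl.IH by linarith
qed

text \<open>Along the same chain every step now lowers the height strictly.\<close>

lemma regular_stabilizer:
  assumes "w \<in> weyl" "\<And>\<alpha>. \<alpha> \<in> simple_roots \<Longrightarrow> pair x \<alpha> > 0" "w x = x"
  shows "w = id"
proof -
  have "w = id \<or> ht (w x) < ht x" using assms(1)
  proof (induction rule: weyl_reduced_induct)
  case (refl \<beta> w)
  have "ht ((w \<circ> refl \<beta>) x) = ht (w x) - pair x \<beta> * ht (w \<beta>)"
    using refl by (simp add: refl_pair weyl_diff weyl_scaleR ht_simps)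
  moreover have "pair x \<beta> * ht (w \<beta>) > 0" using refl ht_pos assms(2) by simp
  moreover have "ht (w x) \<le> ht x" using refl.IH by auto
  ultimately show ?case by linarith
  qed simp
  then show ?thesis using assms(3) by auto
qed

lemma ht_rho_less: "w \<in> weyl \<Longrightarrow> w \<noteq> id \<Longrightarrow> ht (w \<rho>) < ht \<rho>"
  using ht_weyl_le[of w \<rho>] regular_stabilizer[of w \<rho>] by (force simp: pair_rho)

text \<open>Take a point of maximal height in the orbit: at a negative pairing a simple reflection
  would raise the height, by \<open>ht_refl\<close>.\<close>

lemma dominant_conj: "\<exists>w\<in>weyl. \<forall>\<alpha>\<in>simple_roots. pair (w x) \<alpha> \<ge> 0"
proof -
  have "Max ((\<lambda>w. ht (w x)) ` weyl) \<in> (\<lambda>w. ht (w x)) ` weyl"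
    using finite_weyl weyl_nonempty by (intro Max_in) simp_all
  then obtain w where w: "w \<in> weyl" "ht (w x) = Max ((\<lambda>w. ht (w x)) ` weyl)" by auto
  have "pair (w x) \<alpha> \<ge> 0" if a: "\<alpha> \<in> simple_roots" for \<alpha>
  proof -
    have "refl \<alpha> \<circ> w \<in> weyl" using w a weyl_comp weyl_refl simple_R by auto
    then have "ht ((refl \<alpha> \<circ> w) x) \<in> (\<lambda>w. ht (w x)) ` weyl" by (rule imageI)
    then have "ht ((refl \<alpha> \<circ> w) x) \<le> ht (w x)"
      unfolding w(2) using finite_weyl by (intro Max_ge) simp_all
    then show ?thesis using ht_refl[OF a] by simp
  qed
  then show ?thesis using w by blast
qed

lemma pair_nonneg_Rp:
  assumes "\<And>\<alpha>. \<alpha> \<in> simple_roots \<Longrightarrow> pair x \<alpha> \<ge> 0" "\<beta> \<in> Rp" shows "pair x \<beta> \<ge> 0"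
proof -
  have "ip x \<beta> \<ge> 0"
    using assms(2)
  proof (induction rule: Rp_induct)
    case (simple \<alpha>) then show ?case using pair_nonneg_iff simple_R assms by blast
  qed (simp add: ip_simps)
  then show ?thesis using pair_nonneg_iff assms Rp_sub by blast
qed

section \<open>The weight lattice\<close>

lemma weights_iff: "\<mu> \<in> weights \<longleftrightarrow> (\<forall>\<alpha>\<in>R. pair \<mu> \<alpha> \<in> \<int>)"
  by (simp add: weights_def pair_def)

lemma weights_0 [simp]: "0 \<in> weights"
  and weights_add: "\<mu> \<in> weights \<Longrightarrow> \<nu> \<in> weights \<Longrightarrow> \<mu> + \<nu> \<in> weights"
  and weights_diff: "\<mu> \<in> weights \<Longrightarrow> \<nu> \<in> weights \<Longrightarrow> \<mu> - \<nu> \<in> weights"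
  and weights_minus: "\<mu> \<in> weights \<Longrightarrow> - \<mu> \<in> weights"
  and weights_scaleZ: "\<mu> \<in> weights \<Longrightarrow> c \<in> \<int> \<Longrightarrow> c *\<^sub>R \<mu> \<in> weights"
  by (auto simp: weights_iff pair_simps)

lemma weights_root: "\<alpha> \<in> R \<Longrightarrow> \<alpha> \<in> weights"
  by (simp add: weights_iff pair_Ints)

lemma weights_weyl: "w \<in> weyl \<Longrightarrow> \<mu> \<in> weights \<Longrightarrow> w \<mu> \<in> weights"
  by (simp add: weights_iff weyl_pair_inv weyl_root weyl_inv)

lemma weights_refl: "\<alpha> \<in> R \<Longrightarrow> \<mu> \<in> weights \<Longrightarrow> refl \<alpha> \<mu> \<in> weights"
  using weights_weyl weyl_refl by blast

lemma pair_weight_Ints: "\<mu> \<in> weights \<Longrightarrow> \<alpha> \<in> R \<Longrightarrow> pair \<mu> \<alpha> \<in> \<int>"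
  by (simp add: weights_iff)

text \<open>Only the pairings with simple coroots are known to be 1. Every positive root is a
  conjugate of a simple one, and moving the conjugating word over to \<rho> changes \<rho> by an
  integral combination of roots.\<close>

lemma rho_weight: "\<rho> \<in> weights"
proof -
  have word: "\<forall>\<beta>\<in>simple_roots. pair (refl_word \<alpha>s \<rho>) \<beta> \<in> \<int>" if "set \<alpha>s \<subseteq> simple_roots" for \<alpha>s
    using that
  proof (induction \<alpha>s)
    case Nil then show ?case by (simp add: pair_rho)
  next
    case (Cons \<alpha> t)
    then show ?case using pair_Ints simple_R by (auto simp: refl_pair pair_simps)
  qed
  have pos: "pair \<rho> \<alpha> \<in> \<int>" if a: "\<alpha> \<in> Rp" for \<alpha>
  proof -
    obtain \<alpha>s \<beta> where *: "\<alpha>s \<in> lists simple_roots" "\<beta> \<in> simple_roots" "\<alpha> = refl_word \<alpha>s \<beta>"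
      using Rp_conj_simple[OF a] by blast
    have w: "refl_word (rev \<alpha>s) \<in> weyl" using * by (intro simple_word_weyl) (auto simp: lists_eq_set)
    have "pair \<rho> \<alpha> = pair (refl_word (rev \<alpha>s) \<rho>) (refl_word (rev \<alpha>s) (refl_word \<alpha>s \<beta>))"
      using weyl_pair[OF w] * by simp
    also have "refl_word (rev \<alpha>s) (refl_word \<alpha>s \<beta>) = \<beta>"
      using refl_word_rev[OF lists_simple_R[OF *(1)]] by (metis comp_apply id_apply)
    finally show ?thesis using word[of "rev \<alpha>s"] * by (auto simp: lists_eq_set)
  qed
  show ?thesis unfolding weights_iff
  proof
    fix \<alpha> assume "\<alpha> \<in> R"
    then show "pair \<rho> \<alpha> \<in> \<int>"
      using Rp_cases[of \<alpha>] pos[of \<alpha>] pos[of "- \<alpha>"] by (auto simp: pair_neg_root)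
  qed
qed

lemma dominant_weights_iff:
  "\<mu> \<in> dominant_weights \<longleftrightarrow> \<mu> \<in> weights \<and> (\<forall>\<alpha>\<in>simple_roots. pair \<mu> \<alpha> \<ge> 0)"
  using pair_nonneg_Rp simple_Rp unfolding dominant_weights_def pair_def[symmetric] by blast

text \<open>Integrality turns a positive pairing into one of at least 1, which is the pairing of
  \<rho>.\<close>

lemma dominant_regular:
  assumes "\<mu> \<in> weights" "\<And>\<alpha>. \<alpha> \<in> simple_roots \<Longrightarrow> pair \<mu> \<alpha> > 0"
  shows "\<mu> - \<rho> \<in> dominant_weights"
  unfolding dominant_weights_iff
proof (intro conjI ballI)
  show "\<mu> - \<rho> \<in> weights" using assms rho_weight weights_diff by blast
  fix \<alpha> assume a: "\<alpha> \<in> simple_roots"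
  then have "pair \<mu> \<alpha> \<in> \<int>" using assms pair_weight_Ints simple_R by blast
  then obtain k where "pair \<mu> \<alpha> = of_int k" by (auto elim: Ints_cases)
  then show "pair (\<mu> - \<rho>) \<alpha> \<ge> 0" using assms(2)[OF a] a by (simp add: pair_diff pair_rho)
qed

lemma ht_weight_Ints: "\<mu> \<in> weights \<Longrightarrow> ht \<mu> \<in> \<int>"
  unfolding ht_def using pair_weight_Ints Rp_sub by (intro Ints_sum) auto

lemma ht_dominant_nonneg: "\<mu> \<in> dominant_weights \<Longrightarrow> ht \<mu> \<ge> 0"
  unfolding ht_def by (intro sum_nonneg) (auto simp: dominant_weights_def pair_def)

section \<open>Alternating words and Matsumoto's theorem\<close>

lemma alternating_0 [simp]: "alternating 0 \<alpha> \<beta> = []" by (simp add: alternating_def)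

lemma alternating_Suc [simp]: "alternating (Suc m) \<alpha> \<beta> = \<alpha> # alternating m \<beta> \<alpha>"
  by (auto simp: alternating_def upt_conv_Cons map_Suc_upt[symmetric] comp_def simp del: upt_Suc)

lemma length_alternating [simp]: "length (alternating m \<alpha> \<beta>) = m"
  by (simp add: alternating_def)

lemma alternating_add: "\<exists>t. alternating (m + k) \<alpha> \<beta> = alternating m \<alpha> \<beta> @ t"
  by (induction m arbitrary: \<alpha> \<beta>) auto

lemma set_alternating: "set (alternating m \<alpha> \<beta>) \<subseteq> {\<alpha>, \<beta>}"
  by (auto simp: alternating_def)

text \<open>One alternating word times the inverse of the other is a power of the rotation
  \<open>refl \<alpha> \<circ> refl \<beta>\<close>, so both have the same product exactly when this
  power is trivial.\<close>

lemma refl_word_alternating: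
  assumes "\<alpha> \<in> R" "\<beta> \<in> R"
  shows "refl_word (alternating k \<alpha> \<beta>) = (refl \<alpha> \<circ> refl \<beta>) ^^ k \<circ> refl_word (alternating k \<beta> \<alpha>)"
  using assms
proof (induction k arbitrary: \<alpha> \<beta>)
  case (Suc k)
  \<comment> \<open>Passing \<open>refl \<alpha>\<close> through a power of the rotation exchanges
    the two factors of the rotation.\<close>
  have sh: "refl \<alpha> \<circ> (refl \<beta> \<circ> refl \<alpha>) ^^ n = (refl \<alpha> \<circ> refl \<beta>) ^^ n \<circ> refl \<alpha>" for n
  proof (induction n)
    case (Suc n)
    have "refl \<alpha> \<circ> (refl \<beta> \<circ> refl \<alpha>) ^^ Suc n = (refl \<alpha> \<circ> refl \<beta>) \<circ> (refl \<alpha> \<circ> (refl \<beta> \<circ> refl \<alpha>) ^^ n)"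
      by (simp only: funpow.simps comp_assoc)
    then show ?case by (simp only: Suc funpow.simps comp_assoc)
  qed simp
  have "(refl \<alpha> \<circ> refl \<beta>) ^^ Suc k \<circ> refl \<beta> = (refl \<alpha> \<circ> refl \<beta>) ^^ k \<circ> refl \<alpha> \<circ> (refl \<beta> \<circ> refl \<beta>)"
    by (simp add: funpow_Suc_right comp_assoc del: funpow.simps refl_comp_self)
  also have "\<dots> = (refl \<alpha> \<circ> refl \<beta>) ^^ k \<circ> refl \<alpha>" using Suc.prems by simp
  finally have "(refl \<alpha> \<circ> refl \<beta>) ^^ Suc k \<circ> (refl \<beta> \<circ> refl_word (alternating k \<alpha> \<beta>))
      = refl \<alpha> \<circ> ((refl \<beta> \<circ> refl \<alpha>) ^^ k \<circ> refl_word (alternating k \<alpha> \<beta>))"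
    by (metis comp_assoc sh)
  also have "\<dots> = refl \<alpha> \<circ> refl_word (alternating k \<beta> \<alpha>)"
    using Suc.IH[of \<beta> \<alpha>] Suc.prems by metis
  finally show ?case by (simp only: alternating_Suc refl_word_Cons)
qed simp

lemma surj_refl_word: "\<alpha>s \<in> lists R \<Longrightarrow> surj (refl_word \<alpha>s)"
  using weyl_bij bij_is_surj by (auto simp: weyl_def)

lemma alternating_eq_iff:
  assumes "\<alpha> \<in> R" "\<beta> \<in> R"
  shows "refl_word (alternating k \<alpha> \<beta>) = refl_word (alternating k \<beta> \<alpha>) \<longleftrightarrow> (refl \<alpha> \<circ> refl \<beta>) ^^ k = id"
proof -
  have "alternating k \<beta> \<alpha> \<in> lists R" using set_alternating[of k \<beta> \<alpha>] assms by (auto simp: lists_eq_set)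
  then have s: "surj (refl_word (alternating k \<beta> \<alpha>))" by (rule surj_refl_word)
  show ?thesis
  proof
    assume "refl_word (alternating k \<alpha> \<beta>) = refl_word (alternating k \<beta> \<alpha>)"
    then have *: "((refl \<alpha> \<circ> refl \<beta>) ^^ k) (refl_word (alternating k \<beta> \<alpha>) x) = refl_word (alternating k \<beta> \<alpha>) x" for x
      using refl_word_alternating[OF assms, of k] by (metis comp_apply)
    show "(refl \<alpha> \<circ> refl \<beta>) ^^ k = id"
    proof
      fix y obtain x where "y = refl_word (alternating k \<beta> \<alpha>) x" using s by (metis surjD)
      then show "((refl \<alpha> \<circ> refl \<beta>) ^^ k) y = id y" using * by simp
    qed
  next
    assume "(refl \<alpha> \<circ> refl \<beta>) ^^ k = id"
    then show "refl_word (alternating k \<alpha> \<beta>) = refl_word (alternating k \<beta> \<alpha>)"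
      using refl_word_alternating[OF assms, of k] by simp
  qed
qed

text \<open>With m the order: if k exceeded m, the prefix of length m + 1 would have the same
  product as an alternating word of length m - 1 and could not be reduced.\<close>

lemma alternating_reduced_cox:
  assumes ab: "\<alpha> \<in> simple_roots" "\<beta> \<in> simple_roots" and k: "k > 0"
    and red: "reduced_word (alternating k \<alpha> \<beta>) (refl_word (alternating k \<alpha> \<beta>))"
    and eq: "refl_word (alternating k \<alpha> \<beta>) = refl_word (alternating k \<beta> \<alpha>)"
  shows "k = cox \<alpha> \<beta>"
proof (rule antisym)
  have R: "\<alpha> \<in> R" "\<beta> \<in> R" using ab simple_R by auto
  let ?P = "\<lambda>m. m > 0 \<and> (refl \<alpha> \<circ> refl \<beta>) ^^ m = id"
  have Pk: "?P k" using k eq alternating_eq_iff[OF R] by simp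
  then show "cox \<alpha> \<beta> \<le> k" unfolding cox_def by (rule Least_le)
  have "?P (cox \<alpha> \<beta>)" unfolding cox_def using Pk by (rule LeastI)
  then obtain m where m: "cox \<alpha> \<beta> = Suc m" "(refl \<alpha> \<circ> refl \<beta>) ^^ Suc m = id" by (metis gr0_conv_Suc)
  show "k \<le> cox \<alpha> \<beta>"
  proof (rule ccontr)
    assume "\<not> ?thesis"
    then obtain j where j: "k = Suc (Suc m) + j" using m le_Suc_ex[of "Suc (Suc m)" k] by auto
    obtain t where "alternating k \<alpha> \<beta> = alternating (Suc (Suc m)) \<alpha> \<beta> @ t" using alternating_add j by metis
    then have r: "reduced_word (alternating (Suc (Suc m)) \<alpha> \<beta>) (refl_word (alternating (Suc (Suc m)) \<alpha> \<beta>))"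
      using reduced_prefix red by metis
    have "refl_word (alternating (Suc (Suc m)) \<alpha> \<beta>) = refl \<alpha> \<circ> refl_word (alternating (Suc m) \<beta> \<alpha>)"
      by (simp only: alternating_Suc refl_word_Cons)
    also have "\<dots> = refl \<alpha> \<circ> refl_word (alternating (Suc m) \<alpha> \<beta>)"
      using alternating_eq_iff[OF R, of "Suc m"] m by metis
    also have "\<dots> = (refl \<alpha> \<circ> refl \<alpha>) \<circ> refl_word (alternating m \<beta> \<alpha>)"
      by (simp only: alternating_Suc refl_word_Cons comp_assoc)
    also have "\<dots> = refl_word (alternating m \<beta> \<alpha>)" using R by simp
    finally have e: "refl_word (alternating (Suc (Suc m)) \<alpha> \<beta>) = refl_word (alternating m \<beta> \<alpha>)" .
    have "alternating m \<beta> \<alpha> \<in> lists simple_roots"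
      using set_alternating[of m \<beta> \<alpha>] ab by (auto simp: lists_eq_set)
    then have "len (refl_word (alternating (Suc (Suc m)) \<alpha> \<beta>)) \<le> m" unfolding e using len_le by fastforce
    then show False using r by (simp add: reduced_word_def)
  qed
qed

text \<open>Bourbaki's argument: if two reduced words of the same element with different first letters
  are inequivalent, then moving the first letter of one in front of the other and deleting the last
  letter yields another inequivalent pair, and after enough steps both words alternate.\<close>

lemma matsumoto:
  fixes E :: "'v list \<Rightarrow> 'v list \<Rightarrow> bool"
  assumes E_refl: "\<And>a. E a a" and E_sym: "\<And>a b. E a b \<Longrightarrow> E b a"
    and E_trans: "\<And>a b c. E a b \<Longrightarrow> E b c \<Longrightarrow> E a c"
    and E_Cons: "\<And>\<alpha> a b. \<alpha> \<in> simple_roots \<Longrightarrow> set a \<subseteq> simple_roots \<Longrightarrow> set b \<subseteq> simple_roots \<Longrightarrow> E a b \<Longrightarrow> E (\<alpha> # a) (\<alpha> # b)"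
    and E_snoc: "\<And>\<alpha> a b. \<alpha> \<in> simple_roots \<Longrightarrow> set a \<subseteq> simple_roots \<Longrightarrow> set b \<subseteq> simple_roots \<Longrightarrow> E a b \<Longrightarrow> E (a @ [\<alpha>]) (b @ [\<alpha>])"
    and E_braid: "\<And>\<alpha> \<beta>. \<alpha> \<in> simple_roots \<Longrightarrow> \<beta> \<in> simple_roots \<Longrightarrow> \<alpha> \<noteq> \<beta> \<Longrightarrow>
      E (alternating (cox \<alpha> \<beta>) \<alpha> \<beta>) (alternating (cox \<alpha> \<beta>) \<beta> \<alpha>)"
    and ab: "reduced_word a w" "reduced_word b w"
  shows "E a b"
  using ab
proof (induction "length a" arbitrary: a b w)
  case 0
  then have "length a = len w" "length b = len w" unfolding reduced_word_def by simp_all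
  then show ?case using E_refl 0 by simp
next
  case (Suc n)
  have lenw: "len w = Suc n" "length b = Suc n" using Suc by (auto simp: reduced_word_def)
  have sub: "set c \<subseteq> simple_roots" if "reduced_word c w" for c w
    using that by (auto simp: reduced_word_def lists_eq_set)
  have same_hd: "E (\<alpha> # c) (\<alpha> # d)" if "reduced_word (\<alpha> # c) w" "reduced_word (\<alpha> # d) w" for \<alpha> c d
  proof -
    have c: "reduced_word c (refl_word c)" "reduced_word d (refl_word d)"
      using reduced_prefix[of "[\<alpha>]"] that by auto
    have aS: "\<alpha> \<in> simple_roots" using sub[OF that(1)] by auto
    have "refl \<alpha> \<circ> refl_word c = refl \<alpha> \<circ> refl_word d" using that by (simp add: reduced_word_def)
    then have "refl_word c = refl_word d" using simple_R[OF aS] by (metis comp_assoc fun.map_id refl_comp_self id_comp)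
    then have "E c d" using Suc.hyps(1)[of c "refl_word c" d] c that lenw by (auto simp: reduced_word_def)
    then show ?thesis using E_Cons[OF aS] sub[OF that(1)] sub[OF that(2)] by simp
  qed
  have same_last: "E (c @ [\<alpha>]) (d @ [\<alpha>])" if "reduced_word (c @ [\<alpha>]) w" "reduced_word (d @ [\<alpha>]) w" for \<alpha> c d
  proof -
    have c: "reduced_word c (refl_word c)" "reduced_word d (refl_word d)"
      using reduced_prefix that by blast+
    have aS: "\<alpha> \<in> simple_roots" using sub[OF that(1)] by auto
    have "refl_word c \<circ> refl \<alpha> = refl_word d \<circ> refl \<alpha>" using that by (simp add: reduced_word_def)
    then have "refl_word c = refl_word d" using simple_R[OF aS] by (metis comp_assoc comp_id refl_comp_self)
    then have "E c d" using Suc.hyps(1)[of c "refl_word c" d] c that lenw by (auto simp: reduced_word_def)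
    then show ?thesis using E_snoc[OF aS] sub[OF that(1)] sub[OF that(2)] by simp
  qed
  have step: "reduced_word (\<alpha> # butlast d) w"
    if r: "reduced_word (\<alpha> # c) w" "reduced_word d w" and nE: "\<not> E (\<alpha> # c) d" for \<alpha> c d
  proof -
    have aS: "\<alpha> \<in> simple_roots" "\<alpha> \<in> R" using sub[OF r(1)] simple_R by auto
    have cl: "c \<in> lists simple_roots" "d \<in> lists simple_roots" using r by (auto simp: reduced_word_def)
    have wW: "w \<in> weyl" using simple_word_weyl r by (auto simp: reduced_word_def)
    have vW: "refl_word (rev c) \<in> weyl" using cl by (intro simple_word_weyl) (auto simp: lists_eq_set)
    have inv1: "winv w = refl_word (rev c) \<circ> refl \<alpha>"
      using r inv_refl_word[of "\<alpha> # c"] lists_simple_R[of "\<alpha> # c"] by (auto simp: reduced_word_def)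
    have inv2: "winv w = refl_word (rev d)"
      using r inv_refl_word[of d] lists_simple_R[of d] by (auto simp: reduced_word_def)
    have "len (refl_word (rev c) \<circ> refl \<alpha>) = Suc n" using inv1 len_inv[OF wW] lenw by simp
    moreover have "len (refl_word (rev c)) \<le> n"
      using len_le[of "rev c"] cl r lenw by (auto simp: reduced_word_def lists_eq_set)
    ultimately have "refl_word (rev c) \<alpha> \<in> Rp" using len_refl_neg[OF vW aS(1)] by fastforce
    then have "- refl_word (rev c) \<alpha> \<notin> Rp" using Rp_neg by blast
    then have "winv w \<alpha> \<notin> Rp" using inv1 vW by (simp add: refl_self aS weyl_minus)
    then obtain as \<gamma> bs where x: "rev d = as @ \<gamma> # bs" "refl_word (rev d) \<circ> refl \<alpha> = refl_word (as @ bs)"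
      using exchange[of "rev d" \<alpha>] inv2 cl aS by (auto simp: lists_eq_set)
    have d: "d = rev bs @ \<gamma> # rev as" using arg_cong[OF x(1), of rev] by simp
    have asl: "as @ bs \<in> lists simple_roots" using cl d by auto
    have "winv (refl \<alpha> \<circ> w) = refl_word (as @ bs)" using inv_refl_comp[OF wW aS(2)] inv2 x by simp
    then have "refl \<alpha> \<circ> w = winv (refl_word (as @ bs))"
      using weyl_inv_inv weyl_comp weyl_refl wW aS by metis
    also have "\<dots> = refl_word (rev bs @ rev as)"
      using inv_refl_word[OF lists_simple_R[OF asl]] by simp
    finally have "refl \<alpha> \<circ> (refl \<alpha> \<circ> w) = refl_word (\<alpha> # rev bs @ rev as)" by simp
    then have "w = refl_word (\<alpha> # rev bs @ rev as)" using aS by (metis comp_assoc id_comp refl_comp_self)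
    moreover have "length (\<alpha> # rev bs @ rev as) = len w" using d r by (auto simp: reduced_word_def)
    ultimately have red: "reduced_word (\<alpha> # rev bs @ rev as) w"
      using asl aS by (auto simp: reduced_word_def lists_eq_set)
    show ?thesis
    \<comment> \<open>Reversed, \<open>as\<close> is the part of \<open>d\<close> after the deleted
      letter. If it is nonempty, the new word shares its last letter with \<open>d\<close> and its
      first letter with \<open>\<alpha> # c\<close>, which would link these two; so the deleted
      letter is the last one.\<close>
    proof (cases as)
      case Nil then show ?thesis using red d by simp
    next
      case (Cons \<delta> as')
      then have "E (\<alpha> # rev bs @ rev as) d"
        using same_last[of "\<alpha> # rev bs @ rev as'" \<delta> "rev bs @ \<gamma> # rev as'"] red r d by simp
      moreover have "E (\<alpha> # c) (\<alpha> # rev bs @ rev as)" using same_hd r red by blast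
      ultimately show ?thesis using nE E_trans by blast
    qed
  qed
  show ?case
  proof (rule ccontr)
    assume nE: "\<not> E a b"
    obtain \<alpha> a' where a: "a = \<alpha> # a'" using Suc.hyps(2) by (cases a) auto
    obtain \<beta> b' where b: "b = \<beta> # b'" using lenw by (cases b) auto
    have ne: "\<alpha> \<noteq> \<beta>" using nE same_hd Suc.prems a b by blast
    have S: "\<alpha> \<in> simple_roots" "\<beta> \<in> simple_roots" using sub[OF Suc.prems(1)] sub[OF Suc.prems(2)] a b by auto
    \<comment> \<open>Exchanging in both words at once lengthens the alternating prefixes by one.
      The new pair stays inequivalent because each new word shares its first letter with an old
      one.\<close>
    have alt: "\<exists>u v. reduced_word (alternating (Suc k) \<alpha> \<beta> @ u) w \<and> reduced_word (alternating (Suc k) \<beta> \<alpha> @ v) w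
        \<and> \<not> E (alternating (Suc k) \<alpha> \<beta> @ u) (alternating (Suc k) \<beta> \<alpha> @ v)" if "k \<le> n" for k
      using that
    proof (induction k)
      case 0
      then show ?case using nE Suc.prems a b by auto
    next
      case (Suc k)
      then obtain u v where uv: "reduced_word (alternating (Suc k) \<alpha> \<beta> @ u) w"
        "reduced_word (alternating (Suc k) \<beta> \<alpha> @ v) w"
        "\<not> E (alternating (Suc k) \<alpha> \<beta> @ u) (alternating (Suc k) \<beta> \<alpha> @ v)" by auto
      have ne: "u \<noteq> []" "v \<noteq> []" using uv lenw Suc.prems by (auto simp: reduced_word_def)
      have c: "reduced_word (alternating (Suc (Suc k)) \<alpha> \<beta> @ butlast v) w"
        using step[of \<alpha> "alternating k \<beta> \<alpha> @ u" "alternating (Suc k) \<beta> \<alpha> @ v"] uv ne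
        by (simp add: butlast_append)
      have d: "reduced_word (alternating (Suc (Suc k)) \<beta> \<alpha> @ butlast u) w"
        using step[of \<beta> "alternating k \<alpha> \<beta> @ v" "alternating (Suc k) \<alpha> \<beta> @ u"] uv ne E_sym
        by (auto simp add: butlast_append)
      have "E (alternating (Suc k) \<alpha> \<beta> @ u) (alternating (Suc (Suc k)) \<alpha> \<beta> @ butlast v)"
        using same_hd[of \<alpha> "alternating k \<beta> \<alpha> @ u"] uv c by simp
      moreover have "E (alternating (Suc k) \<beta> \<alpha> @ v) (alternating (Suc (Suc k)) \<beta> \<alpha> @ butlast u)"
        using same_hd[of \<beta> "alternating k \<alpha> \<beta> @ v"] uv d by simp
      ultimately have "\<not> E (alternating (Suc (Suc k)) \<alpha> \<beta> @ butlast v) (alternating (Suc (Suc k)) \<beta> \<alpha> @ butlast u)"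
        using uv(3) E_trans E_sym by blast
      then show ?case using c d by blast
    qed
    obtain u v where uv: "reduced_word (alternating (Suc n) \<alpha> \<beta> @ u) w"
        "reduced_word (alternating (Suc n) \<beta> \<alpha> @ v) w"
        "\<not> E (alternating (Suc n) \<alpha> \<beta> @ u) (alternating (Suc n) \<beta> \<alpha> @ v)" using alt[of n] by auto
    then have "u = []" "v = []" using lenw by (auto simp: reduced_word_def)
    then have rab: "reduced_word (alternating (Suc n) \<alpha> \<beta>) w" "reduced_word (alternating (Suc n) \<beta> \<alpha>) w"
      and nE': "\<not> E (alternating (Suc n) \<alpha> \<beta>) (alternating (Suc n) \<beta> \<alpha>)"
      using uv by simp_all
    have w: "refl_word (alternating (Suc n) \<alpha> \<beta>) = w" "refl_word (alternating (Suc n) \<beta> \<alpha>) = w"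
      using rab unfolding reduced_word_def by blast+
    have "Suc n = cox \<alpha> \<beta>"
    proof (rule alternating_reduced_cox[OF S])
      show "reduced_word (alternating (Suc n) \<alpha> \<beta>) (refl_word (alternating (Suc n) \<alpha> \<beta>))"
        using rab(1) by (simp only: w)
      show "refl_word (alternating (Suc n) \<alpha> \<beta>) = refl_word (alternating (Suc n) \<beta> \<alpha>)"
        by (simp only: w)
    qed simp
    then show False using nE' E_braid[OF S ne] by simp
  qed
qed

end

section \<open>Braid relations for averaging operators\<close>

text \<open>The Kazhdan--Lusztig elements of a dihedral group, as words in the averaging operators:
  \<open>kl A B k\<close> starts with \<open>A\<close> and has alternating letters.  In the braid case \<open>k = m\<close> it is
  the full symmetrizer with coefficient \<open>\<Prod> c\<^sub>\<gamma>\<close> at each chamber, which is symmetric in \<open>A\<close> and \<open>B\<close>.\<close>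

definition avg :: "'a::field \<Rightarrow> ('t \<Rightarrow> 'a) \<Rightarrow> ('t \<Rightarrow> 't) \<Rightarrow> ('t \<Rightarrow> 'a) \<Rightarrow> 't \<Rightarrow> 'a" where
  "avg S c s \<Phi> x = c x * \<Phi> x + (S - c x) * \<Phi> (s x)"

fun kl :: "(('t \<Rightarrow> 'a::field) \<Rightarrow> 't \<Rightarrow> 'a) \<Rightarrow> (('t \<Rightarrow> 'a) \<Rightarrow> 't \<Rightarrow> 'a) \<Rightarrow> nat \<Rightarrow> ('t \<Rightarrow> 'a) \<Rightarrow> 't \<Rightarrow> 'a" where
  "kl A B 0 \<Phi> = (\<lambda>_. 0)"
| "kl A B (Suc 0) \<Phi> = A \<Phi>"
| "kl A B (Suc (Suc k)) \<Phi> = (\<lambda>x. A (kl B A (Suc k) \<Phi>) x - kl A B k \<Phi> x)"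

fun alt :: "('f \<Rightarrow> 'f) \<Rightarrow> ('f \<Rightarrow> 'f) \<Rightarrow> nat \<Rightarrow> 'f \<Rightarrow> 'f" where
  "alt A B 0 \<Phi> = \<Phi>"
| "alt A B (Suc k) \<Phi> = A (alt B A k \<Phi>)"

text \<open>\<open>D\<close> will be the set of regular characters, where the coefficients have no
  poles. \<open>S\<close> and \<open>p\<close> stand for q + q^-1 and q^-1, and \<open>pS\<close> is
  all that is retained of q.\<close>

locale dihedral_ops =
  fixes D :: "'t set" and S p :: "'a::field" and cA cB :: "'t \<Rightarrow> 'a" and sA sB :: "'t \<Rightarrow> 't"
  assumes sA: "x \<in> D \<Longrightarrow> sA x \<in> D" "x \<in> D \<Longrightarrow> sA (sA x) = x" "x \<in> D \<Longrightarrow> cA (sA x) = S - cA x"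
    and sB: "x \<in> D \<Longrightarrow> sB x \<in> D" "x \<in> D \<Longrightarrow> sB (sB x) = x" "x \<in> D \<Longrightarrow> cB (sB x) = S - cB x"
    and pS: "p * S = 1 + p * p"
begin

abbreviation "thA \<equiv> avg S cA sA"
abbreviation "thB \<equiv> avg S cB sB"

definition TA where "TA \<Phi> x = thA \<Phi> x - p * \<Phi> x"
definition TB where "TB \<Phi> x = thB \<Phi> x - p * \<Phi> x"

text \<open>The sum of p^(k + 1 - l) times the alternating words of length l \<le> k, the empty word
  counted once. It is symmetric in the two generators, so a braid relation for \<open>TA\<close>,
  \<open>TB\<close> amounts to one for \<open>kl\<close>.\<close>

fun rest :: "nat \<Rightarrow> ('t \<Rightarrow> 'a) \<Rightarrow> 't \<Rightarrow> 'a" where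
  "rest 0 \<Phi> = (\<lambda>x. p * \<Phi> x)"
| "rest (Suc k) \<Phi> = (\<lambda>x. p * (rest k \<Phi> x + alt TA TB (Suc k) \<Phi> x + alt TB TA (Suc k) \<Phi> x))"

text \<open>The outermost averaging produces a function invariant under its reflection, since its
  coefficients at a point and at the reflected point add up to S; the subtracted term is invariant
  by induction.\<close>

lemma kl_invariant:
  "x \<in> D \<Longrightarrow> kl thA thB k \<Phi> (sA x) = kl thA thB k \<Phi> x"
  "x \<in> D \<Longrightarrow> kl thB thA k \<Phi> (sB x) = kl thB thA k \<Phi> x"
proof -
  have "(\<forall>x\<in>D. kl thA thB k \<Phi> (sA x) = kl thA thB k \<Phi> x) \<and> (\<forall>x\<in>D. kl thB thA k \<Phi> (sB x) = kl thB thA k \<Phi> x)"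
    by (induction k rule: induct_nat_012) (simp_all add: avg_def sA sB algebra_simps)
  then show "x \<in> D \<Longrightarrow> kl thA thB k \<Phi> (sA x) = kl thA thB k \<Phi> x"
    "x \<in> D \<Longrightarrow> kl thB thA k \<Phi> (sB x) = kl thB thA k \<Phi> x" by auto
qed

lemma kl_eigen:
  "x \<in> D \<Longrightarrow> thA (kl thA thB k \<Phi>) x = S * kl thA thB k \<Phi> x"
  "x \<in> D \<Longrightarrow> thB (kl thB thA k \<Phi>) x = S * kl thB thA k \<Phi> x"
  by (simp_all add: avg_def kl_invariant algebra_simps)

lemma thA_eq: "thA \<Phi> x = TA \<Phi> x + p * \<Phi> x" and thB_eq: "thB \<Phi> x = TB \<Phi> x + p * \<Phi> x"
  by (simp_all add: TA_def TB_def)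

lemma th_cong: "x \<in> D \<Longrightarrow> (\<And>y. y \<in> D \<Longrightarrow> f y = g y) \<Longrightarrow> thA f x = thA g x"
  "x \<in> D \<Longrightarrow> (\<And>y. y \<in> D \<Longrightarrow> f y = g y) \<Longrightarrow> thB f x = thB g x"
  by (simp_all add: avg_def sA sB)

lemma th_lin: "thA (\<lambda>x. f x + g x) x = thA f x + thA g x" "thA (\<lambda>x. c * f x) x = c * thA f x"
  "thB (\<lambda>x. f x + g x) x = thB f x + thB g x" "thB (\<lambda>x. c * f x) x = c * thB f x"
  by (simp_all add: avg_def algebra_simps)

text \<open>The expansion of dihedral Kazhdan--Lusztig elements into standard ones, for operators
  and at points of \<open>D\<close>. The recursion closes because a function invariant under its own
  reflection is an eigenfunction with value S, and p S = 1 + p^2.\<close>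

lemma kl_alt:
  "(\<forall>x\<in>D. kl thA thB (Suc k) \<Phi> x = alt TA TB (Suc k) \<Phi> x + rest k \<Phi> x) \<and>
   (\<forall>x\<in>D. kl thB thA (Suc k) \<Phi> x = alt TB TA (Suc k) \<Phi> x + rest k \<Phi> x)"
proof (induction k rule: less_induct)
  case (less k)
  show ?case
  proof (cases k)
    case 0
    then show ?thesis by (simp add: thA_eq thB_eq)
  next
    case (Suc n)
    have IH: "kl thA thB k \<Phi> x = alt TA TB k \<Phi> x + rest n \<Phi> x"
      "kl thB thA k \<Phi> x = alt TB TA k \<Phi> x + rest n \<Phi> x" if "x \<in> D" for x
      using less[of n] Suc that by simp_all
    have a: "thA (kl thB thA k \<Phi>) x = thA (\<lambda>x. alt TB TA k \<Phi> x + rest n \<Phi> x) x"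
      "thB (kl thA thB k \<Phi>) x = thB (\<lambda>x. alt TA TB k \<Phi> x + rest n \<Phi> x) x" if "x \<in> D" for x
      using that IH by (auto intro!: th_cong)
    \<comment> \<open>For n > 0, \<open>rest n\<close> is p times the sum of \<open>kl\<close> and
      the opposite alternating word, both of length n. On the first summand the averaging acts by S,
      and \<open>pS\<close> rewrites the factor p S.\<close>
    have r: "thA (rest n \<Phi>) x = p * alt TA TB k \<Phi> x + p * p * alt TB TA n \<Phi> x + (1 + p * p) * kl thA thB n \<Phi> x
        + (if n = 0 then p * p * \<Phi> x - p * p * alt TB TA n \<Phi> x else 0)"
      "thB (rest n \<Phi>) x = p * alt TB TA k \<Phi> x + p * p * alt TA TB n \<Phi> x + (1 + p * p) * kl thB thA n \<Phi> x
        + (if n = 0 then p * p * \<Phi> x - p * p * alt TA TB n \<Phi> x else 0)" if x: "x \<in> D" for x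
    proof -
      show "thA (rest n \<Phi>) x = p * alt TA TB k \<Phi> x + p * p * alt TB TA n \<Phi> x + (1 + p * p) * kl thA thB n \<Phi> x
        + (if n = 0 then p * p * \<Phi> x - p * p * alt TB TA n \<Phi> x else 0)"
      proof (cases n)
        case 0
        then show ?thesis using Suc by (simp add: th_lin thA_eq algebra_simps)
      next
        case (Suc m)
        have IH': "kl thA thB n \<Phi> y = alt TA TB n \<Phi> y + rest m \<Phi> y" if "y \<in> D" for y
          using less[of m] Suc \<open>k = Suc n\<close> that by simp
        have "thA (rest n \<Phi>) x = thA (\<lambda>y. p * (kl thA thB n \<Phi> y + alt TB TA n \<Phi> y)) x"
          using x IH' Suc by (intro th_cong) (simp_all add: algebra_simps)
        also have "\<dots> = p * (S * kl thA thB n \<Phi> x + (TA (alt TB TA n \<Phi>) x + p * alt TB TA n \<Phi> x))"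
          by (simp only: th_lin kl_eigen[OF x] thA_eq[symmetric])
        also have "\<dots> = (p * S) * kl thA thB n \<Phi> x + p * TA (alt TB TA n \<Phi>) x + p * p * alt TB TA n \<Phi> x"
          by (simp add: algebra_simps)
        finally show ?thesis unfolding pS using Suc \<open>k = Suc n\<close> by simp
      qed
      show "thB (rest n \<Phi>) x = p * alt TB TA k \<Phi> x + p * p * alt TA TB n \<Phi> x + (1 + p * p) * kl thB thA n \<Phi> x
        + (if n = 0 then p * p * \<Phi> x - p * p * alt TA TB n \<Phi> x else 0)"
      proof (cases n)
        case 0
        then show ?thesis using Suc by (simp add: th_lin thB_eq algebra_simps)
      next
        case (Suc m)
        have IH': "kl thB thA n \<Phi> y = alt TB TA n \<Phi> y + rest m \<Phi> y" if "y \<in> D" for y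
          using less[of m] Suc \<open>k = Suc n\<close> that by simp
        have "thB (rest n \<Phi>) x = thB (\<lambda>y. p * (kl thB thA n \<Phi> y + alt TA TB n \<Phi> y)) x"
          using x IH' Suc by (intro th_cong) (simp_all add: algebra_simps)
        also have "\<dots> = p * (S * kl thB thA n \<Phi> x + (TB (alt TA TB n \<Phi>) x + p * alt TA TB n \<Phi> x))"
          by (simp only: th_lin kl_eigen[OF x] thB_eq[symmetric])
        also have "\<dots> = (p * S) * kl thB thA n \<Phi> x + p * TB (alt TA TB n \<Phi>) x + p * p * alt TA TB n \<Phi> x"
          by (simp add: algebra_simps)
        finally show ?thesis unfolding pS using Suc \<open>k = Suc n\<close> by simp
      qed
    qed
    show ?thesis
    proof (cases n)
      case 0
      have e: "kl thA thB (Suc k) \<Phi> = thA (thB \<Phi>)" "kl thB thA (Suc k) \<Phi> = thB (thA \<Phi>)"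
        using 0 Suc by (simp_all add: fun_eq_iff)
      have "thB \<Phi> = (\<lambda>x. TB \<Phi> x + p * \<Phi> x)" "thA \<Phi> = (\<lambda>x. TA \<Phi> x + p * \<Phi> x)"
        by (simp_all add: fun_eq_iff thA_eq thB_eq)
      then have "thA (thB \<Phi>) x = thA (TB \<Phi>) x + p * thA \<Phi> x" "thB (thA \<Phi>) x = thB (TA \<Phi>) x + p * thB \<Phi> x" for x
        by (simp_all only: th_lin)
      then show ?thesis unfolding e using 0 Suc by (simp add: thA_eq thB_eq algebra_simps)
    next
      case (Suc m)
      have IH': "kl thA thB n \<Phi> x = alt TA TB n \<Phi> x + rest m \<Phi> x"
        "kl thB thA n \<Phi> x = alt TB TA n \<Phi> x + rest m \<Phi> x" if "x \<in> D" for x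
        using less[of m] Suc \<open>k = Suc n\<close> that by simp_all
      have "kl thA thB (Suc k) \<Phi> x = alt TA TB (Suc k) \<Phi> x + rest k \<Phi> x" if x: "x \<in> D" for x
      proof -
        have "kl thA thB (Suc k) \<Phi> x = thA (\<lambda>x. alt TB TA k \<Phi> x + rest n \<Phi> x) x - kl thA thB n \<Phi> x"
          using \<open>k = Suc n\<close> a(1)[OF x] by simp
        also have "\<dots> = alt TA TB (Suc k) \<Phi> x + p * alt TB TA k \<Phi> x + thA (rest n \<Phi>) x - kl thA thB n \<Phi> x"
          by (simp add: th_lin(1)) (simp add: thA_eq)
        also have "\<dots> = alt TA TB (Suc k) \<Phi> x + p * (p * (kl thA thB n \<Phi> x + alt TB TA n \<Phi> x) + alt TA TB k \<Phi> x + alt TB TA k \<Phi> x)"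
          unfolding r(1)[OF x] using Suc by (simp add: algebra_simps)
        also have "p * (kl thA thB n \<Phi> x + alt TB TA n \<Phi> x) = rest n \<Phi> x"
          using Suc IH'(1)[OF x] by simp
        finally show ?thesis using \<open>k = Suc n\<close> by simp
      qed
      moreover have "kl thB thA (Suc k) \<Phi> x = alt TB TA (Suc k) \<Phi> x + rest k \<Phi> x" if x: "x \<in> D" for x
      proof -
        have "kl thB thA (Suc k) \<Phi> x = thB (\<lambda>x. alt TA TB k \<Phi> x + rest n \<Phi> x) x - kl thB thA n \<Phi> x"
          using \<open>k = Suc n\<close> a(2)[OF x] by simp
        also have "\<dots> = alt TB TA (Suc k) \<Phi> x + p * alt TA TB k \<Phi> x + thB (rest n \<Phi>) x - kl thB thA n \<Phi> x"
          by (simp add: th_lin(3)) (simp add: thB_eq)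
        also have "\<dots> = alt TB TA (Suc k) \<Phi> x + p * (p * (kl thB thA n \<Phi> x + alt TA TB n \<Phi> x) + alt TA TB k \<Phi> x + alt TB TA k \<Phi> x)"
          unfolding r(2)[OF x] using Suc by (simp add: algebra_simps)
        also have "p * (kl thB thA n \<Phi> x + alt TA TB n \<Phi> x) = rest n \<Phi> x"
          using Suc IH'(2)[OF x] by (simp add: algebra_simps)
        finally show ?thesis using \<open>k = Suc n\<close> by simp
      qed
      ultimately show ?thesis by blast
    qed
  qed
qed

lemma braid_iff_kl:
  "x \<in> D \<Longrightarrow> alt TA TB (Suc k) \<Phi> x = alt TB TA (Suc k) \<Phi> x \<longleftrightarrow>
    kl thA thB (Suc k) \<Phi> x = kl thB thA (Suc k) \<Phi> x"
  using kl_alt[of k \<Phi>] by simp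

end

text \<open>The numbers \<open>e\<close>, \<open>f\<close> are values of successive words on the
  walls of a hexagon of chambers, one value for the two chambers at a wall. The \<open>a\<close>'s
  belong to the three positive roots in convex order, and \<open>r0\<close> is the three-root
  relation of the middle one.\<close>

lemma kl_A2:
  fixes a0 a1 a2 S e0 e2 e4 :: "'a::field"
  assumes r0: "a0 * a2 = a1 * (a0 + a2 - S) + 1"
    and layers: "f1 = a1 * e0 + (S - a1) * e2"
      "f5 = (S - a2) * e4 + a2 * e0"
  shows "a0 * f5 + (S - a0) * f1 - e0 =
    a1 * a2 * e0
    + (S - a0) * (S - a1) * e2
    + a0 * (S - a2) * e4"
  using assms by Groebner_Basis.algebra

text \<open>The octagon read with the short simple root first: \<open>a0\<close>, \<open>a2\<close>
  belong to short roots and \<open>a1\<close>, \<open>a3\<close> to long ones. Starting with the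
  long simple root changes which triples of roots are additive, hence the separate
  \<open>kl_B2_long\<close>.\<close>

lemma kl_B2_short:
  fixes a0 a1 a2 a3 S e1 e3 e5 e7 :: "'a::field"
  assumes r0: "a0 * a2 = a1 * (a0 + a2 - S) + 1"
    and r1: "a0 * a3 = a2 * (a0 + a3 - S) + 1"
    and layers: "f0 = a0 * e7 + (S - a0) * e1"
      "f2 = a2 * e1 + (S - a2) * e3"
      "f6 = (S - a2) * e5 + a2 * e7"
      "g1 = a1 * f0 + (S - a1) * f2 - e1"
      "g7 = (S - a3) * f6 + a3 * f0 - e7"
  shows "a0 * g7 + (S - a0) * g1 - f0 =
    (S - a0) * a2 * a3 * e1
    + (S - a0) * (S - a1) * (S - a2) * e3
    + a0 * (S - a2) * (S - a3) * e5
    + a0 * a1 * a2 * e7"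
  using assms by Groebner_Basis.algebra

lemma kl_B2_long:
  fixes a0 a1 a2 a3 S e1 e3 e5 e7 :: "'a::field"
  assumes r0: "a0 * a3 = a1 * (a0 + a3 - S) + 1"
    and r1: "a1 * a3 = a2 * (a1 + a3 - S) + 1"
    and layers: "f0 = a0 * e7 + (S - a0) * e1"
      "f2 = a2 * e1 + (S - a2) * e3"
      "f6 = (S - a2) * e5 + a2 * e7"
      "g1 = a1 * f0 + (S - a1) * f2 - e1"
      "g7 = (S - a3) * f6 + a3 * f0 - e7"
  shows "a0 * g7 + (S - a0) * g1 - f0 =
    (S - a0) * a2 * a3 * e1
    + (S - a0) * (S - a1) * (S - a2) * e3
    + a0 * (S - a2) * (S - a3) * e5
    + a0 * a1 * a2 * e7"
  using assms by Groebner_Basis.algebra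

text \<open>Pure expansion, valid for independent \<open>a\<close>'s and therefore shared by both
  starting letters. Only the comparison of d1, ..., d11 with the product formula involves relations
  between roots.\<close>

lemma kl_G2_layers:
  fixes a0 a1 a2 a3 a4 a5 S e1 e3 e5 e7 e9 e11 :: "'a::field"
  assumes layers: "f0 = a0 * e11 + (S - a0) * e1"
      "f2 = a2 * e1 + (S - a2) * e3"
      "f4 = a4 * e3 + (S - a4) * e5"
      "f8 = (S - a2) * e7 + a2 * e9"
      "f10 = (S - a4) * e9 + a4 * e11"
      "g1 = a1 * f0 + (S - a1) * f2 - e1"
      "g3 = a3 * f2 + (S - a3) * f4 - e3"
      "g9 = (S - a3) * f8 + a3 * f10 - e9"
      "g11 = (S - a5) * f10 + a5 * f0 - e11"
      "h0 = a0 * g11 + (S - a0) * g1 - f0"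
      "h2 = a2 * g1 + (S - a2) * g3 - f2"
      "h10 = (S - a4) * g9 + a4 * g11 - f10"
      "k1 = a1 * h0 + (S - a1) * h2 - g1"
      "k11 = (S - a5) * h10 + a5 * h0 - g11"
    and coeffs: "0 - a0^3*a1*a1 + 2*a0^3*a1*a5 - a0^3*a5*a5 - 2*a0*a0*a1*a1*a2 + 3*a0*a0*a1*a1*S + a0*a0*a1*a2*a5 +
      2*a0*a0*a1*a2*S - 4*a0*a0*a1*a5*S - 4*a0*a0*a1 - a0*a0*a2*a5*S + a0*a0*a4*a5*a5 - a0*a0*a4*a5*S +
      a0*a0*a5*a5*S + 4*a0*a0*a5 - a0*a1*a1*a2*a2 + 4*a0*a1*a1*a2*S - 3*a0*a1*a1*S*S - a0*a1*a2*a2*a3 +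
      2*a0*a1*a2*a2*S + a0*a1*a2*a3*S - a0*a1*a2*a5*S - 4*a0*a1*a2*S*S - 4*a0*a1*a2 + 2*a0*a1*a5*S*S +
      8*a0*a1*S + a0*a2*a2*a3*S - a0*a2*a2*S*S - a0*a2*a3*S*S + a0*a2*a5*S*S + 4*a0*a2*S - a0*a4*a5*a5*S +
      a0*a4*a5*S*S - 4*a0*a5*S - 3*a0 + a1*a1*a2*a2*S - 2*a1*a1*a2*S*S + a1*a1*S^3 + a1*a2*a2*a3*S -
      2*a1*a2*a2*S*S - a1*a2*a3*S*S + 2*a1*a2*S^3 + 4*a1*a2*S - 4*a1*S*S - a2*a2*a3*S*S + a2*a2*S^3 +
      a2*a3*S^3 - 4*a2*S*S + 3*S = d1"
      "a0*a0*a1*a1*a2 - a0*a0*a1*a1*S - a0*a0*a1*a2*a5 - a0*a0*a1*a2*S + a0*a0*a1*a5*S + a0*a0*a1*S*S +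
      a0*a0*a2*a5*S - a0*a0*a5*S*S + a0*a1*a1*a2*a2 - 3*a0*a1*a1*a2*S + 2*a0*a1*a1*S*S + a0*a1*a2*a2*a3 -
      2*a0*a1*a2*a2*S + a0*a1*a2*a3*a4 - 2*a0*a1*a2*a3*S - a0*a1*a2*a4*S + a0*a1*a2*a5*S + 4*a0*a1*a2*S*S
      + 4*a0*a1*a2 - a0*a1*a3*a4*S + a0*a1*a3*S*S + a0*a1*a4*S*S - a0*a1*a5*S*S - 2*a0*a1*S^3 - 4*a0*a1*S
      - a0*a2*a2*a3*S + a0*a2*a2*S*S - a0*a2*a3*a4*S + 2*a0*a2*a3*S*S + a0*a2*a4*S*S - a0*a2*a5*S*S -
      a0*a2*S^3 - 4*a0*a2*S + a0*a3*a4*S*S - a0*a3*S^3 - a0*a4*S^3 + a0*a5*S^3 + 4*a0*S*S - a1*a1*a2*a2*S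
      + 2*a1*a1*a2*S*S - a1*a1*S^3 - a1*a2*a2*a3*S + 2*a1*a2*a2*S*S - a1*a2*a3*a4*S + 2*a1*a2*a3*S*S +
      a1*a2*a4*S*S - 3*a1*a2*S^3 - 4*a1*a2*S + a1*a3*a4*S*S - a1*a3*S^3 - a1*a4*S^3 + a1*S^4 + 4*a1*S*S +
      a2*a2*a3*S*S - a2*a2*S^3 + a2*a3*a4*S*S - 2*a2*a3*S^3 - a2*a4*S^3 + a2*S^4 + 4*a2*S*S - a3*a4*S^3 +
      a3*S^4 + a4*S^4 - 4*S^3 = d3"
      "0 - a0*a1*a2*a3*a4 + a0*a1*a2*a3*S + a0*a1*a2*a4*S - a0*a1*a2*S*S + a0*a1*a3*a4*S - a0*a1*a3*S*S -
      a0*a1*a4*S*S + a0*a1*S^3 + a0*a2*a3*a4*S - a0*a2*a3*S*S - a0*a2*a4*S*S + a0*a2*S^3 - a0*a3*a4*S*S +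
      a0*a3*S^3 + a0*a4*S^3 - a0*S^4 + a1*a2*a3*a4*S - a1*a2*a3*S*S - a1*a2*a4*S*S + a1*a2*S^3 -
      a1*a3*a4*S*S + a1*a3*S^3 + a1*a4*S^3 - a1*S^4 - a2*a3*a4*S*S + a2*a3*S^3 + a2*a4*S^3 - a2*S^4 +
      a3*a4*S^3 - a3*S^4 - a4*S^4 + S^5 = d5"
      "a0*a2*a3*a4*a5 - a0*a2*a3*a4*S - a0*a2*a3*a5*S + a0*a2*a3*S*S - a0*a2*a4*a5*S + a0*a2*a4*S*S +
      a0*a2*a5*S*S - a0*a2*S^3 - a0*a3*a4*a5*S + a0*a3*a4*S*S + a0*a3*a5*S*S - a0*a3*S^3 + a0*a4*a5*S*S -
      a0*a4*S^3 - a0*a5*S^3 + a0*S^4 = d7"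
      "0 - a0*a0*a1*a4*a5 + a0*a0*a1*a4*S + a0*a0*a1*a5*S - a0*a0*a1*S*S + a0*a0*a4*a5*a5 - a0*a0*a4*a5*S -
      a0*a0*a5*a5*S + a0*a0*a5*S*S + a0*a1*a4*a5*S - a0*a1*a4*S*S - a0*a1*a5*S*S + a0*a1*S^3 -
      a0*a2*a3*a4*a5 + a0*a2*a3*a4*S + a0*a2*a3*a5*S - a0*a2*a3*S*S + a0*a2*a4*a5*S - a0*a2*a4*S*S -
      a0*a2*a5*S*S + a0*a2*S^3 - a0*a3*a4*a4*a5 + a0*a3*a4*a4*S + 2*a0*a3*a4*a5*S - 2*a0*a3*a4*S*S -
      a0*a3*a5*S*S + a0*a3*S^3 - a0*a4*a4*a5*a5 + 2*a0*a4*a4*a5*S - a0*a4*a4*S*S + a0*a4*a5*a5*S -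
      2*a0*a4*a5*S*S - 4*a0*a4*a5 + a0*a4*S^3 + 4*a0*a4*S + 4*a0*a5*S - 4*a0*S*S = d9"
      "a0^3*a1*a1 - 2*a0^3*a1*a5 + a0^3*a5*a5 + a0*a0*a1*a1*a2 - 2*a0*a0*a1*a1*S - a0*a0*a1*a2*S +
      a0*a0*a1*a4*a5 - a0*a0*a1*a4*S + 2*a0*a0*a1*a5*S + 4*a0*a0*a1 - 2*a0*a0*a4*a5*a5 + 2*a0*a0*a4*a5*S -
      4*a0*a0*a5 - a0*a1*a1*a2*S + a0*a1*a1*S*S + a0*a1*a2*S*S - a0*a1*a4*a5*S + a0*a1*a4*S*S - 4*a0*a1*S
      + a0*a3*a4*a4*a5 - a0*a3*a4*a4*S - a0*a3*a4*a5*S + a0*a3*a4*S*S + a0*a4*a4*a5*a5 - 2*a0*a4*a4*a5*S +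
      a0*a4*a4*S*S + 4*a0*a4*a5 - 4*a0*a4*S + 3*a0 = d11"
  shows "a0 * k11 + (S - a0) * k1 - h0 = d1 * e1 + d3 * e3 + d5 * e5 + d7 * e7 + d9 * e9 + d11 * e11"
  unfolding layers coeffs[symmetric] by Groebner_Basis.algebra

text \<open>The cofactors exhibit the differences of the coefficients as elements of the ideal generated by
  \<open>r0\<close>, ..., \<open>r4\<close>.  They were found by linear algebra outside the proof, since completing these
  relations to a Groebner basis is too expensive.\<close>

lemma kl_G2_short:
  fixes a0 a1 a2 a3 a4 a5 S e1 e3 e5 e7 e9 e11 :: "'a::field"
  assumes r0: "a0 * a2 = a1 * (a0 + a2 - S) + 1"
    and r1: "a2 * a4 = a3 * (a2 + a4 - S) + 1"
    and r2: "a0 * a4 = a2 * (a0 + a4 - S) + 1"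
    and r3: "a1 * a5 = a3 * (a1 + a5 - S) + 1"
    and r4: "a0 * a5 = a4 * (a0 + a5 - S) + 1"
    and layers: "f0 = a0 * e11 + (S - a0) * e1"
      "f2 = a2 * e1 + (S - a2) * e3"
      "f4 = a4 * e3 + (S - a4) * e5"
      "f8 = (S - a2) * e7 + a2 * e9"
      "f10 = (S - a4) * e9 + a4 * e11"
      "g1 = a1 * f0 + (S - a1) * f2 - e1"
      "g3 = a3 * f2 + (S - a3) * f4 - e3"
      "g9 = (S - a3) * f8 + a3 * f10 - e9"
      "g11 = (S - a5) * f10 + a5 * f0 - e11"
      "h0 = a0 * g11 + (S - a0) * g1 - f0"
      "h2 = a2 * g1 + (S - a2) * g3 - f2"
      "h10 = (S - a4) * g9 + a4 * g11 - f10"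
      "k1 = a1 * h0 + (S - a1) * h2 - g1"
      "k11 = (S - a5) * h10 + a5 * h0 - g11"
  shows "a0 * k11 + (S - a0) * k1 - h0 =
    (S - a0) * a2 * a3 * a4 * a5 * e1
    + (S - a0) * (S - a1) * (S - a2) * a4 * a5 * e3
    + (S - a0) * (S - a1) * (S - a2) * (S - a3) * (S - a4) * e5
    + a0 * (S - a2) * (S - a3) * (S - a4) * (S - a5) * e7
    + a0 * a1 * a2 * (S - a4) * (S - a5) * e9
    + a0 * a1 * a2 * a3 * a4 * e11"
proof (rule kl_G2_layers[OF layers], goal_cases)
  case 1
  have "(a0*a0*a1 + a0*a0*a2 - 2*a0*a0*a5 + a0*a1*a2 - 2*a0*a1*S + a0*a2*a5 - 3*a0*a2*S + 2*a0*a5*S + 3*a0 - a1*a2*S + a1*S*S + a2*a3*a4 - a2*a3*S - a2*a4*a5 + 2*a2*S*S - 3*S) * (a0 * a2 - (a1 * (a0 + a2 - S) + 1))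
    + (0 - a0*a2*S + a2*S*S - a2) * (a2 * a4 - (a3 * (a2 + a4 - S) + 1))
    + (a0*a0*a2 - a0*a0*a5 - 2*a0*a2*S + a0*a5*S + a2*S*S) * (a0 * a4 - (a2 * (a0 + a4 - S) + 1))
    + (a0*a2*a2 - a0*a2*a4 - a2*a2*a4 + a2*a4*S) * (a1 * a5 - (a3 * (a1 + a5 - S) + 1))
    + (a0*a0*a2 - a0*a0*a5 - a0*a2*a2 - a0*a2*S + a0*a5*S + a2*a2*a3 + a2) * (a0 * a5 - (a4 * (a0 + a5 - S) + 1)) = 0"
    using r0 r1 r2 r3 r4 by simp
  then show ?case by Groebner_Basis.algebra
next
  case 2
  have "(0 - a0*a1*a2 + a0*a1*S + a0*a2*S - a0*S*S + a1*a2*S - a1*S*S - a2*S*S + S^3) * (a0 * a2 - (a1 * (a0 + a2 - S) + 1))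
    + (0 - a0*a1*a2 + a0*a1*S + a0*a2*S - a0*S*S + a1*a2*S - a1*S*S - a2*S*S + S^3) * (a2 * a4 - (a3 * (a2 + a4 - S) + 1))
    + (0 - a0*a1*a2 + a0*a1*S + a0*a2*S - a0*S*S + a1*a2*S - a1*S*S - a2*S*S + S^3) * (a0 * a4 - (a2 * (a0 + a4 - S) + 1))
    + (0 - a0*a1*a2 + a0*a1*S + a0*a2*S - a0*S*S + a1*a2*S - a1*S*S - a2*S*S + S^3) * (a0 * a5 - (a4 * (a0 + a5 - S) + 1)) = 0"
    using r0 r1 r2 r3 r4 by simp
  then show ?case by Groebner_Basis.algebra
next
  case 3
  show ?case by Groebner_Basis.algebra
next
  case 4
  show ?case by Groebner_Basis.algebra
next
  case 5
  have "(a0*a4*a5 - a0*a4*S - a0*a5*S + a0*S*S) * (a0 * a2 - (a1 * (a0 + a2 - S) + 1))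
    + (a0*a4*a5 - a0*a4*S - a0*a5*S + a0*S*S) * (a2 * a4 - (a3 * (a2 + a4 - S) + 1))
    + (a0*a4*a5 - a0*a4*S - a0*a5*S + a0*S*S) * (a0 * a4 - (a2 * (a0 + a4 - S) + 1))
    + (a0*a4*a5 - a0*a4*S - a0*a5*S + a0*S*S) * (a0 * a5 - (a4 * (a0 + a5 - S) + 1)) = 0"
    using r0 r1 r2 r3 r4 by simp
  then show ?case by Groebner_Basis.algebra
next
  case 6
  have "(0 - a0*a0*a1 + a0*a0*a4 + a0*a1*S + a0*a3*a4 - a0*a4*S) * (a0 * a2 - (a1 * (a0 + a2 - S) + 1))
    + (a0*a0*a4) * (a2 * a4 - (a3 * (a2 + a4 - S) + 1))
    + (0 - a0*a0*a1 + a0*a0*a4 + a0*a1*S) * (a0 * a4 - (a2 * (a0 + a4 - S) + 1))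
    + (0 - a0*a0*a4 + a0*a4*S) * (a1 * a5 - (a3 * (a1 + a5 - S) + 1))
    + (0 - 2*a0*a0*a1 + a0*a0*a4 + a0*a0*a5 + 2*a0*a1*S - a0*a3*a4 - a0*a4*a5 + a0*a4*S - 3*a0) * (a0 * a5 - (a4 * (a0 + a5 - S) + 1)) = 0"
    using r0 r1 r2 r3 r4 by simp
  then show ?case by Groebner_Basis.algebra
qed

lemma kl_G2_long:
  fixes a0 a1 a2 a3 a4 a5 S e1 e3 e5 e7 e9 e11 :: "'a::field"
  assumes r0: "a5 * a3 = a4 * (a5 + a3 - S) + 1"
    and r1: "a3 * a1 = a2 * (a3 + a1 - S) + 1"
    and r2: "a5 * a1 = a3 * (a5 + a1 - S) + 1"
    and r3: "a4 * a0 = a2 * (a4 + a0 - S) + 1"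
    and r4: "a5 * a0 = a1 * (a5 + a0 - S) + 1"
    and layers: "f0 = a0 * e11 + (S - a0) * e1"
      "f2 = a2 * e1 + (S - a2) * e3"
      "f4 = a4 * e3 + (S - a4) * e5"
      "f8 = (S - a2) * e7 + a2 * e9"
      "f10 = (S - a4) * e9 + a4 * e11"
      "g1 = a1 * f0 + (S - a1) * f2 - e1"
      "g3 = a3 * f2 + (S - a3) * f4 - e3"
      "g9 = (S - a3) * f8 + a3 * f10 - e9"
      "g11 = (S - a5) * f10 + a5 * f0 - e11"
      "h0 = a0 * g11 + (S - a0) * g1 - f0"
      "h2 = a2 * g1 + (S - a2) * g3 - f2"
      "h10 = (S - a4) * g9 + a4 * g11 - f10"
      "k1 = a1 * h0 + (S - a1) * h2 - g1"
      "k11 = (S - a5) * h10 + a5 * h0 - g11"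
  shows "a0 * k11 + (S - a0) * k1 - h0 =
    (S - a0) * a2 * a3 * a4 * a5 * e1
    + (S - a0) * (S - a1) * (S - a2) * a4 * a5 * e3
    + (S - a0) * (S - a1) * (S - a2) * (S - a3) * (S - a4) * e5
    + a0 * (S - a2) * (S - a3) * (S - a4) * (S - a5) * e7
    + a0 * a1 * a2 * (S - a4) * (S - a5) * e9
    + a0 * a1 * a2 * a3 * a4 * e11"
proof (rule kl_G2_layers[OF layers], goal_cases)
  case 1
  have "(a5) * (a5 * a3 - (a4 * (a5 + a3 - S) + 1))
    + (a0*a1*a2 - a0*a1*a5 - a0*a2*S - a0*a4*a5 - a0*a5*a5 + a0*a5*S - a1*a2*S + a1*a5*S + a2*S*S - a4*a5*a5 + a4*a5*S + a5*a5*S - a5*S*S) * (a3 * a1 - (a2 * (a3 + a1 - S) + 1))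
    + (a0*a1*a2 - a0*a1*a5 - a0*a2*S - a1*a2*S + a1*a5*S + a2*S*S) * (a5 * a1 - (a3 * (a5 + a1 - S) + 1))
    + (a0*a5*a5 - a0*a5*S + a3*a5*a5 - a5*a5*S + a5*S*S - a5) * (a4 * a0 - (a2 * (a4 + a0 - S) + 1))
    + (a0*a0*a1 - a0*a0*a5 + 2*a0*a1*a2 - a0*a1*a5 - 2*a0*a1*S + a0*a2*a5 - 2*a0*a2*S + a0*a5*S + 3*a0 - 2*a1*a2*S + a1*a5*S + a1*S*S + a2*a4*a5 - a2*a5*S + 2*a2*S*S - a3*a4*a5 - 3*S) * (a5 * a0 - (a1 * (a5 + a0 - S) + 1)) = 0"
    using r0 r1 r2 r3 r4 by simp
  then show ?case by Groebner_Basis.algebra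
next
  case 2
  have "(0 - a0*a1*a2 + a0*a1*S + a0*a2*S - a0*S*S + a1*a2*S - a1*S*S - a2*S*S + S^3) * (a5 * a3 - (a4 * (a5 + a3 - S) + 1))
    + (0 - a0*a1*a2 + a0*a1*S + a0*a2*S - a0*S*S + a1*a2*S - a1*S*S - a2*S*S + S^3) * (a3 * a1 - (a2 * (a3 + a1 - S) + 1))
    + (0 - a0*a1*a2 + a0*a1*S + a0*a2*S - a0*S*S + a1*a2*S - a1*S*S - a2*S*S + S^3) * (a5 * a1 - (a3 * (a5 + a1 - S) + 1))
    + (0 - a0*a1*a2 + a0*a1*S + a0*a2*S - a0*S*S + a1*a2*S - a1*S*S - a2*S*S + S^3) * (a5 * a0 - (a1 * (a5 + a0 - S) + 1)) = 0"
    using r0 r1 r2 r3 r4 by simp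
  then show ?case by Groebner_Basis.algebra
next
  case 3
  show ?case by Groebner_Basis.algebra
next
  case 4
  show ?case by Groebner_Basis.algebra
next
  case 5
  have "(a0*a4*a5 - a0*a4*S - a0*a5*S + a0*S*S) * (a5 * a3 - (a4 * (a5 + a3 - S) + 1))
    + (a0*a4*a5 - a0*a4*S - a0*a5*S + a0*S*S) * (a3 * a1 - (a2 * (a3 + a1 - S) + 1))
    + (a0*a4*a5 - a0*a4*S - a0*a5*S + a0*S*S) * (a5 * a1 - (a3 * (a5 + a1 - S) + 1))
    + (a0*a4*a5 - a0*a4*S - a0*a5*S + a0*S*S) * (a5 * a0 - (a1 * (a5 + a0 - S) + 1)) = 0"
    using r0 r1 r2 r3 r4 by simp
  then show ?case by Groebner_Basis.algebra
next
  case 6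
  have "(a0*a0*a1 - a0*a0*a2 + a0*a1*a2 + a0*a1*a5 - a0*a1*S - a0*a4*a5 + a0*a4*S) * (a5 * a3 - (a4 * (a5 + a3 - S) + 1))
    + (a0*a0*a4 - a0*a0*a5 + a0*a1*a5) * (a3 * a1 - (a2 * (a3 + a1 - S) + 1))
    + (a0*a1*a5 - a0*a4*a5 + a0*a4*S) * (a5 * a1 - (a3 * (a5 + a1 - S) + 1))
    + (a0) * (a4 * a0 - (a2 * (a4 + a0 - S) + 1))
    + (0 - a0*a0*a1 + a0*a0*a5 - a0*a1*a2 + a0*a1*a5 + a0*a1*S - a0*a2*a4 + a0*a2*S - 2*a0*a4*a5 + 2*a0*a4*S - 4*a0) * (a5 * a0 - (a1 * (a5 + a0 - S) + 1)) = 0"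
    using r0 r1 r2 r3 r4 by simp
  then show ?case by Groebner_Basis.algebra
qed

text \<open>The points \<open>t0, t1, ...\<close> and \<open>t0, u1, ...\<close> are the chambers on the two galleries that start in
  \<open>t0\<close>; both galleries end in the chamber opposite to \<open>t0\<close>.\<close>

lemma kl_chain_3:
  fixes a0 a1 a2 S :: "'a::field" and t0 t1 t2 t3 u1 u2 :: 't
  assumes rels: "a0 * a2 = a1 * (a0 + a2 - S) + 1"
    and moves: "sA t0 = t1" "sA t1 = t0"
      "sB t1 = t2" "sB t2 = t1"
      "sA t2 = t3" "sA t3 = t2"
      "sA u2 = u1" "sA u1 = u2"
      "sB u1 = t0" "sB t0 = u1"
    and coeffs: "cA t0 = a0" "cA t1 = S - a0"
      "cB t1 = a1" "cB t2 = S - a1"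
      "cA t2 = a2" "cA t3 = S - a2"
      "cA u2 = S - a1" "cA u1 = a1"
      "cB u1 = S - a2" "cB t0 = a2"
  shows "kl (avg S cA sA) (avg S cB sB) 3 \<Phi> t0 =
    a0 * a1 * a2 * \<Phi> t0
    + (S - a0) * a1 * a2 * \<Phi> t1
    + (S - a0) * (S - a1) * a2 * \<Phi> t2
    + (S - a0) * (S - a1) * (S - a2) * \<Phi> t3
    + a0 * (S - a1) * (S - a2) * \<Phi> u2
    + a0 * a1 * (S - a2) * \<Phi> u1"
proof -
  let ?A = "avg S cA sA" and ?B = "avg S cB sB"
  \<comment> \<open>One value per wall: after averaging, a word takes equal values on both sides of
    the wall of its outermost letter.\<close>
  define e0 where "e0 = a0 * \<Phi> t0 + (S - a0) * \<Phi> t1"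
  define e2 where "e2 = a2 * \<Phi> t2 + (S - a2) * \<Phi> t3"
  define e4 where "e4 = (S - a1) * \<Phi> u2 + a1 * \<Phi> u1"
  have e_0: "kl ?A ?B (Suc 0) \<Phi> x = ?A \<Phi> x" for x
    by simp
  have es: "kl ?A ?B (Suc 0) \<Phi> t0 = e0"
    "kl ?A ?B (Suc 0) \<Phi> t1 = e0"
    "kl ?A ?B (Suc 0) \<Phi> t2 = e2"
    "kl ?A ?B (Suc 0) \<Phi> t3 = e2"
    "kl ?A ?B (Suc 0) \<Phi> u2 = e4"
    "kl ?A ?B (Suc 0) \<Phi> u1 = e4"
    by (simp_all add: e_0 avg_def moves coeffs  e0_def e2_def e4_def kl.simps(1) algebra_simps del: kl.simps(2,3))
  define f1 where "f1 = a1 * e0 + (S - a1) * e2"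
  define f5 where "f5 = (S - a2) * e4 + a2 * e0"
  have f0: "kl ?B ?A 2 \<Phi> x = ?B (kl ?A ?B (Suc 0) \<Phi>) x - kl ?B ?A 0 \<Phi> x" for x
    by (simp add: eval_nat_numeral)
  have fs: "kl ?B ?A 2 \<Phi> t1 = f1"
    "kl ?B ?A 2 \<Phi> t2 = f1"
    "kl ?B ?A 2 \<Phi> u1 = f5"
    "kl ?B ?A 2 \<Phi> t0 = f5"
    by (simp_all add: f0 avg_def moves coeffs es f1_def f5_def kl.simps(1) algebra_simps del: kl.simps(2,3))
  have "kl ?A ?B 3 \<Phi> t0 = ?A (kl ?B ?A 2 \<Phi>) t0 - kl ?A ?B (Suc 0) \<Phi> t0"
    by (simp add: eval_nat_numeral)
  also have "\<dots> = a0 * f5 + (S - a0) * f1 - e0"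
    by (simp add: avg_def moves coeffs fs es del: kl.simps)
  also have "\<dots> = a1 * a2 * e0
    + (S - a0) * (S - a1) * e2
    + a0 * (S - a2) * e4"
    by (rule kl_A2[OF rels f1_def f5_def])
  finally show ?thesis
    unfolding e0_def e2_def e4_def by (simp only: distrib_left mult_ac add_ac)
qed

text \<open>Both alternatives of \<open>rels\<close> occur, because the formula is needed once with
  the short and once with the long simple root as the first letter.\<close>

lemma kl_chain_4:
  fixes a0 a1 a2 a3 S :: "'a::field" and t0 t1 t2 t3 t4 u1 u2 u3 :: 't
  assumes rels: "a0 * a2 = a1 * (a0 + a2 - S) + 1 \<and> a0 * a3 = a2 * (a0 + a3 - S) + 1 \<or>
      a0 * a3 = a1 * (a0 + a3 - S) + 1 \<and> a1 * a3 = a2 * (a1 + a3 - S) + 1"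
    and moves: "sA t0 = t1" "sA t1 = t0"
      "sB t1 = t2" "sB t2 = t1"
      "sA t2 = t3" "sA t3 = t2"
      "sB t3 = t4" "sB t4 = t3"
      "sB u3 = u2" "sB u2 = u3"
      "sA u2 = u1" "sA u1 = u2"
      "sB u1 = t0" "sB t0 = u1"
    and coeffs: "cA t0 = a0" "cA t1 = S - a0"
      "cB t1 = a1" "cB t2 = S - a1"
      "cA t2 = a2" "cA t3 = S - a2"
      "cB t3 = a3" "cB t4 = S - a3"
      "cB u3 = S - a1" "cB u2 = a1"
      "cA u2 = S - a2" "cA u1 = a2"
      "cB u1 = S - a3" "cB t0 = a3"
  shows "kl (avg S cA sA) (avg S cB sB) 4 \<Phi> t0 =
    a0 * a1 * a2 * a3 * \<Phi> t0
    + (S - a0) * a1 * a2 * a3 * \<Phi> t1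
    + (S - a0) * (S - a1) * a2 * a3 * \<Phi> t2
    + (S - a0) * (S - a1) * (S - a2) * a3 * \<Phi> t3
    + (S - a0) * (S - a1) * (S - a2) * (S - a3) * \<Phi> t4
    + a0 * (S - a1) * (S - a2) * (S - a3) * \<Phi> u3
    + a0 * a1 * (S - a2) * (S - a3) * \<Phi> u2
    + a0 * a1 * a2 * (S - a3) * \<Phi> u1"
proof -
  let ?A = "avg S cA sA" and ?B = "avg S cB sB"
  define e1 where "e1 = a1 * \<Phi> t1 + (S - a1) * \<Phi> t2"
  define e3 where "e3 = a3 * \<Phi> t3 + (S - a3) * \<Phi> t4"
  define e5 where "e5 = (S - a1) * \<Phi> u3 + a1 * \<Phi> u2"
  define e7 where "e7 = (S - a3) * \<Phi> u1 + a3 * \<Phi> t0"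
  have e_0: "kl ?B ?A (Suc 0) \<Phi> x = ?B \<Phi> x" for x
    by simp
  have es: "kl ?B ?A (Suc 0) \<Phi> t1 = e1"
    "kl ?B ?A (Suc 0) \<Phi> t2 = e1"
    "kl ?B ?A (Suc 0) \<Phi> t3 = e3"
    "kl ?B ?A (Suc 0) \<Phi> t4 = e3"
    "kl ?B ?A (Suc 0) \<Phi> u3 = e5"
    "kl ?B ?A (Suc 0) \<Phi> u2 = e5"
    "kl ?B ?A (Suc 0) \<Phi> u1 = e7"
    "kl ?B ?A (Suc 0) \<Phi> t0 = e7"
    by (simp_all add: e_0 avg_def moves coeffs  e1_def e3_def e5_def e7_def kl.simps(1) algebra_simps del: kl.simps(2,3))
  define f0 where "f0 = a0 * e7 + (S - a0) * e1"
  define f2 where "f2 = a2 * e1 + (S - a2) * e3"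
  define f6 where "f6 = (S - a2) * e5 + a2 * e7"
  have f0: "kl ?A ?B 2 \<Phi> x = ?A (kl ?B ?A (Suc 0) \<Phi>) x - kl ?A ?B 0 \<Phi> x" for x
    by (simp add: eval_nat_numeral)
  have fs: "kl ?A ?B 2 \<Phi> t0 = f0"
    "kl ?A ?B 2 \<Phi> t1 = f0"
    "kl ?A ?B 2 \<Phi> t2 = f2"
    "kl ?A ?B 2 \<Phi> t3 = f2"
    "kl ?A ?B 2 \<Phi> u2 = f6"
    "kl ?A ?B 2 \<Phi> u1 = f6"
    by (simp_all add: f0 avg_def moves coeffs es f0_def f2_def f6_def kl.simps(1) algebra_simps del: kl.simps(2,3))
  define g1 where "g1 = a1 * f0 + (S - a1) * f2 - e1"
  define g7 where "g7 = (S - a3) * f6 + a3 * f0 - e7"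
  have g0: "kl ?B ?A 3 \<Phi> x = ?B (kl ?A ?B 2 \<Phi>) x - kl ?B ?A (Suc 0) \<Phi> x" for x
    by (simp add: eval_nat_numeral)
  have gs: "kl ?B ?A 3 \<Phi> t1 = g1"
    "kl ?B ?A 3 \<Phi> t2 = g1"
    "kl ?B ?A 3 \<Phi> u1 = g7"
    "kl ?B ?A 3 \<Phi> t0 = g7"
    by (simp_all add: g0 avg_def moves coeffs es fs g1_def g7_def kl.simps(1) algebra_simps del: kl.simps(2,3))
  have "kl ?A ?B 4 \<Phi> t0 = ?A (kl ?B ?A 3 \<Phi>) t0 - kl ?A ?B 2 \<Phi> t0"
    by (simp add: eval_nat_numeral)
  also have "\<dots> = a0 * g7 + (S - a0) * g1 - f0"
    by (simp add: avg_def moves coeffs gs fs del: kl.simps)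
  also have "\<dots> = (S - a0) * a2 * a3 * e1
    + (S - a0) * (S - a1) * (S - a2) * e3
    + a0 * (S - a2) * (S - a3) * e5
    + a0 * a1 * a2 * e7"
    using rels
  proof (elim disjE conjE)
    assume r: "a0 * a2 = a1 * (a0 + a2 - S) + 1" "a0 * a3 = a2 * (a0 + a3 - S) + 1"
    show ?thesis by (rule kl_B2_short[OF r f0_def f2_def f6_def g1_def g7_def])
  next
    assume r: "a0 * a3 = a1 * (a0 + a3 - S) + 1" "a1 * a3 = a2 * (a1 + a3 - S) + 1"
    show ?thesis by (rule kl_B2_long[OF r f0_def f2_def f6_def g1_def g7_def])
  qed
  finally show ?thesis
    unfolding e1_def e3_def e5_def e7_def by (simp only: distrib_left mult_ac add_ac)
qed

lemma kl_chain_6: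
  fixes a0 a1 a2 a3 a4 a5 S :: "'a::field" and t0 t1 t2 t3 t4 t5 t6 u1 u2 u3 u4 u5 :: 't
  assumes rels: "a0 * a2 = a1 * (a0 + a2 - S) + 1 \<and> a2 * a4 = a3 * (a2 + a4 - S) + 1 \<and> a0 * a4 = a2 * (a0 + a4 - S) + 1 \<and> a1 * a5 = a3 * (a1 + a5 - S) + 1 \<and> a0 * a5 = a4 * (a0 + a5 - S) + 1 \<or>
      a5 * a3 = a4 * (a5 + a3 - S) + 1 \<and> a3 * a1 = a2 * (a3 + a1 - S) + 1 \<and> a5 * a1 = a3 * (a5 + a1 - S) + 1 \<and> a4 * a0 = a2 * (a4 + a0 - S) + 1 \<and> a5 * a0 = a1 * (a5 + a0 - S) + 1"
    and moves: "sA t0 = t1" "sA t1 = t0"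
      "sB t1 = t2" "sB t2 = t1"
      "sA t2 = t3" "sA t3 = t2"
      "sB t3 = t4" "sB t4 = t3"
      "sA t4 = t5" "sA t5 = t4"
      "sB t5 = t6" "sB t6 = t5"
      "sB u5 = u4" "sB u4 = u5"
      "sA u4 = u3" "sA u3 = u4"
      "sB u3 = u2" "sB u2 = u3"
      "sA u2 = u1" "sA u1 = u2"
      "sB u1 = t0" "sB t0 = u1"
    and coeffs: "cA t0 = a0" "cA t1 = S - a0"
      "cB t1 = a1" "cB t2 = S - a1"
      "cA t2 = a2" "cA t3 = S - a2"
      "cB t3 = a3" "cB t4 = S - a3"
      "cA t4 = a4" "cA t5 = S - a4"
      "cB t5 = a5" "cB t6 = S - a5"
      "cB u5 = S - a1" "cB u4 = a1"
      "cA u4 = S - a2" "cA u3 = a2"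
      "cB u3 = S - a3" "cB u2 = a3"
      "cA u2 = S - a4" "cA u1 = a4"
      "cB u1 = S - a5" "cB t0 = a5"
  shows "kl (avg S cA sA) (avg S cB sB) 6 \<Phi> t0 =
    a0 * a1 * a2 * a3 * a4 * a5 * \<Phi> t0
    + (S - a0) * a1 * a2 * a3 * a4 * a5 * \<Phi> t1
    + (S - a0) * (S - a1) * a2 * a3 * a4 * a5 * \<Phi> t2
    + (S - a0) * (S - a1) * (S - a2) * a3 * a4 * a5 * \<Phi> t3
    + (S - a0) * (S - a1) * (S - a2) * (S - a3) * a4 * a5 * \<Phi> t4
    + (S - a0) * (S - a1) * (S - a2) * (S - a3) * (S - a4) * a5 * \<Phi> t5
    + (S - a0) * (S - a1) * (S - a2) * (S - a3) * (S - a4) * (S - a5) * \<Phi> t6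
    + a0 * (S - a1) * (S - a2) * (S - a3) * (S - a4) * (S - a5) * \<Phi> u5
    + a0 * a1 * (S - a2) * (S - a3) * (S - a4) * (S - a5) * \<Phi> u4
    + a0 * a1 * a2 * (S - a3) * (S - a4) * (S - a5) * \<Phi> u3
    + a0 * a1 * a2 * a3 * (S - a4) * (S - a5) * \<Phi> u2
    + a0 * a1 * a2 * a3 * a4 * (S - a5) * \<Phi> u1"
proof -
  let ?A = "avg S cA sA" and ?B = "avg S cB sB"
  define e1 where "e1 = a1 * \<Phi> t1 + (S - a1) * \<Phi> t2"
  define e3 where "e3 = a3 * \<Phi> t3 + (S - a3) * \<Phi> t4"
  define e5 where "e5 = a5 * \<Phi> t5 + (S - a5) * \<Phi> t6"
  define e7 where "e7 = (S - a1) * \<Phi> u5 + a1 * \<Phi> u4"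
  define e9 where "e9 = (S - a3) * \<Phi> u3 + a3 * \<Phi> u2"
  define e11 where "e11 = (S - a5) * \<Phi> u1 + a5 * \<Phi> t0"
  have e_0: "kl ?B ?A (Suc 0) \<Phi> x = ?B \<Phi> x" for x
    by simp
  have es: "kl ?B ?A (Suc 0) \<Phi> t1 = e1"
    "kl ?B ?A (Suc 0) \<Phi> t2 = e1"
    "kl ?B ?A (Suc 0) \<Phi> t3 = e3"
    "kl ?B ?A (Suc 0) \<Phi> t4 = e3"
    "kl ?B ?A (Suc 0) \<Phi> t5 = e5"
    "kl ?B ?A (Suc 0) \<Phi> t6 = e5"
    "kl ?B ?A (Suc 0) \<Phi> u5 = e7"
    "kl ?B ?A (Suc 0) \<Phi> u4 = e7"
    "kl ?B ?A (Suc 0) \<Phi> u3 = e9"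
    "kl ?B ?A (Suc 0) \<Phi> u2 = e9"
    "kl ?B ?A (Suc 0) \<Phi> u1 = e11"
    "kl ?B ?A (Suc 0) \<Phi> t0 = e11"
    by (simp_all add: e_0 avg_def moves coeffs  e1_def e3_def e5_def e7_def e9_def e11_def kl.simps(1) algebra_simps del: kl.simps(2,3))
  define f0 where "f0 = a0 * e11 + (S - a0) * e1"
  define f2 where "f2 = a2 * e1 + (S - a2) * e3"
  define f4 where "f4 = a4 * e3 + (S - a4) * e5"
  define f8 where "f8 = (S - a2) * e7 + a2 * e9"
  define f10 where "f10 = (S - a4) * e9 + a4 * e11"
  have f0: "kl ?A ?B 2 \<Phi> x = ?A (kl ?B ?A (Suc 0) \<Phi>) x - kl ?A ?B 0 \<Phi> x" for x
    by (simp add: eval_nat_numeral)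
  have fs: "kl ?A ?B 2 \<Phi> t0 = f0"
    "kl ?A ?B 2 \<Phi> t1 = f0"
    "kl ?A ?B 2 \<Phi> t2 = f2"
    "kl ?A ?B 2 \<Phi> t3 = f2"
    "kl ?A ?B 2 \<Phi> t4 = f4"
    "kl ?A ?B 2 \<Phi> t5 = f4"
    "kl ?A ?B 2 \<Phi> u4 = f8"
    "kl ?A ?B 2 \<Phi> u3 = f8"
    "kl ?A ?B 2 \<Phi> u2 = f10"
    "kl ?A ?B 2 \<Phi> u1 = f10"
    by (simp_all add: f0 avg_def moves coeffs es f0_def f2_def f4_def f8_def f10_def kl.simps(1) algebra_simps del: kl.simps(2,3))
  define g1 where "g1 = a1 * f0 + (S - a1) * f2 - e1"
  define g3 where "g3 = a3 * f2 + (S - a3) * f4 - e3"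
  define g9 where "g9 = (S - a3) * f8 + a3 * f10 - e9"
  define g11 where "g11 = (S - a5) * f10 + a5 * f0 - e11"
  have g0: "kl ?B ?A 3 \<Phi> x = ?B (kl ?A ?B 2 \<Phi>) x - kl ?B ?A (Suc 0) \<Phi> x" for x
    by (simp add: eval_nat_numeral)
  have gs: "kl ?B ?A 3 \<Phi> t1 = g1"
    "kl ?B ?A 3 \<Phi> t2 = g1"
    "kl ?B ?A 3 \<Phi> t3 = g3"
    "kl ?B ?A 3 \<Phi> t4 = g3"
    "kl ?B ?A 3 \<Phi> u3 = g9"
    "kl ?B ?A 3 \<Phi> u2 = g9"
    "kl ?B ?A 3 \<Phi> u1 = g11"
    "kl ?B ?A 3 \<Phi> t0 = g11"
    by (simp_all add: g0 avg_def moves coeffs es fs g1_def g3_def g9_def g11_def kl.simps(1) algebra_simps del: kl.simps(2,3))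
  define h0 where "h0 = a0 * g11 + (S - a0) * g1 - f0"
  define h2 where "h2 = a2 * g1 + (S - a2) * g3 - f2"
  define h10 where "h10 = (S - a4) * g9 + a4 * g11 - f10"
  have h0: "kl ?A ?B 4 \<Phi> x = ?A (kl ?B ?A 3 \<Phi>) x - kl ?A ?B 2 \<Phi> x" for x
    by (simp add: eval_nat_numeral)
  have hs: "kl ?A ?B 4 \<Phi> t0 = h0"
    "kl ?A ?B 4 \<Phi> t1 = h0"
    "kl ?A ?B 4 \<Phi> t2 = h2"
    "kl ?A ?B 4 \<Phi> t3 = h2"
    "kl ?A ?B 4 \<Phi> u2 = h10"
    "kl ?A ?B 4 \<Phi> u1 = h10"
    by (simp_all add: h0 avg_def moves coeffs fs gs h0_def h2_def h10_def kl.simps(1) algebra_simps del: kl.simps(2,3))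
  define k1 where "k1 = a1 * h0 + (S - a1) * h2 - g1"
  define k11 where "k11 = (S - a5) * h10 + a5 * h0 - g11"
  have k0: "kl ?B ?A 5 \<Phi> x = ?B (kl ?A ?B 4 \<Phi>) x - kl ?B ?A 3 \<Phi> x" for x
    by (simp add: eval_nat_numeral)
  have ks: "kl ?B ?A 5 \<Phi> t1 = k1"
    "kl ?B ?A 5 \<Phi> t2 = k1"
    "kl ?B ?A 5 \<Phi> u1 = k11"
    "kl ?B ?A 5 \<Phi> t0 = k11"
    by (simp_all add: k0 avg_def moves coeffs gs hs k1_def k11_def kl.simps(1) algebra_simps del: kl.simps(2,3))
  have "kl ?A ?B 6 \<Phi> t0 = ?A (kl ?B ?A 5 \<Phi>) t0 - kl ?A ?B 4 \<Phi> t0"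
    by (simp add: eval_nat_numeral)
  also have "\<dots> = a0 * k11 + (S - a0) * k1 - h0"
    by (simp add: avg_def moves coeffs ks hs del: kl.simps)
  also have "\<dots> = (S - a0) * a2 * a3 * a4 * a5 * e1
    + (S - a0) * (S - a1) * (S - a2) * a4 * a5 * e3
    + (S - a0) * (S - a1) * (S - a2) * (S - a3) * (S - a4) * e5
    + a0 * (S - a2) * (S - a3) * (S - a4) * (S - a5) * e7
    + a0 * a1 * a2 * (S - a4) * (S - a5) * e9
    + a0 * a1 * a2 * a3 * a4 * e11"
    using rels
  proof (elim disjE conjE)
    assume r: "a0 * a2 = a1 * (a0 + a2 - S) + 1" "a2 * a4 = a3 * (a2 + a4 - S) + 1" "a0 * a4 = a2 * (a0 + a4 - S) + 1" "a1 * a5 = a3 * (a1 + a5 - S) + 1" "a0 * a5 = a4 * (a0 + a5 - S) + 1"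
    show ?thesis by (rule kl_G2_short[OF r f0_def f2_def f4_def f8_def f10_def g1_def g3_def g9_def g11_def h0_def h2_def h10_def k1_def k11_def])
  next
    assume r: "a5 * a3 = a4 * (a5 + a3 - S) + 1" "a3 * a1 = a2 * (a3 + a1 - S) + 1" "a5 * a1 = a3 * (a5 + a1 - S) + 1" "a4 * a0 = a2 * (a4 + a0 - S) + 1" "a5 * a0 = a1 * (a5 + a0 - S) + 1"
    show ?thesis by (rule kl_G2_long[OF r f0_def f2_def f4_def f8_def f10_def g1_def g3_def g9_def g11_def h0_def h2_def h10_def k1_def k11_def])
  qed
  finally show ?thesis
    unfolding e1_def e3_def e5_def e7_def e9_def e11_def by (simp only: distrib_left mult_ac add_ac)
qed

section \<open>Demazure--Lusztig operators\<close>

lemma q_nz [simp]: "q \<noteq> 0"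
  by (simp add: q_def Zero_fract_def eq_fract)

context based_root_system
begin

text \<open>Macdonald's c-function (q - q^-1 x^(-\<alpha>)) / (1 - x^(-\<alpha>)), evaluated at
  \<tau>.\<close>

definition cc :: "'v \<Rightarrow> ('v \<Rightarrow> scalar) \<Rightarrow> scalar" where
  "cc \<alpha> \<tau> = inverse q + (q - inverse q) / (1 - \<tau> (- \<alpha>))"

text \<open>Characters of the weight lattice avoiding the poles and zeros of the Demazure--Lusztig operators.\<close>

definition regch :: "('v \<Rightarrow> scalar) set" where
  "regch = {\<tau>. \<tau> 0 = 1 \<and> (\<forall>\<mu>\<in>weights. \<forall>\<nu>\<in>weights. \<tau> (\<mu> + \<nu>) = \<tau> \<mu> * \<tau> \<nu>)
    \<and> (\<forall>\<alpha>\<in>R. \<tau> \<alpha> \<noteq> 1 \<and> \<tau> \<alpha> \<noteq> q\<^sup>2)}"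

lemma regch_0: "\<tau> \<in> regch \<Longrightarrow> \<tau> 0 = 1"
  and regch_add: "\<tau> \<in> regch \<Longrightarrow> \<mu> \<in> weights \<Longrightarrow> \<nu> \<in> weights \<Longrightarrow> \<tau> (\<mu> + \<nu>) = \<tau> \<mu> * \<tau> \<nu>"
  and regch_root: "\<tau> \<in> regch \<Longrightarrow> \<alpha> \<in> R \<Longrightarrow> \<tau> \<alpha> \<noteq> 1" "\<tau> \<in> regch \<Longrightarrow> \<alpha> \<in> R \<Longrightarrow> \<tau> \<alpha> \<noteq> q\<^sup>2"
  by (auto simp: regch_def)

lemma regch_inv: "\<tau> \<in> regch \<Longrightarrow> \<mu> \<in> weights \<Longrightarrow> \<tau> \<mu> * \<tau> (- \<mu>) = 1"
  using regch_add[of \<tau> \<mu> "- \<mu>"] regch_0[of \<tau>] weights_minus[of \<mu>] by simp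

lemma regch_nz: "\<tau> \<in> regch \<Longrightarrow> \<mu> \<in> weights \<Longrightarrow> \<tau> \<mu> \<noteq> 0"
  using regch_inv by fastforce

lemma regch_minus: "\<tau> \<in> regch \<Longrightarrow> \<mu> \<in> weights \<Longrightarrow> \<tau> (- \<mu>) = inverse (\<tau> \<mu>)"
  using regch_inv inverse_unique by metis

lemma regch_weyl: assumes "\<tau> \<in> regch" "w \<in> weyl" shows "\<tau> \<circ> w \<in> regch"
  using assms weights_weyl[OF assms(2)] weyl_root[OF assms(2)]
  by (auto simp: regch_def weyl_add weyl_zero)

lemma regch_refl: "\<tau> \<in> regch \<Longrightarrow> \<alpha> \<in> R \<Longrightarrow> \<tau> \<circ> refl \<alpha> \<in> regch"
  using regch_weyl weyl_refl by blast

lemma cc_comp: "cc \<gamma> (\<tau> \<circ> w) = cc (w \<gamma>) \<tau>" if "linear w"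
  using that by (simp add: cc_def linear_neg)

lemma cc_refl: "cc \<gamma> (\<tau> \<circ> refl \<alpha>) = cc (refl \<alpha> \<gamma>) \<tau>"
  using cc_comp[OF linear_refl] .

text \<open>Rests on 1/(1 - t) + 1/(1 - t^-1) = 1. It means that the reflection exchanges the two
  coefficients of its averaging operator.\<close>

lemma cc_neg:
  assumes "\<tau> \<in> regch" "\<gamma> \<in> R" shows "cc (- \<gamma>) \<tau> = q + inverse q - cc \<gamma> \<tau>"
proof -
  have t: "\<tau> \<gamma> \<noteq> 0" "\<tau> \<gamma> \<noteq> 1" using assms regch_nz regch_root weights_root by auto
  have e: "1 - inverse (\<tau> \<gamma>) = - ((1 - \<tau> \<gamma>) / \<tau> \<gamma>)" using t by (simp add: field_simps)
  have "1 / (1 - \<tau> \<gamma>) + 1 / (1 - inverse (\<tau> \<gamma>)) = 1"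
    unfolding e using t by (simp add: diff_divide_distrib[symmetric])
  then have "(q - inverse q) * (1 / (1 - \<tau> \<gamma>) + 1 / (1 - inverse (\<tau> \<gamma>))) = q - inverse q" by simp
  then show ?thesis using regch_minus[OF assms(1) weights_root[OF assms(2)]]
    by (simp add: cc_def distrib_left)
qed

text \<open>With x, y, z the inverses of 1 - a, 1 - b, 1 - a b, the core is x y = z (x + y - 1); the
  remaining terms add up to q^-1 q = 1. It supplies all relations between different roots in the
  rank-two computations.\<close>

lemma cc_rel:
  assumes t: "\<tau> \<in> regch" and R: "\<gamma> \<in> R" "\<delta> \<in> R" "\<gamma> + \<delta> \<in> R"
  shows "cc \<gamma> \<tau> * cc \<delta> \<tau> = cc (\<gamma> + \<delta>) \<tau> * (cc \<gamma> \<tau> + cc \<delta> \<tau> - (q + inverse q)) + 1"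
proof -
  let ?a = "\<tau> (- \<gamma>)" and ?b = "\<tau> (- \<delta>)"
  have ab: "\<tau> (- (\<gamma> + \<delta>)) = ?a * ?b"
    using regch_add[OF t, of "- \<gamma>" "- \<delta>"] R weights_root neg_closed by simp
  have ne: "1 - ?a \<noteq> 0" "1 - ?b \<noteq> 0" "1 - ?a * ?b \<noteq> 0"
    using regch_root(1)[OF t neg_closed] R ab by (metis right_minus_eq)+
  define x y z h where "x = 1 / (1 - ?a)" and "y = 1 / (1 - ?b)" and "z = 1 / (1 - ?a * ?b)" and "h = q - inverse q"
  have xyz: "x * y = z * (x + y - 1)" using ne by (simp add: x_def y_def z_def divide_simps) (simp add: algebra_simps)
  have c: "cc \<gamma> \<tau> = inverse q + h * x" "cc \<delta> \<tau> = inverse q + h * y" "cc (\<gamma> + \<delta>) \<tau> = inverse q + h * z"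
    unfolding cc_def ab x_def y_def z_def h_def by simp_all
  have S: "q + inverse q = 2 * inverse q + h" by (simp add: h_def)
  have hh: "inverse q * (inverse q + h) = 1" by (simp add: h_def)
  have "(inverse q + h * x) * (inverse q + h * y) - (inverse q + h * z) * (h * (x + y - 1))
      = inverse q * (inverse q + h) + h * h * (x * y - z * (x + y - 1))"
    by (simp add: algebra_simps)
  then have "(inverse q + h * x) * (inverse q + h * y) = (inverse q + h * z) * (h * (x + y - 1)) + 1"
    unfolding hh xyz by (simp add: algebra_simps)
  moreover have "inverse q + h * x + (inverse q + h * y) - (q + inverse q) = h * (x + y - 1)"
    unfolding S by (simp add: algebra_simps)
  ultimately show ?thesis unfolding c by simp
qed

definition th :: "'v \<Rightarrow> (('v \<Rightarrow> scalar) \<Rightarrow> scalar) \<Rightarrow> ('v \<Rightarrow> scalar) \<Rightarrow> scalar" where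
  "th \<alpha> = avg (q + inverse q) (cc \<alpha>) (\<lambda>\<tau>. \<tau> \<circ> refl \<alpha>)"

definition Top :: "'v \<Rightarrow> (('v \<Rightarrow> scalar) \<Rightarrow> scalar) \<Rightarrow> ('v \<Rightarrow> scalar) \<Rightarrow> scalar" where
  "Top \<alpha> \<Phi> \<tau> = th \<alpha> \<Phi> \<tau> - inverse q * \<Phi> \<tau>"

lemma alt_Top_iff:
  assumes "\<alpha> \<in> R" "\<beta> \<in> R" "\<tau> \<in> regch" "m > 0"
  shows "alt (Top \<alpha>) (Top \<beta>) m \<Phi> \<tau> = alt (Top \<beta>) (Top \<alpha>) m \<Phi> \<tau> \<longleftrightarrow>
    kl (th \<alpha>) (th \<beta>) m \<Phi> \<tau> = kl (th \<beta>) (th \<alpha>) m \<Phi> \<tau>"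
proof -
  have *: "dihedral_ops regch (q + inverse q) (inverse q) (cc \<alpha>) (cc \<beta>) (\<lambda>\<tau>. \<tau> \<circ> refl \<alpha>) (\<lambda>\<tau>. \<tau> \<circ> refl \<beta>)"
    by unfold_locales
      (use assms in \<open>simp_all add: regch_refl comp_assoc cc_refl refl_self cc_neg distrib_left\<close>)
  interpret dihedral_ops regch "q + inverse q" "inverse q" "cc \<alpha>" "cc \<beta>" "\<lambda>\<tau>. \<tau> \<circ> refl \<alpha>" "\<lambda>\<tau>. \<tau> \<circ> refl \<beta>"
    by (rule *)
  have "TA = Top \<alpha>" "TB = Top \<beta>"
    by (simp_all add: fun_eq_iff TA_def TB_def Top_def th_def)
  moreover obtain k where "m = Suc k" using assms(4) gr0_conv_Suc by auto
  ultimately show ?thesis using braid_iff_kl[OF assms(3), of k \<Phi>] by (simp only: th_def)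
qed

section \<open>Braid relations in rank two\<close>

definition cmb :: "'v \<Rightarrow> 'v \<Rightarrow> real \<Rightarrow> real \<Rightarrow> 'v" where "cmb \<alpha> \<beta> x y = x *\<^sub>R \<alpha> + y *\<^sub>R \<beta>"

text \<open>Proportional roots differ at most by a sign, so two roots that are neither equal nor
  opposite are independent.\<close>

lemma cmb_eq_iff:
  assumes "\<alpha> \<in> R" "\<beta> \<in> R" "\<alpha> \<noteq> \<beta>" "\<alpha> \<noteq> - \<beta>"
  shows "cmb \<alpha> \<beta> x y = cmb \<alpha> \<beta> x' y' \<longleftrightarrow> x = x' \<and> y = y'"
proof
  assume "cmb \<alpha> \<beta> x y = cmb \<alpha> \<beta> x' y'"
  then have e: "(y - y') *\<^sub>R \<beta> = (x' - x) *\<^sub>R \<alpha>" by (simp add: cmb_def algebra_simps)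
  show "x = x' \<and> y = y'"
  proof (cases "y = y'")
    case True then show ?thesis using e root_nz assms by simp
  next
    case False
    have "\<beta> = inverse (y - y') *\<^sub>R ((y - y') *\<^sub>R \<beta>)" using False by simp
    then have "\<beta> = ((x' - x) / (y - y')) *\<^sub>R \<alpha>" unfolding e by (simp add: divide_inverse mult.commute)
    then show ?thesis using reduced[OF assms(1), of "(x' - x) / (y - y')"] assms by auto
  qed
qed simp

lemma scaleR_double: "(x * 2) *\<^sub>R v = x *\<^sub>R v + x *\<^sub>R (v::'v)"
  by (simp only: mult_2_right scaleR_left.add)

text \<open>The non-orthogonal configurations, with \<beta> at least as long as \<alpha>: k is the
  ratio of the squared lengths, equal to 1, 2, 3 for A2, B2, G2.\<close>

context
  fixes \<alpha> \<beta> :: 'v and k :: real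
  assumes ab: "\<alpha> \<in> R" "\<beta> \<in> R" and pairs: "pair \<beta> \<alpha> = - k" "pair \<alpha> \<beta> = - 1" and ne: "\<alpha> \<noteq> \<beta>" "\<alpha> \<noteq> - \<beta>"
begin

lemma refl_cmb:
  "refl \<alpha> (cmb \<alpha> \<beta> x y) = cmb \<alpha> \<beta> (k * y - x) y" "refl \<beta> (cmb \<alpha> \<beta> x y) = cmb \<alpha> \<beta> x (x - y)"
  "refl \<alpha> \<alpha> = cmb \<alpha> \<beta> (- 1) 0" "refl \<alpha> \<beta> = cmb \<alpha> \<beta> k 1" "refl \<beta> \<alpha> = cmb \<alpha> \<beta> 1 1" "refl \<beta> \<beta> = cmb \<alpha> \<beta> 0 (- 1)"
  using ab by (simp_all add: cmb_def refl_pair pair_simps pairs pair_self algebra_simps scaleR_double scaleR_2)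

lemma cmb_unit: "cmb \<alpha> \<beta> 1 0 = \<alpha>" "cmb \<alpha> \<beta> 0 1 = \<beta>" "cmb \<alpha> \<beta> (- 1) 0 = - \<alpha>" "cmb \<alpha> \<beta> 0 (- 1) = - \<beta>"
  by (simp_all add: cmb_def)

lemma cmb_neg: "- cmb \<alpha> \<beta> x y = cmb \<alpha> \<beta> (- x) (- y)"
  by (simp add: cmb_def)

text \<open>On an arbitrary vector only the displacement in the plane of \<alpha> and \<beta>
  changes, so equality of two words on the whole space becomes a computation with two
  coordinates.\<close>

lemma refl_add_cmb:
  "refl \<alpha> (x + cmb \<alpha> \<beta> a b) = x + cmb \<alpha> \<beta> (k * b - a - pair x \<alpha>) b"
  "refl \<beta> (x + cmb \<alpha> \<beta> a b) = x + cmb \<alpha> \<beta> a (a - b - pair x \<beta>)"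
  using ab by (simp_all add: cmb_def refl_pair pair_simps pairs pair_self algebra_simps scaleR_double scaleR_2)

lemma cmb_roots: "cmb \<alpha> \<beta> 1 0 \<in> R" "cmb \<alpha> \<beta> 0 1 \<in> R" "cmb \<alpha> \<beta> k 1 \<in> R" "cmb \<alpha> \<beta> 1 1 \<in> R"
  "cmb \<alpha> \<beta> (k - 1) 1 \<in> R" "cmb \<alpha> \<beta> k (k - 1) \<in> R"
  using ab refl_closed[of \<alpha> \<beta>] refl_closed[of \<beta> \<alpha>] refl_closed[of \<alpha> "refl \<beta> \<alpha>"] refl_closed[of \<beta> "refl \<alpha> \<beta>"]
  by (simp_all add: cmb_unit refl_cmb)

lemma alternating_cmb_3: "k = 1 \<Longrightarrow> refl_word (alternating 3 \<alpha> \<beta>) = refl_word (alternating 3 \<beta> \<alpha>)"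
  and alternating_cmb_4: "k = 2 \<Longrightarrow> refl_word (alternating 4 \<alpha> \<beta>) = refl_word (alternating 4 \<beta> \<alpha>)"
  and alternating_cmb_6: "k = 3 \<Longrightarrow> refl_word (alternating 6 \<alpha> \<beta>) = refl_word (alternating 6 \<beta> \<alpha>)"
proof -
  have 0: "x = x + cmb \<alpha> \<beta> 0 0" for x by (simp add: cmb_def)
  note ev = eval_nat_numeral refl_add_cmb algebra_simps
  show "refl_word (alternating 3 \<alpha> \<beta>) = refl_word (alternating 3 \<beta> \<alpha>)" if "k = 1"
    by (rule ext, subst (1 2) 0) (simp add: ev that)
  show "refl_word (alternating 4 \<alpha> \<beta>) = refl_word (alternating 4 \<beta> \<alpha>)" if "k = 2"
    by (rule ext, subst (1 2) 0) (simp add: ev that)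
  show "refl_word (alternating 6 \<alpha> \<beta>) = refl_word (alternating 6 \<beta> \<alpha>)" if "k = 3"
    by (rule ext, subst (1 2) 0) (simp add: ev that)
qed

text \<open>It suffices to test at \<alpha>, which the smaller powers of the rotation move.\<close>

lemma funpow_ne:
  "k = 1 \<Longrightarrow> 0 < j \<Longrightarrow> j < 3 \<Longrightarrow> (refl \<alpha> \<circ> refl \<beta>) ^^ j \<noteq> id"
  "k = 2 \<Longrightarrow> 0 < j \<Longrightarrow> j < 4 \<Longrightarrow> (refl \<alpha> \<circ> refl \<beta>) ^^ j \<noteq> id"
  "k = 3 \<Longrightarrow> 0 < j \<Longrightarrow> j < 6 \<Longrightarrow> (refl \<alpha> \<circ> refl \<beta>) ^^ j \<noteq> id"
proof -
  have ev: "(refl \<alpha> \<circ> refl \<beta>) ^^ j \<noteq> id" if "((refl \<alpha> \<circ> refl \<beta>) ^^ j) (cmb \<alpha> \<beta> 1 0) \<noteq> cmb \<alpha> \<beta> 1 0" for j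
    using that by auto
  have cs3: "0 < j \<Longrightarrow> j < 3 \<Longrightarrow> j = 1 \<or> j = Suc 1"
    and cs4: "0 < j \<Longrightarrow> j < 4 \<Longrightarrow> j = 1 \<or> j = Suc 1 \<or> j = Suc (Suc 1)"
    and cs6: "0 < j \<Longrightarrow> j < 6 \<Longrightarrow> j = 1 \<or> j = Suc 1 \<or> j = Suc (Suc 1) \<or> j = Suc (Suc (Suc 1)) \<or> j = Suc (Suc (Suc (Suc 1)))"
    for j :: nat by auto
  note eqi = cmb_eq_iff[OF ab ne]
  show "k = 1 \<Longrightarrow> 0 < j \<Longrightarrow> j < 3 \<Longrightarrow> (refl \<alpha> \<circ> refl \<beta>) ^^ j \<noteq> id"
    by (rule ev, drule (1) cs3) (auto simp: refl_cmb eqi)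
  show "k = 2 \<Longrightarrow> 0 < j \<Longrightarrow> j < 4 \<Longrightarrow> (refl \<alpha> \<circ> refl \<beta>) ^^ j \<noteq> id"
    by (rule ev, drule (1) cs4) (auto simp: refl_cmb eqi)
  show "k = 3 \<Longrightarrow> 0 < j \<Longrightarrow> j < 6 \<Longrightarrow> (refl \<alpha> \<circ> refl \<beta>) ^^ j \<noteq> id"
    by (rule ev, drule (1) cs6) (auto simp: refl_cmb eqi)
qed

lemma coxI:
  assumes "m > 0" "refl_word (alternating m \<alpha> \<beta>) = refl_word (alternating m \<beta> \<alpha>)"
    "\<And>j. 0 < j \<Longrightarrow> j < m \<Longrightarrow> (refl \<alpha> \<circ> refl \<beta>) ^^ j \<noteq> id"
  shows "cox \<alpha> \<beta> = m"
  unfolding cox_def using assms alternating_eq_iff[OF ab]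
  by (intro Least_equality) (auto simp: not_less[symmetric])

lemma cox_cmb: "k = 1 \<Longrightarrow> cox \<alpha> \<beta> = 3" "k = 2 \<Longrightarrow> cox \<alpha> \<beta> = 4" "k = 3 \<Longrightarrow> cox \<alpha> \<beta> = 6"
  by (rule coxI; (simp add: alternating_cmb_3 alternating_cmb_4 alternating_cmb_6 funpow_ne))+

context
  fixes \<tau> assumes \<tau>: "\<tau> \<in> regch"
begin

lemma cc_unit: "cc \<alpha> \<tau> = cc (cmb \<alpha> \<beta> 1 0) \<tau>" "cc \<beta> \<tau> = cc (cmb \<alpha> \<beta> 0 1) \<tau>"
  by (simp_all add: cmb_unit)

lemma cc_cmb_neg:
  "cmb \<alpha> \<beta> x y \<in> R \<Longrightarrow> cc (cmb \<alpha> \<beta> (- x) (- y)) \<tau> = q + inverse q - cc (cmb \<alpha> \<beta> x y) \<tau>"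
  using cc_neg[OF \<tau>, of "cmb \<alpha> \<beta> x y"] by (simp add: cmb_neg)

lemma cc_cmb_rel:
  assumes "cmb \<alpha> \<beta> x y \<in> R" "cmb \<alpha> \<beta> x' y' \<in> R" "cmb \<alpha> \<beta> z w \<in> R" "z = x + x'" "w = y + y'"
  shows "cc (cmb \<alpha> \<beta> x y) \<tau> * cc (cmb \<alpha> \<beta> x' y') \<tau>
    = cc (cmb \<alpha> \<beta> z w) \<tau> * (cc (cmb \<alpha> \<beta> x y) \<tau> + cc (cmb \<alpha> \<beta> x' y') \<tau> - (q + inverse q)) + 1"
proof -
  have "cmb \<alpha> \<beta> z w = cmb \<alpha> \<beta> x y + cmb \<alpha> \<beta> x' y'" using assms by (simp add: cmb_def algebra_simps)
  then show ?thesis using cc_rel[OF \<tau>] assms by metis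
qed

text \<open>Both sides are given by \<open>kl_chain_3\<close>. The second gallery of one expansion
  is the first gallery of the other, the order of the positive roots is reversed, and
  \<open>tm\<close> identifies the opposite chambers.\<close>

lemma kl_braid_3:
  assumes k: "k = 1" shows "kl (th \<alpha>) (th \<beta>) 3 \<Phi> \<tau> = kl (th \<beta>) (th \<alpha>) 3 \<Phi> \<tau>"
proof -
  note roots = cmb_roots[unfolded k, simplified]
  have rels: "cc (cmb \<alpha> \<beta> 1 0) \<tau> * cc (cmb \<alpha> \<beta> 0 1) \<tau>
      = cc (cmb \<alpha> \<beta> 1 1) \<tau> * (cc (cmb \<alpha> \<beta> 1 0) \<tau> + cc (cmb \<alpha> \<beta> 0 1) \<tau> - (q + inverse q)) + 1"
    "cc (cmb \<alpha> \<beta> 0 1) \<tau> * cc (cmb \<alpha> \<beta> 1 0) \<tau>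
      = cc (cmb \<alpha> \<beta> 1 1) \<tau> * (cc (cmb \<alpha> \<beta> 0 1) \<tau> + cc (cmb \<alpha> \<beta> 1 0) \<tau> - (q + inverse q)) + 1"
    by (rule cc_cmb_rel; simp add: roots)+
  have negs: "cc (cmb \<alpha> \<beta> (- 1) 0) \<tau> = q + inverse q - cc (cmb \<alpha> \<beta> 1 0) \<tau>"
    "cc (cmb \<alpha> \<beta> (- 1) (- 1)) \<tau> = q + inverse q - cc (cmb \<alpha> \<beta> 1 1) \<tau>"
    "cc (cmb \<alpha> \<beta> 0 (- 1)) \<tau> = q + inverse q - cc (cmb \<alpha> \<beta> 0 1) \<tau>"
    using cc_cmb_neg[of 1 0] cc_cmb_neg[of 1 1] cc_cmb_neg[of 0 1]
    by (simp_all add: roots)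
  have tm: "\<tau> \<circ> refl \<alpha> \<circ> refl \<beta> \<circ> refl \<alpha> = \<tau> \<circ> refl \<beta> \<circ> refl \<alpha> \<circ> refl \<beta>"
    using arg_cong[OF alternating_cmb_3[OF k], of "\<lambda>f. \<tau> \<circ> f"] by (simp add: comp_assoc eval_nat_numeral)
  note L = kl_chain_3[where S = "q + inverse q" and cA = "cc \<alpha>" and cB = "cc \<beta>"
    and sA = "\<lambda>\<tau>. \<tau> \<circ> refl \<alpha>" and sB = "\<lambda>\<tau>. \<tau> \<circ> refl \<beta>" and \<Phi> = \<Phi>
    and ?a0.0 = "cc (cmb \<alpha> \<beta> 1 0) \<tau>" and ?a1.0 = "cc (cmb \<alpha> \<beta> 1 1) \<tau>"
      and ?a2.0 = "cc (cmb \<alpha> \<beta> 0 1) \<tau>" and ?t0.0 = "\<tau>" and ?t1.0 = "\<tau> \<circ> refl \<alpha>"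
      and ?t2.0 = "\<tau> \<circ> refl \<alpha> \<circ> refl \<beta>"
      and ?t3.0 = "\<tau> \<circ> refl \<alpha> \<circ> refl \<beta> \<circ> refl \<alpha>"
      and ?u1.0 = "\<tau> \<circ> refl \<beta>" and ?u2.0 = "\<tau> \<circ> refl \<beta> \<circ> refl \<alpha>"]
  note R = kl_chain_3[where S = "q + inverse q" and cA = "cc \<beta>" and cB = "cc \<alpha>"
    and sA = "\<lambda>\<tau>. \<tau> \<circ> refl \<beta>" and sB = "\<lambda>\<tau>. \<tau> \<circ> refl \<alpha>" and \<Phi> = \<Phi>
    and ?a0.0 = "cc (cmb \<alpha> \<beta> 0 1) \<tau>" and ?a1.0 = "cc (cmb \<alpha> \<beta> 1 1) \<tau>"
      and ?a2.0 = "cc (cmb \<alpha> \<beta> 1 0) \<tau>" and ?t0.0 = "\<tau>" and ?t1.0 = "\<tau> \<circ> refl \<beta>"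
      and ?t2.0 = "\<tau> \<circ> refl \<beta> \<circ> refl \<alpha>"
      and ?t3.0 = "\<tau> \<circ> refl \<beta> \<circ> refl \<alpha> \<circ> refl \<beta>"
      and ?u1.0 = "\<tau> \<circ> refl \<alpha>" and ?u2.0 = "\<tau> \<circ> refl \<alpha> \<circ> refl \<beta>"]
  show ?thesis unfolding th_def
    \<comment> \<open>The alternatives settle, in this order, the equality of the two expansions,
      the three-root relations, the moves between chambers and the coefficients.\<close>
    by (rule trans[OF L trans[OF _ R[symmetric]]];
      (simp only: tm mult_ac add_ac; fail | simp only: rels simp_thms; fail
        | simp add: comp_assoc ab; fail | simp add: cc_refl refl_cmb cc_unit k negs; fail))
qed

lemma kl_braid_4:
  assumes k: "k = 2" shows "kl (th \<alpha>) (th \<beta>) 4 \<Phi> \<tau> = kl (th \<beta>) (th \<alpha>) 4 \<Phi> \<tau>"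
proof -
  note roots = cmb_roots[unfolded k, simplified]
  have rels: "cc (cmb \<alpha> \<beta> 1 0) \<tau> * cc (cmb \<alpha> \<beta> 1 1) \<tau>
      = cc (cmb \<alpha> \<beta> 2 1) \<tau> * (cc (cmb \<alpha> \<beta> 1 0) \<tau> + cc (cmb \<alpha> \<beta> 1 1) \<tau> - (q + inverse q)) + 1"
    "cc (cmb \<alpha> \<beta> 1 0) \<tau> * cc (cmb \<alpha> \<beta> 0 1) \<tau>
      = cc (cmb \<alpha> \<beta> 1 1) \<tau> * (cc (cmb \<alpha> \<beta> 1 0) \<tau> + cc (cmb \<alpha> \<beta> 0 1) \<tau> - (q + inverse q)) + 1"
    "cc (cmb \<alpha> \<beta> 0 1) \<tau> * cc (cmb \<alpha> \<beta> 1 0) \<tau>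
      = cc (cmb \<alpha> \<beta> 1 1) \<tau> * (cc (cmb \<alpha> \<beta> 0 1) \<tau> + cc (cmb \<alpha> \<beta> 1 0) \<tau> - (q + inverse q)) + 1"
    "cc (cmb \<alpha> \<beta> 1 1) \<tau> * cc (cmb \<alpha> \<beta> 1 0) \<tau>
      = cc (cmb \<alpha> \<beta> 2 1) \<tau> * (cc (cmb \<alpha> \<beta> 1 1) \<tau> + cc (cmb \<alpha> \<beta> 1 0) \<tau> - (q + inverse q)) + 1"
    by (rule cc_cmb_rel; simp add: roots)+
  have negs: "cc (cmb \<alpha> \<beta> (- 1) 0) \<tau> = q + inverse q - cc (cmb \<alpha> \<beta> 1 0) \<tau>"
    "cc (cmb \<alpha> \<beta> (- 2) (- 1)) \<tau> = q + inverse q - cc (cmb \<alpha> \<beta> 2 1) \<tau>"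
    "cc (cmb \<alpha> \<beta> (- 1) (- 1)) \<tau> = q + inverse q - cc (cmb \<alpha> \<beta> 1 1) \<tau>"
    "cc (cmb \<alpha> \<beta> 0 (- 1)) \<tau> = q + inverse q - cc (cmb \<alpha> \<beta> 0 1) \<tau>"
    using cc_cmb_neg[of 1 0] cc_cmb_neg[of 2 1] cc_cmb_neg[of 1 1] cc_cmb_neg[of 0 1]
    by (simp_all add: roots)
  have tm: "\<tau> \<circ> refl \<alpha> \<circ> refl \<beta> \<circ> refl \<alpha> \<circ> refl \<beta> = \<tau> \<circ> refl \<beta> \<circ> refl \<alpha> \<circ> refl \<beta> \<circ> refl \<alpha>"
    using arg_cong[OF alternating_cmb_4[OF k], of "\<lambda>f. \<tau> \<circ> f"] by (simp add: comp_assoc eval_nat_numeral)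
  note L = kl_chain_4[where S = "q + inverse q" and cA = "cc \<alpha>" and cB = "cc \<beta>"
    and sA = "\<lambda>\<tau>. \<tau> \<circ> refl \<alpha>" and sB = "\<lambda>\<tau>. \<tau> \<circ> refl \<beta>" and \<Phi> = \<Phi>
    and ?a0.0 = "cc (cmb \<alpha> \<beta> 1 0) \<tau>" and ?a1.0 = "cc (cmb \<alpha> \<beta> 2 1) \<tau>"
      and ?a2.0 = "cc (cmb \<alpha> \<beta> 1 1) \<tau>" and ?a3.0 = "cc (cmb \<alpha> \<beta> 0 1) \<tau>" and ?t0.0 = "\<tau>"
      and ?t1.0 = "\<tau> \<circ> refl \<alpha>" and ?t2.0 = "\<tau> \<circ> refl \<alpha> \<circ> refl \<beta>"
      and ?t3.0 = "\<tau> \<circ> refl \<alpha> \<circ> refl \<beta> \<circ> refl \<alpha>"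
      and ?t4.0 = "\<tau> \<circ> refl \<alpha> \<circ> refl \<beta> \<circ> refl \<alpha> \<circ> refl \<beta>"
      and ?u1.0 = "\<tau> \<circ> refl \<beta>" and ?u2.0 = "\<tau> \<circ> refl \<beta> \<circ> refl \<alpha>"
      and ?u3.0 = "\<tau> \<circ> refl \<beta> \<circ> refl \<alpha> \<circ> refl \<beta>"]
  note R = kl_chain_4[where S = "q + inverse q" and cA = "cc \<beta>" and cB = "cc \<alpha>"
    and sA = "\<lambda>\<tau>. \<tau> \<circ> refl \<beta>" and sB = "\<lambda>\<tau>. \<tau> \<circ> refl \<alpha>" and \<Phi> = \<Phi>
    and ?a0.0 = "cc (cmb \<alpha> \<beta> 0 1) \<tau>" and ?a1.0 = "cc (cmb \<alpha> \<beta> 1 1) \<tau>"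
      and ?a2.0 = "cc (cmb \<alpha> \<beta> 2 1) \<tau>" and ?a3.0 = "cc (cmb \<alpha> \<beta> 1 0) \<tau>" and ?t0.0 = "\<tau>"
      and ?t1.0 = "\<tau> \<circ> refl \<beta>" and ?t2.0 = "\<tau> \<circ> refl \<beta> \<circ> refl \<alpha>"
      and ?t3.0 = "\<tau> \<circ> refl \<beta> \<circ> refl \<alpha> \<circ> refl \<beta>"
      and ?t4.0 = "\<tau> \<circ> refl \<beta> \<circ> refl \<alpha> \<circ> refl \<beta> \<circ> refl \<alpha>"
      and ?u1.0 = "\<tau> \<circ> refl \<alpha>" and ?u2.0 = "\<tau> \<circ> refl \<alpha> \<circ> refl \<beta>"
      and ?u3.0 = "\<tau> \<circ> refl \<alpha> \<circ> refl \<beta> \<circ> refl \<alpha>"]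
  show ?thesis unfolding th_def
    by (rule trans[OF L trans[OF _ R[symmetric]]];
      (simp only: tm mult_ac add_ac; fail | simp only: rels simp_thms; fail
        | simp add: comp_assoc ab; fail | simp add: cc_refl refl_cmb cc_unit k negs; fail))
qed

lemma kl_braid_6:
  assumes k: "k = 3" shows "kl (th \<alpha>) (th \<beta>) 6 \<Phi> \<tau> = kl (th \<beta>) (th \<alpha>) 6 \<Phi> \<tau>"
proof -
  note roots = cmb_roots[unfolded k, simplified]
  have rels: "cc (cmb \<alpha> \<beta> 1 0) \<tau> * cc (cmb \<alpha> \<beta> 2 1) \<tau>
      = cc (cmb \<alpha> \<beta> 3 1) \<tau> * (cc (cmb \<alpha> \<beta> 1 0) \<tau> + cc (cmb \<alpha> \<beta> 2 1) \<tau> - (q + inverse q)) + 1"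
    "cc (cmb \<alpha> \<beta> 2 1) \<tau> * cc (cmb \<alpha> \<beta> 1 1) \<tau>
      = cc (cmb \<alpha> \<beta> 3 2) \<tau> * (cc (cmb \<alpha> \<beta> 2 1) \<tau> + cc (cmb \<alpha> \<beta> 1 1) \<tau> - (q + inverse q)) + 1"
    "cc (cmb \<alpha> \<beta> 1 0) \<tau> * cc (cmb \<alpha> \<beta> 1 1) \<tau>
      = cc (cmb \<alpha> \<beta> 2 1) \<tau> * (cc (cmb \<alpha> \<beta> 1 0) \<tau> + cc (cmb \<alpha> \<beta> 1 1) \<tau> - (q + inverse q)) + 1"
    "cc (cmb \<alpha> \<beta> 3 1) \<tau> * cc (cmb \<alpha> \<beta> 0 1) \<tau>
      = cc (cmb \<alpha> \<beta> 3 2) \<tau> * (cc (cmb \<alpha> \<beta> 3 1) \<tau> + cc (cmb \<alpha> \<beta> 0 1) \<tau> - (q + inverse q)) + 1"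
    "cc (cmb \<alpha> \<beta> 1 0) \<tau> * cc (cmb \<alpha> \<beta> 0 1) \<tau>
      = cc (cmb \<alpha> \<beta> 1 1) \<tau> * (cc (cmb \<alpha> \<beta> 1 0) \<tau> + cc (cmb \<alpha> \<beta> 0 1) \<tau> - (q + inverse q)) + 1"
    by (rule cc_cmb_rel; simp add: roots)+
  have negs: "cc (cmb \<alpha> \<beta> (- 1) 0) \<tau> = q + inverse q - cc (cmb \<alpha> \<beta> 1 0) \<tau>"
    "cc (cmb \<alpha> \<beta> (- 3) (- 1)) \<tau> = q + inverse q - cc (cmb \<alpha> \<beta> 3 1) \<tau>"
    "cc (cmb \<alpha> \<beta> (- 2) (- 1)) \<tau> = q + inverse q - cc (cmb \<alpha> \<beta> 2 1) \<tau>"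
    "cc (cmb \<alpha> \<beta> (- 3) (- 2)) \<tau> = q + inverse q - cc (cmb \<alpha> \<beta> 3 2) \<tau>"
    "cc (cmb \<alpha> \<beta> (- 1) (- 1)) \<tau> = q + inverse q - cc (cmb \<alpha> \<beta> 1 1) \<tau>"
    "cc (cmb \<alpha> \<beta> 0 (- 1)) \<tau> = q + inverse q - cc (cmb \<alpha> \<beta> 0 1) \<tau>"
    using cc_cmb_neg[of 1 0] cc_cmb_neg[of 3 1] cc_cmb_neg[of 2 1] cc_cmb_neg[of 3 2] cc_cmb_neg[of 1 1] cc_cmb_neg[of 0 1]
    by (simp_all add: roots)
  have tm: "\<tau> \<circ> refl \<alpha> \<circ> refl \<beta> \<circ> refl \<alpha> \<circ> refl \<beta> \<circ> refl \<alpha> \<circ> refl \<beta> = \<tau> \<circ> refl \<beta> \<circ> refl \<alpha> \<circ> refl \<beta> \<circ> refl \<alpha> \<circ> refl \<beta> \<circ> refl \<alpha>"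
    using arg_cong[OF alternating_cmb_6[OF k], of "\<lambda>f. \<tau> \<circ> f"] by (simp add: comp_assoc eval_nat_numeral)
  note L = kl_chain_6[where S = "q + inverse q" and cA = "cc \<alpha>" and cB = "cc \<beta>"
    and sA = "\<lambda>\<tau>. \<tau> \<circ> refl \<alpha>" and sB = "\<lambda>\<tau>. \<tau> \<circ> refl \<beta>" and \<Phi> = \<Phi>
    and ?a0.0 = "cc (cmb \<alpha> \<beta> 1 0) \<tau>" and ?a1.0 = "cc (cmb \<alpha> \<beta> 3 1) \<tau>"
      and ?a2.0 = "cc (cmb \<alpha> \<beta> 2 1) \<tau>" and ?a3.0 = "cc (cmb \<alpha> \<beta> 3 2) \<tau>"
      and ?a4.0 = "cc (cmb \<alpha> \<beta> 1 1) \<tau>" and ?a5.0 = "cc (cmb \<alpha> \<beta> 0 1) \<tau>" and ?t0.0 = "\<tau>"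
      and ?t1.0 = "\<tau> \<circ> refl \<alpha>" and ?t2.0 = "\<tau> \<circ> refl \<alpha> \<circ> refl \<beta>"
      and ?t3.0 = "\<tau> \<circ> refl \<alpha> \<circ> refl \<beta> \<circ> refl \<alpha>"
      and ?t4.0 = "\<tau> \<circ> refl \<alpha> \<circ> refl \<beta> \<circ> refl \<alpha> \<circ> refl \<beta>"
      and ?t5.0 = "\<tau> \<circ> refl \<alpha> \<circ> refl \<beta> \<circ> refl \<alpha> \<circ> refl \<beta> \<circ> refl \<alpha>"
      and ?t6.0 = "\<tau> \<circ> refl \<alpha> \<circ> refl \<beta> \<circ> refl \<alpha> \<circ> refl \<beta> \<circ> refl \<alpha> \<circ> refl \<beta>"
      and ?u1.0 = "\<tau> \<circ> refl \<beta>" and ?u2.0 = "\<tau> \<circ> refl \<beta> \<circ> refl \<alpha>"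
      and ?u3.0 = "\<tau> \<circ> refl \<beta> \<circ> refl \<alpha> \<circ> refl \<beta>"
      and ?u4.0 = "\<tau> \<circ> refl \<beta> \<circ> refl \<alpha> \<circ> refl \<beta> \<circ> refl \<alpha>"
      and ?u5.0 = "\<tau> \<circ> refl \<beta> \<circ> refl \<alpha> \<circ> refl \<beta> \<circ> refl \<alpha> \<circ> refl \<beta>"]
  note R = kl_chain_6[where S = "q + inverse q" and cA = "cc \<beta>" and cB = "cc \<alpha>"
    and sA = "\<lambda>\<tau>. \<tau> \<circ> refl \<beta>" and sB = "\<lambda>\<tau>. \<tau> \<circ> refl \<alpha>" and \<Phi> = \<Phi>
    and ?a0.0 = "cc (cmb \<alpha> \<beta> 0 1) \<tau>" and ?a1.0 = "cc (cmb \<alpha> \<beta> 1 1) \<tau>"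
      and ?a2.0 = "cc (cmb \<alpha> \<beta> 3 2) \<tau>" and ?a3.0 = "cc (cmb \<alpha> \<beta> 2 1) \<tau>"
      and ?a4.0 = "cc (cmb \<alpha> \<beta> 3 1) \<tau>" and ?a5.0 = "cc (cmb \<alpha> \<beta> 1 0) \<tau>" and ?t0.0 = "\<tau>"
      and ?t1.0 = "\<tau> \<circ> refl \<beta>" and ?t2.0 = "\<tau> \<circ> refl \<beta> \<circ> refl \<alpha>"
      and ?t3.0 = "\<tau> \<circ> refl \<beta> \<circ> refl \<alpha> \<circ> refl \<beta>"
      and ?t4.0 = "\<tau> \<circ> refl \<beta> \<circ> refl \<alpha> \<circ> refl \<beta> \<circ> refl \<alpha>"
      and ?t5.0 = "\<tau> \<circ> refl \<beta> \<circ> refl \<alpha> \<circ> refl \<beta> \<circ> refl \<alpha> \<circ> refl \<beta>"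
      and ?t6.0 = "\<tau> \<circ> refl \<beta> \<circ> refl \<alpha> \<circ> refl \<beta> \<circ> refl \<alpha> \<circ> refl \<beta> \<circ> refl \<alpha>"
      and ?u1.0 = "\<tau> \<circ> refl \<alpha>" and ?u2.0 = "\<tau> \<circ> refl \<alpha> \<circ> refl \<beta>"
      and ?u3.0 = "\<tau> \<circ> refl \<alpha> \<circ> refl \<beta> \<circ> refl \<alpha>"
      and ?u4.0 = "\<tau> \<circ> refl \<alpha> \<circ> refl \<beta> \<circ> refl \<alpha> \<circ> refl \<beta>"
      and ?u5.0 = "\<tau> \<circ> refl \<alpha> \<circ> refl \<beta> \<circ> refl \<alpha> \<circ> refl \<beta> \<circ> refl \<alpha>"]
  show ?thesis unfolding th_def
    by (rule trans[OF L trans[OF _ R[symmetric]]];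
      (simp only: tm mult_ac add_ac; fail | simp only: rels simp_thms; fail
        | simp add: comp_assoc ab; fail | simp add: cc_refl refl_cmb cc_unit k negs; fail))
qed
end

end

lemma kl_braid_comm:
  assumes "\<alpha> \<in> R" "\<beta> \<in> R" "pair \<beta> \<alpha> = 0" "pair \<alpha> \<beta> = 0"
  shows "kl (th \<alpha>) (th \<beta>) 2 \<Phi> \<tau> = kl (th \<beta>) (th \<alpha>) 2 \<Phi> \<tau>"
proof -
  have r: "refl \<alpha> \<beta> = \<beta>" "refl \<beta> \<alpha> = \<alpha>" using assms by (simp_all add: refl_pair)
  have c: "\<tau> \<circ> refl \<alpha> \<circ> refl \<beta> = \<tau> \<circ> refl \<beta> \<circ> refl \<alpha>"
    by (rule ext) (simp add: refl_pair pair_simps assms algebra_simps)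
  show ?thesis by (simp add: eval_nat_numeral th_def avg_def cc_refl r c algebra_simps)
qed

lemma cox_comm:
  assumes "\<alpha> \<in> R" "\<beta> \<in> R" "pair \<beta> \<alpha> = 0" "pair \<alpha> \<beta> = 0"
  shows "cox \<alpha> \<beta> = 2"
  unfolding cox_def
proof (rule Least_equality)
  have "((refl \<alpha> \<circ> refl \<beta>) ^^ 2) x = x" for x
    using assms by (simp add: eval_nat_numeral refl_pair pair_simps pair_self algebra_simps)
  then show "0 < (2::nat) \<and> (refl \<alpha> \<circ> refl \<beta>) ^^ 2 = id" by auto
  fix j :: nat assume j: "0 < j \<and> (refl \<alpha> \<circ> refl \<beta>) ^^ j = id"
  show "2 \<le> j"
  proof (rule ccontr)
    assume "\<not> ?thesis"
    then have "j = 1" using j by auto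
    then have "(refl \<alpha> \<circ> refl \<beta>) \<alpha> = \<alpha>" using j by simp
    then have "- \<alpha> = \<alpha>" using assms by (simp add: refl_pair[of \<beta>] refl_self)
    then have "2 *\<^sub>R \<alpha> = 0" by (metis add.right_inverse scaleR_2)
    then show False using root_nz[OF assms(1)] by simp
  qed
qed

lemma cox_sym: assumes "\<alpha> \<in> R" "\<beta> \<in> R" shows "cox \<alpha> \<beta> = cox \<beta> \<alpha>"
  unfolding cox_def alternating_eq_iff[OF assms, symmetric] alternating_eq_iff[OF assms(2,1), symmetric]
  by (simp only: eq_commute)

text \<open>The two pairings are nonpositive integers with product below 4 that vanish together.
  Hence both are 0, or after exchanging the roots one is -1 and the other -1, -2 or -3; each case is
  one rank-two computation.\<close>

lemma Top_braid:
  assumes S: "\<alpha> \<in> simple_roots" "\<beta> \<in> simple_roots" "\<alpha> \<noteq> \<beta>" and \<tau>: "\<tau> \<in> regch"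
  shows "alt (Top \<alpha>) (Top \<beta>) (cox \<alpha> \<beta>) \<Phi> \<tau> = alt (Top \<beta>) (Top \<alpha>) (cox \<alpha> \<beta>) \<Phi> \<tau>"
proof -
  have R: "\<alpha> \<in> R" "\<beta> \<in> R" using S simple_R by auto
  have ne: "\<alpha> \<noteq> - \<beta>" using S simple_Rp Rp_neg by fastforce
  have ne': "\<beta> \<noteq> - \<alpha>" using ne by auto
  obtain i j :: int where ij: "pair \<alpha> \<beta> = of_int i" "pair \<beta> \<alpha> = of_int j"
    using pair_Ints R by (meson Ints_cases)
  have le: "i \<le> 0" "j \<le> 0" using simple_obtuse[OF S(1,2)] simple_obtuse[OF S(2,1)] S(3) ij by auto
  have "real_of_int (i * j) < 4" using pair_prod(2)[OF R] S(3) ne' ij by auto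
  then have lt: "i * j < 4" by linarith
  have z: "i = 0 \<longleftrightarrow> j = 0"
    using ip_pair[OF R(1), of \<beta>] ip_pair[OF R(2), of \<alpha>] ij ip_pos[OF root_nz[OF R(1)]] ip_pos[OF root_nz[OF R(2)]]
    by (auto simp: ip_sym[of \<beta> \<alpha>])
  have short: "alt (Top \<alpha>) (Top \<beta>) (cox \<alpha> \<beta>) \<Phi> \<tau> = alt (Top \<beta>) (Top \<alpha>) (cox \<alpha> \<beta>) \<Phi> \<tau>"
    if R: "\<alpha> \<in> R" "\<beta> \<in> R" "\<alpha> \<noteq> \<beta>" "\<alpha> \<noteq> - \<beta>" and p: "pair \<beta> \<alpha> = of_int j" "pair \<alpha> \<beta> = -1" and j: "j = -1 \<or> j = -2 \<or> j = -3"
    for \<alpha> \<beta> j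
  proof -
    have p': "pair \<beta> \<alpha> = - of_int (- j)" using p by simp
    note * = R(1,2) p' p(2) R(3,4)
    show ?thesis
      using j kl_braid_3[OF * \<tau>, of \<Phi>] kl_braid_4[OF * \<tau>, of \<Phi>] kl_braid_6[OF * \<tau>, of \<Phi>] cox_cmb[OF *]
      by (elim disjE) (simp_all add: alt_Top_iff[OF R(1,2) \<tau>])
  qed
  have "i = 0 \<and> j = 0 \<or> i = -1 \<and> (j = -1 \<or> j = -2 \<or> j = -3) \<or> j = -1 \<and> (i = -1 \<or> i = -2 \<or> i = -3)"
  proof (cases "i = 0 \<or> j = 0")
    case False
    define a b where "a = - i" and "b = - j"
    have ab: "a \<ge> 1" "b \<ge> 1" "a * b < 4" using False le lt by (auto simp: a_def b_def)
    have "a = 1 \<or> b = 1"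
    proof (rule ccontr)
      assume "\<not> ?thesis"
      then have "2 * 2 \<le> a * b" using ab by (intro mult_mono) auto
      then show False using ab by simp
    qed
    then have "a = 1 \<and> b < 4 \<or> b = 1 \<and> a < 4" using ab by auto
    then show ?thesis using ab unfolding a_def b_def by presburger
  qed (use z in auto)
  then consider "i = 0" "j = 0" | "i = -1" "j = -1 \<or> j = -2 \<or> j = -3" | "j = -1" "i = -1 \<or> i = -2 \<or> i = -3"
    by blast
  then show ?thesis
  proof cases
    case 1
    then show ?thesis using kl_braid_comm[OF R, of \<Phi> \<tau>] cox_comm[OF R] ij
      by (simp add: alt_Top_iff[OF R \<tau>])
  next
    case 2
    then show ?thesis using short[OF R S(3) ne ij(2)] ij by simp
  next
    case 3
    then show ?thesis using short[OF R(2,1) S(3)[symmetric] ne' ij(1)] ij cox_sym[OF R] by simp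
  qed
qed

end

section \<open>The group algebra of the weight lattice\<close>

lemma poly_mapping_sum_singles: "f = (\<Sum>k\<in>Poly_Mapping.keys f. Poly_Mapping.single k (Poly_Mapping.lookup f k))"
proof (rule poly_mapping_eqI)
  fix i
  have "(\<Sum>k\<in>Poly_Mapping.keys f. Poly_Mapping.lookup f k when k = i)
      = (\<Sum>k\<in>Poly_Mapping.keys f. if k = i then Poly_Mapping.lookup f k else 0)"
    by (simp add: when_def)
  then show "Poly_Mapping.lookup f i = Poly_Mapping.lookup (\<Sum>k\<in>Poly_Mapping.keys f. Poly_Mapping.single k (Poly_Mapping.lookup f k)) i"
    by (simp add: lookup_sum lookup_single in_keys_iff)
qed

lemma lookup_times_single:
  fixes f :: "'a::ab_group_add \<Rightarrow>\<^sub>0 'b::comm_ring_1"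
  shows "Poly_Mapping.lookup (f * Poly_Mapping.single a c) k = Poly_Mapping.lookup f (k - a) * c"
proof -
  have "Poly_Mapping.lookup (f * Poly_Mapping.single a c) k
      = (\<Sum>j\<in>Poly_Mapping.keys f. Poly_Mapping.lookup f j * c when j + a = k)"
    by (subst poly_mapping_sum_singles[of f]) (simp add: sum_distrib_right mult_single lookup_sum lookup_single)
  also have "\<dots> = (\<Sum>j\<in>Poly_Mapping.keys f. if j = k - a then Poly_Mapping.lookup f j * c else 0)"
    by (rule sum.cong) (auto simp: when_def)
  also have "\<dots> = Poly_Mapping.lookup f (k - a) * c"
    by (simp add: in_keys_iff)
  finally show ?thesis .
qed

lemma scalar_infinite: "infinite (UNIV :: scalar set)"
proof -
  have "inj (\<lambda>n::nat. Fract [:int n:] 1)" by (rule injI) (simp add: eq_fract)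
  then show ?thesis by (metis finite_imageD finite_subset infinite_UNIV_nat subset_UNIV)
qed

lemma finite_power_int_eq:
  fixes c :: scalar
  assumes "n \<noteq> 0" "c \<noteq> 0" shows "finite {t. t powi n = c}"
proof -
  have pos: "finite {t::scalar. t ^ m = d}" if "m > 0" for m d
  proof -
    have "coeff (monom 1 m - [:d:]) m \<noteq> 0" using that by (cases m) auto
    then have "monom 1 m - [:d:] \<noteq> 0" by (metis coeff_0)
    then have "finite {t. poly (monom 1 m - [:d:]) t = 0}" by (rule poly_roots_finite)
    then show ?thesis by (simp add: poly_monom)
  qed
  show ?thesis
  proof (cases "n > 0")
    case True
    then show ?thesis using pos[of "nat n" c] by (simp add: power_int_def)
  next
    case False
    then have "{t. t powi n = c} \<subseteq> {t. t ^ nat (- n) = inverse c}"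
      using assms by (auto simp: power_int_def power_inverse)
    then show ?thesis using pos[of "nat (- n)" "inverse c"] False assms finite_subset by fastforce
  qed
qed

lemma finite_Laurent_zeros:
  fixes c :: "'i \<Rightarrow> scalar" and g :: "'i \<Rightarrow> int"
  assumes "finite I" "inj_on g I" "i \<in> I" "c i \<noteq> 0"
  shows "finite {t. t \<noteq> 0 \<and> (\<Sum>i\<in>I. c i * t powi g i) = 0}"
proof -
  \<comment> \<open>Large enough for multiplication by t^N to clear all negative exponents.\<close>
  define N where "N = (\<Sum>i\<in>I. \<bar>g i\<bar>)"
  have N: "g i + N \<ge> 0" if "i \<in> I" for i
    using member_le_sum[of i I "\<lambda>i. \<bar>g i\<bar>"] that assms(1) by (auto simp: N_def)
  define P where "P = (\<Sum>i\<in>I. monom (c i) (nat (g i + N)))"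
  have "coeff P (nat (g i + N)) = (\<Sum>j\<in>I. if j = i then c j else 0)"
    unfolding P_def coeff_sum
  proof (rule sum.cong)
    fix j assume j: "j \<in> I"
    have "nat (g j + N) = nat (g i + N) \<longleftrightarrow> j = i"
      using N[OF j] N[OF assms(3)] inj_onD[OF assms(2), of j i] j assms(3) by (auto simp: nat_eq_iff2)
    then show "coeff (monom (c j) (nat (g j + N))) (nat (g i + N)) = (if j = i then c j else 0)" by simp
  qed simp
  also have "\<dots> = c i" using assms by simp
  finally have "P \<noteq> 0" using assms(4) by (metis coeff_0)
  then have "finite {t. poly P t = 0}" by (rule poly_roots_finite)
  moreover
  have "poly P t = 0" if "t \<noteq> 0" "(\<Sum>i\<in>I. c i * t powi g i) = 0" for t
  proof -
    have "poly P t = (\<Sum>i\<in>I. c i * t powi (g i + N))"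
      unfolding P_def poly_sum by (rule sum.cong) (use N in \<open>auto simp: poly_monom power_int_def\<close>)
    also have "\<dots> = (\<Sum>i\<in>I. c i * t powi g i) * t powi N"
      using that(1) by (simp add: power_int_add sum_distrib_right mult.assoc)
    finally show ?thesis using that by simp
  qed
  then have "{t. t \<noteq> 0 \<and> (\<Sum>i\<in>I. c i * t powi g i) = 0} \<subseteq> {t. poly P t = 0}" by blast
  ultimately show ?thesis by (rule finite_subset[rotated])
qed

lemma keys_nonempty: "f \<noteq> 0 \<Longrightarrow> \<exists>k. k \<in> Poly_Mapping.keys f"
  by (metis poly_mapping_eqI lookup_zero in_keys_iff)

context based_root_system
begin

section \<open>Generic characters\<close>

lemma separating_functional:
  assumes "finite S" "S \<subseteq> weights" "0 \<notin> S"
  shows "\<exists>c::'v \<Rightarrow> int. \<forall>\<mu>\<in>S. (\<Sum>\<alpha>\<in>R. of_int (c \<alpha>) * pair \<mu> \<alpha>) \<noteq> 0"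
  using assms
proof (induction S rule: finite_induct)
  case (insert \<nu> S)
  define g where "g c \<mu> = (\<Sum>\<alpha>\<in>R. real_of_int (c \<alpha>) * pair \<mu> \<alpha>)" for c \<mu>
  obtain c where c: "\<forall>\<mu>\<in>S. g c \<mu> \<noteq> 0" using insert unfolding g_def by auto
  obtain \<gamma> where \<gamma>: "\<gamma> \<in> R" "pair \<nu> \<gamma> \<noteq> 0" using pair_all_zero[of \<nu>] insert by auto
  \<comment> \<open>Multiply the old functional by N and add one coroot that does not vanish on the
    new weight; each weight excludes only finitely many N.\<close>
  define e where "e N \<alpha> = N * c \<alpha> + (if \<alpha> = \<gamma> then 1 else 0)" for N :: int and \<alpha>
  have ge: "g (e N) \<mu> = of_int N * g c \<mu> + pair \<mu> \<gamma>" for N \<mu>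
  proof -
    have "g (e N) \<mu> = (\<Sum>\<alpha>\<in>R. of_int N * (of_int (c \<alpha>) * pair \<mu> \<alpha>) + (if \<alpha> = \<gamma> then pair \<mu> \<alpha> else 0))"
      unfolding g_def e_def by (rule sum.cong) (auto simp: algebra_simps)
    then show ?thesis using \<gamma> finite_R by (simp add: sum.distrib g_def sum_distrib_left)
  qed
  have fin: "finite {N::int. g (e N) \<mu> = 0}" if "\<mu> \<in> insert \<nu> S" for \<mu>
  proof (cases "g c \<mu> = 0")
    case True
    then have "\<mu> = \<nu>" using c that by auto
    then show ?thesis using True \<gamma> by (simp add: ge)
  next
    case False
    have "real_of_int N = - pair \<mu> \<gamma> / g c \<mu>" if "g (e N) \<mu> = 0" for N
      using that False by (simp add: ge field_simps)
    then have "N = \<lfloor>- pair \<mu> \<gamma> / g c \<mu>\<rfloor>" if "g (e N) \<mu> = 0" for N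
      using that by (metis floor_of_int)
    then have "{N::int. g (e N) \<mu> = 0} \<subseteq> {\<lfloor>- pair \<mu> \<gamma> / g c \<mu>\<rfloor>}" by blast
    then show ?thesis using finite_subset by blast
  qed
  have "finite (\<Union>\<mu>\<in>insert \<nu> S. {N::int. g (e N) \<mu> = 0})" using fin insert by blast
  then obtain N :: int where "N \<notin> (\<Union>\<mu>\<in>insert \<nu> S. {N. g (e N) \<mu> = 0})"
    using infinite_UNIV_int by (metis ex_new_if_finite)
  then have "\<forall>\<mu>\<in>insert \<nu> S. g (e N) \<mu> \<noteq> 0" by auto
  then show ?case unfolding g_def by blast
qed simp

definition ev :: "('v \<Rightarrow> scalar) \<Rightarrow> ('v \<Rightarrow>\<^sub>0 scalar) \<Rightarrow> scalar" where
  "ev \<tau> f = (\<Sum>\<mu>\<in>Poly_Mapping.keys f. Poly_Mapping.lookup f \<mu> * \<tau> \<mu>)"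

text \<open>On the one-parameter family \<tau> \<mu> = t^(g \<mu>) each condition excludes the zeros
  of a nonzero Laurent polynomial in t, hence finitely many t, while there are infinitely many
  scalars.\<close>

lemma generic_character:
  assumes fh: "f \<noteq> 0" "h \<noteq> 0" and keys: "Poly_Mapping.keys f \<subseteq> weights" "Poly_Mapping.keys h \<subseteq> weights"
  shows "\<exists>\<tau>\<in>regch. ev \<tau> f \<noteq> 0 \<and> ev \<tau> h \<noteq> 0 \<and> inj_on \<tau> R"
proof -
  define D where "D = Poly_Mapping.keys f \<union> Poly_Mapping.keys h"
  have D: "finite D" "D \<subseteq> weights" using keys by (auto simp: D_def)
  \<comment> \<open>Differences of roots make \<tau> injective on R; differences of exponents keep
    the terms of f and h from merging under g.\<close>
  define S where "S = (R \<union> (\<lambda>(\<alpha>, \<beta>). \<alpha> - \<beta>) ` (R \<times> R) \<union> (\<lambda>(\<alpha>, \<beta>). \<alpha> - \<beta>) ` (D \<times> D)) - {0}"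
  have "finite S" using finite_R D by (simp add: S_def)
  moreover have "S \<subseteq> weights" using subsetD[OF D(2)] weights_root weights_diff by (auto simp: S_def)
  ultimately obtain c :: "'v \<Rightarrow> int" where c: "\<forall>\<mu>\<in>S. (\<Sum>\<alpha>\<in>R. of_int (c \<alpha>) * pair \<mu> \<alpha>) \<noteq> 0"
    using separating_functional[of S] by (auto simp: S_def)
  define g where "g \<mu> = \<lfloor>\<Sum>\<alpha>\<in>R. of_int (c \<alpha>) * pair \<mu> \<alpha>\<rfloor>" for \<mu>
  have g: "real_of_int (g \<mu>) = (\<Sum>\<alpha>\<in>R. of_int (c \<alpha>) * pair \<mu> \<alpha>)" if "\<mu> \<in> weights" for \<mu>
  proof -
    have "(\<Sum>\<alpha>\<in>R. of_int (c \<alpha>) * pair \<mu> \<alpha>) \<in> \<int>"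
      using pair_weight_Ints[OF that] by (intro Ints_sum Ints_mult) auto
    then show ?thesis unfolding g_def by (metis Ints_cases floor_of_int)
  qed
  have g_diff: "g (\<mu> - \<nu>) = g \<mu> - g \<nu>" if "\<mu> \<in> weights" "\<nu> \<in> weights" for \<mu> \<nu>
  proof -
    have "real_of_int (g (\<mu> - \<nu>)) = real_of_int (g \<mu> - g \<nu>)"
      using that weights_diff g by (simp add: pair_diff algebra_simps sum_subtractf)
    then show ?thesis by (simp only: of_int_eq_iff)
  qed
  have g_add: "g (\<mu> + \<nu>) = g \<mu> + g \<nu>" if "\<mu> \<in> weights" "\<nu> \<in> weights" for \<mu> \<nu>
    using g_diff[OF weights_add[OF that] that(2)] by simp
  have g_S: "g \<mu> \<noteq> 0" if "\<mu> \<in> S" for \<mu>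
    using c g[of \<mu>] that \<open>S \<subseteq> weights\<close> by force
  have g_inj: "inj_on g R" "inj_on g D"
  proof -
    have "\<alpha> = \<beta>" if "\<alpha> \<in> R \<and> \<beta> \<in> R \<or> \<alpha> \<in> D \<and> \<beta> \<in> D" "g \<alpha> = g \<beta>" for \<alpha> \<beta>
    proof (rule ccontr)
      assume "\<alpha> \<noteq> \<beta>"
      then have "\<alpha> - \<beta> \<in> S" using that by (auto simp: S_def image_iff)
      moreover have "\<alpha> \<in> weights" "\<beta> \<in> weights" using that D(2) weights_root by auto
      ultimately show False using g_S g_diff that by force
    qed
    then show "inj_on g R" "inj_on g D" by (auto intro: inj_onI)
  qed
  have zeros: "finite {t. t \<noteq> 0 \<and> (\<Sum>\<mu>\<in>Poly_Mapping.keys e. Poly_Mapping.lookup e \<mu> * t powi g \<mu>) = 0}"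
    if e: "e \<noteq> 0" "Poly_Mapping.keys e \<subseteq> D" for e :: "'v \<Rightarrow>\<^sub>0 scalar"
  proof -
    obtain \<mu>0 where "\<mu>0 \<in> Poly_Mapping.keys e" using keys_nonempty[OF e(1)] by blast
    then show ?thesis using inj_on_subset[OF g_inj(2) e(2)]
      by (intro finite_Laurent_zeros) (auto simp: in_keys_iff)
  qed
  define bad where "bad = {0::scalar} \<union> (\<Union>\<alpha>\<in>R. {t. t powi g \<alpha> = 1} \<union> {t. t powi g \<alpha> = q\<^sup>2})
    \<union> (\<Union>\<mu>\<in>(\<lambda>(\<alpha>, \<beta>). g \<alpha> - g \<beta>) ` (R \<times> R) - {0}. {t. t powi \<mu> = 1})
    \<union> {t. t \<noteq> 0 \<and> (\<Sum>\<mu>\<in>Poly_Mapping.keys f. Poly_Mapping.lookup f \<mu> * t powi g \<mu>) = 0}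
    \<union> {t. t \<noteq> 0 \<and> (\<Sum>\<mu>\<in>Poly_Mapping.keys h. Poly_Mapping.lookup h \<mu> * t powi g \<mu>) = 0}"
  have "finite bad"
    unfolding bad_def
  proof (intro finite_UnI finite_UN_I)
    fix \<alpha> assume "\<alpha> \<in> R"
    then have "\<alpha> \<in> S" using root_nz by (auto simp: S_def)
    then show "finite {t::scalar. t powi g \<alpha> = 1}" "finite {t. t powi g \<alpha> = q\<^sup>2}"
      using g_S by (auto intro!: finite_power_int_eq)
  next
    show "finite {t. t \<noteq> 0 \<and> (\<Sum>\<mu>\<in>Poly_Mapping.keys f. Poly_Mapping.lookup f \<mu> * t powi g \<mu>) = 0}"
      "finite {t. t \<noteq> 0 \<and> (\<Sum>\<mu>\<in>Poly_Mapping.keys h. Poly_Mapping.lookup h \<mu> * t powi g \<mu>) = 0}"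
      using fh by (auto intro!: zeros simp: D_def)
  qed (use finite_R in \<open>auto intro!: finite_power_int_eq\<close>)
  then obtain t where t: "t \<notin> bad" using scalar_infinite ex_new_if_finite by blast
  then have t0: "t \<noteq> 0" by (simp add: bad_def)
  define \<tau> where "\<tau> \<mu> = t powi g \<mu>" for \<mu>
  have "g 0 = 0" using g_add[of 0 0] by simp
  then have "\<tau> \<in> regch"
    using t t0 g_add by (auto simp: regch_def \<tau>_def bad_def power_int_add)
  moreover have "ev \<tau> f \<noteq> 0" "ev \<tau> h \<noteq> 0" using t t0 by (simp_all add: ev_def \<tau>_def bad_def)
  moreover have "inj_on \<tau> R"
  proof (rule inj_onI)
    fix \<alpha> \<beta> assume ab: "\<alpha> \<in> R" "\<beta> \<in> R" "\<tau> \<alpha> = \<tau> \<beta>"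
    then have "t powi (g \<alpha> - g \<beta>) = 1" using t0 by (simp add: \<tau>_def power_int_diff)
    then have "g \<alpha> - g \<beta> = 0" using t ab by (auto simp: bad_def)
    then show "\<alpha> = \<beta>" using g_inj(1) ab by (auto dest: inj_onD)
  qed
  ultimately show ?thesis by blast
qed

section \<open>Coefficients and divided differences\<close>

abbreviation KK :: "scalar set" where "KK \<equiv> carrier coeff_ring"

lemma KK_def: "KK = generate_ring ring_of_type_algebra {q, inverse q, inverse (W0 (q\<^sup>2))}"
  by (simp add: coeff_ring_def)

lemma rota_simps: "carrier (ring_of_type_algebra :: 'z::ring_1 ring) = UNIV"
  "monoid.mult (ring_of_type_algebra :: 'z::ring_1 ring) = (*)" "monoid.one (ring_of_type_algebra :: 'z::ring_1 ring) = 1"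
  "ring.zero (ring_of_type_algebra :: 'z::ring_1 ring) = 0" "ring.add (ring_of_type_algebra :: 'z::ring_1 ring) = (+)"
  by (simp_all add: ring_of_type_algebra_def)

lemma ring_type_ring: "ring (ring_of_type_algebra :: 'z::ring_1 ring)"
proof (rule ringI)
  show "abelian_group (ring_of_type_algebra :: 'z ring)"
    by (rule abelian_groupI) (auto simp: rota_simps add.assoc add.commute intro: exI[of _ "- _"] add.left_inverse)
  show "monoid (ring_of_type_algebra :: 'z ring)"
    by (rule monoidI) (auto simp: rota_simps mult.assoc)
qed (auto simp: rota_simps distrib_left distrib_right)

lemma rota_minus: "a_inv (ring_of_type_algebra :: 'z::ring_1 ring) x = - x"
proof -
  interpret r: ring "ring_of_type_algebra :: 'z ring" by (rule ring_type_ring)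
  show ?thesis by (rule r.minus_equality) (simp_all add: rota_simps)
qed

lemma KK_1 [simp]: "1 \<in> KK"
  and KK_add: "a \<in> KK \<Longrightarrow> b \<in> KK \<Longrightarrow> a + b \<in> KK"
  and KK_mult: "a \<in> KK \<Longrightarrow> b \<in> KK \<Longrightarrow> a * b \<in> KK"
  and KK_uminus: "a \<in> KK \<Longrightarrow> - a \<in> KK"
  and KK_q [simp]: "q \<in> KK" "inverse q \<in> KK" "inverse (W0 (q\<^sup>2)) \<in> KK"
  using generate_ring.one[of "ring_of_type_algebra :: scalar ring" "{q, inverse q, inverse (W0 (q\<^sup>2))}"]
    generate_ring.eng_add[of a "ring_of_type_algebra :: scalar ring" "{q, inverse q, inverse (W0 (q\<^sup>2))}" b]
    generate_ring.eng_mult[of a "ring_of_type_algebra :: scalar ring" "{q, inverse q, inverse (W0 (q\<^sup>2))}" b]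
    generate_ring.a_inv[of a "ring_of_type_algebra :: scalar ring" "{q, inverse q, inverse (W0 (q\<^sup>2))}"]
  unfolding KK_def by (simp_all add: rota_simps rota_minus generate_ring.incl)

lemma KK_0 [simp]: "0 \<in> KK" using KK_add[OF KK_1 KK_uminus[OF KK_1]] by simp

lemma KK_diff: "a \<in> KK \<Longrightarrow> b \<in> KK \<Longrightarrow> a - b \<in> KK"
  using KK_add[of a "- b"] KK_uminus[of b] by simp

lemma KK_power: "a \<in> KK \<Longrightarrow> a ^ n \<in> KK"
  by (induction n) (auto simp: KK_mult)

lemma KP_iff: "f \<in> KP \<longleftrightarrow> Poly_Mapping.keys f \<subseteq> weights \<and> (\<forall>\<mu>. Poly_Mapping.lookup f \<mu> \<in> KK)"
  by (simp add: KP_def)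

lemma KP_0 [simp]: "0 \<in> KP" and KP_single: "\<mu> \<in> weights \<Longrightarrow> k \<in> KK \<Longrightarrow> Poly_Mapping.single \<mu> k \<in> KP"
  and KP_add: "f \<in> KP \<Longrightarrow> g \<in> KP \<Longrightarrow> f + g \<in> KP"
  and KP_uminus: "f \<in> KP \<Longrightarrow> - f \<in> KP"
  using keys_add[of f g] by (auto simp: KP_iff lookup_single when_def lookup_add KK_add KK_uminus)

lemma KP_diff: "f \<in> KP \<Longrightarrow> g \<in> KP \<Longrightarrow> f - g \<in> KP"
  using KP_add[of f "- g"] KP_uminus[of g] by simp

lemma KP_xpow: "\<mu> \<in> weights \<Longrightarrow> xpow \<mu> \<in> KP"
  by (simp add: xpow_def KP_single)

lemma KP_1 [simp]: "1 \<in> KP" using KP_single[of 0 1] by simp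

lemma KP_sum: "(\<And>i. i \<in> I \<Longrightarrow> f i \<in> KP) \<Longrightarrow> sum f I \<in> KP"
  by (induction I rule: infinite_finite_induct) (auto simp: KP_add)

lemma KP_mult: assumes "f \<in> KP" "g \<in> KP" shows "f * g \<in> KP"
proof -
  have "f * g = (\<Sum>i\<in>Poly_Mapping.keys f. \<Sum>j\<in>Poly_Mapping.keys g. Poly_Mapping.single (i + j) (Poly_Mapping.lookup f i * Poly_Mapping.lookup g j))"
    by (subst poly_mapping_sum_singles[of f], subst poly_mapping_sum_singles[of g])
      (simp add: sum_distrib_left sum_distrib_right mult_single sum.swap[of _ "Poly_Mapping.keys g"])
  also have "\<dots> \<in> KP"
    using assms by (intro KP_sum KP_single weights_add KK_mult) (auto simp: KP_iff)
  finally show ?thesis .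
qed

lemma xpow_add: "xpow (\<mu> + \<nu>) = xpow \<mu> * xpow \<nu>"
  and xpow_0 [simp]: "xpow 0 = 1"
  by (simp_all add: xpow_def mult_single)

lemma root_factor_cancel:
  assumes "\<alpha> \<noteq> 0" "h * (1 - xpow (- \<alpha>)) = h' * (1 - xpow (- \<alpha>))" shows "h = h'"
proof (rule ccontr)
  assume "h \<noteq> h'"
  define d where "d = h - h'"
  have "d * (1 - xpow (- \<alpha>)) = 0" using assms(2) by (simp add: d_def left_diff_distrib)
  then have "Poly_Mapping.lookup (d - d * Poly_Mapping.single (- \<alpha>) 1) \<mu> = 0" for \<mu>
    by (simp add: right_diff_distrib xpow_def)
  then have per: "Poly_Mapping.lookup d \<mu> = Poly_Mapping.lookup d (\<mu> + \<alpha>)" for \<mu>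
    by (simp add: lookup_minus lookup_times_single)
  obtain \<mu> where "\<mu> \<in> Poly_Mapping.keys d" using keys_nonempty[of d] \<open>h \<noteq> h'\<close> by (auto simp: d_def)
  then have "\<mu> + real n *\<^sub>R \<alpha> \<in> Poly_Mapping.keys d" for n
  proof (induction n)
    case (Suc n)
    then show ?case using per[of "\<mu> + real n *\<^sub>R \<alpha>"] by (simp add: in_keys_iff algebra_simps)
  qed simp
  then have "range (\<lambda>n. \<mu> + real n *\<^sub>R \<alpha>) \<subseteq> Poly_Mapping.keys d" by auto
  moreover have "inj (\<lambda>n. \<mu> + real n *\<^sub>R \<alpha>)" using assms(1) by (auto intro!: injI)
  ultimately show False using finite_imageD finite_subset[OF _ finite_keys] infinite_UNIV_nat by metis
qed

text \<open>A geometric sum along the \<alpha>-string, growing by one term per step.\<close>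

lemma string_quotient:
  assumes "\<mu> \<in> weights" "\<alpha> \<in> R"
  shows "\<exists>h\<in>KP. h * (1 - xpow (- \<alpha>)) = xpow \<mu> - xpow (\<mu> - real n *\<^sub>R \<alpha>)"
proof (induction n)
  case 0 show ?case by (rule bexI[of _ 0]) auto
next
  case (Suc n)
  then obtain h where h: "h \<in> KP" "h * (1 - xpow (- \<alpha>)) = xpow \<mu> - xpow (\<mu> - real n *\<^sub>R \<alpha>)" by blast
  let ?x = "xpow (\<mu> - real n *\<^sub>R \<alpha>)"
  have "?x * xpow (- \<alpha>) = xpow (\<mu> - real (Suc n) *\<^sub>R \<alpha>)"
    by (simp flip: xpow_add add: algebra_simps)
  then have "(h + ?x) * (1 - xpow (- \<alpha>)) = xpow \<mu> - xpow (\<mu> - real (Suc n) *\<^sub>R \<alpha>)"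
    unfolding distrib_right h(2) by (simp add: right_diff_distrib)
  moreover have "h + ?x \<in> KP"
    using KP_add[OF h(1) KP_xpow[OF weights_diff[OF assms(1) weights_scaleZ[OF weights_root[OF assms(2)]]]]] by simp
  ultimately show ?case by blast
qed

lemma refl_quotient:
  assumes "\<mu> \<in> weights" "\<alpha> \<in> R"
  shows "\<exists>h\<in>KP. h * (1 - xpow (- \<alpha>)) = xpow \<mu> - xpow (refl \<alpha> \<mu>)"
proof -
  obtain k where k: "pair \<mu> \<alpha> = of_int k" using pair_weight_Ints assms by (blast elim: Ints_cases)
  show ?thesis
  proof (cases "k \<ge> 0")
    case True
    then show ?thesis using string_quotient[OF assms, of "nat k"] k by (simp add: refl_pair)
  next
    case False
    \<comment> \<open>For a negative pairing the string is read downwards from the reflected weight,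
      which changes the sign of the quotient.\<close>
    have "refl \<alpha> \<mu> - real (nat (- k)) *\<^sub>R \<alpha> = \<mu>" using False k by (simp add: refl_pair)
    then obtain h where h: "h \<in> KP" "h * (1 - xpow (- \<alpha>)) = xpow (refl \<alpha> \<mu>) - xpow \<mu>"
      using string_quotient[OF weights_refl[OF assms(2,1)] assms(2), of "nat (- k)"] by auto
    then have "- h \<in> KP" "- h * (1 - xpow (- \<alpha>)) = xpow \<mu> - xpow (refl \<alpha> \<mu>)" by (auto simp: KP_uminus)
    then show ?thesis by blast
  qed
qed

definition dd :: "'v \<Rightarrow> 'v \<Rightarrow> ('v \<Rightarrow>\<^sub>0 scalar)" where
  "dd \<alpha> \<mu> = exact_quot (xpow \<mu> - xpow (refl \<alpha> \<mu>)) (1 - xpow (- \<alpha>))"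

lemma dd:
  assumes "\<mu> \<in> weights" "\<alpha> \<in> R"
  shows "dd \<alpha> \<mu> \<in> KP" "dd \<alpha> \<mu> * (1 - xpow (- \<alpha>)) = xpow \<mu> - xpow (refl \<alpha> \<mu>)"
proof -
  obtain h where h: "h \<in> KP" "h * (1 - xpow (- \<alpha>)) = xpow \<mu> - xpow (refl \<alpha> \<mu>)"
    using refl_quotient[OF assms] by blast
  have "dd \<alpha> \<mu> = h" unfolding dd_def exact_quot_def
  proof (rule the_equality)
    fix g assume "g * (1 - xpow (- \<alpha>)) = xpow \<mu> - xpow (refl \<alpha> \<mu>)"
    then show "g = h" using h root_factor_cancel root_nz[OF assms(2)] by metis
  qed (rule h)
  then show "dd \<alpha> \<mu> \<in> KP" "dd \<alpha> \<mu> * (1 - xpow (- \<alpha>)) = xpow \<mu> - xpow (refl \<alpha> \<mu>)" using h by auto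
qed

lemma ev_superset: "finite S \<Longrightarrow> Poly_Mapping.keys f \<subseteq> S \<Longrightarrow> ev \<tau> f = (\<Sum>\<mu>\<in>S. Poly_Mapping.lookup f \<mu> * \<tau> \<mu>)"
  unfolding ev_def by (rule sum.mono_neutral_left) (auto simp: in_keys_iff)

lemma ev_add: "ev \<tau> (f + g) = ev \<tau> f + ev \<tau> g"
proof -
  let ?S = "Poly_Mapping.keys f \<union> Poly_Mapping.keys g"
  have "ev \<tau> (f + g) = (\<Sum>\<mu>\<in>?S. Poly_Mapping.lookup (f + g) \<mu> * \<tau> \<mu>)"
    by (intro ev_superset) (use keys_add[of f g] in auto)
  then show ?thesis using ev_superset[of ?S f \<tau>] ev_superset[of ?S g \<tau>]
    by (simp add: lookup_add distrib_right sum.distrib)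
qed

lemma ev_single: "ev \<tau> (Poly_Mapping.single \<mu> k) = k * \<tau> \<mu>"
  by (simp add: ev_def)

lemma ev_uminus: "ev \<tau> (- f) = - ev \<tau> f"
  by (simp add: ev_def sum_negf)

lemma ev_diff: "ev \<tau> (f - g) = ev \<tau> f - ev \<tau> g"
  using ev_add[of \<tau> f "- g"] by (simp add: ev_uminus)

lemma ev_0 [simp]: "ev \<tau> 0 = 0" by (simp add: ev_def)

lemma ev_sum: "ev \<tau> (sum f I) = (\<Sum>i\<in>I. ev \<tau> (f i))"
  by (induction I rule: infinite_finite_induct) (auto simp: ev_add)

lemma ev_mult:
  assumes "\<tau> \<in> regch" "Poly_Mapping.keys f \<subseteq> weights" "Poly_Mapping.keys g \<subseteq> weights"
  shows "ev \<tau> (f * g) = ev \<tau> f * ev \<tau> g"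
proof -
  have "f * g = (\<Sum>i\<in>Poly_Mapping.keys f. \<Sum>j\<in>Poly_Mapping.keys g. Poly_Mapping.single (i + j) (Poly_Mapping.lookup f i * Poly_Mapping.lookup g j))"
    by (subst poly_mapping_sum_singles[of f], subst poly_mapping_sum_singles[of g])
      (simp add: sum_distrib_left sum_distrib_right mult_single sum.swap[of _ "Poly_Mapping.keys g"])
  then have "ev \<tau> (f * g) = (\<Sum>i\<in>Poly_Mapping.keys f. \<Sum>j\<in>Poly_Mapping.keys g. Poly_Mapping.lookup f i * Poly_Mapping.lookup g j * \<tau> (i + j))"
    by (simp add: ev_sum ev_single)
  also have "\<dots> = (\<Sum>i\<in>Poly_Mapping.keys f. \<Sum>j\<in>Poly_Mapping.keys g. (Poly_Mapping.lookup f i * \<tau> i) * (Poly_Mapping.lookup g j * \<tau> j))"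
    using assms by (intro sum.cong) (auto simp: regch_add subset_iff)
  finally show ?thesis by (simp add: ev_def sum_product)
qed

lemma ev_eq_0: "Poly_Mapping.keys f \<subseteq> weights \<Longrightarrow> (\<And>\<tau>. \<tau> \<in> regch \<Longrightarrow> inj_on \<tau> R \<Longrightarrow> ev \<tau> f = 0) \<Longrightarrow> f = 0"
  using generic_character[of f f] by blast

lemma KP_no_zero_divisors:
  fixes f h :: "'v \<Rightarrow>\<^sub>0 scalar"
  assumes "Poly_Mapping.keys f \<subseteq> weights" "Poly_Mapping.keys h \<subseteq> weights" "f * h = 0"
  shows "f = 0 \<or> h = 0"
  using generic_character[of f h] assms ev_mult[of _ f h] by (metis ev_0 mult_eq_0_iff)

section \<open>The principal series representation\<close>

abbreviation FA :: "('v gen word \<Rightarrow>\<^sub>0 scalar) set" where "FA \<equiv> carrier free_alg"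

definition gens :: "'v gen set" where "gens = X_gen ` weights \<union> T_gen ` simple_roots"

lemma FA_iff: "f \<in> FA \<longleftrightarrow> (\<forall>u\<in>Poly_Mapping.keys f. set (letters u) \<subseteq> gens) \<and> (\<forall>u. Poly_Mapping.lookup f u \<in> KK)"
  by (auto simp: free_alg_def gens_def lists_eq_set subset_iff)

lemma free_alg_simps: "monoid.mult free_alg = (*)" "monoid.one free_alg = 1" "ring.zero free_alg = 0" "ring.add free_alg = (+)"
  by (simp_all add: free_alg_def ring_of_type_algebra_def)

lemma FA_add: "f \<in> FA \<Longrightarrow> g \<in> FA \<Longrightarrow> f + g \<in> FA"
  unfolding FA_iff using keys_add[of f g] by (simp add: lookup_add KK_add) blast

lemma FA_0 [simp]: "0 \<in> FA" and FA_1 [simp]: "1 \<in> FA"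
  and FA_uminus: "f \<in> FA \<Longrightarrow> - f \<in> FA"
  and FA_single: "k \<in> KK \<Longrightarrow> set (letters u) \<subseteq> gens \<Longrightarrow> Poly_Mapping.single u k \<in> FA"
  by (auto simp: FA_iff lookup_single when_def lookup_add KK_add KK_uminus lookup_one zero_word_def)

lemma FA_diff: "f \<in> FA \<Longrightarrow> g \<in> FA \<Longrightarrow> f - g \<in> FA"
  using FA_add[of f "- g"] FA_uminus[of g] by simp

lemma FA_sum: "(\<And>i. i \<in> I \<Longrightarrow> f i \<in> FA) \<Longrightarrow> sum f I \<in> FA"
  by (induction I rule: infinite_finite_induct) (auto simp: FA_add)

lemma mult_singles:
  fixes f g :: "'x::monoid_add \<Rightarrow>\<^sub>0 scalar"
  shows "f * g = (\<Sum>i\<in>Poly_Mapping.keys f. \<Sum>j\<in>Poly_Mapping.keys g.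
      Poly_Mapping.single (i + j) (Poly_Mapping.lookup f i * Poly_Mapping.lookup g j))"
  by (subst poly_mapping_sum_singles[of f], subst poly_mapping_sum_singles[of g])
    (simp add: sum_distrib_left sum_distrib_right mult_single sum.swap[of _ "Poly_Mapping.keys g"])

lemma FA_mult: assumes "f \<in> FA" "g \<in> FA" shows "f * g \<in> FA"
  unfolding mult_singles using assms
  by (intro FA_sum FA_single KK_mult) (auto simp: FA_iff plus_word_def)

lemma ring_free_alg: "ring free_alg"
proof (rule ringI)
  show "abelian_group free_alg"
    by (rule abelian_groupI)
      (auto simp: free_alg_simps FA_add add.assoc add.commute intro!: bexI[of _ "- _"] FA_uminus)
  show "monoid free_alg"
    by (rule monoidI) (auto simp: free_alg_simps FA_mult mult.assoc)
qed (auto simp: free_alg_simps distrib_left distrib_right)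

lemma const_simps: "const (a + b) = const a + const b" "const (a * b) = const a * const b" "const 1 = 1" "const 0 = 0"
  "const (- a) = - const a" "const (a - b) = const a - const b"
  by (simp_all add: const_def single_add mult_single single_uminus single_diff)

lemma const_power: "const (a ^ n) = const a ^ n"
  by (induction n) (simp_all add: const_simps)

lemma const_commute: "f * const k = const k * f"
  unfolding const_def
  by (subst (1 2) poly_mapping_sum_singles[of f])
    (simp add: sum_distrib_left sum_distrib_right mult_single mult.commute)

lemma const_left_commute: "f * (const k * g) = const k * (f * g)"
  by (simp only: mult.assoc[symmetric] const_commute[of f k])

lemma FA_const: "k \<in> KK \<Longrightarrow> const k \<in> FA" and FA_gX: "\<mu> \<in> weights \<Longrightarrow> gX \<mu> \<in> FA"
  and FA_gT: "\<alpha> \<in> simple_roots \<Longrightarrow> gT \<alpha> \<in> FA"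
  unfolding const_def gX_def gT_def by (auto intro!: FA_single simp: gens_def zero_word_def)

lemma T_word_Nil [simp]: "T_word [] = 1" and T_word_Cons [simp]: "T_word (\<alpha> # \<alpha>s) = gT \<alpha> * T_word \<alpha>s"
  and T_word_append: "T_word (\<alpha>s @ \<beta>s) = T_word \<alpha>s * T_word \<beta>s"
  by (simp_all add: T_word_def)

lemma FA_T_word: "set \<alpha>s \<subseteq> simple_roots \<Longrightarrow> T_word \<alpha>s \<in> FA"
  by (induction \<alpha>s) (auto simp: FA_mult FA_gT)

lemma lift_superset:
  assumes "finite S" "Poly_Mapping.keys f \<subseteq> S"
  shows "lift_KP f = (\<Sum>\<mu>\<in>S. const (Poly_Mapping.lookup f \<mu>) * gX \<mu>)"
  unfolding lift_KP_def using assms by (intro sum.mono_neutral_left) (auto simp: in_keys_iff const_simps)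

lemma lift_add: "lift_KP (f + g) = lift_KP f + lift_KP g"
proof -
  let ?S = "Poly_Mapping.keys f \<union> Poly_Mapping.keys g"
  have "lift_KP (f + g) = (\<Sum>\<mu>\<in>?S. const (Poly_Mapping.lookup (f + g) \<mu>) * gX \<mu>)"
    by (intro lift_superset) (use keys_add[of f g] in auto)
  then show ?thesis using lift_superset[of ?S f] lift_superset[of ?S g]
    by (simp add: lookup_add const_simps distrib_right sum.distrib)
qed

lemma lift_uminus: "lift_KP (- f) = - lift_KP f"
  by (simp add: lift_KP_def const_simps sum_negf)

lemma lift_diff: "lift_KP (f - g) = lift_KP f - lift_KP g"
  using lift_add[of f "- g"] by (simp add: lift_uminus)

lemma lift_single: "lift_KP (Poly_Mapping.single \<mu> k) = const k * gX \<mu>"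
  by (simp add: lift_KP_def const_simps)

lemma lift_0 [simp]: "lift_KP 0 = 0" by (simp add: lift_KP_def)

lemma lift_sum: "lift_KP (sum f I) = (\<Sum>i\<in>I. lift_KP (f i))"
  by (induction I rule: infinite_finite_induct) (auto simp: lift_add)

lemma lift_xpow: "lift_KP (xpow \<mu>) = gX \<mu>"
  by (simp add: xpow_def lift_single const_simps)

lemma lift_scale: "lift_KP (Poly_Mapping.single 0 k * f) = const k * lift_KP f"
  by (subst (1 2) poly_mapping_sum_singles[of f])
    (simp add: sum_distrib_left lift_sum mult_single lift_single const_simps mult.assoc)

lemma FA_lift: "f \<in> KP \<Longrightarrow> lift_KP f \<in> FA"
  unfolding lift_KP_def by (intro FA_sum FA_mult FA_const FA_gX) (auto simp: KP_iff)

fun act_gen :: "'v gen \<Rightarrow> (('v \<Rightarrow> scalar) \<Rightarrow> scalar) \<Rightarrow> ('v \<Rightarrow> scalar) \<Rightarrow> scalar" where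
  "act_gen (X_gen \<mu>) \<Phi> \<tau> = \<tau> \<mu> * \<Phi> \<tau>"
| "act_gen (T_gen \<alpha>) \<Phi> \<tau> = Top \<alpha> \<Phi> \<tau>"

definition act_word :: "'v gen word \<Rightarrow> (('v \<Rightarrow> scalar) \<Rightarrow> scalar) \<Rightarrow> ('v \<Rightarrow> scalar) \<Rightarrow> scalar" where
  "act_word u = foldr act_gen (letters u)"

text \<open>The principal series: \<open>x\<^sup>\<mu>\<close> multiplies a function of the character \<open>\<tau>\<close> by \<open>\<tau> \<mu>\<close>, and \<open>T\<^sub>\<alpha>\<close> acts by \<open>Top \<alpha>\<close>.\<close>

definition rep :: "('v gen word \<Rightarrow>\<^sub>0 scalar) \<Rightarrow> (('v \<Rightarrow> scalar) \<Rightarrow> scalar) \<Rightarrow> ('v \<Rightarrow> scalar) \<Rightarrow> scalar" where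
  "rep f \<Phi> \<tau> = (\<Sum>u\<in>Poly_Mapping.keys f. Poly_Mapping.lookup f u * act_word u \<Phi> \<tau>)"

lemma act_word_0 [simp]: "act_word 0 \<Phi> = \<Phi>" and act_word_add: "act_word (u + v) \<Phi> = act_word u (act_word v \<Phi>)"
  by (simp_all add: act_word_def zero_word_def plus_word_def)

lemma Top_eq: "Top \<alpha> \<Phi> \<tau> = (cc \<alpha> \<tau> - inverse q) * \<Phi> \<tau> + (q + inverse q - cc \<alpha> \<tau>) * \<Phi> (\<tau> \<circ> refl \<alpha>)"
  by (simp add: Top_def th_def avg_def algebra_simps)

lemma act_gen_lin: "act_gen g (\<lambda>\<tau>. \<Sum>i\<in>I. c i * \<Psi> i \<tau>) \<tau> = (\<Sum>i\<in>I. c i * act_gen g (\<Psi> i) \<tau>)"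
  by (cases g) (simp_all add: Top_eq sum_distrib_left sum.distrib[symmetric] algebra_simps)

lemma act_word_lin: "act_word u (\<lambda>\<tau>. \<Sum>i\<in>I. c i * \<Psi> i \<tau>) \<tau> = (\<Sum>i\<in>I. c i * act_word u (\<Psi> i) \<tau>)"
proof -
  have "foldr act_gen l (\<lambda>\<tau>. \<Sum>i\<in>I. c i * \<Psi> i \<tau>) = (\<lambda>\<tau>. \<Sum>i\<in>I. c i * foldr act_gen l (\<Psi> i) \<tau>)" for l
    by (induction l) (auto simp: act_gen_lin)
  then show ?thesis by (simp add: act_word_def)
qed

lemma rep_superset: "finite S \<Longrightarrow> Poly_Mapping.keys f \<subseteq> S \<Longrightarrow> rep f \<Phi> \<tau> = (\<Sum>u\<in>S. Poly_Mapping.lookup f u * act_word u \<Phi> \<tau>)"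
  unfolding rep_def by (rule sum.mono_neutral_left) (auto simp: in_keys_iff)

lemma rep_add: "rep (f + g) \<Phi> \<tau> = rep f \<Phi> \<tau> + rep g \<Phi> \<tau>"
proof -
  let ?S = "Poly_Mapping.keys f \<union> Poly_Mapping.keys g"
  have "rep (f + g) \<Phi> \<tau> = (\<Sum>u\<in>?S. Poly_Mapping.lookup (f + g) u * act_word u \<Phi> \<tau>)"
    by (intro rep_superset) (use keys_add[of f g] in auto)
  then show ?thesis using rep_superset[of ?S f \<Phi> \<tau>] rep_superset[of ?S g \<Phi> \<tau>]
    by (simp add: lookup_add distrib_right sum.distrib)
qed

lemma rep_uminus: "rep (- f) \<Phi> \<tau> = - rep f \<Phi> \<tau>"
  by (simp add: rep_def sum_negf)

lemma rep_diff: "rep (f - g) \<Phi> \<tau> = rep f \<Phi> \<tau> - rep g \<Phi> \<tau>"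
  using rep_add[of f "- g"] by (simp add: rep_uminus)

lemma rep_0 [simp]: "rep 0 \<Phi> \<tau> = 0" by (simp add: rep_def)

lemma rep_sum: "rep (sum f I) \<Phi> \<tau> = (\<Sum>i\<in>I. rep (f i) \<Phi> \<tau>)"
  by (induction I rule: infinite_finite_induct) (auto simp: rep_add)

lemma rep_single: "rep (Poly_Mapping.single u k) \<Phi> \<tau> = k * act_word u \<Phi> \<tau>"
  by (simp add: rep_def)

lemma rep_mult: "rep (f * g) \<Phi> \<tau> = rep f (rep g \<Phi>) \<tau>"
proof -
  have g: "rep g \<Phi> = (\<lambda>\<tau>. \<Sum>j\<in>Poly_Mapping.keys g. Poly_Mapping.lookup g j * act_word j \<Phi> \<tau>)"
    by (rule ext) (simp add: rep_def)
  have "rep (f * g) \<Phi> \<tau> = (\<Sum>i\<in>Poly_Mapping.keys f. \<Sum>j\<in>Poly_Mapping.keys g.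
      Poly_Mapping.lookup f i * (Poly_Mapping.lookup g j * act_word i (act_word j \<Phi>) \<tau>))"
    unfolding mult_singles by (simp add: rep_sum rep_single act_word_add mult.assoc)
  also have "\<dots> = rep f (rep g \<Phi>) \<tau>"
    unfolding g by (simp add: rep_def act_word_lin sum_distrib_left)
  finally show ?thesis .
qed

lemma rep_const: "rep (const k) \<Phi> \<tau> = k * \<Phi> \<tau>"
  and rep_gX: "rep (gX \<mu>) \<Phi> \<tau> = \<tau> \<mu> * \<Phi> \<tau>"
  and rep_gT: "rep (gT \<alpha>) \<Phi> \<tau> = Top \<alpha> \<Phi> \<tau>"
  unfolding const_def gX_def gT_def by (simp_all add: rep_single) (simp_all add: act_word_def)

lemma rep_1: "rep 1 \<Phi> \<tau> = \<Phi> \<tau>"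
  using rep_const[of 1] by (simp add: const_simps)

lemma rep_lift: "rep (lift_KP f) \<Phi> \<tau> = ev \<tau> f * \<Phi> \<tau>"
  by (simp add: lift_KP_def rep_sum rep_mult rep_const rep_gX ev_def sum_distrib_right mult.assoc)

lemma act_gen_cong:
  assumes "g \<in> gens" "\<And>\<tau>. \<tau> \<in> regch \<Longrightarrow> \<Phi> \<tau> = \<Psi> \<tau>" "\<tau> \<in> regch"
  shows "act_gen g \<Phi> \<tau> = act_gen g \<Psi> \<tau>"
  using assms simple_R by (cases g) (auto simp: Top_eq gens_def regch_refl)

text \<open>The operators evaluate their argument only at characters in the W-orbit of \<tau>, and
  these are again regular.\<close>

lemma rep_cong:
  assumes "f \<in> FA" "\<And>\<tau>. \<tau> \<in> regch \<Longrightarrow> \<Phi> \<tau> = \<Psi> \<tau>" "\<tau> \<in> regch"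
  shows "rep f \<Phi> \<tau> = rep f \<Psi> \<tau>"
proof -
  have "foldr act_gen l \<Phi> \<tau> = foldr act_gen l \<Psi> \<tau>" if "set l \<subseteq> gens" "\<tau> \<in> regch" for l \<tau>
    using that
  proof (induction l arbitrary: \<tau>)
    case (Cons g l)
    then show ?case using act_gen_cong[of g "foldr act_gen l \<Phi>" "foldr act_gen l \<Psi>" \<tau>] by simp
  qed (use assms in auto)
  then show ?thesis unfolding rep_def act_word_def using assms by (intro sum.cong) (auto simp: FA_iff)
qed

text \<open>Annihilation is demanded at regular characters, where the relations are verified;
  \<open>rep_cong\<close> is what makes this set stable under left multiplication.\<close>

definition Null :: "('v gen word \<Rightarrow>\<^sub>0 scalar) set" where
  "Null = {f \<in> FA. \<forall>\<Phi>. \<forall>\<tau>\<in>regch. rep f \<Phi> \<tau> = 0}"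

lemma free_alg_minus: "x \<in> FA \<Longrightarrow> a_inv free_alg x = - x"
proof -
  interpret r: ring free_alg by (rule ring_free_alg)
  assume "x \<in> FA"
  then show ?thesis using r.minus_equality[of "- x" x] by (simp add: free_alg_simps FA_uminus)
qed

lemma ideal_free_algI:
  assumes "J \<subseteq> FA" "0 \<in> J" "\<And>x y. x \<in> J \<Longrightarrow> y \<in> J \<Longrightarrow> x + y \<in> J" "\<And>x. x \<in> J \<Longrightarrow> - x \<in> J"
    "\<And>x a. x \<in> J \<Longrightarrow> a \<in> FA \<Longrightarrow> a * x \<in> J" "\<And>x a. x \<in> J \<Longrightarrow> a \<in> FA \<Longrightarrow> x * a \<in> J"
  shows "ideal J free_alg"
proof (rule idealI[OF ring_free_alg])
  interpret r: ring free_alg by (rule ring_free_alg)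
  show "subgroup J (add_monoid free_alg)"
  proof (rule group.subgroupI)
    show "Group.group (add_monoid free_alg)" by (rule r.add.is_group)
    show "J \<subseteq> carrier (add_monoid free_alg)" using assms by simp
    show "J \<noteq> {}" using assms by auto
    fix a assume "a \<in> J"
    then show "inv\<^bsub>add_monoid free_alg\<^esub> a \<in> J"
      using free_alg_minus[of a] assms by (auto simp: a_inv_def)
  qed (use assms in \<open>simp add: free_alg_simps\<close>)
qed (use assms in \<open>simp_all add: free_alg_simps\<close>)

lemma ideal_Null: "ideal Null free_alg"
proof (rule ideal_free_algI)
  fix x a assume x: "x \<in> Null" and a: "a \<in> FA"
  have "rep a (rep x \<Phi>) \<tau> = 0" if "\<tau> \<in> regch" for \<Phi> \<tau>
  proof -
    have "rep a (rep x \<Phi>) \<tau> = rep a (rep 0 \<Phi>) \<tau>"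
      using x that by (intro rep_cong[OF a]) (auto simp: Null_def)
    also have "\<dots> = rep (a * 0) \<Phi> \<tau>" by (simp only: rep_mult)
    finally show ?thesis by simp
  qed
  then show "a * x \<in> Null" "x * a \<in> Null"
    using x a by (auto simp: Null_def rep_mult FA_mult)
qed (auto simp: Null_def rep_add rep_uminus FA_add FA_uminus)

lemma rep_T_word: "rep (T_word \<alpha>s) \<Phi> = foldr Top \<alpha>s \<Phi>"
proof (induction \<alpha>s)
  case Nil then show ?case by (simp add: fun_eq_iff rep_1)
next
  case (Cons \<alpha> \<alpha>s)
  show ?case by (rule ext) (simp add: rep_mult rep_gT Cons)
qed

lemma foldr_alternating: "foldr Top (alternating m \<alpha> \<beta>) \<Phi> = alt (Top \<alpha>) (Top \<beta>) m \<Phi>"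
  by (induction m arbitrary: \<alpha> \<beta>) auto

lemma Top_quadratic:
  assumes "\<alpha> \<in> R" "\<tau> \<in> regch"
  shows "Top \<alpha> (Top \<alpha> \<Phi>) \<tau> = (q - inverse q) * Top \<alpha> \<Phi> \<tau> + \<Phi> \<tau>"
proof -
  have i: "\<tau> \<circ> refl \<alpha> \<circ> refl \<alpha> = \<tau>" using assms by (simp add: comp_assoc)
  have c: "cc \<alpha> (\<tau> \<circ> refl \<alpha>) = q + inverse q - cc \<alpha> \<tau>"
    using assms by (simp add: cc_refl refl_self cc_neg)
  define p where "p = inverse q"
  have "q * p = 1" by (simp add: p_def)
  then show ?thesis unfolding Top_eq i c p_def[symmetric] by Groebner_Basis.algebra
qed

lemma alternating_FA: "\<alpha> \<in> simple_roots \<Longrightarrow> \<beta> \<in> simple_roots \<Longrightarrow> T_word (alternating m \<alpha> \<beta>) \<in> FA"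
  using set_alternating[of m \<alpha> \<beta>] by (intro FA_T_word) auto

lemma relations_FA: "relations \<subseteq> FA"
unfolding relations_def dd_def[symmetric]
  by (auto intro!: FA_diff FA_add FA_mult FA_gX FA_gT FA_const FA_lift KK_diff alternating_FA
    weights_add weights_refl simple_R dd)

lemma relations_Null: "relations \<subseteq> Null"
proof -
  \<comment> \<open>At a regular character the divided difference becomes an actual quotient of
    scalars, because 1 - \<tau>(-\<alpha>) is nonzero.\<close>
  have cross: "rep (gX \<mu> * gT \<alpha> - (gT \<alpha> * gX (refl \<alpha> \<mu>) + const (q - inverse q) * lift_KP (dd \<alpha> \<mu>))) \<Phi> \<tau> = 0"
    if "\<mu> \<in> weights" "\<alpha> \<in> simple_roots" "\<tau> \<in> regch" for \<mu> \<alpha> \<Phi> \<tau>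
  proof -
    have a: "\<alpha> \<in> R" using that simple_R by auto
    have "ev \<tau> (dd \<alpha> \<mu> * (1 - xpow (- \<alpha>))) = ev \<tau> (dd \<alpha> \<mu>) * ev \<tau> (1 - xpow (- \<alpha>))"
      using dd[OF that(1) a] a KP_diff[OF KP_1 KP_xpow] weights_root neg_closed
      by (intro ev_mult that) (auto simp: KP_iff)
    moreover have "ev \<tau> (xpow \<nu>) = \<tau> \<nu>" for \<nu> by (simp add: xpow_def ev_single)
    moreover from this[of 0] have "ev \<tau> 1 = 1" using regch_0 that by simp
    ultimately have "ev \<tau> (dd \<alpha> \<mu>) * (1 - \<tau> (- \<alpha>)) = \<tau> \<mu> - \<tau> (refl \<alpha> \<mu>)"
      using dd(2)[OF that(1) a] by (simp add: ev_diff)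
    moreover have "1 - \<tau> (- \<alpha>) \<noteq> 0" using regch_root(1)[OF that(3) neg_closed[OF a]] by simp
    ultimately have e: "ev \<tau> (dd \<alpha> \<mu>) = (\<tau> \<mu> - \<tau> (refl \<alpha> \<mu>)) / (1 - \<tau> (- \<alpha>))" by (simp add: field_simps)
    show ?thesis using a
      by (simp add: rep_diff rep_add rep_mult rep_gX rep_gT rep_const rep_lift Top_eq e cc_def diff_divide_distrib algebra_simps)
  qed
  have braid: "rep (T_word (alternating (cox \<alpha> \<beta>) \<alpha> \<beta>) - T_word (alternating (cox \<alpha> \<beta>) \<beta> \<alpha>)) \<Phi> \<tau> = 0"
    if "\<alpha> \<in> simple_roots" "\<beta> \<in> simple_roots" "\<alpha> \<noteq> \<beta>" "\<tau> \<in> regch" for \<alpha> \<beta> \<Phi> \<tau>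
    using Top_braid[OF that] by (simp add: rep_diff rep_T_word foldr_alternating)
  have quad: "rep (gT \<alpha> * gT \<alpha> - (const (q - inverse q) * gT \<alpha> + 1)) \<Phi> \<tau> = 0"
    if "\<alpha> \<in> simple_roots" "\<tau> \<in> regch" for \<alpha> \<Phi> \<tau>
  proof -
    have "rep (gT \<alpha>) \<Phi> = Top \<alpha> \<Phi>" by (simp add: fun_eq_iff rep_gT)
    then show ?thesis
      using Top_quadratic[OF simple_R[OF that(1)] that(2)] by (simp add: rep_diff rep_add rep_mult rep_gT rep_const rep_1)
  qed
  show ?thesis
  proof
    fix f assume f: "f \<in> relations"
    then have "f \<in> FA" using relations_FA by auto
    moreover have "rep f \<Phi> \<tau> = 0" if "\<tau> \<in> regch" for \<Phi> \<tau>
      using f that cross braid quad unfolding relations_def dd_def[symmetric]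
      by (auto simp: rep_diff rep_mult rep_gX rep_1 regch_0 regch_add)
    ultimately show "f \<in> Null" by (simp add: Null_def)
  qed
qed

lemma ideal_rel: "ideal rel_ideal free_alg"
  unfolding rel_ideal_def by (rule ring.genideal_ideal[OF ring_free_alg relations_FA])

lemma rel_ideal_Null: "rel_ideal \<subseteq> Null"
  unfolding rel_ideal_def by (rule ring.genideal_minimal[OF ring_free_alg ideal_Null relations_Null])

lemma relations_rel: "relations \<subseteq> rel_ideal"
  unfolding rel_ideal_def by (rule ring.genideal_self[OF ring_free_alg relations_FA])

section \<open>Normal forms and the basis theorem\<close>

lemma act_superset:
  assumes "finite S" "Poly_Mapping.keys f \<subseteq> S"
  shows "act w f = (\<Sum>\<mu>\<in>S. Poly_Mapping.single (w \<mu>) (Poly_Mapping.lookup f \<mu>))"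
  unfolding act_def using assms by (intro sum.mono_neutral_left) (auto simp: in_keys_iff)

lemma act_add: "act w (f + g) = act w f + act w g"
proof -
  let ?S = "Poly_Mapping.keys f \<union> Poly_Mapping.keys g"
  have "act w (f + g) = (\<Sum>\<mu>\<in>?S. Poly_Mapping.single (w \<mu>) (Poly_Mapping.lookup (f + g) \<mu>))"
    by (intro act_superset) (use keys_add[of f g] in auto)
  then show ?thesis using act_superset[of ?S f w] act_superset[of ?S g w]
    by (simp add: lookup_add single_add sum.distrib)
qed

lemma act_uminus: "act w (- f) = - act w f"
  by (simp add: act_def single_uminus sum_negf)

lemma act_diff: "act w (f - g) = act w f - act w g"
  using act_add[of w f "- g"] by (simp add: act_uminus)

lemma act_0 [simp]: "act w 0 = 0" by (simp add: act_def)

lemma act_sum: "act w (sum f I) = (\<Sum>i\<in>I. act w (f i))"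
  by (induction I rule: infinite_finite_induct) (auto simp: act_add)

lemma act_single: "act w (Poly_Mapping.single \<mu> k) = Poly_Mapping.single (w \<mu>) k"
  by (simp add: act_def)

lemma act_xpow: "act w (xpow \<mu>) = xpow (w \<mu>)"
  by (simp add: xpow_def act_single)

lemma act_comp: "act (v \<circ> w) f = act v (act w f)"
  by (simp add: act_def[of w f] act_sum act_single) (simp add: act_def)

lemma act_id [simp]: "act id f = f"
  unfolding act_def using poly_mapping_sum_singles[of f] by simp

lemma act_mult: assumes "w \<in> weyl" shows "act w (f * g) = act w f * act w g"
  unfolding mult_singles[of f g]
  by (simp add: act_sum act_single weyl_add[OF assms], simp add: act_def sum_product mult_single)

lemma act_1: "w \<in> weyl \<Longrightarrow> act w 1 = 1"
  using act_xpow[of w 0] by (simp add: weyl_zero)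

lemma KP_act: assumes "w \<in> weyl" "f \<in> KP" shows "act w f \<in> KP"
  unfolding act_def using assms weights_weyl by (intro KP_sum KP_single) (auto simp: KP_iff)

lemma act_refl_refl: "\<alpha> \<in> R \<Longrightarrow> act (refl \<alpha>) (act (refl \<alpha>) f) = f"
  using act_comp[of "refl \<alpha>" "refl \<alpha>" f] by simp

text \<open>The divided difference of f, assembled termwise because the defining relations provide
  it for single exponents.\<close>

definition DD :: "'v \<Rightarrow> ('v \<Rightarrow>\<^sub>0 scalar) \<Rightarrow> ('v \<Rightarrow>\<^sub>0 scalar)" where
  "DD \<alpha> f = (\<Sum>\<mu>\<in>Poly_Mapping.keys f. Poly_Mapping.single 0 (Poly_Mapping.lookup f \<mu>) * dd \<alpha> \<mu>)"

lemma KP_DD: "f \<in> KP \<Longrightarrow> \<alpha> \<in> R \<Longrightarrow> DD \<alpha> f \<in> KP"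
  unfolding DD_def by (intro KP_sum KP_mult KP_single dd) (auto simp: KP_iff)

lemma DD:
  assumes "f \<in> KP" "\<alpha> \<in> R"
  shows "DD \<alpha> f * (1 - xpow (- \<alpha>)) = f - act (refl \<alpha>) f"
proof -
  have "DD \<alpha> f * (1 - xpow (- \<alpha>))
      = (\<Sum>\<mu>\<in>Poly_Mapping.keys f. Poly_Mapping.single 0 (Poly_Mapping.lookup f \<mu>) * (dd \<alpha> \<mu> * (1 - xpow (- \<alpha>))))"
    by (simp add: DD_def sum_distrib_right mult.assoc)
  also have "\<dots> = (\<Sum>\<mu>\<in>Poly_Mapping.keys f. Poly_Mapping.single \<mu> (Poly_Mapping.lookup f \<mu>)
      - Poly_Mapping.single (refl \<alpha> \<mu>) (Poly_Mapping.lookup f \<mu>))"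
  proof (rule sum.cong)
    fix \<mu> assume "\<mu> \<in> Poly_Mapping.keys f"
    then have "\<mu> \<in> weights" using assms by (auto simp: KP_iff)
    then show "Poly_Mapping.single 0 (Poly_Mapping.lookup f \<mu>) * (dd \<alpha> \<mu> * (1 - xpow (- \<alpha>)))
        = Poly_Mapping.single \<mu> (Poly_Mapping.lookup f \<mu>) - Poly_Mapping.single (refl \<alpha> \<mu>) (Poly_Mapping.lookup f \<mu>)"
      unfolding dd(2)[OF \<open>\<mu> \<in> weights\<close> assms(2)] by (simp add: right_diff_distrib xpow_def mult_single)
  qed simp
  also have "\<dots> = f - act (refl \<alpha>) f"
    using poly_mapping_sum_singles[of f] by (simp add: sum_subtractf act_def)
  finally show ?thesis .
qed

lemma rel_closed: "0 \<in> rel_ideal" "x \<in> rel_ideal \<Longrightarrow> y \<in> rel_ideal \<Longrightarrow> x + y \<in> rel_ideal"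
  "x \<in> rel_ideal \<Longrightarrow> - x \<in> rel_ideal" "x \<in> rel_ideal \<Longrightarrow> a \<in> FA \<Longrightarrow> a * x \<in> rel_ideal"
  "x \<in> rel_ideal \<Longrightarrow> a \<in> FA \<Longrightarrow> x * a \<in> rel_ideal" "x \<in> rel_ideal \<Longrightarrow> x \<in> FA"
proof -
  interpret i: ideal rel_ideal free_alg by (rule ideal_rel)
  show "0 \<in> rel_ideal" using additive_subgroup.zero_closed[OF i.is_additive_subgroup] by (simp add: free_alg_simps)
  show "x \<in> rel_ideal \<Longrightarrow> y \<in> rel_ideal \<Longrightarrow> x + y \<in> rel_ideal" using additive_subgroup.a_closed[OF i.is_additive_subgroup] by (simp add: free_alg_simps)
  show FA: "x \<in> rel_ideal \<Longrightarrow> x \<in> FA" using i.a_subset by auto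
  show "x \<in> rel_ideal \<Longrightarrow> - x \<in> rel_ideal" using i.I_l_closed[of x "- 1"] FA_uminus[OF FA_1] by (simp add: free_alg_simps)
  show "x \<in> rel_ideal \<Longrightarrow> a \<in> FA \<Longrightarrow> a * x \<in> rel_ideal" "x \<in> rel_ideal \<Longrightarrow> a \<in> FA \<Longrightarrow> x * a \<in> rel_ideal"
    using i.I_l_closed i.I_r_closed by (simp_all add: free_alg_simps)
qed

section \<open>Calculus modulo the relations\<close>

definition heq :: "('v gen word \<Rightarrow>\<^sub>0 scalar) \<Rightarrow> ('v gen word \<Rightarrow>\<^sub>0 scalar) \<Rightarrow> bool" (infix "\<doteq>" 50) where
  "f \<doteq> g \<longleftrightarrow> f - g \<in> rel_ideal"

lemma heq_refl [simp]: "f \<doteq> f" by (simp add: heq_def rel_closed)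

lemma heq_sym: "f \<doteq> g \<Longrightarrow> g \<doteq> f"
  using rel_closed(3)[of "f - g"] by (simp add: heq_def)

lemma heq_trans [trans]: "f \<doteq> g \<Longrightarrow> g \<doteq> h \<Longrightarrow> f \<doteq> h"
  using rel_closed(2)[of "f - g" "g - h"] by (simp add: heq_def)

lemma heq_add: "f \<doteq> f' \<Longrightarrow> g \<doteq> g' \<Longrightarrow> f + g \<doteq> f' + g'"
  using rel_closed(2)[of "f - f'" "g - g'"] by (simp add: heq_def algebra_simps)

lemma heq_uminus: "f \<doteq> f' \<Longrightarrow> - f \<doteq> - f'"
  using rel_closed(3)[of "f - f'"] by (simp add: heq_def)

lemma heq_diff: "f \<doteq> f' \<Longrightarrow> g \<doteq> g' \<Longrightarrow> f - g \<doteq> f' - g'"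
  using heq_add[of f f' "- g" "- g'"] heq_uminus by simp

lemma heq_lmult: "f \<doteq> f' \<Longrightarrow> a \<in> FA \<Longrightarrow> a * f \<doteq> a * f'"
  using rel_closed(4)[of "f - f'" a] by (simp add: heq_def right_diff_distrib)

lemma heq_rmult: "f \<doteq> f' \<Longrightarrow> a \<in> FA \<Longrightarrow> f * a \<doteq> f' * a"
  using rel_closed(5)[of "f - f'" a] by (simp add: heq_def left_diff_distrib)

lemma heq_mult: "f \<doteq> f' \<Longrightarrow> g \<doteq> g' \<Longrightarrow> f' \<in> FA \<Longrightarrow> g \<in> FA \<Longrightarrow> f * g \<doteq> f' * g'"
  using heq_trans[OF heq_rmult heq_lmult] by blast

lemma heq_sum: "(\<And>i. i \<in> I \<Longrightarrow> f i \<doteq> g i) \<Longrightarrow> sum f I \<doteq> sum g I"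
  by (induction I rule: infinite_finite_induct) (auto simp: heq_add)

lemma heq_rep: "f \<doteq> g \<Longrightarrow> \<tau> \<in> regch \<Longrightarrow> rep f \<Phi> \<tau> = rep g \<Phi> \<tau>"
  using rel_ideal_Null by (auto simp: heq_def Null_def rep_diff)

lemma heq_relI: "f - g \<in> relations \<Longrightarrow> f \<doteq> g"
  using relations_rel by (auto simp: heq_def)

lemma heq_braid: "\<alpha> \<in> simple_roots \<Longrightarrow> \<beta> \<in> simple_roots \<Longrightarrow> \<alpha> \<noteq> \<beta> \<Longrightarrow>
    T_word (alternating (cox \<alpha> \<beta>) \<alpha> \<beta>) \<doteq> T_word (alternating (cox \<alpha> \<beta>) \<beta> \<alpha>)"
  and heq_quad: "\<alpha> \<in> simple_roots \<Longrightarrow> gT \<alpha> * gT \<alpha> \<doteq> const (q - inverse q) * gT \<alpha> + 1"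
  and heq_X0: "gX 0 \<doteq> 1"
  and heq_X: "\<mu> \<in> weights \<Longrightarrow> \<nu> \<in> weights \<Longrightarrow> gX \<mu> * gX \<nu> \<doteq> gX (\<mu> + \<nu>)"
  and heq_cross: "\<mu> \<in> weights \<Longrightarrow> \<alpha> \<in> simple_roots \<Longrightarrow>
    gX \<mu> * gT \<alpha> \<doteq> gT \<alpha> * gX (refl \<alpha> \<mu>) + const (q - inverse q) * lift_KP (dd \<alpha> \<mu>)"
  by (rule heq_relI; force simp: relations_def dd_def)+

lemmas gX_const = const_left_commute[of "gX \<mu>" for \<mu>]
lemmas gT_const = const_left_commute[of "gT \<alpha>" for \<alpha>]
lemmas Tw_const = const_left_commute[of "Tw w" for w]

lemma lift_mult: assumes "f \<in> KP" "g \<in> KP" shows "lift_KP (f * g) \<doteq> lift_KP f * lift_KP g"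
proof -
  let ?F = "Poly_Mapping.keys f" and ?G = "Poly_Mapping.keys g" and ?f = "Poly_Mapping.lookup f" and ?g = "Poly_Mapping.lookup g"
  have "lift_KP (f * g) = (\<Sum>i\<in>?F. \<Sum>j\<in>?G. const (?f i * ?g j) * gX (i + j))"
    unfolding mult_singles[of f g] by (simp add: lift_sum lift_single)
  also have "\<dots> \<doteq> (\<Sum>i\<in>?F. \<Sum>j\<in>?G. const (?f i * ?g j) * (gX i * gX j))"
    using assms by (intro heq_sum heq_lmult heq_sym[OF heq_X] FA_const KK_mult) (auto simp: KP_iff)
  also have "(\<Sum>i\<in>?F. \<Sum>j\<in>?G. const (?f i * ?g j) * (gX i * gX j)) = lift_KP f * lift_KP g"
    by (simp add: lift_KP_def sum_product const_simps mult.assoc gX_const)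
  finally show ?thesis .
qed

lemma lift_1: "lift_KP 1 \<doteq> 1"
  using lift_xpow[of 0] heq_X0 by simp

abbreviation hh :: scalar where "hh \<equiv> q - inverse q"

lemma KK_hh: "hh \<in> KK" by (simp add: KK_diff)

lemma lift_cross:
  assumes "f \<in> KP" "\<alpha> \<in> simple_roots"
  shows "lift_KP f * gT \<alpha> \<doteq> gT \<alpha> * lift_KP (act (refl \<alpha>) f) + const hh * lift_KP (DD \<alpha> f)"
proof -
  let ?F = "Poly_Mapping.keys f" and ?f = "Poly_Mapping.lookup f"
  have "lift_KP f * gT \<alpha> = (\<Sum>\<mu>\<in>?F. const (?f \<mu>) * (gX \<mu> * gT \<alpha>))"
    by (simp add: lift_KP_def sum_distrib_right mult.assoc)
  also have "\<dots> \<doteq> (\<Sum>\<mu>\<in>?F. const (?f \<mu>) * (gT \<alpha> * gX (refl \<alpha> \<mu>) + const hh * lift_KP (dd \<alpha> \<mu>)))"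
    using assms by (intro heq_sum heq_lmult heq_cross FA_const) (auto simp: KP_iff)
  also have "(\<Sum>\<mu>\<in>?F. const (?f \<mu>) * (gT \<alpha> * gX (refl \<alpha> \<mu>) + const hh * lift_KP (dd \<alpha> \<mu>)))
      = gT \<alpha> * lift_KP (act (refl \<alpha>) f) + const hh * lift_KP (DD \<alpha> f)"
    by (simp add: act_def DD_def lift_sum lift_single lift_scale sum_distrib_left distrib_left sum.distrib
      gT_const const_left_commute[of "const hh"])
  finally show ?thesis .
qed

text \<open>The crossing relation for the reflected f, solved for the term with T_\<alpha> on the
  left.\<close>

lemma lift_cross_left:
  assumes "f \<in> KP" "\<alpha> \<in> simple_roots"
  shows "gT \<alpha> * lift_KP f \<doteq> lift_KP (act (refl \<alpha>) f) * gT \<alpha> - const hh * lift_KP (DD \<alpha> (act (refl \<alpha>) f))"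
proof -
  have a: "\<alpha> \<in> R" using assms simple_R by auto
  have "lift_KP (act (refl \<alpha>) f) * gT \<alpha> \<doteq> gT \<alpha> * lift_KP f + const hh * lift_KP (DD \<alpha> (act (refl \<alpha>) f))"
    using lift_cross[OF KP_act[OF weyl_refl[OF a] assms(1)] assms(2)] by (simp add: act_refl_refl a)
  from heq_diff[OF this heq_refl[of "const hh * lift_KP (DD \<alpha> (act (refl \<alpha>) f))"]]
  show ?thesis by (simp add: heq_sym)
qed

text \<open>Matsumoto's theorem for the congruence, which makes the choice of a reduced word in
  \<open>Tw\<close> harmless.\<close>

lemma T_word_heq:
  assumes "reduced_word a w" "reduced_word b w" shows "T_word a \<doteq> T_word b"
  by (rule matsumoto[where E = "\<lambda>a b. T_word a \<doteq> T_word b", OF _ _ _ _ _ _ assms])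
    (auto intro: heq_sym heq_trans heq_lmult heq_rmult heq_braid FA_gT simp: T_word_append)

definition rw :: "('v \<Rightarrow> 'v) \<Rightarrow> 'v list" where "rw w = (SOME \<alpha>s. reduced_word \<alpha>s w)"

lemma Tw_rw: "Tw w = T_word (rw w)" by (simp add: Tw_def rw_def)

lemma reduced_rw: "w \<in> weyl \<Longrightarrow> reduced_word (rw w) w"
  unfolding rw_def using reduced_word_exists by (rule someI_ex)

lemma FA_Tw: "w \<in> weyl \<Longrightarrow> Tw w \<in> FA"
  using reduced_rw unfolding Tw_rw by (intro FA_T_word) (auto simp: reduced_word_def)

lemma Tw_heq: "reduced_word a w \<Longrightarrow> w \<in> weyl \<Longrightarrow> T_word a \<doteq> Tw w"
  unfolding Tw_rw using T_word_heq reduced_rw by blast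

lemma Tw_id: "Tw id \<doteq> 1"
  using Tw_heq[of "[]" id] by (simp add: reduced_word_def heq_sym)

lemma gT_Tw_up:
  assumes "w \<in> weyl" "\<beta> \<in> simple_roots" "winv w \<beta> \<in> Rp"
  shows "gT \<beta> * Tw w \<doteq> Tw (refl \<beta> \<circ> w)"
proof -
  have "reduced_word (\<beta> # rw w) (refl \<beta> \<circ> w)"
    using reduced_rw[OF assms(1)] len_refl_left_pos[OF assms] assms by (auto simp: reduced_word_def)
  from Tw_heq[OF this] show ?thesis using assms weyl_comp weyl_refl simple_R by (simp add: Tw_rw)
qed

text \<open>Write \<open>Tw w\<close> as T_\<beta> times the element of a shorter word and apply the
  quadratic relation.\<close>

lemma gT_Tw_down:
  assumes w: "w \<in> weyl" and b: "\<beta> \<in> simple_roots" and "winv w \<beta> \<notin> Rp"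
  shows "gT \<beta> * Tw w \<doteq> const hh * Tw w + Tw (refl \<beta> \<circ> w)"
proof -
  let ?v = "refl \<beta> \<circ> w"
  have bR: "\<beta> \<in> R" using b simple_R by auto
  have v: "?v \<in> weyl" using w bR weyl_comp weyl_refl by auto
  have bv: "refl \<beta> \<circ> ?v = w" using bR by (simp add: comp_assoc[symmetric])
  have "reduced_word (\<beta> # rw ?v) w"
    using reduced_rw[OF v] len_refl_left_neg[OF assms] b bv by (auto simp: reduced_word_def)
  from Tw_heq[OF this w] have 1: "gT \<beta> * Tw ?v \<doteq> Tw w" by (simp add: Tw_rw)
  have "gT \<beta> * Tw w \<doteq> gT \<beta> * (gT \<beta> * Tw ?v)"
    by (intro heq_lmult heq_sym[OF 1] FA_gT b)
  also have "gT \<beta> * (gT \<beta> * Tw ?v) = (gT \<beta> * gT \<beta>) * Tw ?v" by (simp add: mult.assoc)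
  also have "\<dots> \<doteq> (const hh * gT \<beta> + 1) * Tw ?v"
    by (intro heq_rmult heq_quad b FA_Tw v)
  also have "(const hh * gT \<beta> + 1) * Tw ?v = const hh * (gT \<beta> * Tw ?v) + Tw ?v"
    by (simp add: distrib_right mult.assoc)
  also have "\<dots> \<doteq> const hh * Tw w + Tw ?v"
    by (intro heq_add heq_lmult 1 FA_const KK_hh) simp
  finally show ?thesis .
qed

lemma Tw_gT_up:
  assumes "w \<in> weyl" "\<beta> \<in> simple_roots" "w \<beta> \<in> Rp"
  shows "Tw w * gT \<beta> \<doteq> Tw (w \<circ> refl \<beta>)"
proof -
  have "reduced_word (rw w @ [\<beta>]) (w \<circ> refl \<beta>)"
    using reduced_rw[OF assms(1)] len_refl_pos[OF assms] assms by (auto simp: reduced_word_def)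
  from Tw_heq[OF this] show ?thesis using assms weyl_comp weyl_refl simple_R by (simp add: Tw_rw T_word_append)
qed

lemma Tw_gT_down:
  assumes w: "w \<in> weyl" and b: "\<beta> \<in> simple_roots" and "w \<beta> \<notin> Rp"
  shows "Tw w * gT \<beta> \<doteq> const hh * Tw w + Tw (w \<circ> refl \<beta>)"
proof -
  let ?v = "w \<circ> refl \<beta>"
  have bR: "\<beta> \<in> R" using b simple_R by auto
  have v: "?v \<in> weyl" using w bR weyl_comp weyl_refl by auto
  have bv: "?v \<circ> refl \<beta> = w" using bR by (simp add: comp_assoc)
  have "reduced_word (rw ?v @ [\<beta>]) w"
    using reduced_rw[OF v] len_refl_neg[OF assms] b bv by (auto simp: reduced_word_def)
  from Tw_heq[OF this w] have 1: "Tw ?v * gT \<beta> \<doteq> Tw w" by (simp add: Tw_rw T_word_append)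
  have "Tw w * gT \<beta> \<doteq> (Tw ?v * gT \<beta>) * gT \<beta>"
    by (intro heq_rmult heq_sym[OF 1] FA_gT b)
  also have "(Tw ?v * gT \<beta>) * gT \<beta> = Tw ?v * (gT \<beta> * gT \<beta>)" by (simp add: mult.assoc)
  also have "\<dots> \<doteq> Tw ?v * (const hh * gT \<beta> + 1)"
    by (intro heq_lmult heq_quad b FA_Tw v)
  also have "Tw ?v * (const hh * gT \<beta> + 1) = const hh * (Tw ?v * gT \<beta>) + Tw ?v"
    by (simp add: distrib_left Tw_const)
  also have "\<dots> \<doteq> const hh * Tw w + Tw ?v"
    by (intro heq_add heq_lmult 1 FA_const KK_hh) simp
  finally show ?thesis .
qed

section \<open>Spanning by the elements x^\<lambda> T_w\<close>

definition NFsum :: "(('v \<Rightarrow> 'v) \<Rightarrow> ('v \<Rightarrow>\<^sub>0 scalar)) \<Rightarrow> ('v gen word \<Rightarrow>\<^sub>0 scalar)" where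
  "NFsum c = (\<Sum>w\<in>weyl. lift_KP (c w) * Tw w)"

definition NF :: "('v gen word \<Rightarrow>\<^sub>0 scalar) \<Rightarrow> bool" where
  "NF f \<longleftrightarrow> (\<exists>c. (\<forall>w\<in>weyl. c w \<in> KP) \<and> f \<doteq> NFsum c)"

lemma NF_heq: "f \<doteq> g \<Longrightarrow> NF g \<Longrightarrow> NF f"
  unfolding NF_def using heq_trans by blast

lemma NF_add: assumes "NF f" "NF g" shows "NF (f + g)"
proof -
  obtain c d where "\<forall>w\<in>weyl. c w \<in> KP" "f \<doteq> NFsum c" "\<forall>w\<in>weyl. d w \<in> KP" "g \<doteq> NFsum d"
    using assms by (auto simp: NF_def)
  then show ?thesis unfolding NF_def
    by (intro exI[of _ "\<lambda>w. c w + d w"]) (auto simp: KP_add NFsum_def lift_add distrib_right sum.distrib intro: heq_add[unfolded NFsum_def])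
qed

lemma NF_sum: "finite I \<Longrightarrow> (\<And>i. i \<in> I \<Longrightarrow> NF (f i)) \<Longrightarrow> NF (sum f I)"
proof (induction I rule: finite_induct)
  case empty
  show ?case unfolding NF_def by (intro exI[of _ "\<lambda>_. 0"]) (simp add: NFsum_def)
next
  case (insert x F)
  then show ?case by (simp add: NF_add)
qed

lemma NF_lift_Tw: assumes "g \<in> KP" "w \<in> weyl" shows "NF (lift_KP g * Tw w)"
proof -
  have "NFsum (\<lambda>v. if v = w then g else 0) = (\<Sum>v\<in>weyl. if v = w then lift_KP g * Tw v else 0)"
    unfolding NFsum_def by (rule sum.cong) auto
  then have "lift_KP g * Tw w = NFsum (\<lambda>v. if v = w then g else 0)" using assms finite_weyl by simp
  then show ?thesis unfolding NF_def using assms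
    by (intro exI[of _ "\<lambda>v. if v = w then g else 0"]) auto
qed

lemma NF_lift: assumes "g \<in> KP" "NF f" shows "NF (lift_KP g * f)"
proof -
  obtain c where c: "\<forall>w\<in>weyl. c w \<in> KP" "f \<doteq> NFsum c" using assms by (auto simp: NF_def)
  have "lift_KP g * f \<doteq> lift_KP g * NFsum c" using c by (intro heq_lmult FA_lift assms)
  also have "lift_KP g * NFsum c = (\<Sum>w\<in>weyl. (lift_KP g * lift_KP (c w)) * Tw w)"
    by (simp add: NFsum_def sum_distrib_left mult.assoc)
  also have "\<dots> \<doteq> (\<Sum>w\<in>weyl. lift_KP (g * c w) * Tw w)"
    using c assms by (intro heq_sum heq_rmult heq_sym[OF lift_mult] FA_Tw) auto
  finally show ?thesis unfolding NF_def NFsum_def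
    using c assms by (intro exI[of _ "\<lambda>w. g * c w"]) (auto simp: KP_mult)
qed

text \<open>T_\<alpha> is moved past the coefficient by \<open>lift_cross_left\<close> and then
  multiplied with \<open>Tw w\<close>, which produces one or two basis elements.\<close>

lemma NF_gT: assumes "\<alpha> \<in> simple_roots" "NF f" shows "NF (gT \<alpha> * f)"
proof -
  have a: "\<alpha> \<in> R" using assms simple_R by auto
  obtain c where c: "\<forall>w\<in>weyl. c w \<in> KP" "f \<doteq> NFsum c" using assms by (auto simp: NF_def)
  have "gT \<alpha> * f \<doteq> gT \<alpha> * NFsum c" using c by (intro heq_lmult FA_gT assms)
  moreover have "gT \<alpha> * NFsum c = (\<Sum>w\<in>weyl. (gT \<alpha> * lift_KP (c w)) * Tw w)"
    by (simp add: NFsum_def sum_distrib_left mult.assoc)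
  moreover have "NF (\<Sum>w\<in>weyl. (gT \<alpha> * lift_KP (c w)) * Tw w)"
  proof (rule NF_sum[OF finite_weyl])
    fix w assume w: "w \<in> weyl"
    let ?s = "act (refl \<alpha>) (c w)"
    have s: "?s \<in> KP" using c w a KP_act weyl_refl by auto
    have v: "refl \<alpha> \<circ> w \<in> weyl" using w a weyl_comp weyl_refl by auto
    have g: "- (Poly_Mapping.single 0 hh * DD \<alpha> ?s) \<in> KP"
      using KP_DD[OF s a] by (intro KP_uminus KP_mult KP_single KK_hh) auto
    have "(gT \<alpha> * lift_KP (c w)) * Tw w
        \<doteq> (lift_KP ?s * gT \<alpha> - const hh * lift_KP (DD \<alpha> ?s)) * Tw w"
      using c w assms by (intro heq_rmult lift_cross_left FA_Tw) auto
    also have "(lift_KP ?s * gT \<alpha> - const hh * lift_KP (DD \<alpha> ?s)) * Tw w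
        = lift_KP ?s * (gT \<alpha> * Tw w) + lift_KP (- (Poly_Mapping.single 0 hh * DD \<alpha> ?s)) * Tw w"
      by (simp add: lift_uminus lift_scale algebra_simps)
    finally have 1: "(gT \<alpha> * lift_KP (c w)) * Tw w \<doteq> lift_KP ?s * (gT \<alpha> * Tw w) + lift_KP (- (Poly_Mapping.single 0 hh * DD \<alpha> ?s)) * Tw w" .
    have one: "NF (Tw u)" if "u \<in> weyl" for u
      using NF_heq[OF heq_sym[OF heq_rmult[OF lift_1 FA_Tw[OF that]]] ] NF_lift_Tw[OF KP_1 that]
        NF_heq[OF heq_rmult[OF heq_sym[OF lift_1] FA_Tw[OF that]]] by simp
    have "NF (gT \<alpha> * Tw w)"
    proof (cases "winv w \<alpha> \<in> Rp")
      case True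
      then show ?thesis using NF_heq[OF gT_Tw_up[OF w assms(1)]] one v by blast
    next
      case False
      have "const hh * Tw w = lift_KP (Poly_Mapping.single 0 hh) * Tw w + (const hh - lift_KP (Poly_Mapping.single 0 hh)) * Tw w"
        by (simp add: algebra_simps)
      have "const hh * Tw w \<doteq> lift_KP (Poly_Mapping.single 0 hh) * Tw w"
      proof -
        have "const hh * 1 \<doteq> const hh * gX 0" by (intro heq_lmult heq_sym[OF heq_X0] FA_const KK_hh)
        then show ?thesis by (intro heq_rmult FA_Tw w) (simp add: lift_single)
      qed
      then have "NF (const hh * Tw w)"
        using NF_heq NF_lift_Tw[OF KP_single[OF weights_0 KK_hh] w] by blast
      then have "NF (const hh * Tw w + Tw (refl \<alpha> \<circ> w))" using NF_add one[OF v] by blast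
      then show ?thesis using NF_heq[OF gT_Tw_down[OF w assms(1) False]] by blast
    qed
    then show "NF ((gT \<alpha> * lift_KP (c w)) * Tw w)"
      using NF_heq[OF 1] NF_add NF_lift[OF s] NF_lift_Tw[OF g w] by blast
  qed
  ultimately show ?thesis using NF_heq by auto
qed

lemma NF_1: "NF 1"
proof -
  have "1 * 1 \<doteq> lift_KP 1 * Tw id"
    using FA_lift[OF KP_1] by (intro heq_mult heq_sym[OF lift_1] heq_sym[OF Tw_id]) auto
  then show ?thesis using NF_heq NF_lift_Tw[OF KP_1 weyl_id] by (metis mult_1)
qed

text \<open>Normal forms include 1 and are stable under left multiplication by every generator, so
  they exhaust all words.\<close>

lemma NF_all: assumes "f \<in> FA" shows "NF f"
proof -
  have word: "NF (Poly_Mapping.single (Word l) 1)" if "set l \<subseteq> gens" for l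
    using that
  proof (induction l)
    case Nil
    then show ?case using NF_1 single_one[where 'a = "'v gen word" and 'b = scalar] by (simp add: zero_word_def)
  next
    case (Cons g l)
    have e: "Poly_Mapping.single (Word (g # l)) 1 = Poly_Mapping.single (Word [g]) 1 * Poly_Mapping.single (Word l) (1::scalar)"
      by (simp add: mult_single plus_word_def)
    have IH: "NF (Poly_Mapping.single (Word l) 1)" using Cons by auto
    have "g \<in> gens" using Cons.prems by auto
    then consider \<mu> where "g = X_gen \<mu>" "\<mu> \<in> weights" | \<alpha> where "g = T_gen \<alpha>" "\<alpha> \<in> simple_roots"
      by (auto simp: gens_def)
    then show ?case
    proof cases
      case 1
      show ?thesis using NF_lift[OF KP_xpow[OF 1(2)] IH] unfolding e unfolding 1(1) lift_xpow gX_def .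
    next
      case 2
      show ?thesis using NF_gT[OF 2(2) IH] unfolding e unfolding 2(1) gT_def .
    qed
  qed
  have "f = (\<Sum>u\<in>Poly_Mapping.keys f. const (Poly_Mapping.lookup f u) * Poly_Mapping.single u 1)"
    by (subst poly_mapping_sum_singles) (simp add: const_def mult_single)
  moreover have "NF (\<Sum>u\<in>Poly_Mapping.keys f. const (Poly_Mapping.lookup f u) * Poly_Mapping.single u 1)"
  proof (rule NF_sum)
    fix u assume u: "u \<in> Poly_Mapping.keys f"
    then have l: "set (letters u) \<subseteq> gens" and k: "Poly_Mapping.lookup f u \<in> KK" using assms by (auto simp: FA_iff)
    have s: "Poly_Mapping.single u (1::scalar) \<in> FA" using l by (intro FA_single) auto
    have "const (Poly_Mapping.lookup f u) * 1 \<doteq> const (Poly_Mapping.lookup f u) * gX 0"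
      by (intro heq_lmult heq_sym[OF heq_X0] FA_const k)
    then have "const (Poly_Mapping.lookup f u) * Poly_Mapping.single u 1
        \<doteq> lift_KP (Poly_Mapping.single 0 (Poly_Mapping.lookup f u)) * Poly_Mapping.single u 1"
      by (intro heq_rmult s) (simp add: lift_single)
    moreover have "NF (lift_KP (Poly_Mapping.single 0 (Poly_Mapping.lookup f u)) * Poly_Mapping.single u 1)"
      using NF_lift[OF KP_single[OF weights_0 k]] word[OF l] by simp
    ultimately show "NF (const (Poly_Mapping.lookup f u) * Poly_Mapping.single u 1)" using NF_heq by blast
  qed simp
  ultimately show ?thesis by simp
qed

section \<open>Linear independence\<close>

fun rcoef :: "'v list \<Rightarrow> ('v \<Rightarrow> 'v) \<Rightarrow> ('v \<Rightarrow> scalar) \<Rightarrow> scalar" where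
  "rcoef [] w \<tau> = (if w = id then 1 else 0)"
| "rcoef (\<alpha> # \<alpha>s) w \<tau> = (cc \<alpha> \<tau> - inverse q) * rcoef \<alpha>s w \<tau>
    + (q + inverse q - cc \<alpha> \<tau>) * rcoef \<alpha>s (refl \<alpha> \<circ> w) (\<tau> \<circ> refl \<alpha>)"

text \<open>\<open>rcoef\<close> is the coefficient of evaluation at
  \<open>\<tau> \<circ> w\<close>. Its recursion is \<open>Top_eq\<close>, with w replaced by
  \<open>refl \<alpha> \<circ> w\<close> in the second term.\<close>

lemma rep_T_word_rcoef:
  assumes "set \<alpha>s \<subseteq> R"
  shows "rep (T_word \<alpha>s) \<Phi> \<tau> = (\<Sum>w\<in>weyl. rcoef \<alpha>s w \<tau> * \<Phi> (\<tau> \<circ> w))"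
  using assms
proof (induction \<alpha>s arbitrary: \<tau>)
  case Nil
  have "(\<Sum>w\<in>weyl. rcoef [] w \<tau> * \<Phi> (\<tau> \<circ> w)) = (\<Sum>w\<in>weyl. if w = id then \<Phi> (\<tau> \<circ> w) else 0)"
    by (rule sum.cong) auto
  also have "\<dots> = \<Phi> \<tau>" using finite_weyl weyl_id by (simp del: weyl_id)
  finally show ?case by (simp add: rep_1 comp_def)
next
  case (Cons \<alpha> \<alpha>s)
  have a: "\<alpha> \<in> R" using Cons by auto
  have bij: "bij_betw (\<lambda>w. refl \<alpha> \<circ> w) weyl weyl"
    by (rule bij_betw_byWitness[where f' = "\<lambda>w. refl \<alpha> \<circ> w"])
      (use a weyl_comp weyl_refl in \<open>auto simp: comp_assoc[symmetric]\<close>)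
  have "rep (T_word \<alpha>s) \<Phi> (\<tau> \<circ> refl \<alpha>) = (\<Sum>w\<in>weyl. rcoef \<alpha>s w (\<tau> \<circ> refl \<alpha>) * \<Phi> (\<tau> \<circ> refl \<alpha> \<circ> w))"
    by (rule Cons.IH) (use Cons.prems in auto)
  also have "\<dots> = (\<Sum>w\<in>weyl. rcoef \<alpha>s (refl \<alpha> \<circ> w) (\<tau> \<circ> refl \<alpha>) * \<Phi> (\<tau> \<circ> refl \<alpha> \<circ> (refl \<alpha> \<circ> w)))"
    by (rule sum.reindex_bij_betw[OF bij, symmetric])
  also have "\<dots> = (\<Sum>w\<in>weyl. rcoef \<alpha>s (refl \<alpha> \<circ> w) (\<tau> \<circ> refl \<alpha>) * \<Phi> (\<tau> \<circ> w))"
  proof (rule sum.cong)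
    fix w :: "'v \<Rightarrow> 'v"
    have "\<tau> \<circ> refl \<alpha> \<circ> (refl \<alpha> \<circ> w) = \<tau> \<circ> (refl \<alpha> \<circ> refl \<alpha>) \<circ> w" by (simp add: comp_assoc del: refl_comp_self)
    then show "rcoef \<alpha>s (refl \<alpha> \<circ> w) (\<tau> \<circ> refl \<alpha>) * \<Phi> (\<tau> \<circ> refl \<alpha> \<circ> (refl \<alpha> \<circ> w))
        = rcoef \<alpha>s (refl \<alpha> \<circ> w) (\<tau> \<circ> refl \<alpha>) * \<Phi> (\<tau> \<circ> w)" using a by simp
  qed simp
  finally have r: "rep (T_word \<alpha>s) \<Phi> (\<tau> \<circ> refl \<alpha>) = (\<Sum>w\<in>weyl. rcoef \<alpha>s (refl \<alpha> \<circ> w) (\<tau> \<circ> refl \<alpha>) * \<Phi> (\<tau> \<circ> w))" .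
  have "rep (T_word (\<alpha> # \<alpha>s)) \<Phi> \<tau> = (cc \<alpha> \<tau> - inverse q) * rep (T_word \<alpha>s) \<Phi> \<tau>
      + (q + inverse q - cc \<alpha> \<tau>) * rep (T_word \<alpha>s) \<Phi> (\<tau> \<circ> refl \<alpha>)"
    by (simp add: rep_mult rep_gT Top_eq)
  also have "rep (T_word \<alpha>s) \<Phi> \<tau> = (\<Sum>w\<in>weyl. rcoef \<alpha>s w \<tau> * \<Phi> (\<tau> \<circ> w))"
    by (rule Cons.IH) (use Cons.prems in auto)
  finally have "rep (T_word (\<alpha> # \<alpha>s)) \<Phi> \<tau> = (\<Sum>w\<in>weyl. rcoef (\<alpha> # \<alpha>s) w \<tau> * \<Phi> (\<tau> \<circ> w))"
    unfolding r by (simp only: rcoef.simps distrib_right mult.assoc sum.distrib sum_distrib_left)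
  then show ?case .
qed

text \<open>The coefficient vanishes exactly where \<tau> \<alpha> = q^2, a value excluded in
  \<open>regch\<close> so that leading coefficients stay nonzero.\<close>

lemma cc_coeff_nz: assumes "\<tau> \<in> regch" "\<alpha> \<in> R" shows "q + inverse q - cc \<alpha> \<tau> \<noteq> 0"
proof -
  have t: "1 - \<tau> \<alpha> \<noteq> 0" "\<tau> \<alpha> \<noteq> q\<^sup>2" using regch_root[OF assms] by auto
  have "q + inverse q - cc \<alpha> \<tau> = cc (- \<alpha>) \<tau>" using cc_neg[OF assms] by simp
  also have "\<dots> = inverse q * (q\<^sup>2 - \<tau> \<alpha>) / (1 - \<tau> \<alpha>)"
    using t(1) by (simp add: cc_def field_simps power2_eq_square)
  finally show ?thesis using t by simp
qed

text \<open>Each letter raises the length by at most one. A word of n letters therefore reaches an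
  element of length n only by using the reflection part of every letter, and the coefficient is then
  a product of nonzero factors.\<close>

lemma rcoef_len:
  assumes "set \<alpha>s \<subseteq> simple_roots" "w \<in> weyl" "\<tau> \<in> regch"
  shows "(length \<alpha>s < len w \<longrightarrow> rcoef \<alpha>s w \<tau> = 0) \<and>
    (length \<alpha>s = len w \<longrightarrow> (rcoef \<alpha>s w \<tau> \<noteq> 0 \<longleftrightarrow> refl_word \<alpha>s = w))"
  using assms
proof (induction \<alpha>s arbitrary: w \<tau>)
  case Nil
  then show ?case using len_0[of w] by auto
next
  case (Cons \<alpha> \<alpha>s)
  have a: "\<alpha> \<in> simple_roots" "\<alpha> \<in> R" using Cons.prems simple_R by auto
  let ?v = "refl \<alpha> \<circ> w"
  have v: "?v \<in> weyl" using a Cons.prems weyl_comp weyl_refl by auto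
  have t: "\<tau> \<circ> refl \<alpha> \<in> regch" using regch_refl a Cons.prems by auto
  have lv: "len w \<le> Suc (len ?v)"
    using len_refl_left_pos[OF Cons.prems(2) a(1)] len_refl_left_neg[OF Cons.prems(2) a(1)] by (cases "winv w \<alpha> \<in> Rp") auto
  have eqv: "refl_word (\<alpha> # \<alpha>s) = w \<longleftrightarrow> refl_word \<alpha>s = ?v"
  proof
    assume e: "refl_word (\<alpha> # \<alpha>s) = w"
    have "refl \<alpha> \<circ> refl_word (\<alpha> # \<alpha>s) = (refl \<alpha> \<circ> refl \<alpha>) \<circ> refl_word \<alpha>s"
      by (simp only: refl_word_Cons comp_assoc)
    then show "refl_word \<alpha>s = ?v" by (simp only: e refl_comp_self[OF a(2)] id_comp)
  next
    assume e: "refl_word \<alpha>s = ?v"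
    have "refl_word (\<alpha> # \<alpha>s) = (refl \<alpha> \<circ> refl \<alpha>) \<circ> w" by (simp only: refl_word_Cons e comp_assoc)
    then show "refl_word (\<alpha> # \<alpha>s) = w" by (simp only: refl_comp_self[OF a(2)] id_comp)
  qed
  have s: "set \<alpha>s \<subseteq> simple_roots" using Cons.prems by auto
  note IHw = Cons.IH[OF s Cons.prems(2,3)]
  have IHv: "(length \<alpha>s < len ?v \<longrightarrow> rcoef \<alpha>s ?v (\<tau> \<circ> refl \<alpha>) = 0) \<and>
    (length \<alpha>s = len ?v \<longrightarrow> (rcoef \<alpha>s ?v (\<tau> \<circ> refl \<alpha>) \<noteq> 0 \<longleftrightarrow> refl_word \<alpha>s = ?v))"
    by (rule Cons.IH[OF s v t])
  have lenle: "len (refl_word \<alpha>s) \<le> length \<alpha>s" using s by (intro len_le) (auto simp: lists_eq_set)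
  show ?case
  proof (intro conjI impI)
    assume l: "length (\<alpha> # \<alpha>s) < len w"
    then have "rcoef \<alpha>s w \<tau> = 0" "rcoef \<alpha>s ?v (\<tau> \<circ> refl \<alpha>) = 0" using IHw IHv lv by auto
    then show "rcoef (\<alpha> # \<alpha>s) w \<tau> = 0" by simp
  next
    assume l: "length (\<alpha> # \<alpha>s) = len w"
    then have z: "rcoef \<alpha>s w \<tau> = 0" using IHw by auto
    have "rcoef \<alpha>s ?v (\<tau> \<circ> refl \<alpha>) \<noteq> 0 \<longleftrightarrow> refl_word \<alpha>s = ?v"
    proof (cases "length \<alpha>s = len ?v")
      case True then show ?thesis using IHv by auto
    next
      case False
      then have "length \<alpha>s < len ?v" using lv l by auto
      then show ?thesis using IHv lenle by auto
    qed
    then show "rcoef (\<alpha> # \<alpha>s) w \<tau> \<noteq> 0 \<longleftrightarrow> refl_word (\<alpha> # \<alpha>s) = w"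
      unfolding eqv using z cc_coeff_nz[OF Cons.prems(3) a(2)] by simp
  qed
qed

text \<open>Since \<tau> separates roots and R spans, the orbit of \<tau> under W is free.\<close>

lemma character_free:
  assumes "inj_on \<tau> R" "v \<in> weyl" "w \<in> weyl" "\<tau> \<circ> v = \<tau> \<circ> w" shows "v = w"
proof (rule weyl_eq_on_R[OF assms(2,3)])
  fix \<alpha> assume "\<alpha> \<in> R"
  then show "v \<alpha> = w \<alpha>" using assms weyl_root inj_onD[OF assms(1), of "v \<alpha>" "w \<alpha>"] by (auto simp: fun_eq_iff)
qed

lemma rep_Tw: "w \<in> weyl \<Longrightarrow> rep (Tw w) \<Phi> \<tau> = (\<Sum>v\<in>weyl. rcoef (rw w) v \<tau> * \<Phi> (\<tau> \<circ> v))"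
  unfolding Tw_rw using reduced_rw[of w] simple_R by (intro rep_T_word_rcoef) (auto simp: reduced_word_def)

lemma rcoef_rw:
  assumes "w \<in> weyl" "v \<in> weyl" "\<tau> \<in> regch" "len w \<le> len v"
  shows "rcoef (rw w) v \<tau> \<noteq> 0 \<longleftrightarrow> w = v"
proof -
  have "set (rw w) \<subseteq> simple_roots" "length (rw w) = len w" "refl_word (rw w) = w"
    using reduced_rw[OF assms(1)] by (auto simp: reduced_word_def)
  then show ?thesis using rcoef_len[of "rw w" v \<tau>] assms by (cases "len w = len v") auto
qed

definition opcoef :: "(('v \<Rightarrow> 'v) \<Rightarrow> ('v \<Rightarrow>\<^sub>0 scalar)) \<Rightarrow> ('v \<Rightarrow> 'v) \<Rightarrow> ('v \<Rightarrow> scalar) \<Rightarrow> scalar" where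
  "opcoef c v \<tau> = (\<Sum>w\<in>weyl. ev \<tau> (c w) * rcoef (rw w) v \<tau>)"

lemma rep_NFsum: "rep (NFsum c) \<Phi> \<tau> = (\<Sum>v\<in>weyl. opcoef c v \<tau> * \<Phi> (\<tau> \<circ> v))"
proof -
  have "rep (NFsum c) \<Phi> \<tau> = (\<Sum>w\<in>weyl. \<Sum>v\<in>weyl. ev \<tau> (c w) * rcoef (rw w) v \<tau> * \<Phi> (\<tau> \<circ> v))"
    by (simp add: NFsum_def rep_sum rep_mult rep_lift rep_Tw sum_distrib_left mult.assoc)
  then show ?thesis unfolding opcoef_def sum_distrib_right by (simp only:) (rule sum.swap)
qed

lemma opcoef_top:
  assumes "v \<in> weyl" "\<tau> \<in> regch" "\<And>w. w \<in> weyl \<Longrightarrow> len v < len w \<Longrightarrow> c w = 0" "opcoef c v \<tau> = 0"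
  shows "ev \<tau> (c v) = 0"
proof -
  have "opcoef c v \<tau> = (\<Sum>w\<in>weyl. if w = v then ev \<tau> (c v) * rcoef (rw v) v \<tau> else 0)"
    unfolding opcoef_def
  proof (rule sum.cong)
    fix w assume w: "w \<in> weyl"
    show "ev \<tau> (c w) * rcoef (rw w) v \<tau> = (if w = v then ev \<tau> (c v) * rcoef (rw v) v \<tau> else 0)"
    proof (cases "len w \<le> len v")
      case True then show ?thesis using rcoef_rw[OF w assms(1,2)] by auto
    next
      case False then show ?thesis using assms(3)[OF w] by auto
    qed
  qed simp
  also have "\<dots> = ev \<tau> (c v) * rcoef (rw v) v \<tau>" using finite_weyl assms by simp
  finally show ?thesis using rcoef_rw[OF assms(1,1,2)] assms(4) by simp
qed

text \<open>Descends from the longest element: once the longer coefficients vanish, the operator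
  coefficient at v is a nonzero multiple of the value of \<open>c v\<close>, and generic characters
  force \<open>c v = 0\<close>. The set V is closed under increasing length; all of W serves for
  independence, the complement of id for the center.\<close>

lemma opcoef_zero:
  assumes keys: "\<And>w. w \<in> weyl \<Longrightarrow> Poly_Mapping.keys (c w) \<subseteq> weights"
    and z: "\<And>\<tau> v. \<tau> \<in> regch \<Longrightarrow> inj_on \<tau> R \<Longrightarrow> v \<in> weyl \<Longrightarrow> v \<in> V \<Longrightarrow> opcoef c v \<tau> = 0"
    and V: "\<And>v w. v \<in> weyl \<Longrightarrow> w \<in> weyl \<Longrightarrow> v \<in> V \<Longrightarrow> len v < len w \<Longrightarrow> w \<in> V"
    and "v \<in> weyl" "v \<in> V"
  shows "c v = 0"
  using assms(4,5)
proof (induction "card Rp - len v" arbitrary: v rule: less_induct)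
  case less
  have le: "len w \<le> card Rp" if "w \<in> weyl" for w
    using longest_element that by (metis le_add2)
  have "c w = 0" if "w \<in> weyl" "len v < len w" for w
  proof (rule less.hyps[OF _ that(1)])
    show "card Rp - len w < card Rp - len v" using le[OF that(1)] that(2) by linarith
    show "w \<in> V" by (rule V[OF less.prems(1) that(1) less.prems(2) that(2)])
  qed
  then show ?case
    using opcoef_top[OF less.prems(1)] z less.prems keys by (intro ev_eq_0) blast+
qed

text \<open>The representation space contains all functions, so on a free orbit a delta function
  isolates a single operator coefficient.\<close>

lemma delta_opcoef:
  assumes "\<tau> \<in> regch" "inj_on \<tau> R" "v \<in> weyl"
  shows "rep (NFsum c) (\<lambda>\<sigma>. if \<sigma> = \<tau> \<circ> v then k else 0) \<tau> = opcoef c v \<tau> * k"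
proof -
  have "(\<Sum>w\<in>weyl. opcoef c w \<tau> * (if \<tau> \<circ> w = \<tau> \<circ> v then k else 0)) = (\<Sum>w\<in>weyl. if w = v then opcoef c v \<tau> * k else 0)"
  proof (rule sum.cong)
    fix w assume "w \<in> weyl"
    then have "\<tau> \<circ> w = \<tau> \<circ> v \<longleftrightarrow> w = v" using character_free[OF assms(2) _ assms(3)] by blast
    then show "opcoef c w \<tau> * (if \<tau> \<circ> w = \<tau> \<circ> v then k else 0) = (if w = v then opcoef c v \<tau> * k else 0)"
      by (simp only: if_distrib mult_zero_right cong: if_cong) simp
  qed simp
  then show ?thesis unfolding rep_NFsum using finite_weyl assms by simp
qed

text \<open>Congruent elements have equal operators, so all operator coefficients vanish. With
  \<open>NF_all\<close> this makes the elements x^\<lambda> T_w a basis.\<close>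

theorem PBW:
  assumes "\<And>w. w \<in> weyl \<Longrightarrow> Poly_Mapping.keys (c w) \<subseteq> weights" "NFsum c \<doteq> 0" "v \<in> weyl"
  shows "c v = 0"
proof (rule opcoef_zero[where V = UNIV and c = c and v = v])
  fix \<tau> v assume *: "\<tau> \<in> regch" "inj_on \<tau> R" "v \<in> weyl"
  show "opcoef c v \<tau> = 0"
    using delta_opcoef[OF *, of c 1] heq_rep[OF assms(2) *(1)] by simp
qed (use assms in auto)

end

section \<open>The idempotents and the center\<close>

lemma q_power_emb: "q ^ n = Fract (monom 1 n) 1"
proof (induction n)
  case 0 then show ?case by (simp add: One_fract_def monom_0 one_pCons)
next
  case (Suc n)
  have "[:0, 1:] * monom (1::int) n = monom 1 (Suc n)" by (simp add: monom_Suc)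
  then show ?case using Suc by (simp add: q_def)
qed

text \<open>At q = 1 the underlying integer polynomial counts its terms.\<close>

lemma sum_q_powers_nz:
  assumes "finite I" "I \<noteq> {}" shows "(\<Sum>i\<in>I. q ^ e i) \<noteq> 0"
proof -
  have "(\<Sum>i\<in>I. q ^ e i) = Fract (\<Sum>i\<in>I. monom 1 (e i)) 1"
    using assms(1) by (induction I rule: finite_induct) (auto simp: q_power_emb Zero_fract_def)
  moreover have "poly (\<Sum>i\<in>I. monom 1 (e i)) (1::int) = int (card I)"
    by (simp add: poly_sum poly_monom)
  then have "(\<Sum>i\<in>I. monom (1::int) (e i)) \<noteq> 0" using assms by (metis card_gt_0_iff less_irrefl of_nat_0_less_iff poly_0)
  ultimately show ?thesis by (simp add: Zero_fract_def eq_fract)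
qed

text \<open>Dedekind's argument. Multiplicativity is asked on a submonoid M because
  \<open>regch\<close> controls characters on the weights, not on the whole space.\<close>

lemma characters_independent:
  fixes \<chi> :: "'i \<Rightarrow> 'm::monoid_add \<Rightarrow> 'k::field" and a :: "'i \<Rightarrow> 'k"
  assumes "finite I" and M: "0 \<in> M" "\<And>x y. x \<in> M \<Longrightarrow> y \<in> M \<Longrightarrow> x + y \<in> M"
    and hom: "\<And>i. i \<in> I \<Longrightarrow> \<chi> i 0 = 1" "\<And>i x y. i \<in> I \<Longrightarrow> x \<in> M \<Longrightarrow> y \<in> M \<Longrightarrow> \<chi> i (x + y) = \<chi> i x * \<chi> i y"
    and distinct: "\<And>i j. i \<in> I \<Longrightarrow> j \<in> I \<Longrightarrow> i \<noteq> j \<Longrightarrow> \<exists>x\<in>M. \<chi> i x \<noteq> \<chi> j x"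
    and zero: "\<And>x. x \<in> M \<Longrightarrow> (\<Sum>i\<in>I. a i * \<chi> i x) = 0"
    and "i \<in> I"
  shows "a i = 0"
  using assms(1) hom distinct zero \<open>i \<in> I\<close>
proof (induction I arbitrary: a i rule: finite_induct)
  case (insert z I)
  have aI: "a j = 0" if j: "j \<in> I" for j
  proof -
    have "j \<noteq> z" using j insert.hyps by auto
    then obtain y where y: "y \<in> M" "\<chi> j y \<noteq> \<chi> z y" using insert.prems(3)[of j z] j by auto
    \<comment> \<open>Shift the argument of the relation by y and subtract \<open>\<chi> z y\<close>
      times the original relation; the term of z cancels.\<close>
    have "a j * (\<chi> j y - \<chi> z y) = 0"
    proof (rule insert.IH[where a = "\<lambda>i. a i * (\<chi> i y - \<chi> z y)"])
      fix x assume x: "x \<in> M"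
      have "(\<Sum>i\<in>insert z I. a i * \<chi> i (y + x)) = 0" "(\<Sum>i\<in>insert z I. a i * \<chi> i x) = 0"
        using insert.prems(4) x y M by blast+
      then have "(\<Sum>i\<in>insert z I. a i * (\<chi> i y * \<chi> i x)) - \<chi> z y * (\<Sum>i\<in>insert z I. a i * \<chi> i x) = 0"
        using insert.prems(2) x y by simp
      then have "(\<Sum>i\<in>insert z I. a i * (\<chi> i y - \<chi> z y) * \<chi> i x) = 0"
        by (simp only: sum_distrib_left sum_subtractf[symmetric]) (simp add: algebra_simps)
      then show "(\<Sum>i\<in>I. a i * (\<chi> i y - \<chi> z y) * \<chi> i x) = 0" using insert.hyps by simp
    qed (use insert.prems j in auto)
    then show ?thesis using y by simp
  qed
  have "(\<Sum>i\<in>insert z I. a i * \<chi> i 0) = 0" using insert.prems(4) M by blast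
  then have "a z = 0" using aI insert.hyps insert.prems(1)[of z] by simp
  then show ?case using aI insert.prems(5) by auto
qed simp

context based_root_system
begin

text \<open>As for \<open>root_factor_cancel\<close>, the support would contain an infinite
  arithmetic progression; neighbouring coefficients are now proportional instead of equal.\<close>

lemma binomial_cancel:
  assumes "\<alpha> \<noteq> 0" "a \<noteq> 0" "b \<noteq> 0" "d * (Poly_Mapping.single 0 a - Poly_Mapping.single (- \<alpha>) b) = (0 :: 'v \<Rightarrow>\<^sub>0 scalar)"
  shows "d = 0"
proof (rule ccontr)
  assume "d \<noteq> 0"
  have "Poly_Mapping.lookup (d * Poly_Mapping.single 0 a - d * Poly_Mapping.single (- \<alpha>) b) \<mu> = 0" for \<mu>
    using assms(4) by (simp add: right_diff_distrib)
  then have per: "Poly_Mapping.lookup d \<mu> * a = Poly_Mapping.lookup d (\<mu> + \<alpha>) * b" for \<mu>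
    by (simp add: lookup_minus lookup_times_single)
  obtain \<mu> where "\<mu> \<in> Poly_Mapping.keys d" using keys_nonempty[OF \<open>d \<noteq> 0\<close>] by auto
  then have "\<mu> + real n *\<^sub>R \<alpha> \<in> Poly_Mapping.keys d" for n
  proof (induction n)
    case (Suc n)
    then show ?case using per[of "\<mu> + real n *\<^sub>R \<alpha>"] assms by (auto simp: in_keys_iff algebra_simps)
  qed simp
  then have "range (\<lambda>n. \<mu> + real n *\<^sub>R \<alpha>) \<subseteq> Poly_Mapping.keys d" by auto
  moreover have "inj (\<lambda>n. \<mu> + real n *\<^sub>R \<alpha>)" using assms(1) by (auto intro!: injI)
  ultimately show False using finite_imageD finite_subset[OF _ finite_keys] infinite_UNIV_nat by metis
qed

lemma W0_nz: "W0 (q\<^sup>2) \<noteq> 0"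
  using sum_q_powers_nz[OF finite_weyl weyl_nonempty, of "\<lambda>w. 2 * len w"] by (simp add: W0_def power_mult)

text \<open>Left multiplication by the longest element turns l(w) into N - l(w), with N the number
  of positive roots. Hence 1/W_0(q^-2) lies in K although only 1/W_0(q^2) was adjoined.\<close>

lemma W0_inverse: "q ^ (2 * card Rp) * W0 (inverse q ^ 2) = W0 (q\<^sup>2)"
proof -
  obtain w0 where w0: "w0 \<in> weyl" "\<And>w. w \<in> weyl \<Longrightarrow> len (w0 \<circ> w) + len w = card Rp" by (rule longest_element) blast
  have bij: "bij_betw (\<lambda>w. w0 \<circ> w) weyl weyl"
    by (rule bij_betw_byWitness[where f' = "\<lambda>w. winv w0 \<circ> w"])
      (use w0(1) weyl_comp weyl_inv weyl_inv_comp in \<open>auto simp: comp_assoc[symmetric]\<close>)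
  have "W0 (inverse q ^ 2) = (\<Sum>w\<in>weyl. (inverse q ^ 2) ^ len (w0 \<circ> w))"
    unfolding W0_def by (rule sum.reindex_bij_betw[OF bij, symmetric])
  then have "q ^ (2 * card Rp) * W0 (inverse q ^ 2) = (\<Sum>w\<in>weyl. q ^ (2 * card Rp) * (inverse q ^ 2) ^ len (w0 \<circ> w))"
    by (simp add: sum_distrib_left)
  also have "\<dots> = (\<Sum>w\<in>weyl. (q\<^sup>2) ^ len w)"
  proof (rule sum.cong)
    fix w assume "w \<in> weyl"
    then have "card Rp = len (w0 \<circ> w) + len w" using w0(2) by simp
    then have "q ^ (2 * card Rp) * (inverse q ^ 2) ^ len (w0 \<circ> w)
        = (q * inverse q) ^ (2 * len (w0 \<circ> w)) * (q\<^sup>2) ^ len w"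
      by (simp only: power_mult_distrib power_mult power_add distrib_left) (simp add: power_mult[symmetric] mult_ac)
    then show "q ^ (2 * card Rp) * (inverse q ^ 2) ^ len (w0 \<circ> w) = (q\<^sup>2) ^ len w" by simp
  qed simp
  finally show ?thesis by (simp add: W0_def)
qed

lemma W0_inverse_nz: "W0 (inverse q ^ 2) \<noteq> 0" and KK_W0_inverse: "inverse (W0 (inverse q ^ 2)) \<in> KK"
proof -
  show nz: "W0 (inverse q ^ 2) \<noteq> 0" using W0_inverse W0_nz by auto
  have "inverse (W0 (inverse q ^ 2)) = q ^ (2 * card Rp) * inverse (W0 (q\<^sup>2))"
    using nz W0_inverse[symmetric] by (simp add: field_simps)
  then show "inverse (W0 (inverse q ^ 2)) \<in> KK" by (simp add: KK_mult KK_power)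
qed

lemma heq_eq_trans [trans]: "f \<doteq> g \<Longrightarrow> g = h \<Longrightarrow> f \<doteq> h"
  and eq_heq_trans [trans]: "f = g \<Longrightarrow> g \<doteq> h \<Longrightarrow> f \<doteq> h"
  by simp_all

section \<open>The two symmetrizers\<close>

definition Usum :: "scalar \<Rightarrow> ('v gen word \<Rightarrow>\<^sub>0 scalar)" where
  "Usum t = (\<Sum>w\<in>weyl. const (t ^ len w) * Tw w)"

lemma FA_Usum: "t \<in> KK \<Longrightarrow> Usum t \<in> FA"
  unfolding Usum_def by (intro FA_sum FA_mult FA_const FA_Tw KK_power)

lemma bij_refl_left: "\<alpha> \<in> R \<Longrightarrow> bij_betw (\<lambda>w. refl \<alpha> \<circ> w) weyl weyl"
  by (rule bij_betw_byWitness[where f' = "\<lambda>w. refl \<alpha> \<circ> w"])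
    (use weyl_comp weyl_refl in \<open>auto simp: comp_assoc[symmetric]\<close>)

lemma bij_refl_right: "\<alpha> \<in> R \<Longrightarrow> bij_betw (\<lambda>w. w \<circ> refl \<alpha>) weyl weyl"
  by (rule bij_betw_byWitness[where f' = "\<lambda>w. w \<circ> refl \<alpha>"])
    (use weyl_comp weyl_refl in \<open>auto simp: comp_assoc\<close>)

text \<open>Treats both symmetrizers at once: the condition on t is the quadratic relation, with
  roots q and -q^-1.\<close>

lemma gT_Usum:
  assumes t: "t \<in> KK" "t * t = hh * t + 1" and b: "\<beta> \<in> simple_roots"
  shows "gT \<beta> * Usum t \<doteq> const t * Usum t" "Usum t * gT \<beta> \<doteq> const t * Usum t"
proof -
  have bR: "\<beta> \<in> R" using b simple_R by auto
  \<comment> \<open>The extra term appears exactly when T_\<beta> meets an element whose length it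
    lowers; \<open>step\<close> compares the coefficients of \<open>Tw w\<close> on both
    sides.\<close>
  define d where "d w = (if winv w \<beta> \<in> Rp then 0 else hh)" for w :: "'v \<Rightarrow> 'v"
  define e where "e w = (if w \<beta> \<in> Rp then 0 else hh)" for w :: "'v \<Rightarrow> 'v"
  have up: "gT \<beta> * Tw w \<doteq> const (d w) * Tw w + Tw (refl \<beta> \<circ> w)" if "w \<in> weyl" for w
    using gT_Tw_up[OF that b] gT_Tw_down[OF that b] by (simp add: d_def const_simps)
  have up': "Tw w * gT \<beta> \<doteq> const (e w) * Tw w + Tw (w \<circ> refl \<beta>)" if "w \<in> weyl" for w
    using Tw_gT_up[OF that b] Tw_gT_down[OF that b] by (simp add: e_def const_simps)
  have step: "t ^ len w * d w + t ^ len (refl \<beta> \<circ> w) = t * t ^ len w" if w: "w \<in> weyl" for w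
  proof (cases "winv w \<beta> \<in> Rp")
    case True
    then show ?thesis using len_refl_left_pos[OF w b] by (simp add: d_def)
  next
    case False
    have "t ^ n * t * hh + t ^ n = t * (t ^ n * t)" for n
    proof -
      have "t ^ n * t * hh + t ^ n = t ^ n * (hh * t + 1)" by (simp add: distrib_left mult_ac)
      then show ?thesis by (simp only: t(2)[symmetric]) (simp add: mult_ac)
    qed
    from this[of "len (refl \<beta> \<circ> w)"] show ?thesis using False unfolding d_def len_refl_left_neg[OF w b False] by (simp add: mult_ac)
  qed
  have step': "t ^ len w * e w + t ^ len (w \<circ> refl \<beta>) = t * t ^ len w" if w: "w \<in> weyl" for w
  proof (cases "w \<beta> \<in> Rp")
    case True
    then show ?thesis using len_refl_pos[OF w b] by (simp add: e_def)
  next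
    case False
    have "t ^ n * t * hh + t ^ n = t * (t ^ n * t)" for n
    proof -
      have "t ^ n * t * hh + t ^ n = t ^ n * (hh * t + 1)" by (simp add: distrib_left mult_ac)
      then show ?thesis by (simp only: t(2)[symmetric]) (simp add: mult_ac)
    qed
    from this[of "len (w \<circ> refl \<beta>)"] show ?thesis using False unfolding e_def len_refl_neg[OF w b False] by (simp add: mult_ac)
  qed
  have "gT \<beta> * Usum t = (\<Sum>w\<in>weyl. const (t ^ len w) * (gT \<beta> * Tw w))"
    by (simp add: Usum_def sum_distrib_left gT_const)
  also have "\<dots> \<doteq> (\<Sum>w\<in>weyl. const (t ^ len w) * (const (d w) * Tw w + Tw (refl \<beta> \<circ> w)))"
    using t by (intro heq_sum heq_lmult up FA_const KK_power)
  also have "(\<Sum>w\<in>weyl. const (t ^ len w) * (const (d w) * Tw w + Tw (refl \<beta> \<circ> w)))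
      = (\<Sum>w\<in>weyl. const (t ^ len w * d w) * Tw w) + (\<Sum>w\<in>weyl. const (t ^ len w) * Tw (refl \<beta> \<circ> w))"
    by (simp only: distrib_left sum.distrib const_simps(2) mult.assoc)
  also have "(\<Sum>w\<in>weyl. const (t ^ len w) * Tw (refl \<beta> \<circ> w))
      = (\<Sum>w\<in>weyl. const (t ^ len (refl \<beta> \<circ> w)) * Tw (refl \<beta> \<circ> (refl \<beta> \<circ> w)))"
    by (rule sum.reindex_bij_betw[OF bij_refl_left[OF bR], symmetric])
  also have "\<dots> = (\<Sum>w\<in>weyl. const (t ^ len (refl \<beta> \<circ> w)) * Tw w)"
    using bR by (simp add: comp_assoc[symmetric])
  also have "(\<Sum>w\<in>weyl. const (t ^ len w * d w) * Tw w) + (\<Sum>w\<in>weyl. const (t ^ len (refl \<beta> \<circ> w)) * Tw w)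
      = (\<Sum>w\<in>weyl. const (t ^ len w * d w + t ^ len (refl \<beta> \<circ> w)) * Tw w)"
    by (simp only: const_simps distrib_right sum.distrib)
  also have "\<dots> = const t * Usum t"
    unfolding Usum_def sum_distrib_left by (rule sum.cong) (simp_all only: step const_simps(2) mult.assoc)
  finally show "gT \<beta> * Usum t \<doteq> const t * Usum t" .
  have "Usum t * gT \<beta> = (\<Sum>w\<in>weyl. const (t ^ len w) * (Tw w * gT \<beta>))"
    by (simp add: Usum_def sum_distrib_right mult.assoc)
  also have "\<dots> \<doteq> (\<Sum>w\<in>weyl. const (t ^ len w) * (const (e w) * Tw w + Tw (w \<circ> refl \<beta>)))"
    using t by (intro heq_sum heq_lmult up' FA_const KK_power)
  also have "(\<Sum>w\<in>weyl. const (t ^ len w) * (const (e w) * Tw w + Tw (w \<circ> refl \<beta>)))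
      = (\<Sum>w\<in>weyl. const (t ^ len w * e w) * Tw w) + (\<Sum>w\<in>weyl. const (t ^ len w) * Tw (w \<circ> refl \<beta>))"
    by (simp only: distrib_left sum.distrib const_simps(2) mult.assoc)
  also have "(\<Sum>w\<in>weyl. const (t ^ len w) * Tw (w \<circ> refl \<beta>))
      = (\<Sum>w\<in>weyl. const (t ^ len (w \<circ> refl \<beta>)) * Tw (w \<circ> refl \<beta> \<circ> refl \<beta>))"
    by (rule sum.reindex_bij_betw[OF bij_refl_right[OF bR], symmetric])
  also have "\<dots> = (\<Sum>w\<in>weyl. const (t ^ len (w \<circ> refl \<beta>)) * Tw w)"
    using bR by (simp add: comp_assoc)
  also have "(\<Sum>w\<in>weyl. const (t ^ len w * e w) * Tw w) + (\<Sum>w\<in>weyl. const (t ^ len (w \<circ> refl \<beta>)) * Tw w)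
      = (\<Sum>w\<in>weyl. const (t ^ len w * e w + t ^ len (w \<circ> refl \<beta>)) * Tw w)"
    by (simp only: const_simps distrib_right sum.distrib)
  also have "\<dots> = const t * Usum t"
    unfolding Usum_def sum_distrib_left by (rule sum.cong) (simp_all only: step' const_simps(2) mult.assoc)
  finally show "Usum t * gT \<beta> \<doteq> const t * Usum t" .
qed

definition e1 where "e1 = const (inverse (W0 (q\<^sup>2))) * Usum q"
definition e2 where "e2 = const (inverse (W0 (inverse q ^ 2))) * Usum (inverse (- q))"

lemma one0_e1: "one0 = cls e1" and eps0_e2: "eps0 = cls e2"
  by (simp_all add: one0_def eps0_def e1_def e2_def Usum_def)

lemma KK_minus_q: "inverse (- q) \<in> KK" by (simp add: KK_uminus)

lemma FA_e1: "e1 \<in> FA" and FA_e2: "e2 \<in> FA"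
  unfolding e1_def e2_def by (intro FA_mult FA_const FA_Usum KK_q KK_W0_inverse KK_minus_q)+

lemma gT_e1: assumes "\<beta> \<in> simple_roots" shows "gT \<beta> * e1 \<doteq> const q * e1"
proof -
  have "gT \<beta> * e1 = const (inverse (W0 (q\<^sup>2))) * (gT \<beta> * Usum q)" by (simp add: e1_def gT_const)
  also have "\<dots> \<doteq> const (inverse (W0 (q\<^sup>2))) * (const q * Usum q)"
    by (intro heq_lmult gT_Usum FA_const KK_q assms) (simp add: left_diff_distrib)
  finally show ?thesis by (simp add: e1_def const_left_commute[of "const q"])
qed

lemma e2_gT: assumes "\<beta> \<in> simple_roots" shows "e2 * gT \<beta> \<doteq> const (- inverse q) * e2"
proof -
  have "e2 * gT \<beta> = const (inverse (W0 (inverse q ^ 2))) * (Usum (inverse (- q)) * gT \<beta>)"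
    by (simp add: e2_def mult.assoc)
  also have "\<dots> \<doteq> const (inverse (W0 (inverse q ^ 2))) * (const (inverse (- q)) * Usum (inverse (- q)))"
    by (intro heq_lmult gT_Usum FA_const KK_W0_inverse KK_minus_q assms) (simp add: left_diff_distrib)
  finally show ?thesis by (simp add: e2_def const_left_commute[of "const (- inverse q)"] const_left_commute[of "const (inverse (- q))"])
qed

lemma Tw_e1: assumes "w \<in> weyl" shows "Tw w * e1 \<doteq> const (q ^ len w) * e1"
proof -
  have "T_word \<alpha>s * e1 \<doteq> const (q ^ length \<alpha>s) * e1" if "set \<alpha>s \<subseteq> simple_roots" for \<alpha>s
    using that
  proof (induction \<alpha>s)
    case (Cons \<alpha> \<alpha>s)
    have "gT \<alpha> * (T_word \<alpha>s * e1) \<doteq> gT \<alpha> * (const (q ^ length \<alpha>s) * e1)"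
      using Cons by (intro heq_lmult FA_gT) auto
    also have "gT \<alpha> * (const (q ^ length \<alpha>s) * e1) = const (q ^ length \<alpha>s) * (gT \<alpha> * e1)" by (rule const_left_commute)
    also have "\<dots> \<doteq> const (q ^ length \<alpha>s) * (const q * e1)"
      using Cons.prems by (intro heq_lmult gT_e1 FA_const KK_power KK_q) auto
    finally show ?case by (simp add: const_simps mult.assoc const_left_commute[of "const q"])
  qed (simp add: const_simps)
  from this[of "rw w"] show ?thesis using reduced_rw[OF assms] by (auto simp: Tw_rw reduced_word_def)
qed

lemma const_sum: "const (sum f I) = (\<Sum>i\<in>I. const (f i))"
  by (induction I rule: infinite_finite_induct) (simp_all add: const_simps)

lemma e1_e1: "e1 * e1 \<doteq> e1"
proof -
  have "e1 * e1 = const (inverse (W0 (q\<^sup>2))) * (\<Sum>w\<in>weyl. const (q ^ len w) * (Tw w * e1))"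
    by (subst (1) e1_def) (simp add: Usum_def mult.assoc sum_distrib_right)
  also have "\<dots> \<doteq> const (inverse (W0 (q\<^sup>2))) * (\<Sum>w\<in>weyl. const (q ^ len w) * (const (q ^ len w) * e1))"
    by (intro heq_lmult heq_sum Tw_e1 FA_const KK_power KK_q)
  also have "(\<Sum>w\<in>weyl. const (q ^ len w) * (const (q ^ len w) * e1)) = const (W0 (q\<^sup>2)) * e1"
  proof -
    have "const (W0 (q\<^sup>2)) = (\<Sum>w\<in>weyl. const (q ^ len w) * const (q ^ len w))"
      by (simp only: W0_def const_sum const_simps(2)[symmetric])
        (simp add: power_mult[symmetric] mult_2 power_add)
    then show ?thesis by (simp add: sum_distrib_right mult.assoc)
  qed
  also have "const (inverse (W0 (q\<^sup>2))) * (const (W0 (q\<^sup>2)) * e1) = const (inverse (W0 (q\<^sup>2)) * W0 (q\<^sup>2)) * e1"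
    by (simp only: const_simps mult.assoc)
  also have "\<dots> = e1" using W0_nz by (simp add: const_simps)
  finally show ?thesis .
qed

lemma const_lift: "k \<in> KK \<Longrightarrow> const k \<doteq> lift_KP (Poly_Mapping.single 0 k)"
  using heq_lmult[OF heq_sym[OF heq_X0] FA_const, of k] by (simp add: lift_single)

text \<open>\<open>Tw w\<close> acts on \<open>e1\<close> by a scalar, so a normal form collapses to
  an element of K[P].\<close>

lemma H_e1: assumes "f \<in> FA" shows "\<exists>g\<in>KP. f * e1 \<doteq> lift_KP g * e1"
proof -
  obtain c where c: "\<forall>w\<in>weyl. c w \<in> KP" "f \<doteq> NFsum c" using NF_all[OF assms] by (auto simp: NF_def)
  let ?g = "\<Sum>w\<in>weyl. Poly_Mapping.single 0 (q ^ len w) * c w"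
  have "f * e1 \<doteq> NFsum c * e1" by (intro heq_rmult c FA_e1)
  also have "NFsum c * e1 = (\<Sum>w\<in>weyl. lift_KP (c w) * (Tw w * e1))"
    by (simp add: NFsum_def sum_distrib_right mult.assoc)
  also have "\<dots> \<doteq> (\<Sum>w\<in>weyl. lift_KP (c w) * (const (q ^ len w) * e1))"
    using c by (intro heq_sum heq_lmult Tw_e1 FA_lift) auto
  also have "(\<Sum>w\<in>weyl. lift_KP (c w) * (const (q ^ len w) * e1)) = lift_KP ?g * e1"
    by (simp only: lift_sum lift_scale sum_distrib_right const_left_commute[of "lift_KP (c _)"] mult.assoc)
  finally have "f * e1 \<doteq> lift_KP ?g * e1" .
  moreover have "?g \<in> KP" using c by (intro KP_sum KP_mult KP_single KK_power) auto
  ultimately show ?thesis by blast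
qed

lemma lift_e1_NF: "lift_KP g * e1 = NFsum (\<lambda>w. Poly_Mapping.single 0 (inverse (W0 (q\<^sup>2)) * q ^ len w) * g)"
  by (simp only: NFsum_def e1_def Usum_def lift_scale const_simps sum_distrib_left const_left_commute[of "lift_KP g"] mult.assoc)

lemma single_mult_eq_0: "k \<noteq> 0 \<Longrightarrow> Poly_Mapping.single 0 k * f = 0 \<Longrightarrow> f = (0 :: 'v \<Rightarrow>\<^sub>0 scalar)"
proof -
  assume k: "k \<noteq> 0" "Poly_Mapping.single 0 k * f = 0"
  have "Poly_Mapping.single 0 (inverse k) * (Poly_Mapping.single 0 k * f) = f"
    using k(1) by (simp only: mult.assoc[symmetric] mult_single) simp
  then show "f = 0" using k(2) by simp
qed

lemma NFsum_diff: "NFsum c - NFsum d = NFsum (\<lambda>w. c w - d w)"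
  by (simp add: NFsum_def lift_diff left_diff_distrib sum_subtractf)

lemma keys_KP: "f \<in> KP \<Longrightarrow> Poly_Mapping.keys f \<subseteq> weights" by (simp add: KP_iff)

lemma NFsum_inj:
  assumes "\<And>w. w \<in> weyl \<Longrightarrow> c w \<in> KP" "\<And>w. w \<in> weyl \<Longrightarrow> d w \<in> KP" "NFsum c \<doteq> NFsum d" "v \<in> weyl"
  shows "c v = d v"
  using PBW[of "\<lambda>w. c w - d w" v] assms keys_KP[OF KP_diff]
  by (simp add: heq_def NFsum_diff)

text \<open>Compare the basis coefficients at id, which are f and g divided by W_0(q^2).\<close>

lemma lift_e1_inj:
  assumes "f \<in> KP" "g \<in> KP" "lift_KP f * e1 \<doteq> lift_KP g * e1" shows "f = g"
proof -
  let ?k = "inverse (W0 (q\<^sup>2)) * q ^ len id"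
  have "Poly_Mapping.single 0 ?k * f = Poly_Mapping.single 0 ?k * g"
    by (rule NFsum_inj[where v = id and c = "\<lambda>w. Poly_Mapping.single 0 (inverse (W0 (q\<^sup>2)) * q ^ len w) * f"
          and d = "\<lambda>w. Poly_Mapping.single 0 (inverse (W0 (q\<^sup>2)) * q ^ len w) * g"])
      (use assms in \<open>auto simp: lift_e1_NF[symmetric] intro!: KP_mult KP_single KK_mult KK_power\<close>)
  then have "Poly_Mapping.single 0 ?k * (f - g) = 0" by (simp add: right_diff_distrib)
  then show ?thesis using single_mult_eq_0[of ?k "f - g"] W0_nz by simp
qed

lemma lift_inj: assumes "f \<in> KP" "g \<in> KP" "lift_KP f \<doteq> lift_KP g" shows "f = g"
  using lift_e1_inj[OF assms(1,2) heq_rmult[OF assms(3) FA_e1]] .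

text \<open>A nonzero scalar multiplies every coefficient of a normal form, and K lies in a field.
  This takes the place of dividing by 2, |W| and q + q^-1.\<close>

lemma torsion_free:
  assumes "f \<in> FA" "k \<noteq> 0" "const k * f \<doteq> 0" "k \<in> KK" shows "f \<doteq> 0"
proof -
  obtain c where c: "\<forall>w\<in>weyl. c w \<in> KP" "f \<doteq> NFsum c" using NF_all[OF assms(1)] by (auto simp: NF_def)
  have "NFsum (\<lambda>w. Poly_Mapping.single 0 k * c w) = const k * NFsum c"
    by (simp only: NFsum_def lift_scale sum_distrib_left mult.assoc)
  also have "\<dots> \<doteq> const k * f" by (intro heq_lmult heq_sym[OF c(2)] FA_const assms)
  finally have z: "NFsum (\<lambda>w. Poly_Mapping.single 0 k * c w) \<doteq> 0" using assms(3) heq_trans by blast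
  have "c w = 0" if "w \<in> weyl" for w
  proof -
    have "Poly_Mapping.single 0 k * c w = 0"
      by (rule PBW[where v = w, OF _ z that])
        (use c assms in \<open>auto intro!: keys_KP KP_mult KP_single dest!: subsetD[OF keys_KP]\<close>)
    then show ?thesis using single_mult_eq_0 assms(2) by blast
  qed
  then have "NFsum c = 0" by (simp add: NFsum_def)
  then show ?thesis using c by simp
qed

section \<open>Invariants and the center\<close>

definition InvKP :: "('v \<Rightarrow>\<^sub>0 scalar) set" where "InvKP = {f \<in> KP. \<forall>w\<in>weyl. act w f = f}"

lemma InvKP_I:
  assumes "f \<in> KP" "\<And>\<alpha>. \<alpha> \<in> simple_roots \<Longrightarrow> act (refl \<alpha>) f = f" shows "f \<in> InvKP"
proof -
  have "act (refl_word \<alpha>s) f = f" if "\<alpha>s \<in> lists simple_roots" for \<alpha>s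
    using that
  proof (induction \<alpha>s)
    case Nil
    have "refl_word [] = id" by (simp add: refl_word_def)
    then show ?case by (simp only: act_id)
  next
    case (Cons \<alpha> \<alpha>s)
    have "refl_word (\<alpha> # \<alpha>s) = refl \<alpha> \<circ> refl_word \<alpha>s" by (simp add: refl_word_def)
    then show ?case by (simp only: act_comp) (use Cons assms in simp)
  qed
  then show ?thesis using assms(1) weyl_simple by (auto simp: InvKP_def)
qed

lemma InvKP_D: "f \<in> InvKP \<Longrightarrow> f \<in> KP" "f \<in> InvKP \<Longrightarrow> w \<in> weyl \<Longrightarrow> act w f = f"
  by (auto simp: InvKP_def)

lemma DD_inv: assumes "f \<in> KP" "\<alpha> \<in> R" "act (refl \<alpha>) f = f" shows "DD \<alpha> f = 0"
  using root_factor_cancel[OF root_nz[OF assms(2)], of "DD \<alpha> f" 0] DD[OF assms(1,2)] assms(3) by simp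

lemma lift_gT_commute:
  assumes "f \<in> KP" "\<alpha> \<in> simple_roots" "act (refl \<alpha>) f = f"
  shows "lift_KP f * gT \<alpha> \<doteq> gT \<alpha> * lift_KP f"
  using lift_cross[OF assms(1,2)] DD_inv[OF assms(1) simple_R[OF assms(2)] assms(3)] assms(3) by simp

lemma lift_commute: assumes "f \<in> KP" "g \<in> KP" shows "lift_KP f * lift_KP g \<doteq> lift_KP g * lift_KP f"
proof -
  have "lift_KP f * lift_KP g \<doteq> lift_KP (f * g)" by (intro heq_sym[OF lift_mult] assms)
  also have "\<dots> \<doteq> lift_KP g * lift_KP f" by (subst mult.commute) (intro lift_mult assms)
  finally show ?thesis .
qed

text \<open>The divided differences of an invariant vanish, so it commutes with each T_\<alpha>,
  hence with every \<open>Tw w\<close> and with all normal forms.\<close>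

lemma InvKP_central:
  assumes f: "f \<in> InvKP" and h: "h \<in> FA"
  shows "lift_KP f * h \<doteq> h * lift_KP f"
proof -
  have fK: "f \<in> KP" using f InvKP_D by auto
  have F: "lift_KP f \<in> FA" using fK FA_lift by auto
  have gT: "lift_KP f * gT \<alpha> \<doteq> gT \<alpha> * lift_KP f" if "\<alpha> \<in> simple_roots" for \<alpha>
    using lift_gT_commute[OF fK that] InvKP_D(2)[OF f] weyl_refl simple_R that by blast
  have word: "lift_KP f * T_word \<alpha>s \<doteq> T_word \<alpha>s * lift_KP f" if "set \<alpha>s \<subseteq> simple_roots" for \<alpha>s
    using that
  proof (induction \<alpha>s)
    case (Cons \<alpha> \<alpha>s)
    have "lift_KP f * T_word (\<alpha> # \<alpha>s) = (lift_KP f * gT \<alpha>) * T_word \<alpha>s" by (simp add: mult.assoc)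
    also have "\<dots> \<doteq> (gT \<alpha> * lift_KP f) * T_word \<alpha>s" using Cons.prems by (intro heq_rmult gT FA_T_word) auto
    also have "(gT \<alpha> * lift_KP f) * T_word \<alpha>s = gT \<alpha> * (lift_KP f * T_word \<alpha>s)" by (simp add: mult.assoc)
    also have "\<dots> \<doteq> gT \<alpha> * (T_word \<alpha>s * lift_KP f)" using Cons by (intro heq_lmult FA_gT) auto
    finally show ?case by (simp add: mult.assoc)
  qed simp
  have Tw: "lift_KP f * Tw w \<doteq> Tw w * lift_KP f" if "w \<in> weyl" for w
    using word reduced_rw[OF that] by (auto simp: Tw_rw reduced_word_def)
  obtain c where c: "\<forall>w\<in>weyl. c w \<in> KP" "h \<doteq> NFsum c" using NF_all[OF h] by (auto simp: NF_def)
  have "lift_KP f * h \<doteq> lift_KP f * NFsum c" by (intro heq_lmult c F)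
  also have "lift_KP f * NFsum c = (\<Sum>w\<in>weyl. (lift_KP f * lift_KP (c w)) * Tw w)"
    by (simp add: NFsum_def sum_distrib_left mult.assoc)
  also have "\<dots> \<doteq> (\<Sum>w\<in>weyl. (lift_KP (c w) * lift_KP f) * Tw w)"
    using c by (intro heq_sum heq_rmult lift_commute fK FA_Tw) auto
  also have "(\<Sum>w\<in>weyl. (lift_KP (c w) * lift_KP f) * Tw w) = (\<Sum>w\<in>weyl. lift_KP (c w) * (lift_KP f * Tw w))"
    by (simp add: mult.assoc)
  also have "\<dots> \<doteq> (\<Sum>w\<in>weyl. lift_KP (c w) * (Tw w * lift_KP f))"
    using c by (intro heq_sum heq_lmult Tw FA_lift) auto
  also have "(\<Sum>w\<in>weyl. lift_KP (c w) * (Tw w * lift_KP f)) = NFsum c * lift_KP f"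
    by (simp add: NFsum_def sum_distrib_right mult.assoc)
  also have "\<dots> \<doteq> h * lift_KP f" by (intro heq_rmult heq_sym[OF c(2)] F)
  finally show ?thesis .
qed

text \<open>Write g for the reflected f. Cancelling \<open>e1\<close> gives q (g - f) = (q - q^-1) D
  with D (1 - x^(-\<alpha>)) = g - f; eliminating D leaves (g - f) (q^-1 - q x^(-\<alpha>)) =
  0.\<close>

lemma lift_eigen_inv:
  assumes f: "f \<in> KP" and a: "\<alpha> \<in> simple_roots"
    and eig: "gT \<alpha> * (lift_KP f * e1) \<doteq> const q * (lift_KP f * e1)"
  shows "act (refl \<alpha>) f = f"
proof -
  have aR: "\<alpha> \<in> R" using a simple_R by auto
  let ?s = "act (refl \<alpha>) f" and ?D = "DD \<alpha> (act (refl \<alpha>) f)"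
  have sK: "?s \<in> KP" using KP_act weyl_refl aR f by auto
  have D: "?D \<in> KP" "?D * (1 - xpow (- \<alpha>)) = ?s - f"
    using KP_DD[OF sK aR] DD[OF sK aR] by (simp_all add: act_refl_refl aR)
  have "lift_KP (Poly_Mapping.single 0 q * f) * e1 = const q * (lift_KP f * e1)"
    by (simp add: lift_scale mult.assoc)
  also have "\<dots> \<doteq> (gT \<alpha> * lift_KP f) * e1" using heq_sym[OF eig] by (simp add: mult.assoc)
  also have "\<dots> \<doteq> (lift_KP ?s * gT \<alpha> - const hh * lift_KP ?D) * e1"
    by (intro heq_rmult lift_cross_left f a FA_e1)
  also have "(lift_KP ?s * gT \<alpha> - const hh * lift_KP ?D) * e1 = lift_KP ?s * (gT \<alpha> * e1) - const hh * (lift_KP ?D * e1)"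
    by (simp add: left_diff_distrib mult.assoc)
  also have "\<dots> \<doteq> lift_KP ?s * (const q * e1) - const hh * (lift_KP ?D * e1)"
    by (intro heq_diff heq_lmult gT_e1 a FA_lift sK heq_refl)
  also have "lift_KP ?s * (const q * e1) - const hh * (lift_KP ?D * e1)
      = lift_KP (Poly_Mapping.single 0 q * ?s - Poly_Mapping.single 0 hh * ?D) * e1"
    by (simp only: lift_diff lift_scale left_diff_distrib const_left_commute[of "lift_KP _"] mult.assoc)
  finally have "Poly_Mapping.single 0 q * f = Poly_Mapping.single 0 q * ?s - Poly_Mapping.single 0 hh * ?D"
    by (rule lift_e1_inj[rotated 2])
      (use f sK D KK_hh in \<open>auto intro!: KP_diff KP_mult KP_single\<close>)
  then have "Poly_Mapping.single 0 q * (?s - f) = Poly_Mapping.single 0 hh * ?D" by (simp add: right_diff_distrib)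
  then have "Poly_Mapping.single 0 q * (?s - f) * (1 - xpow (- \<alpha>)) = Poly_Mapping.single 0 hh * (?D * (1 - xpow (- \<alpha>)))"
    by (simp only: mult.assoc)
  then have "(?s - f) * (Poly_Mapping.single 0 q * (1 - xpow (- \<alpha>)) - Poly_Mapping.single 0 hh) = 0"
    unfolding D(2) by (simp add: algebra_simps)
  moreover have "Poly_Mapping.single 0 q * (1 - xpow (- \<alpha>)) - Poly_Mapping.single 0 hh
      = Poly_Mapping.single 0 (inverse q) - Poly_Mapping.single (- \<alpha>) q"
    by (simp add: right_diff_distrib xpow_def mult_single single_diff)
  ultimately have "?s - f = 0" using binomial_cancel[OF root_nz[OF aR], of "inverse q" q "?s - f"] by simp
  then show ?thesis by simp
qed

lemma spherical:
  assumes "h \<in> FA" shows "\<exists>g\<in>InvKP. e1 * h * e1 \<doteq> lift_KP g * e1"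
proof -
  have F: "e1 * h \<in> FA" using assms FA_e1 FA_mult by auto
  obtain g where g: "g \<in> KP" "e1 * h * e1 \<doteq> lift_KP g * e1" using H_e1[OF F] by blast
  have "act (refl \<alpha>) g = g" if a: "\<alpha> \<in> simple_roots" for \<alpha>
  proof (rule lift_eigen_inv[OF g(1) a])
    have "gT \<alpha> * (lift_KP g * e1) \<doteq> gT \<alpha> * (e1 * h * e1)" by (intro heq_lmult heq_sym[OF g(2)] FA_gT a)
    also have "gT \<alpha> * (e1 * h * e1) = (gT \<alpha> * e1) * (h * e1)" by (simp add: mult.assoc)
    also have "\<dots> \<doteq> (const q * e1) * (h * e1)" by (intro heq_rmult gT_e1 a FA_mult assms FA_e1)
    also have "(const q * e1) * (h * e1) = const q * (e1 * h * e1)" by (simp add: mult.assoc)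
    also have "\<dots> \<doteq> const q * (lift_KP g * e1)" by (intro heq_lmult g FA_const KK_q)
    finally show "gT \<alpha> * (lift_KP g * e1) \<doteq> const q * (lift_KP g * e1)" .
  qed
  then show ?thesis using InvKP_I g by blast
qed

lemma central_InvKP:
  assumes z: "z \<in> FA" and comm: "\<And>h. h \<in> FA \<Longrightarrow> z * h \<doteq> h * z"
  shows "\<exists>f\<in>InvKP. z \<doteq> lift_KP f"
proof -
  obtain c where c: "\<forall>w\<in>weyl. c w \<in> KP" "z \<doteq> NFsum c" using NF_all[OF z] by (auto simp: NF_def)
  have op: "opcoef c v \<tau> = 0" if t: "\<tau> \<in> regch" "inj_on \<tau> R" "v \<in> weyl" "v \<noteq> id" for v \<tau>
  proof -
    \<comment> \<open>A root moved by v. Tested on the delta function at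
      \<open>\<tau> \<circ> v\<close>, multiplication by x^\<alpha> contributes \<tau>(v \<alpha>)
      from the right and \<tau> \<alpha> from the left, and these differ.\<close>
    obtain \<alpha> where a: "\<alpha> \<in> R" "v \<alpha> \<noteq> \<alpha>" using weyl_eq_on_R[OF t(3) weyl_id] t(4) by auto
    have ne: "\<tau> (v \<alpha>) \<noteq> \<tau> \<alpha>" using a inj_onD[OF t(2)] weyl_root[OF t(3)] by blast
    have gX: "gX \<alpha> \<in> FA" using FA_gX weights_root a by auto
    let ?\<Phi> = "\<lambda>\<sigma>. if \<sigma> = \<tau> \<circ> v then 1 else 0 :: scalar"
    have "rep (gX \<alpha>) ?\<Phi> = (\<lambda>\<sigma>. if \<sigma> = \<tau> \<circ> v then \<tau> (v \<alpha>) else 0)"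
      by (rule ext) (simp add: rep_gX)
    then have "rep (NFsum c * gX \<alpha>) ?\<Phi> \<tau> = opcoef c v \<tau> * \<tau> (v \<alpha>)"
      using delta_opcoef[OF t(1-3), of c "\<tau> (v \<alpha>)"] by (simp add: rep_mult)
    moreover have "rep (gX \<alpha> * NFsum c) ?\<Phi> \<tau> = \<tau> \<alpha> * opcoef c v \<tau>"
      using delta_opcoef[OF t(1-3), of c 1] by (simp add: rep_mult rep_gX)
    moreover have "NFsum c * gX \<alpha> \<doteq> gX \<alpha> * NFsum c"
    proof -
      have "NFsum c * gX \<alpha> \<doteq> z * gX \<alpha>" by (intro heq_rmult heq_sym[OF c(2)] gX)
      also have "\<dots> \<doteq> gX \<alpha> * z" by (rule comm[OF gX])
      also have "\<dots> \<doteq> gX \<alpha> * NFsum c" by (intro heq_lmult c gX)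
      finally show ?thesis .
    qed
    moreover have "rep (NFsum c * gX \<alpha>) ?\<Phi> \<tau> = rep (gX \<alpha> * NFsum c) ?\<Phi> \<tau>"
      using heq_rep[OF calculation(3) t(1)] .
    ultimately have "opcoef c v \<tau> * (\<tau> (v \<alpha>) - \<tau> \<alpha>) = 0"
      by (simp only: right_diff_distrib) (auto simp: mult.commute)
    then show ?thesis using ne by simp
  qed
  \<comment> \<open>The elements other than id are closed under increasing length, so the descent
    never reaches id.\<close>
  have c0: "c v = 0" if "v \<in> weyl" "v \<noteq> id" for v
    by (rule opcoef_zero[where V = "- {id}" and c = c and v = v]) (use op c keys_KP that in auto)
  let ?f = "c id"
  have fK: "?f \<in> KP" using c by auto
  have "NFsum c = (\<Sum>w\<in>weyl. if w = id then lift_KP ?f * Tw id else 0)"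
    unfolding NFsum_def by (rule sum.cong) (auto simp: c0)
  then have "NFsum c = lift_KP ?f * Tw id" using finite_weyl by simp
  then have "z \<doteq> lift_KP ?f * Tw id" using c by simp
  also have "\<dots> \<doteq> lift_KP ?f * 1" by (intro heq_lmult Tw_id FA_lift fK)
  finally have zf: "z \<doteq> lift_KP ?f" by simp
  have "act (refl \<alpha>) ?f = ?f" if a: "\<alpha> \<in> simple_roots" for \<alpha>
  proof (rule lift_eigen_inv[OF fK a])
    have "gT \<alpha> * (lift_KP ?f * e1) = (gT \<alpha> * lift_KP ?f) * e1" by (simp add: mult.assoc)
    also have "\<dots> \<doteq> (gT \<alpha> * z) * e1" by (intro heq_rmult heq_lmult heq_sym[OF zf] FA_gT a FA_e1)
    also have "\<dots> \<doteq> (z * gT \<alpha>) * e1" by (intro heq_rmult heq_sym[OF comm] FA_gT a FA_e1)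
    also have "(z * gT \<alpha>) * e1 = z * (gT \<alpha> * e1)" by (simp add: mult.assoc)
    also have "\<dots> \<doteq> z * (const q * e1)" by (intro heq_lmult gT_e1 a z)
    also have "z * (const q * e1) = const q * (z * e1)" by (rule const_left_commute)
    also have "\<dots> \<doteq> const q * (lift_KP ?f * e1)" by (intro heq_lmult heq_rmult zf FA_e1 FA_const KK_q)
    finally show "gT \<alpha> * (lift_KP ?f * e1) \<doteq> const q * (lift_KP ?f * e1)" .
  qed
  then show ?thesis using InvKP_I[OF fK] zf by blast
qed

section \<open>The elements A_\<mu>\<close>

definition AA :: "'v \<Rightarrow> ('v gen word \<Rightarrow>\<^sub>0 scalar)" where "AA \<mu> = e2 * gX \<mu> * e1"

lemma FA_AA: "\<mu> \<in> weights \<Longrightarrow> AA \<mu> \<in> FA"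
  unfolding AA_def by (intro FA_mult FA_e1 FA_e2 FA_gX)

lemma q_plus_nz: "q + inverse q \<noteq> 0"
proof -
  have "(\<Sum>i\<in>{0,2::nat}. q ^ i) \<noteq> 0" by (rule sum_q_powers_nz) auto
  then have "q * (q + inverse q) \<noteq> 0" by (simp add: power2_eq_square distrib_left add.commute)
  then show ?thesis by simp
qed

lemma e2_sym_e1:
  assumes f: "f \<in> KP" and a: "\<alpha> \<in> simple_roots" and inv: "act (refl \<alpha>) f = f"
  shows "e2 * lift_KP f * e1 \<doteq> 0"
proof -
  let ?x = "e2 * lift_KP f * e1"
  have F: "lift_KP f \<in> FA" using FA_lift f by auto
  \<comment> \<open>T_\<alpha> is borrowed from \<open>e1\<close> for the factor q, moved across f,
    and absorbed by \<open>e2\<close> with the factor -q^-1.\<close>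
  have "const q * ?x = e2 * (lift_KP f * (const q * e1))" by (simp add: mult.assoc const_left_commute[of _ q])
  also have "\<dots> \<doteq> e2 * (lift_KP f * (gT \<alpha> * e1))" by (intro heq_lmult heq_sym[OF gT_e1] FA_e2 F a)
  also have "e2 * (lift_KP f * (gT \<alpha> * e1)) = e2 * ((lift_KP f * gT \<alpha>) * e1)" by (simp add: mult.assoc)
  also have "\<dots> \<doteq> e2 * ((gT \<alpha> * lift_KP f) * e1)"
    by (intro heq_lmult heq_rmult lift_gT_commute f a inv FA_e1 FA_e2)
  also have "e2 * ((gT \<alpha> * lift_KP f) * e1) = (e2 * gT \<alpha>) * (lift_KP f * e1)" by (simp add: mult.assoc)
  also have "\<dots> \<doteq> (const (- inverse q) * e2) * (lift_KP f * e1)" by (intro heq_rmult e2_gT a FA_mult F FA_e1)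
  also have "(const (- inverse q) * e2) * (lift_KP f * e1) = const (- inverse q) * ?x" by (simp add: mult.assoc)
  finally have "const q * ?x \<doteq> const (- inverse q) * ?x" .
  then have "const (q + inverse q) * ?x \<doteq> 0" by (simp add: heq_def const_simps algebra_simps)
  then show ?thesis by (rule torsion_free[rotated 2]) (use q_plus_nz F FA_e1 FA_e2 in \<open>auto intro: FA_mult KK_add\<close>)
qed

text \<open>The sum of x^\<mu> and its reflection is fixed by the reflection, so
  \<open>e2_sym_e1\<close> applies to it.\<close>

lemma AA_refl: assumes "\<mu> \<in> weights" "\<alpha> \<in> simple_roots" shows "AA (refl \<alpha> \<mu>) \<doteq> - AA \<mu>"
proof -
  have a: "\<alpha> \<in> R" using assms simple_R by auto
  have "e2 * lift_KP (xpow (refl \<alpha> \<mu>) + xpow \<mu>) * e1 \<doteq> 0"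
    using assms a weights_refl by (intro e2_sym_e1[OF _ assms(2)] KP_add KP_xpow) (simp_all add: act_add act_xpow add.commute)
  then show ?thesis by (simp add: heq_def AA_def lift_add lift_xpow distrib_left distrib_right)
qed

lemma AA_weyl: assumes "w \<in> weyl" "\<mu> \<in> weights" shows "AA (w \<mu>) \<doteq> (-1) ^ len w * AA \<mu>"
proof -
  have "AA (refl_word \<alpha>s \<mu>) \<doteq> (-1) ^ length \<alpha>s * AA \<mu>" if "\<alpha>s \<in> lists simple_roots" for \<alpha>s
    using that
  proof (induction \<alpha>s)
    case (Cons \<alpha> \<alpha>s)
    have "AA (refl \<alpha> (refl_word \<alpha>s \<mu>)) \<doteq> - AA (refl_word \<alpha>s \<mu>)"
      using Cons weights_weyl[OF simple_word_weyl assms(2), of \<alpha>s] by (intro AA_refl) auto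
    also have "\<dots> \<doteq> - ((-1) ^ length \<alpha>s * AA \<mu>)" using Cons by (intro heq_uminus) auto
    finally show ?case by simp
  qed simp
  from this[of "rw w"] show ?thesis using reduced_rw[OF assms(1)] by (simp only: reduced_word_def)
qed

text \<open>Here \<mu> is fixed by a reflection, so A_\<mu> equals its own negative; the factor 2 is
  removed by \<open>torsion_free\<close>.\<close>

lemma AA_singular:
  assumes "\<mu> \<in> weights" "\<alpha> \<in> simple_roots" "pair \<mu> \<alpha> = 0" shows "AA \<mu> \<doteq> 0"
proof -
  have "AA \<mu> \<doteq> - AA \<mu>" using AA_refl[OF assms(1,2)] assms(3) by (simp add: refl_pair)
  then have "const (1 + 1) * AA \<mu> \<doteq> 0" by (simp only: heq_def const_simps) (simp add: mult_2)
  then show ?thesis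
  proof (rule torsion_free[rotated 2])
    have "(1::scalar) + 1 = Fract [:2:] 1" by (simp add: One_fract_def one_pCons)
    also have "\<dots> \<noteq> 0" by (simp add: Zero_fract_def eq_fract)
    finally show "(1::scalar) + 1 \<noteq> 0" .
  qed (use FA_AA assms KK_add[OF KK_1 KK_1] in auto)
qed

text \<open>The two coefficients of \<open>Top\<close> add up to q, so on constant functions every
  T_\<alpha> acts by q and the idempotent acts as the identity.\<close>

lemma rep_e1_one: "rep e1 (\<lambda>_. 1) \<tau> = 1"
proof -
  have g: "rep (T_word \<alpha>s) (\<lambda>_. 1) \<tau> = q ^ length \<alpha>s" for \<alpha>s \<tau>
  proof (induction \<alpha>s arbitrary: \<tau>)
    case Nil then show ?case by (simp add: rep_1)
  next
    case (Cons \<alpha> \<alpha>s) then show ?case by (simp add: rep_mult rep_gT Top_eq algebra_simps)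
  qed
  have "rep (Tw w) (\<lambda>_. 1) \<tau> = q ^ len w" if "w \<in> weyl" for w
    using reduced_rw[OF that] g[of "rw w" \<tau>] by (simp add: Tw_rw reduced_word_def)
  then have "(\<Sum>w\<in>weyl. q ^ len w * rep (Tw w) (\<lambda>_. 1) \<tau>) = (\<Sum>w\<in>weyl. q ^ len w * q ^ len w)"
    by (intro sum.cong) auto
  then have "rep e1 (\<lambda>_. 1) \<tau> = inverse (W0 (q\<^sup>2)) * (\<Sum>w\<in>weyl. q ^ len w * q ^ len w)"
    by (simp add: e1_def Usum_def rep_mult rep_const rep_sum)
  also have "(\<Sum>w\<in>weyl. q ^ len w * q ^ len w) = W0 (q\<^sup>2)"
    by (simp add: W0_def power_mult[symmetric] mult_2 power_add)
  finally show ?thesis using W0_nz by simp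
qed

text \<open>The element x^\<mu> 1_0 turns the constant 1 into \<sigma> \<mapsto> \<sigma> \<mu>. For
  generic \<tau> the maps \<mu> \<mapsto> \<tau>(v \<mu>), with v in W, are independent characters
  of P, so if \<open>e2\<close> kills all these functions, its operator coefficients vanish, and
  with them its coefficients in the basis.\<close>

lemma AA_not_all_zero:
  assumes "\<And>\<mu>. \<mu> \<in> weights \<Longrightarrow> AA \<mu> \<doteq> 0" shows False
proof -
  let ?k = "inverse (W0 (inverse q ^ 2))" and ?t = "inverse (- q)"
  define c where "c w = (Poly_Mapping.single 0 (?k * ?t ^ len w) :: 'v \<Rightarrow>\<^sub>0 scalar)" for w :: "'v \<Rightarrow> 'v"
  have cK: "c w \<in> KP" for w
    unfolding c_def by (intro KP_single KK_mult KK_power KK_W0_inverse KK_minus_q) simp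
  have "e2 = (\<Sum>w\<in>weyl. const (?k * ?t ^ len w) * Tw w)"
    by (simp only: e2_def Usum_def sum_distrib_left const_simps mult.assoc)
  also have "\<dots> \<doteq> NFsum c"
    unfolding NFsum_def c_def by (intro heq_sum heq_rmult const_lift FA_Tw KK_mult KK_power KK_W0_inverse KK_minus_q)
  finally have e2c: "e2 \<doteq> NFsum c" .
  have op: "opcoef c v \<tau> = 0" if t: "\<tau> \<in> regch" "inj_on \<tau> R" "v \<in> weyl" for v \<tau>
  proof (rule characters_independent[where I = weyl and M = weights and \<chi> = "\<lambda>v \<mu>. \<tau> (v \<mu>)" and a = "\<lambda>v. opcoef c v \<tau>"])
    fix \<mu> assume m: "\<mu> \<in> weights"
    have "rep (gX \<mu> * e1) (\<lambda>_. 1) = (\<lambda>\<sigma>. \<sigma> \<mu>)" by (rule ext) (simp add: rep_mult rep_gX rep_e1_one)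
    then have "rep e2 (\<lambda>\<sigma>. \<sigma> \<mu>) \<tau> = rep (AA \<mu>) (\<lambda>_. 1) \<tau>" by (simp add: AA_def mult.assoc rep_mult)
    also have "\<dots> = 0" using heq_rep[OF assms[OF m] t(1)] by simp
    finally have "rep (NFsum c) (\<lambda>\<sigma>. \<sigma> \<mu>) \<tau> = 0" using heq_rep[OF e2c t(1)] by simp
    then show "(\<Sum>v\<in>weyl. opcoef c v \<tau> * \<tau> (v \<mu>)) = 0" by (simp add: rep_NFsum)
  next
    fix v w assume vw: "v \<in> weyl" "w \<in> weyl" "v \<noteq> w"
    then obtain \<alpha> where "\<alpha> \<in> R" "v \<alpha> \<noteq> w \<alpha>" using weyl_eq_on_R by blast
    then show "\<exists>x\<in>weights. \<tau> (v x) \<noteq> \<tau> (w x)"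
      using inj_onD[OF t(2)] weyl_root vw weights_root by metis
  qed (use t finite_weyl in \<open>auto simp: weights_add weyl_zero weyl_add regch_0 regch_add weights_weyl\<close>)
  \<comment> \<open>This coefficient is 1/W_0(q^-2), which gives the contradiction.\<close>
  have "c id = 0"
    by (rule opcoef_zero[where V = UNIV and c = c and v = id]) (use op keys_KP[OF cK] in auto)
  then have "Poly_Mapping.lookup (c id) 0 = 0" by simp
  then show False using W0_inverse_nz by (simp add: c_def)
qed

section \<open>Weyl characters\<close>

abbreviation sg :: "('v \<Rightarrow> 'v) \<Rightarrow> scalar" where "sg w \<equiv> (-1) ^ len w"

lemma sg_sg: "sg w * sg w = 1" by (simp add: power_mult_distrib[symmetric])

lemma alt_sum_single: "alt_sum \<mu> = (\<Sum>w\<in>weyl. Poly_Mapping.single (w \<mu>) (sg w))"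
proof -
  have "(- 1) ^ n * xpow \<nu> = Poly_Mapping.single \<nu> ((-1) ^ n)" for n and \<nu> :: 'v
    by (cases "even n") (simp_all add: xpow_def single_uminus)
  then show ?thesis by (simp add: alt_sum_def)
qed

lemma KP_alt_sum: "\<mu> \<in> weights \<Longrightarrow> alt_sum \<mu> \<in> KP"
  unfolding alt_sum_single by (intro KP_sum KP_single KK_power KK_uminus KK_1) (rule weights_weyl)

lemma bij_weyl_right: assumes "v \<in> weyl" shows "bij_betw (\<lambda>w. w \<circ> v) weyl weyl"
  by (rule bij_betw_byWitness[where f' = "\<lambda>w. w \<circ> winv v"])
    (use assms weyl_comp weyl_inv weyl_inv_comp[OF assms] in \<open>auto simp: comp_assoc\<close>)

lemma single_scale: "Poly_Mapping.single \<nu> (k * c) = Poly_Mapping.single 0 k * Poly_Mapping.single (\<nu> :: 'v) c"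
  by (simp add: mult_single)

lemma alt_sum_weyl: assumes v: "v \<in> weyl" shows "alt_sum (v \<mu>) = Poly_Mapping.single 0 (sg v) * alt_sum \<mu>"
proof -
  have "sg w = sg v * sg (w \<circ> v)" if "w \<in> weyl" for w
    using sgn_comp[OF that v, where 'b = scalar] sg_sg[of v] by (simp add: mult.commute mult.left_commute)
  then have "alt_sum (v \<mu>) = (\<Sum>w\<in>weyl. Poly_Mapping.single ((w \<circ> v) \<mu>) (sg v * sg (w \<circ> v)))"
    unfolding alt_sum_single by (intro sum.cong) auto
  also have "\<dots> = (\<Sum>w\<in>weyl. Poly_Mapping.single (w \<mu>) (sg v * sg w))"
    by (rule sum.reindex_bij_betw[OF bij_weyl_right[OF v]])
  finally show ?thesis by (simp only: single_scale sum_distrib_left alt_sum_single)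
qed

lemma scalar_of_nat_nz: "n > 0 \<Longrightarrow> (of_nat n :: scalar) \<noteq> 0"
proof -
  assume n: "n > 0"
  have "(of_nat n :: scalar) = Fract (of_nat n) 1" by (induction n) (simp_all add: Zero_fract_def One_fract_def)
  moreover have "(of_nat n :: int poly) \<noteq> 0" using n by simp
  ultimately show ?thesis by (simp add: Zero_fract_def eq_fract)
qed

lemma alt_sum_singular:
  assumes "\<alpha> \<in> simple_roots" "pair \<mu> \<alpha> = 0" shows "alt_sum \<mu> = 0"
proof -
  have "refl \<alpha> \<mu> = \<mu>" using assms(2) by (simp add: refl_pair)
  moreover have "sg (refl \<alpha>) = - 1" using sgn_refl[of id \<alpha>, where 'b = scalar] assms(1) by simp
  ultimately have "alt_sum \<mu> = - alt_sum \<mu>"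
    using alt_sum_weyl[of "refl \<alpha>" \<mu>] weyl_refl simple_R[OF assms(1)] by (simp add: single_uminus)
  then have "Poly_Mapping.single 0 (1 + 1) * alt_sum \<mu> = 0"
    by (simp only: single_add distrib_right) (simp add: eq_neg_iff_add_eq_0)
  moreover have "(1 + 1 :: scalar) \<noteq> 0" using scalar_of_nat_nz[of 2] by simp
  ultimately show ?thesis using single_mult_eq_0 by blast
qed

text \<open>The cancellation law is proved at the leading exponent, since it has to hold without any
  restriction on the exponents of \<open>f\<close>.\<close>

lemma alt_sum_rho_cancel:
  assumes "f * alt_sum \<rho> = 0" shows "f = 0"
proof (rule ccontr)
  assume "f \<noteq> 0"
  then have ne: "Poly_Mapping.keys f \<noteq> {}" using keys_nonempty by auto
  have "Max (ht ` Poly_Mapping.keys f) \<in> ht ` Poly_Mapping.keys f" using ne by (intro Max_in) auto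
  then obtain k where k: "k \<in> Poly_Mapping.keys f" "ht k = Max (ht ` Poly_Mapping.keys f)" by auto
  have mx: "ht m \<le> ht k" if "m \<in> Poly_Mapping.keys f" for m using k(2) that by simp
  have "0 = Poly_Mapping.lookup (f * alt_sum \<rho>) (k + \<rho>)" using assms by simp
  also have "\<dots> = (\<Sum>w\<in>weyl. Poly_Mapping.lookup f (k + \<rho> - w \<rho>) * sg w)"
    by (simp only: alt_sum_single sum_distrib_left lookup_sum lookup_times_single)
  also have "\<dots> = (\<Sum>w\<in>weyl. if w = id then Poly_Mapping.lookup f k else 0)"
  proof (rule sum.cong)
    fix w assume w: "w \<in> weyl"
    show "Poly_Mapping.lookup f (k + \<rho> - w \<rho>) * sg w = (if w = id then Poly_Mapping.lookup f k else 0)"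
    proof (cases "w = id")
      case False
      then have "ht (k + \<rho> - w \<rho>) > ht k" using ht_rho_less[OF w] by (simp add: ht_simps)
      then have "k + \<rho> - w \<rho> \<notin> Poly_Mapping.keys f" using mx by force
      then show ?thesis using False by (simp add: in_keys_iff)
    qed (simp add: len_id)
  qed simp
  also have "\<dots> = Poly_Mapping.lookup f k" using finite_weyl by simp
  finally show False using k(1) by (simp add: in_keys_iff)
qed

section \<open>Divisibility of alternating sums\<close>

definition orbit :: "'v \<Rightarrow> 'v set" where "orbit \<mu> = (\<lambda>w. w \<mu>) ` weyl"

lemma finite_orbit: "finite (orbit \<mu>)" by (simp add: orbit_def finite_weyl)

lemma orbit_bij: assumes "w \<in> weyl" shows "bij_betw w (orbit \<mu>) (orbit \<mu>)"
proof -
  have *: "v ` orbit \<mu> \<subseteq> orbit \<mu>" if v: "v \<in> weyl" for v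
    unfolding orbit_def using weyl_comp[OF v] by (auto intro!: image_eqI[where x = "v \<circ> _"])
  show ?thesis
    by (rule bij_betw_byWitness[where f' = "winv w"])
      (use *[OF assms] *[OF weyl_inv[OF assms]] weyl_inv_apply[OF assms] in auto)
qed

definition orbit_sum :: "'v \<Rightarrow> ('v \<Rightarrow>\<^sub>0 scalar)" where "orbit_sum \<mu> = (\<Sum>\<nu>\<in>orbit \<mu>. xpow \<nu>)"

lemma orbit_sum_InvKP: assumes "\<mu> \<in> weights" shows "orbit_sum \<mu> \<in> InvKP"
  unfolding InvKP_def
proof (intro CollectI conjI ballI)
  show "orbit_sum \<mu> \<in> KP" unfolding orbit_sum_def orbit_def
    using assms weights_weyl by (intro KP_sum KP_xpow) auto
  fix w assume "w \<in> weyl"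
  then show "act w (orbit_sum \<mu>) = orbit_sum \<mu>"
    unfolding orbit_sum_def act_sum act_xpow by (rule sum.reindex_bij_betw[OF orbit_bij])
qed

text \<open>In the summand of w the orbit is reindexed by w, which turns \<nu> + w \<rho> into w
  (\<nu> + \<rho>).\<close>

lemma orbit_sum_alt_sum: "orbit_sum \<mu> * alt_sum \<rho> = (\<Sum>\<nu>\<in>orbit \<mu>. alt_sum (\<nu> + \<rho>))"
proof -
  have "orbit_sum \<mu> * alt_sum \<rho> = (\<Sum>w\<in>weyl. \<Sum>\<nu>\<in>orbit \<mu>. Poly_Mapping.single (\<nu> + w \<rho>) (sg w))"
    unfolding orbit_sum_def alt_sum_single sum_distrib_left sum_distrib_right
    by (simp add: xpow_def mult_single)
  also have "\<dots> = (\<Sum>w\<in>weyl. \<Sum>\<nu>\<in>orbit \<mu>. Poly_Mapping.single (w (\<nu> + \<rho>)) (sg w))"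
  proof (rule sum.cong)
    fix w assume w: "w \<in> weyl"
    have "(\<Sum>\<nu>\<in>orbit \<mu>. Poly_Mapping.single (w \<nu> + w \<rho>) (sg w)) = (\<Sum>\<nu>\<in>orbit \<mu>. Poly_Mapping.single (\<nu> + w \<rho>) (sg w))"
      by (rule sum.reindex_bij_betw[OF orbit_bij[OF w]])
    then show "(\<Sum>\<nu>\<in>orbit \<mu>. Poly_Mapping.single (\<nu> + w \<rho>) (sg w)) = (\<Sum>\<nu>\<in>orbit \<mu>. Poly_Mapping.single (w (\<nu> + \<rho>)) (sg w))"
      by (simp add: weyl_add[OF w])
  qed simp
  also have "\<dots> = (\<Sum>\<nu>\<in>orbit \<mu>. \<Sum>w\<in>weyl. Poly_Mapping.single (w (\<nu> + \<rho>)) (sg w))" by (rule sum.swap)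
  finally show ?thesis by (simp only: alt_sum_single)
qed

lemma InvKP_0 [simp]: "0 \<in> InvKP" and InvKP_1 [simp]: "1 \<in> InvKP"
  and InvKP_add: "f \<in> InvKP \<Longrightarrow> g \<in> InvKP \<Longrightarrow> f + g \<in> InvKP"
  and InvKP_uminus: "f \<in> InvKP \<Longrightarrow> - f \<in> InvKP"
  and InvKP_diff: "f \<in> InvKP \<Longrightarrow> g \<in> InvKP \<Longrightarrow> f - g \<in> InvKP"
  and InvKP_mult: "f \<in> InvKP \<Longrightarrow> g \<in> InvKP \<Longrightarrow> f * g \<in> InvKP"
  and InvKP_const: "k \<in> KK \<Longrightarrow> Poly_Mapping.single 0 k \<in> InvKP"
  by (auto simp: InvKP_def KP_add KP_uminus KP_diff KP_mult KP_single act_add act_uminus act_diff act_mult act_1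
      act_single weyl_zero)

lemma InvKP_sum: "(\<And>i. i \<in> I \<Longrightarrow> f i \<in> InvKP) \<Longrightarrow> sum f I \<in> InvKP"
  by (induction I rule: infinite_finite_induct) (auto simp: InvKP_add)

lemma KK_sg: "sg w \<in> KK" by (intro KK_power KK_uminus KK_1)

text \<open>A dominant conjugate lies either on a wall or strictly inside the chamber, and in the
  second case it stays dominant after subtracting \<rho>.\<close>

lemma dominant_conj_weight:
  assumes "\<mu> \<in> weights"
  obtains w where "w \<in> weyl" "w \<mu> - \<rho> \<in> dominant_weights"
    | w \<alpha> where "w \<in> weyl" "\<alpha> \<in> simple_roots" "pair (w \<mu>) \<alpha> = 0"
proof -
  obtain w where w: "w \<in> weyl" "\<forall>\<alpha>\<in>simple_roots. pair (w \<mu>) \<alpha> \<ge> 0" using dominant_conj by blast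
  show ?thesis
  proof (cases "\<exists>\<alpha>\<in>simple_roots. pair (w \<mu>) \<alpha> = 0")
    case False
    then have "w \<mu> - \<rho> \<in> dominant_weights"
      using w by (intro dominant_regular weights_weyl[OF w(1) assms]) (auto simp: less_le)
    then show ?thesis using that w by blast
  qed (use that w in blast)
qed

text \<open>The orbit sum times a_\<rho> is the sum of a_(\<nu>+\<rho>) over the orbit of \<mu>.
  Each term with \<nu> different from \<mu> is zero or, up to sign, an a_(\<lambda>+\<rho>) with
  \<lambda> dominant of smaller height, so induction solves for a_(\<mu>+\<rho>). The quotient is
  then visibly invariant with coefficients in K.\<close>

lemma alt_sum_divisible:
  assumes "\<mu> \<in> dominant_weights" shows "\<exists>h\<in>InvKP. h * alt_sum \<rho> = alt_sum (\<mu> + \<rho>)"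
  using assms
proof (induction "nat \<lfloor>ht \<mu>\<rfloor>" arbitrary: \<mu> rule: less_induct)
  case less
  have m: "\<mu> \<in> weights" "\<And>\<alpha>. \<alpha> \<in> simple_roots \<Longrightarrow> pair \<mu> \<alpha> \<ge> 0"
    using less.prems by (auto simp: dominant_weights_iff)
  have r: "\<And>\<alpha>. \<alpha> \<in> simple_roots \<Longrightarrow> pair \<rho> \<alpha> \<ge> 0" by (simp add: pair_rho)
  have "\<exists>h\<in>InvKP. h * alt_sum \<rho> = alt_sum (\<nu> + \<rho>)" if n: "\<nu> \<in> orbit \<mu>" "\<nu> \<noteq> \<mu>" for \<nu>
  proof -
    obtain v where v: "v \<in> weyl" "\<nu> = v \<mu>" using n(1) by (auto simp: orbit_def)
    have nw: "\<nu> + \<rho> \<in> weights" using v m weights_weyl weights_add rho_weight by auto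
    show ?thesis
    proof (rule dominant_conj_weight[OF nw])
      fix w assume w: "w \<in> weyl" "w (\<nu> + \<rho>) - \<rho> \<in> dominant_weights"
      let ?l = "w (\<nu> + \<rho>) - \<rho>"
      have "(w \<circ> v) \<in> weyl" using weyl_comp w v by auto
      from ht_weyl_le[OF this m(2)] have 1: "ht (w \<nu>) \<le> ht \<mu>" "ht (w \<nu>) = ht \<mu> \<Longrightarrow> w \<nu> = \<mu>" by (simp_all add: v)
      have 2: "ht (w \<rho>) \<le> ht \<rho>" using ht_weyl_le[OF w(1) r] by blast
      \<comment> \<open>Otherwise both \<mu> and \<rho> keep their full height; for \<rho> this
        forces w = id, and then \<nu> = \<mu>.\<close>
      have "ht ?l < ht \<mu>"
      proof (rule ccontr)
        assume "\<not> ht ?l < ht \<mu>"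
        then have e: "ht (w \<nu>) = ht \<mu>" "ht (w \<rho>) = ht \<rho>" using 1(1) 2 by (simp_all add: weyl_add[OF w(1)] ht_simps)
        have "w = id" using ht_rho_less[OF w(1)] e(2) by auto
        then show False using 1(2)[OF e(1)] n(2) by simp
      qed
      moreover have "ht ?l \<in> \<int>" "ht \<mu> \<in> \<int>" "ht ?l \<ge> 0"
        using ht_weight_Ints ht_dominant_nonneg w(2) m(1) by (auto simp: dominant_weights_iff)
      ultimately have "nat \<lfloor>ht ?l\<rfloor> < nat \<lfloor>ht \<mu>\<rfloor>" by (auto elim!: Ints_cases)
      from less.hyps[OF this w(2)] obtain h where h: "h \<in> InvKP" "h * alt_sum \<rho> = alt_sum (w (\<nu> + \<rho>))" by auto
      have "Poly_Mapping.single 0 (sg w) * h * alt_sum \<rho>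
          = Poly_Mapping.single 0 (sg w) * (Poly_Mapping.single 0 (sg w) * alt_sum (\<nu> + \<rho>))"
        using h(2) alt_sum_weyl[OF w(1)] by (simp only: mult.assoc)
      also have "\<dots> = alt_sum (\<nu> + \<rho>)" by (simp only: mult.assoc[symmetric] mult_single sg_sg) simp
      finally show ?thesis using InvKP_mult[OF InvKP_const[OF KK_sg] h(1)] by blast
    next
      fix w \<alpha> assume w: "w \<in> weyl" "\<alpha> \<in> simple_roots" "pair (w (\<nu> + \<rho>)) \<alpha> = 0"
      have "Poly_Mapping.single 0 (sg w) * alt_sum (\<nu> + \<rho>) = 0"
        using alt_sum_singular[OF w(2,3)] alt_sum_weyl[OF w(1)] by simp
      then have "alt_sum (\<nu> + \<rho>) = 0" by (rule single_mult_eq_0[rotated]) simp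
      then show ?thesis by (intro bexI[of _ 0]) simp_all
    qed
  qed
  then obtain h where h: "\<And>\<nu>. \<nu> \<in> orbit \<mu> - {\<mu>} \<Longrightarrow> h \<nu> \<in> InvKP \<and> h \<nu> * alt_sum \<rho> = alt_sum (\<nu> + \<rho>)" by (metis DiffE singletonI)
  have mo: "\<mu> \<in> orbit \<mu>" unfolding orbit_def by (rule image_eqI[of _ _ id]) auto
  let ?h = "orbit_sum \<mu> - sum h (orbit \<mu> - {\<mu>})"
  have "?h * alt_sum \<rho> = (\<Sum>\<nu>\<in>orbit \<mu>. alt_sum (\<nu> + \<rho>)) - (\<Sum>\<nu>\<in>orbit \<mu> - {\<mu>}. alt_sum (\<nu> + \<rho>))"
    using h by (simp add: left_diff_distrib orbit_sum_alt_sum sum_distrib_right)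
  also have "\<dots> = alt_sum (\<mu> + \<rho>)" using sum.remove[OF finite_orbit mo, of "\<lambda>\<nu>. alt_sum (\<nu> + \<rho>)"] by simp
  finally have "?h * alt_sum \<rho> = alt_sum (\<mu> + \<rho>)" .
  moreover have "?h \<in> InvKP" using h by (intro InvKP_diff InvKP_sum orbit_sum_InvKP m) auto
  ultimately show ?case by blast
qed

lemma weyl_character:
  assumes "\<mu> \<in> dominant_weights"
  shows "weyl_character \<mu> \<in> InvKP" "weyl_character \<mu> * alt_sum \<rho> = alt_sum (\<mu> + \<rho>)"
proof -
  obtain h where h: "h \<in> InvKP" "h * alt_sum \<rho> = alt_sum (\<mu> + \<rho>)" using alt_sum_divisible[OF assms] by blast
  have "weyl_character \<mu> = h" unfolding weyl_character_def exact_quot_def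
  proof (rule the_equality)
    show "h * alt_sum \<rho> = alt_sum (\<mu> + \<rho>)" by (rule h(2))
    fix g assume "g * alt_sum \<rho> = alt_sum (\<mu> + \<rho>)"
    then have "(g - h) * alt_sum \<rho> = 0" using h(2) by (simp add: left_diff_distrib)
    then show "g = h" using alt_sum_rho_cancel by fastforce
  qed
  then show "weyl_character \<mu> \<in> InvKP" "weyl_character \<mu> * alt_sum \<rho> = alt_sum (\<mu> + \<rho>)" using h by auto
qed

section \<open>Images of the Weyl characters\<close>

lemma const_sg: "const (sg w) = (-1) ^ len w"
  by (simp add: const_power const_simps)

text \<open>The signs of a_\<mu> and of \<open>AA_weyl\<close> cancel, so all |W| terms
  coincide.\<close>

lemma e2_alt_sum: assumes m: "\<mu> \<in> weights" shows "e2 * lift_KP (alt_sum \<mu>) * e1 \<doteq> const (of_nat (card weyl)) * AA \<mu>"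
proof -
  have "lift_KP (alt_sum \<mu>) = (\<Sum>w\<in>weyl. const (sg w) * gX (w \<mu>))"
    by (simp only: alt_sum_single lift_sum lift_single)
  then have "e2 * lift_KP (alt_sum \<mu>) * e1 = (\<Sum>w\<in>weyl. const (sg w) * AA (w \<mu>))"
    by (simp only: sum_distrib_left sum_distrib_right AA_def mult.assoc const_left_commute[of e2])
  also have "\<dots> \<doteq> (\<Sum>w\<in>weyl. const (sg w) * ((-1) ^ len w * AA \<mu>))"
    by (intro heq_sum heq_lmult AA_weyl m FA_const KK_sg)
  also have "\<dots> = (\<Sum>w\<in>weyl. const (sg w * sg w) * AA \<mu>)"
    by (simp only: const_simps(2) const_sg mult.assoc)
  also have "\<dots> = const (of_nat (card weyl)) * AA \<mu>"
    by (simp only: sg_sg sum_distrib_right[symmetric] const_sum[symmetric]) simp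
  finally show ?thesis .
qed

lemma KK_of_nat: "of_nat n \<in> KK" by (induction n) (simp_all add: KK_add)

lemma AA_lift:
  assumes f: "f \<in> InvKP" and m: "\<mu> \<in> weights"
  shows "AA \<mu> * (lift_KP f * e1) \<doteq> lift_KP f * AA \<mu>" "AA \<mu> * (lift_KP f * e1) \<doteq> e2 * (lift_KP f * gX \<mu>) * e1"
proof -
  have F: "lift_KP f \<in> FA" using f InvKP_D FA_lift by auto
  have X: "gX \<mu> \<in> FA" using FA_gX m by auto
  have "AA \<mu> * (lift_KP f * e1) \<doteq> lift_KP f * AA \<mu> * e1"
    using heq_rmult[OF heq_sym[OF InvKP_central[OF f FA_AA[OF m]]] FA_e1] by (simp add: mult.assoc)
  also have "lift_KP f * AA \<mu> * e1 = lift_KP f * (e2 * gX \<mu> * (e1 * e1))" by (simp add: AA_def mult.assoc)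
  also have "\<dots> \<doteq> lift_KP f * (e2 * gX \<mu> * e1)" by (intro heq_lmult e1_e1 FA_mult F X FA_e2)
  finally show 1: "AA \<mu> * (lift_KP f * e1) \<doteq> lift_KP f * AA \<mu>" by (simp add: AA_def)
  also have "lift_KP f * AA \<mu> = (lift_KP f * e2) * (gX \<mu> * e1)" by (simp add: AA_def mult.assoc)
  also have "\<dots> \<doteq> (e2 * lift_KP f) * (gX \<mu> * e1)" by (intro heq_rmult InvKP_central f FA_e2 FA_mult X FA_e1)
  finally show "AA \<mu> * (lift_KP f * e1) \<doteq> e2 * (lift_KP f * gX \<mu>) * e1" by (simp add: mult.assoc)
qed

text \<open>Place the product of the character with a_\<rho> between the two idempotents. Both sides
  then carry the factor |W|, which is removed only at the end, by
  \<open>torsion_free\<close>.\<close>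

lemma AA_character:
  assumes l: "\<mu> \<in> dominant_weights"
  shows "AA \<rho> * (lift_KP (weyl_character \<mu>) * e1) \<doteq> AA (\<mu> + \<rho>)"
proof -
  let ?s = "weyl_character \<mu>" and ?N = "of_nat (card weyl) :: scalar"
  have s: "?s \<in> InvKP" "?s \<in> KP" "lift_KP ?s \<in> FA" using weyl_character[OF l] InvKP_D FA_lift by auto
  have mw: "\<mu> + \<rho> \<in> weights" using l rho_weight weights_add by (auto simp: dominant_weights_iff)
  have aK: "alt_sum \<rho> \<in> KP" "lift_KP (alt_sum \<rho>) \<in> FA" using KP_alt_sum rho_weight FA_lift by auto
  have "const ?N * AA (\<mu> + \<rho>) \<doteq> e2 * lift_KP (?s * alt_sum \<rho>) * e1"
    using heq_sym[OF e2_alt_sum[OF mw]] by (simp add: weyl_character(2)[OF l])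
  also have "\<dots> \<doteq> e2 * (lift_KP ?s * lift_KP (alt_sum \<rho>)) * e1"
    by (intro heq_rmult heq_lmult lift_mult s aK FA_e1 FA_e2)
  also have "e2 * (lift_KP ?s * lift_KP (alt_sum \<rho>)) * e1 = (e2 * lift_KP ?s) * (lift_KP (alt_sum \<rho>) * e1)"
    by (simp add: mult.assoc)
  also have "\<dots> \<doteq> (lift_KP ?s * e2) * (lift_KP (alt_sum \<rho>) * e1)"
    by (intro heq_rmult heq_sym[OF InvKP_central] s FA_e2 FA_mult aK FA_e1)
  also have "(lift_KP ?s * e2) * (lift_KP (alt_sum \<rho>) * e1) = lift_KP ?s * (e2 * lift_KP (alt_sum \<rho>) * e1)"
    by (simp add: mult.assoc)
  also have "\<dots> \<doteq> lift_KP ?s * (const ?N * AA \<rho>)" by (intro heq_lmult e2_alt_sum rho_weight s)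
  also have "lift_KP ?s * (const ?N * AA \<rho>) = const ?N * (lift_KP ?s * AA \<rho>)" by (rule const_left_commute)
  also have "\<dots> \<doteq> const ?N * (AA \<rho> * (lift_KP ?s * e1))"
    by (intro heq_lmult heq_sym[OF AA_lift(1)] s rho_weight FA_const KK_of_nat)
  finally have "const ?N * (AA \<rho> * (lift_KP ?s * e1) - AA (\<mu> + \<rho>)) \<doteq> 0"
    using heq_sym by (fastforce simp: heq_def right_diff_distrib)
  moreover have "?N \<noteq> 0" using finite_weyl weyl_nonempty by (intro scalar_of_nat_nz) (simp add: card_gt_0_iff)
  moreover have "AA \<rho> * (lift_KP ?s * e1) - AA (\<mu> + \<rho>) \<in> FA"
    by (intro FA_diff FA_mult FA_AA rho_weight mw s FA_e1)
  ultimately have "AA \<rho> * (lift_KP ?s * e1) - AA (\<mu> + \<rho>) \<doteq> 0"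
    using torsion_free KK_of_nat by blast
  then show ?thesis by (simp add: heq_def)
qed

text \<open>Conjugate \<mu> to a dominant weight. Strictly inside the chamber A_\<mu> is, up to
  sign, the image of a Weyl character; on a wall it is zero.\<close>

lemma AA_surj: assumes m: "\<mu> \<in> weights" shows "\<exists>f\<in>InvKP. AA \<mu> \<doteq> AA \<rho> * (lift_KP f * e1)"
proof (rule dominant_conj_weight[OF m])
  fix w assume w: "w \<in> weyl" "w \<mu> - \<rho> \<in> dominant_weights"
  let ?s = "weyl_character (w \<mu> - \<rho>)"
  have "const (sg w) * AA (w \<mu>) \<doteq> const (sg w) * ((-1) ^ len w * AA \<mu>)"
    by (intro heq_lmult AA_weyl w m FA_const KK_sg)
  also have "const (sg w) * ((-1) ^ len w * AA \<mu>) = const (sg w * sg w) * AA \<mu>"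
    by (simp only: const_simps(2) const_sg mult.assoc)
  also have "\<dots> = AA \<mu>" by (simp only: sg_sg const_simps) simp
  finally have "AA \<mu> \<doteq> const (sg w) * AA (w \<mu>)" by (rule heq_sym)
  also have "\<dots> \<doteq> const (sg w) * (AA \<rho> * (lift_KP ?s * e1))"
    by (intro heq_lmult FA_const KK_sg) (use heq_sym[OF AA_character[OF w(2)]] in simp)
  also have "const (sg w) * (AA \<rho> * (lift_KP ?s * e1)) = AA \<rho> * (lift_KP (Poly_Mapping.single 0 (sg w) * ?s) * e1)"
    by (simp only: lift_scale mult.assoc const_left_commute[of "AA \<rho>"])
  finally show ?thesis using InvKP_mult[OF InvKP_const[OF KK_sg] weyl_character(1)[OF w(2)]] by blast
next
  fix w \<alpha> assume w: "w \<in> weyl" "\<alpha> \<in> simple_roots" "pair (w \<mu>) \<alpha> = 0"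
  have "const (sg w) * AA \<mu> \<doteq> AA (w \<mu>)" using heq_sym[OF AA_weyl[OF w(1) m]] by (simp add: const_sg)
  also have "\<dots> \<doteq> 0" by (rule AA_singular[OF weights_weyl[OF w(1) m] w(2,3)])
  finally have "AA \<mu> \<doteq> 0" by (rule torsion_free[OF FA_AA[OF m], rotated]) (use KK_sg in auto)
  then show ?thesis by (intro bexI[of _ 0]) simp_all
qed

text \<open>By \<open>H_e1\<close> the middle factor may be taken in K[P], and linearity reduces to
  single exponents.\<close>

lemma alternating_surj:
  assumes "h \<in> FA" shows "\<exists>f\<in>InvKP. e2 * h * e1 \<doteq> AA \<rho> * (lift_KP f * e1)"
proof -
  obtain g where g: "g \<in> KP" "h * e1 \<doteq> lift_KP g * e1" using H_e1[OF assms] by blast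
  have k: "Poly_Mapping.keys g \<subseteq> weights" "\<And>\<mu>. Poly_Mapping.lookup g \<mu> \<in> KK" using g KP_iff by auto
  obtain f where f: "\<And>\<mu>. \<mu> \<in> Poly_Mapping.keys g \<Longrightarrow> f \<mu> \<in> InvKP \<and> AA \<mu> \<doteq> AA \<rho> * (lift_KP (f \<mu>) * e1)"
    using AA_surj k(1) by (metis subsetD)
  let ?f = "\<Sum>\<mu>\<in>Poly_Mapping.keys g. Poly_Mapping.single 0 (Poly_Mapping.lookup g \<mu>) * f \<mu>"
  have "e2 * h * e1 \<doteq> e2 * (lift_KP g * e1)" using heq_lmult[OF g(2) FA_e2] by (simp add: mult.assoc)
  also have "e2 * (lift_KP g * e1) = (\<Sum>\<mu>\<in>Poly_Mapping.keys g. const (Poly_Mapping.lookup g \<mu>) * AA \<mu>)"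
    by (simp only: lift_KP_def sum_distrib_left sum_distrib_right AA_def mult.assoc const_left_commute[of e2])
  also have "\<dots> \<doteq> (\<Sum>\<mu>\<in>Poly_Mapping.keys g. const (Poly_Mapping.lookup g \<mu>) * (AA \<rho> * (lift_KP (f \<mu>) * e1)))"
    using f k by (intro heq_sum heq_lmult FA_const) auto
  also have "\<dots> = AA \<rho> * (lift_KP ?f * e1)"
    by (simp only: lift_sum lift_scale sum_distrib_left sum_distrib_right mult.assoc const_left_commute[of "AA \<rho>"])
  finally have "e2 * h * e1 \<doteq> AA \<rho> * (lift_KP ?f * e1)" .
  moreover have "?f \<in> InvKP" using f k by (intro InvKP_sum InvKP_mult InvKP_const) auto
  ultimately show ?thesis by blast
qed

text \<open>By \<open>AA_surj\<close> every A_\<mu> is a right multiple of A_\<rho>, so its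
  vanishing would kill them all.\<close>

lemma AA_rho_nz: "\<not> AA \<rho> \<doteq> 0"
proof
  assume z: "AA \<rho> \<doteq> 0"
  have "AA \<mu> \<doteq> 0" if m: "\<mu> \<in> weights" for \<mu>
  proof -
    obtain f where f: "f \<in> InvKP" "AA \<mu> \<doteq> AA \<rho> * (lift_KP f * e1)" using AA_surj[OF m] by blast
    have "AA \<rho> * (lift_KP f * e1) \<doteq> 0 * (lift_KP f * e1)"
      using f InvKP_D by (intro heq_rmult z FA_mult FA_lift FA_e1) auto
    then show ?thesis using heq_trans[OF f(2)] by simp
  qed
  then show False by (rule AA_not_all_zero)
qed

lemma alternating_inj:
  assumes f: "f \<in> InvKP" "AA \<rho> * (lift_KP f * e1) \<doteq> 0" shows "f = 0"
proof (rule ccontr)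
  assume f0: "f \<noteq> 0"
  have fK: "f \<in> KP" using f InvKP_D by auto
  obtain c where c: "\<forall>w\<in>weyl. c w \<in> KP" "AA \<rho> \<doteq> NFsum c"
    using NF_all[OF FA_AA[OF rho_weight]] by (auto simp: NF_def)
  have "NFsum (\<lambda>w. f * c w) \<doteq> (\<Sum>w\<in>weyl. lift_KP f * lift_KP (c w) * Tw w)"
    unfolding NFsum_def using c fK by (intro heq_sum heq_rmult lift_mult FA_Tw) auto
  also have "(\<Sum>w\<in>weyl. lift_KP f * lift_KP (c w) * Tw w) = lift_KP f * NFsum c"
    by (simp only: NFsum_def sum_distrib_left mult.assoc)
  also have "\<dots> \<doteq> lift_KP f * AA \<rho>" by (intro heq_lmult heq_sym[OF c(2)] FA_lift fK)
  also have "\<dots> \<doteq> AA \<rho> * (lift_KP f * e1)" by (rule heq_sym[OF AA_lift(1)[OF f(1) rho_weight]])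
  also have "\<dots> \<doteq> 0" by (rule f(2))
  finally have z: "NFsum (\<lambda>w. f * c w) \<doteq> 0" .
  have "c w = 0" if w: "w \<in> weyl" for w
  proof -
    have "f * c v \<in> KP" if "v \<in> weyl" for v using c fK that by (intro KP_mult) auto
    then have "f * c w = 0" using PBW[of "\<lambda>w. f * c w" w] z w keys_KP by blast
    then show ?thesis using KP_no_zero_divisors[of f "c w"] keys_KP fK c w f0 by blast
  qed
  then have "NFsum c = 0" by (simp add: NFsum_def)
  then show False using c(2) AA_rho_nz by simp
qed

section \<open>The quotient algebra\<close>

lemma coeff_ring_simps: "monoid.mult coeff_ring = (*)" "monoid.one coeff_ring = 1"
    "ring.zero coeff_ring = 0" "ring.add coeff_ring = (+)"
  by (simp_all add: coeff_ring_def ring_of_type_algebra_def)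

lemma cring_coeff_ring: "cring coeff_ring"
proof (rule cringI)
  show "abelian_group coeff_ring"
    by (rule abelian_groupI)
      (auto simp: coeff_ring_simps KK_add add.assoc add.commute intro!: bexI[of _ "- _"] KK_uminus)
  show "comm_monoid coeff_ring"
    by (rule comm_monoidI) (auto simp: coeff_ring_simps KK_mult mult.assoc mult.commute)
qed (auto simp: coeff_ring_simps distrib_right)

lemma cls_eq: "cls f = cls g \<longleftrightarrow> f \<doteq> g"
proof
  have cls: "cls f = (\<lambda>r. r + f) ` rel_ideal" for f
    by (auto simp: cls_def a_r_coset_def r_coset_def free_alg_simps)
  {
    assume "cls f = cls g"
    then have "0 + f \<in> (\<lambda>r. r + g) ` rel_ideal" unfolding cls using rel_closed(1) by blast
    then show "f \<doteq> g" by (auto simp: heq_def)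
  }
  have "cls f \<subseteq> cls g" if "f \<doteq> g" for f g
  proof
    fix x assume "x \<in> cls f"
    then obtain r where r: "r \<in> rel_ideal" "x = r + f" by (auto simp: cls)
    then have "x = (r + (f - g)) + g" "r + (f - g) \<in> rel_ideal"
      using that by (auto simp: heq_def intro: rel_closed)
    then show "x \<in> cls g" unfolding cls by blast
  qed
  then show "f \<doteq> g \<Longrightarrow> cls f = cls g" using heq_sym by blast
qed

lemma hecke_carrier: "carrier hecke = cls ` FA"
  by (auto simp: hecke_def Let_def FactRing_def A_RCOSETS_def RCOSETS_def cls_def a_r_coset_def)

lemma hecke_mult: "f \<in> FA \<Longrightarrow> g \<in> FA \<Longrightarrow> monoid.mult hecke (cls f) (cls g) = cls (f * g)"
  using ideal.rcoset_mult_add[OF ideal_rel] by (simp add: hecke_def Let_def FactRing_def cls_def free_alg_simps)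

lemma hecke_add: "f \<in> FA \<Longrightarrow> g \<in> FA \<Longrightarrow> ring.add hecke (cls f) (cls g) = cls (f + g)"
proof -
  interpret i: ideal rel_ideal free_alg by (rule ideal_rel)
  show "f \<in> FA \<Longrightarrow> g \<in> FA \<Longrightarrow> ring.add hecke (cls f) (cls g) = cls (f + g)"
    using i.a_rcos_sum[of f g] by (simp add: hecke_def Let_def FactRing_def cls_def free_alg_simps)
qed

lemma hecke_one: "monoid.one hecke = cls 1"
  by (simp add: hecke_def Let_def FactRing_def cls_def free_alg_simps)

lemma hecke_zero: "ring.zero hecke = cls 0"
proof -
  have "cls 0 = rel_ideal" by (auto simp: cls_def a_r_coset_def r_coset_def free_alg_simps)
  then show ?thesis by (simp add: hecke_def Let_def FactRing_def)
qed

lemma hecke_smult: "k \<in> KK \<Longrightarrow> f \<in> FA \<Longrightarrow> module.smult hecke k (cls f) = cls (const k * f)"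
  using hecke_mult[of "const k" f] FA_const by (simp add: hecke_def Let_def)

lemma KPW_simps: "carrier KPW = InvKP" "monoid.mult KPW = (*)" "monoid.one KPW = 1"
    "ring.zero KPW = 0" "ring.add KPW = (+)" "module.smult KPW k f = Poly_Mapping.single 0 k * f"
  by (simp_all add: KPW_def InvKP_def)

lemma module_KPW: "Module.module coeff_ring KPW"
proof (rule moduleI[OF cring_coeff_ring])
  show "abelian_group KPW"
    by (rule abelian_groupI)
      (auto simp: KPW_simps InvKP_add add.assoc add.commute intro!: bexI[of _ "- _"] InvKP_uminus)
qed (auto simp: KPW_simps coeff_ring_simps single_add distrib_left distrib_right InvKP_mult InvKP_const
      mult.assoc[symmetric] mult_single)

text \<open>Each of the four modules of the theorem is the image of the invariants under an injective
  linear map into the free algebra modulo relations.\<close>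

definition embeds :: "(('v \<Rightarrow>\<^sub>0 scalar) \<Rightarrow> ('v gen word \<Rightarrow>\<^sub>0 scalar)) \<Rightarrow> bool" where
  "embeds \<phi> \<longleftrightarrow> (\<forall>f\<in>InvKP. \<phi> f \<in> FA) \<and> (\<forall>f g. \<phi> (f + g) = \<phi> f + \<phi> g) \<and>
    (\<forall>k f. \<phi> (Poly_Mapping.single 0 k * f) = const k * \<phi> f) \<and> (\<forall>f\<in>InvKP. \<phi> f \<doteq> 0 \<longrightarrow> f = 0)"

definition Img :: "(('v \<Rightarrow>\<^sub>0 scalar) \<Rightarrow> ('v gen word \<Rightarrow>\<^sub>0 scalar)) \<Rightarrow> ('v gen word \<Rightarrow>\<^sub>0 scalar) set set" where
  "Img \<phi> = (\<lambda>f. cls (\<phi> f)) ` InvKP"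

lemma embedsD:
  assumes "embeds \<phi>"
  shows "f \<in> InvKP \<Longrightarrow> \<phi> f \<in> FA" "\<phi> (f + g) = \<phi> f + \<phi> g" "\<phi> (Poly_Mapping.single 0 k * f) = const k * \<phi> f"
    "f \<in> InvKP \<Longrightarrow> \<phi> f \<doteq> 0 \<Longrightarrow> f = 0" "\<phi> 0 = 0" "\<phi> (- f) = - \<phi> f" "\<phi> (f - g) = \<phi> f - \<phi> g"
proof -
  show add: "\<phi> (f + g) = \<phi> f + \<phi> g" for f g using assms by (simp add: embeds_def)
  show z: "\<phi> 0 = 0" using add[of 0 0] by simp
  show m: "\<phi> (- f) = - \<phi> f" for f using add[of f "- f"] z by (simp add: eq_neg_iff_add_eq_0 add.commute)
  show "\<phi> (f - g) = \<phi> f - \<phi> g" using add[of f "- g"] m by simp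
qed (use assms in \<open>auto simp: embeds_def\<close>)

lemma embeds_bij: assumes "embeds \<phi>" shows "bij_betw (\<lambda>f. cls (\<phi> f)) InvKP (Img \<phi>)"
  unfolding bij_betw_def Img_def
proof (intro conjI inj_onI refl)
  fix f g assume fg: "f \<in> InvKP" "g \<in> InvKP" "cls (\<phi> f) = cls (\<phi> g)"
  then have "\<phi> (f - g) \<doteq> 0" by (simp add: cls_eq embedsD(7)[OF assms] heq_def)
  then have "f - g = 0" using embedsD(4)[OF assms] InvKP_diff fg by blast
  then show "f = g" by simp
qed

lemma embeds_module:
  assumes e: "embeds \<phi>" shows "Module.module coeff_ring (hecke\<lparr>carrier := Img \<phi>\<rparr>)"
proof -
  note D = embedsD[OF e]
  have add: "ring.add hecke (cls (\<phi> f)) (cls (\<phi> g)) = cls (\<phi> (f + g))" if "f \<in> InvKP" "g \<in> InvKP" for f g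
    using that by (simp only: D(2)) (simp add: hecke_add D(1))
  have sm: "module.smult hecke k (cls (\<phi> f)) = cls (\<phi> (Poly_Mapping.single 0 k * f))" if "k \<in> KK" "f \<in> InvKP" for k f
    using that by (simp only: D(3)) (simp add: hecke_smult D(1))
  have zero: "ring.zero hecke = cls (\<phi> 0)" by (simp add: hecke_zero D(5))
  have m: "- f \<in> InvKP \<and> (- f) + f = 0" if "f \<in> InvKP" for f using that InvKP_uminus by simp
  show ?thesis
  proof (rule moduleI[OF cring_coeff_ring])
    show "abelian_group (hecke\<lparr>carrier := Img \<phi>\<rparr>)"
    proof (rule abelian_groupI)
      fix x assume "x \<in> carrier (hecke\<lparr>carrier := Img \<phi>\<rparr>)"
      then obtain f where f: "f \<in> InvKP" "x = cls (\<phi> f)" by (auto simp: Img_def)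
      have "ring.add hecke (cls (\<phi> (- f))) (cls (\<phi> f)) = ring.zero hecke"
        using add[of "- f" f] m f(1) zero by simp
      then show "\<exists>y\<in>carrier (hecke\<lparr>carrier := Img \<phi>\<rparr>).
          y \<oplus>\<^bsub>hecke\<lparr>carrier := Img \<phi>\<rparr>\<^esub> x = \<zero>\<^bsub>hecke\<lparr>carrier := Img \<phi>\<rparr>\<^esub>"
        using m f by (auto simp: Img_def)
    qed (auto simp: Img_def add zero InvKP_add add_ac)
  qed (auto simp: Img_def add sm coeff_ring_simps KK_add KK_mult InvKP_add InvKP_mult InvKP_const single_add distrib_left
      distrib_right mult.assoc[symmetric] mult_single)
qed

lemma embeds_KPW_iso:
  assumes e: "embeds \<phi>" shows "module_iso coeff_ring KPW (hecke\<lparr>carrier := Img \<phi>\<rparr>) (\<lambda>f. cls (\<phi> f))"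
  unfolding module_iso_def using module_KPW embeds_module[OF e] embeds_bij[OF e] embedsD[OF e]
  by (auto simp: KPW_simps hecke_add hecke_smult)

text \<open>A map that matches the two parametrisations by invariants inherits bijectivity and
  linearity from them.\<close>

lemma embeds_iso:
  assumes e: "embeds \<phi>" "embeds \<psi>" and F: "\<And>f. f \<in> InvKP \<Longrightarrow> F (cls (\<phi> f)) = cls (\<psi> f)"
  shows "module_iso coeff_ring (hecke\<lparr>carrier := Img \<phi>\<rparr>) (hecke\<lparr>carrier := Img \<psi>\<rparr>) F"
  unfolding module_iso_def
proof (intro conjI ballI)
  let ?M = "hecke\<lparr>carrier := Img \<phi>\<rparr>" and ?N = "hecke\<lparr>carrier := Img \<psi>\<rparr>"
  note D = embedsD[OF e(1)] and E = embedsD[OF e(2)]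
  have "bij_betw F (Img \<phi>) (Img \<psi>) \<longleftrightarrow> bij_betw (F \<circ> (\<lambda>f. cls (\<phi> f))) InvKP (Img \<psi>)"
    by (rule bij_betw_comp_iff[OF embeds_bij[OF e(1)]])
  also have "\<dots> \<longleftrightarrow> bij_betw (\<lambda>f. cls (\<psi> f)) InvKP (Img \<psi>)" by (rule bij_betw_cong) (simp add: F)
  finally show "bij_betw F (carrier ?M) (carrier ?N)" using embeds_bij[OF e(2)] by simp
  fix x assume x: "x \<in> carrier ?M"
  then obtain f where f: "f \<in> InvKP" "x = cls (\<phi> f)" by (auto simp: Img_def)
  {
    fix y assume "y \<in> carrier ?M"
    then obtain g where g: "g \<in> InvKP" "y = cls (\<phi> g)" by (auto simp: Img_def)
    have "F (cls (\<phi> (f + g))) = cls (\<psi> (f + g))" by (rule F[OF InvKP_add[OF f(1) g(1)]])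
    then show "F (x \<oplus>\<^bsub>?M\<^esub> y) = F x \<oplus>\<^bsub>?N\<^esub> F y" using f g by (simp add: D E F hecke_add)
  }
  fix k assume k: "k \<in> KK"
  have "F (cls (\<phi> (Poly_Mapping.single 0 k * f))) = cls (\<psi> (Poly_Mapping.single 0 k * f))"
    by (rule F[OF InvKP_mult[OF InvKP_const[OF k] f(1)]])
  then show "F (k \<odot>\<^bsub>?M\<^esub> x) = k \<odot>\<^bsub>?N\<^esub> F x" using f k by (simp add: D E F hecke_smult)
qed (use embeds_module e in auto)

lemma embeds_lift: "embeds lift_KP"
  unfolding embeds_def using InvKP_D FA_lift lift_add lift_scale lift_inj[of _ 0] by auto

lemma embeds_lift_e1: "embeds (\<lambda>f. lift_KP f * e1)"
  unfolding embeds_def using InvKP_D FA_lift FA_mult FA_e1 lift_e1_inj[of _ 0]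
  by (auto simp: lift_add lift_scale distrib_right mult.assoc)

lemma embeds_A: "embeds (\<lambda>f. AA \<rho> * (lift_KP f * e1))"
  unfolding embeds_def using InvKP_D FA_lift FA_mult FA_e1 FA_AA[OF rho_weight] alternating_inj
  by (auto simp: lift_add lift_scale distrib_left distrib_right mult.assoc const_left_commute[of "AA \<rho>"])

lemma A_AA: "\<mu> \<in> weights \<Longrightarrow> A \<mu> = cls (AA \<mu>)"
  by (simp add: A_def one0_e1 eps0_e2 AA_def hecke_mult FA_e1 FA_e2 FA_gX FA_mult)

lemma center: "ring_center hecke = Img lift_KP"
proof -
  have "(\<forall>h\<in>carrier hecke. cls z \<otimes>\<^bsub>hecke\<^esub> h = h \<otimes>\<^bsub>hecke\<^esub> cls z) \<longleftrightarrow> (\<forall>h\<in>FA. z * h \<doteq> h * z)"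
    if "z \<in> FA" for z
    using that by (simp add: hecke_carrier hecke_mult cls_eq cong: ball_cong)
  then have "ring_center hecke = cls ` {z \<in> FA. \<forall>h\<in>FA. z * h \<doteq> h * z}"
    unfolding ring_center_def hecke_carrier by blast
  also have "\<dots> = Img lift_KP"
  proof (intro equalityI subsetI)
    fix x assume "x \<in> cls ` {z \<in> FA. \<forall>h\<in>FA. z * h \<doteq> h * z}"
    then obtain z where z: "x = cls z" "z \<in> FA" "\<And>h. h \<in> FA \<Longrightarrow> z * h \<doteq> h * z" by auto
    then obtain f where "f \<in> InvKP" "z \<doteq> lift_KP f" using central_InvKP by blast
    then show "x \<in> Img lift_KP" by (auto simp: Img_def z(1) cls_eq)
  next
    fix x assume "x \<in> Img lift_KP"
    then show "x \<in> cls ` {z \<in> FA. \<forall>h\<in>FA. z * h \<doteq> h * z}"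
      using InvKP_central embedsD(1)[OF embeds_lift] by (auto simp: Img_def)
  qed
  finally show ?thesis .
qed

lemma lift_e1_mult: "f \<in> InvKP \<Longrightarrow> monoid.mult hecke (cls (lift_KP f)) one0 = cls (lift_KP f * e1)"
  by (simp add: one0_e1 hecke_mult FA_e1 embedsD(1)[OF embeds_lift])

lemma center_one0: "{z \<otimes>\<^bsub>hecke\<^esub> one0 | z. z \<in> ring_center hecke} = Img (\<lambda>f. lift_KP f * e1)"
  unfolding center Img_def using lift_e1_mult by force

lemma one0_hecke_one0: "{one0 \<otimes>\<^bsub>hecke\<^esub> h \<otimes>\<^bsub>hecke\<^esub> one0 | h. h \<in> carrier hecke} = Img (\<lambda>f. lift_KP f * e1)"
proof -
  have "{one0 \<otimes>\<^bsub>hecke\<^esub> h \<otimes>\<^bsub>hecke\<^esub> one0 | h. h \<in> carrier hecke} = {cls (e1 * h * e1) | h. h \<in> FA}"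
    by (auto simp: hecke_carrier one0_e1 hecke_mult FA_e1 FA_mult) (metis FA_e1 FA_mult hecke_mult imageI)
  also have "\<dots> = Img (\<lambda>f. lift_KP f * e1)"
  proof (intro equalityI subsetI)
    fix x assume "x \<in> {cls (e1 * h * e1) | h. h \<in> FA}"
    then obtain h where h: "x = cls (e1 * h * e1)" "h \<in> FA" by auto
    then show "x \<in> Img (\<lambda>f. lift_KP f * e1)" using spherical[OF h(2)] by (auto simp: Img_def cls_eq)
  next
    fix x assume "x \<in> Img (\<lambda>f. lift_KP f * e1)"
    then obtain f where f: "x = cls (lift_KP f * e1)" "f \<in> InvKP" by (auto simp: Img_def)
    have F: "lift_KP f \<in> FA" using embedsD(1)[OF embeds_lift f(2)] .
    \<comment> \<open>For central f, idempotency of 1_0 gives 1_0 f 1_0 = f 1_0.\<close>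
    have "e1 * lift_KP f * e1 \<doteq> lift_KP f * e1 * e1" by (intro heq_rmult heq_sym[OF InvKP_central] f FA_e1)
    also have "lift_KP f * e1 * e1 = lift_KP f * (e1 * e1)" by (rule mult.assoc)
    also have "\<dots> \<doteq> lift_KP f * e1" by (intro heq_lmult e1_e1 F)
    finally have "x = cls (e1 * lift_KP f * e1)" using heq_sym by (simp add: f(1) cls_eq)
    then show "x \<in> {cls (e1 * h * e1) | h. h \<in> FA}" using F by blast
  qed
  finally show ?thesis .
qed

lemma A_lift_e1: "f \<in> InvKP \<Longrightarrow> monoid.mult hecke (A \<rho>) (cls (lift_KP f * e1)) = cls (AA \<rho> * (lift_KP f * e1))"
  by (simp add: A_AA rho_weight hecke_mult FA_AA embedsD(1)[OF embeds_lift_e1])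

lemma eps0_hecke_one0:
  "{eps0 \<otimes>\<^bsub>hecke\<^esub> h \<otimes>\<^bsub>hecke\<^esub> one0 | h. h \<in> carrier hecke} = Img (\<lambda>f. AA \<rho> * (lift_KP f * e1))"
proof -
  have "{eps0 \<otimes>\<^bsub>hecke\<^esub> h \<otimes>\<^bsub>hecke\<^esub> one0 | h. h \<in> carrier hecke} = {cls (e2 * h * e1) | h. h \<in> FA}"
    by (auto simp: hecke_carrier one0_e1 eps0_e2 hecke_mult FA_e1 FA_e2 FA_mult)
      (metis FA_e1 FA_e2 FA_mult hecke_mult imageI)
  also have "\<dots> = Img (\<lambda>f. AA \<rho> * (lift_KP f * e1))"
  proof (intro equalityI subsetI)
    fix x assume "x \<in> {cls (e2 * h * e1) | h. h \<in> FA}"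
    then obtain h where h: "x = cls (e2 * h * e1)" "h \<in> FA" by auto
    then show "x \<in> Img (\<lambda>f. AA \<rho> * (lift_KP f * e1))" using alternating_surj[OF h(2)] by (auto simp: Img_def cls_eq)
  next
    fix x assume "x \<in> Img (\<lambda>f. AA \<rho> * (lift_KP f * e1))"
    then obtain f where f: "x = cls (AA \<rho> * (lift_KP f * e1))" "f \<in> InvKP" by (auto simp: Img_def)
    \<comment> \<open>A_\<rho> f 1_0 has the required shape, with middle factor x^\<rho> 1_0
      f.\<close>
    have "x = cls (e2 * (gX \<rho> * e1 * lift_KP f) * e1)" by (simp add: f(1) AA_def mult.assoc)
    moreover have "gX \<rho> * e1 * lift_KP f \<in> FA"
      by (intro FA_mult FA_gX rho_weight FA_e1 embedsD(1)[OF embeds_lift f(2)])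
    ultimately show "x \<in> {cls (e2 * h * e1) | h. h \<in> FA}" by blast
  qed
  finally show ?thesis .
qed

lemma KP_to_hecke_eq: "KP_to_hecke = (\<lambda>f. cls (lift_KP f))"
  by (rule ext) (simp add: KP_to_hecke_def)

lemma center_ring_iso: "KP_to_hecke \<in> ring_iso KPW (hecke\<lparr>carrier := Img lift_KP\<rparr>)"
proof -
  note L = embedsD(1)[OF embeds_lift]
  have "KP_to_hecke \<in> ring_hom KPW (hecke\<lparr>carrier := Img lift_KP\<rparr>)"
  proof (rule ring_hom_memI)
    fix f g assume "f \<in> carrier KPW" "g \<in> carrier KPW"
    then have fg: "f \<in> InvKP" "g \<in> InvKP" by (simp_all add: KPW_simps)
    then have "lift_KP (f * g) \<doteq> lift_KP f * lift_KP g" using InvKP_D by (intro lift_mult) auto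
    then show "KP_to_hecke (f \<otimes>\<^bsub>KPW\<^esub> g) = KP_to_hecke f \<otimes>\<^bsub>hecke\<lparr>carrier := Img lift_KP\<rparr>\<^esub> KP_to_hecke g"
      using fg by (simp add: KP_to_hecke_eq KPW_simps hecke_mult L cls_eq)
    show "KP_to_hecke (f \<oplus>\<^bsub>KPW\<^esub> g) = KP_to_hecke f \<oplus>\<^bsub>hecke\<lparr>carrier := Img lift_KP\<rparr>\<^esub> KP_to_hecke g"
      using fg by (simp add: KP_to_hecke_eq KPW_simps hecke_add L lift_add)
  qed (auto simp: KP_to_hecke_eq KPW_simps hecke_one cls_eq lift_1 Img_def)
  then show ?thesis using embeds_bij[OF embeds_lift] by (simp add: ring_iso_def KP_to_hecke_eq KPW_simps)
qed

lemma character_A: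
  assumes "\<mu> \<in> dominant_weights"
  shows "A \<rho> \<otimes>\<^bsub>hecke\<^esub> (KP_to_hecke (weyl_character \<mu>) \<otimes>\<^bsub>hecke\<^esub> one0) = A (\<mu> + \<rho>)"
proof -
  have "\<mu> + \<rho> \<in> weights" using assms rho_weight weights_add by (auto simp: dominant_weights_iff)
  then show ?thesis using weyl_character(1)[OF assms] AA_character[OF assms]
    by (simp add: KP_to_hecke_eq lift_e1_mult A_lift_e1 A_AA cls_eq)
qed

end

theorem theorem2p11:
  fixes B :: "'v::real_vector \<Rightarrow> 'v \<Rightarrow> real" and R Rp :: "'v set"
  assumes "based_root_system B R Rp"
  defines "K \<equiv> based_root_system.coeff_ring B R Rp"
    and "KPW \<equiv> based_root_system.KPW B R Rp"
    and "H \<equiv> based_root_system.hecke B R Rp"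
    and "\<iota> \<equiv> based_root_system.KP_to_hecke B R Rp"
    and "one0 \<equiv> based_root_system.one0 B R Rp"
    and "eps0 \<equiv> based_root_system.eps0 B R Rp"
    and "A \<equiv> based_root_system.A B R Rp"
    and "\<rho> \<equiv> based_root_system.\<rho> Rp"
    and "s \<equiv> based_root_system.weyl_character B R Rp"
  defines "Z \<equiv> ring_center H"
  defines "Z1 \<equiv> {z \<otimes>\<^bsub>H\<^esub> one0 | z. z \<in> Z}"
    and "oneHone \<equiv> {one0 \<otimes>\<^bsub>H\<^esub> h \<otimes>\<^bsub>H\<^esub> one0 | h. h \<in> carrier H}"
    and "epsHone \<equiv> {eps0 \<otimes>\<^bsub>H\<^esub> h \<otimes>\<^bsub>H\<^esub> one0 | h. h \<in> carrier H}"
    and "\<Phi>1 \<equiv> (\<lambda>z. z \<otimes>\<^bsub>H\<^esub> one0)"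
    and "\<Phi>2 \<equiv> (\<lambda>y. A \<rho> \<otimes>\<^bsub>H\<^esub> y)"
  shows "Z = \<iota> ` carrier KPW \<and> \<iota> \<in> ring_iso KPW (H\<lparr>carrier := Z\<rparr>)
      \<and> module_iso K KPW (H\<lparr>carrier := Z\<rparr>) \<iota>
    \<and> Z1 = oneHone
    \<and> module_iso K (H\<lparr>carrier := Z\<rparr>) (H\<lparr>carrier := Z1\<rparr>) \<Phi>1
    \<and> module_iso K (H\<lparr>carrier := oneHone\<rparr>) (H\<lparr>carrier := epsHone\<rparr>) \<Phi>2
    \<and> (\<forall>\<mu> \<in> based_root_system.dominant_weights B R Rp.
         s \<mu> \<in> carrier KPW \<and> \<Phi>2 (\<Phi>1 (\<iota> (s \<mu>))) = A (\<mu> + \<rho>))"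
proof -
  interpret b: based_root_system B R Rp by fact
  note defs = K_def KPW_def H_def \<iota>_def one0_def eps0_def A_def \<rho>_def s_def Z_def Z1_def oneHone_def
    epsHone_def \<Phi>1_def \<Phi>2_def
  \<comment> \<open>Once all four sets are images of the invariants, the isomorphisms are instances
    of \<open>embeds_KPW_iso\<close> and \<open>embeds_iso\<close>.\<close>
  have sets: "Z = b.Img b.lift_KP" "Z1 = b.Img (\<lambda>f. b.lift_KP f * b.e1)"
      "oneHone = b.Img (\<lambda>f. b.lift_KP f * b.e1)" "epsHone = b.Img (\<lambda>f. b.AA b.\<rho> * (b.lift_KP f * b.e1))"
    unfolding defs by (rule b.center b.center_one0 b.one0_hecke_one0 b.eps0_hecke_one0)+
  show ?thesis
  proof (intro conjI ballI)
    show "Z = \<iota> ` carrier KPW" unfolding sets unfolding defs by (simp add: b.Img_def b.KP_to_hecke_eq b.KPW_simps)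
    show "\<iota> \<in> ring_iso KPW (H\<lparr>carrier := Z\<rparr>)" unfolding sets unfolding defs by (rule b.center_ring_iso)
    show "module_iso K KPW (H\<lparr>carrier := Z\<rparr>) \<iota>" unfolding sets unfolding defs b.KP_to_hecke_eq
      by (rule b.embeds_KPW_iso[OF b.embeds_lift])
    show "Z1 = oneHone" by (simp add: sets)
    show "module_iso K (H\<lparr>carrier := Z\<rparr>) (H\<lparr>carrier := Z1\<rparr>) \<Phi>1" unfolding sets unfolding defs
      by (rule b.embeds_iso[OF b.embeds_lift b.embeds_lift_e1 b.lift_e1_mult])
    show "module_iso K (H\<lparr>carrier := oneHone\<rparr>) (H\<lparr>carrier := epsHone\<rparr>) \<Phi>2" unfolding sets unfolding defs
      by (rule b.embeds_iso[OF b.embeds_lift_e1 b.embeds_A b.A_lift_e1])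
    fix \<mu> assume m: "\<mu> \<in> b.dominant_weights"
    show "s \<mu> \<in> carrier KPW" unfolding defs b.KPW_simps by (rule b.weyl_character(1)[OF m])
    show "\<Phi>2 (\<Phi>1 (\<iota> (s \<mu>))) = A (\<mu> + \<rho>)" unfolding defs by (rule b.character_A[OF m])
  qed
qed

end
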